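(* Let $0<C_1\le\frac{1}{4\pi}$ and $0<C_2\le\frac{73}{100\pi}$. For $\epsilon>0$ let $\mathcal{L}_\epsilon^{-1}$ be the Stokes slender body PDE operator on $\partial\mathcal{C}_\epsilon$ mapping fiber velocity to force density, and let $(\mathcal{L}_\epsilon^{\mathrm{SB}})^{-1}_{NM}$ be the truncated slender body approximation with $N=C_1/\epsilon$ and $M=C_2/\epsilon$ (both defined in the context). Then there is a constant $C$, independent of $\epsilon$ and $\bm u$, such that for any zero-mean slender body velocity $\bm u\in H^1(\mathbb{T})$, $$\left\|\mathcal{L}_\epsilon^{-1}[\bm u]-(\mathcal{L}_\epsilon^{\mathrm{SB}})^{-1}_{NM}[\bm u]\right\|_{L^2(\mathbb{T})}\le C\epsilon\,\|\bm u\|_{H^1(\mathbb{T})}.$$ Furthermore, if $\bm u\in H^2(\mathbb{T})$, then $$\left\|\mathcal{L}_\epsilon^{-1}[\bm u]-(\mathcal{L}_\epsilon^{\mathrm{SB}})^{-1}_{NM}[\bm u]\right\|_{L^2(\mathbb{T})}\le C\epsilon^2\,\|\bm u\|_{H^2(\mathbb{T})}.$$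
   Context: Let $\mathbb{T}=\mathbb{R}/2\mathbb{Z}$. In cylindrical coordinates $(r,\theta,z)$, let $\mathcal{C}_\epsilon=\{(r,\theta,z): 0\le r\le\epsilon,\ 0\le\theta<2\pi,\ z\in\mathbb{T}\}\subset\mathbb{R}^2\times\mathbb{T}$, with Cartesian basis $\bm e_x,\bm e_y,\bm e_z$ ($\bm e_z$ along the cylinder axis), and let $\Omega_\epsilon=(\mathbb{R}^2\times\mathbb{T})\setminus\overline{\mathcal{C}_\epsilon}$. All functions on $\mathbb{T}$ are assumed to have zero mean (only the Fourier modes $k\ne0$ are considered). PDE operator: for zero-mean $\overline{\bm u}\in H^{1/2}(\mathbb{T})$ (three-component vector valued), let $(\bm u,p)$ be the unique solution of $-\Delta\bm u+\nabla p=0$, $\operatorname{div}\bm u=0$ in $\Omega_\epsilon$, $\bm u=\overline{\bm u}(z)$ on $\partial\mathcal{C}_\epsilon$ (independent of $\theta$), $\bm u\to0$ and $p\to0$ as $r\to\infty$. With $\bm\sigma=\nabla\bm u+(\nabla\bm u)^{\mathrm T}-p\,\mathbf I$ and $\bm n$ the unit normal on $\partial\mathcal{C}_\epsilon$ pointing into $\mathcal{C}_\epsilon$, $$\mathcal{L}_\epsilon^{-1}[\overline{\bm u}](z)=\int_0^{2\pi}(\bm\sigma\bm n)\,\epsilon\,d\theta .$$ Truncated approximation: write Fourier series on $\mathbb{T}$ as $\bm v(z)=\sum_{k}\widehat{\bm v}_ke^{i\pi kz}$, $\widehat{\bm v}_k=\widehat v_{x,k}\bm e_x+\widehat v_{y,k}\bm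 e_y+\widehat v_{z,k}\bm e_z$. Define $\lambda_k^{\mathrm{SB,t}}$, $\lambda_k^{\mathrm{SB,n}}$ by $$\frac{1}{\lambda^{\mathrm{SB,t}}_k} = -\frac{1}{4\pi}\left(1 + 2\log(\pi\epsilon|k|/2) + 2\gamma\right),\qquad \frac{1}{\lambda^{\mathrm{SB,n}}_k} = \frac{1}{8\pi}\left(1 - 2\log(\pi\epsilon|k|/2) - 2\gamma\right),$$ where $\gamma\approx0.5772$ is Euler's constant. Then $$(\mathcal{L}_\epsilon^{\mathrm{SB}})^{-1}_{NM}[\bm v](z)=\sum_{1\le|k|\le N}\lambda_k^{\mathrm{SB,t}}\,\widehat v_{z,k}\,e^{i\pi kz}\bm e_z+\sum_{1\le|k|\le M}\lambda_k^{\mathrm{SB,n}}\left(\widehat v_{x,k}\bm e_x+\widehat v_{y,k}\bm e_y\right)e^{i\pi kz}.$$ *)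

theory Defs
  imports "HOL-Analysis.Analysis"
begin

section \<open>Functions on the torus \<open>\<real>/2\<int>\<close>\<close>

text \<open>Functions on the torus are 2-periodic functions on the real line; elements of \<open>L\<^sup>2\<close> are
  handled through (Borel) representatives.\<close>

definition in_L2 :: "(real \<Rightarrow> 'a::real_normed_vector) \<Rightarrow> bool" where
  "in_L2 g \<longleftrightarrow> (\<forall>z. g (z + 2) = g z) \<and> g \<in> borel_measurable lborel \<and>
     set_integrable lborel {-1..1} (\<lambda>z. (norm (g z))\<^sup>2)"

definition L2_norm :: "(real \<Rightarrow> 'a::real_normed_vector) \<Rightarrow> real" where
  "L2_norm g = sqrt (LBINT z:{-1..1}. (norm (g z))\<^sup>2)"

definition zero_mean :: "(real \<Rightarrow> 'a::{banach,second_countable_topology}) \<Rightarrow> bool" where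
  "zero_mean g \<longleftrightarrow> (LBINT z:{-1..1}. g z) = 0"

definition fourier_coeff :: "(real \<Rightarrow> real^3) \<Rightarrow> int \<Rightarrow> complex^3" where
  "fourier_coeff v k =
     (\<chi> j. (1/2) * (LBINT z:{-1..1}. complex_of_real (v z $ j) * cis (- (pi * of_int k * z))))"

text \<open>The Sobolev spaces \<open>H\<^sup>s\<close>.  The factor 2 is the period, so that \<open>sobolev_norm 0\<close> is the
  \<open>L\<^sup>2\<close> norm and the square of \<open>sobolev_norm 1 v\<close> is the integral of \<open>|v|\<^sup>2 + |v'|\<^sup>2\<close>.\<close>

definition in_sobolev :: "real \<Rightarrow> (real \<Rightarrow> real^3) \<Rightarrow> bool" where
  "in_sobolev s v \<longleftrightarrow> in_L2 v \<and>
     (\<lambda>k::int. (1 + (pi * of_int k)\<^sup>2) powr s * (norm (fourier_coeff v k))\<^sup>2) summable_on UNIV"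

definition sobolev_norm :: "real \<Rightarrow> (real \<Rightarrow> real^3) \<Rightarrow> real" where
  "sobolev_norm s v =
     sqrt (2 * (\<Sum>\<^sub>\<infinity>k::int. (1 + (pi * of_int k)\<^sup>2) powr s * (norm (fourier_coeff v k))\<^sup>2))"


section \<open>The exterior Stokes problem\<close>

definition cyl_radius :: "real^3 \<Rightarrow> real" where
  "cyl_radius x = sqrt ((x$1)\<^sup>2 + (x$2)\<^sup>2)"

definition cyl_point :: "real \<Rightarrow> real \<Rightarrow> real \<Rightarrow> real^3" where
  "cyl_point r \<theta> z = vector [r * cos \<theta>, r * sin \<theta>, z]"

text \<open>The lift to \<open>\<real>\<^sup>3\<close> of the exterior domain; fields on it are required to be 2-periodic
  in the third coordinate.\<close>

definition exterior_domain :: "real \<Rightarrow> (real^3) set" where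
  "exterior_domain \<epsilon> = {x. cyl_radius x > \<epsilon>}"

definition partial :: "3 \<Rightarrow> (real^3 \<Rightarrow> 'a::real_normed_vector) \<Rightarrow> real^3 \<Rightarrow> 'a" where
  "partial j f x = frechet_derivative f (at x) (axis j 1)"

definition C1_on :: "(real^3) set \<Rightarrow> (real^3 \<Rightarrow> 'a::real_normed_vector) \<Rightarrow> bool" where
  "C1_on S f \<longleftrightarrow> (\<forall>x\<in>S. f differentiable (at x)) \<and> (\<forall>j. continuous_on S (partial j f))"

definition C2_on :: "(real^3) set \<Rightarrow> (real^3 \<Rightarrow> 'a::real_normed_vector) \<Rightarrow> bool" where
  "C2_on S f \<longleftrightarrow> C1_on S f \<and> (\<forall>j. C1_on S (partial j f))"

definition laplacian :: "(real^3 \<Rightarrow> real^3) \<Rightarrow> real^3 \<Rightarrow> real^3" where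
  "laplacian u x = (\<Sum>j\<in>UNIV. partial j (partial j u) x)"

definition gradient :: "(real^3 \<Rightarrow> real) \<Rightarrow> real^3 \<Rightarrow> real^3" where
  "gradient p x = (\<chi> j. partial j p x)"

definition jacobian :: "(real^3 \<Rightarrow> real^3) \<Rightarrow> real^3 \<Rightarrow> real^3^3" where
  "jacobian u x = matrix (frechet_derivative u (at x))"

definition divergence :: "(real^3 \<Rightarrow> real^3) \<Rightarrow> real^3 \<Rightarrow> real" where
  "divergence u x = trace (jacobian u x)"

definition stress :: "(real^3 \<Rightarrow> real^3) \<Rightarrow> (real^3 \<Rightarrow> real) \<Rightarrow> real^3 \<Rightarrow> real^3^3" where
  "stress u p x = jacobian u x + transpose (jacobian u x) - p x *\<^sub>R mat 1"

text \<open>Solutions are classical in the open exterior domain (interior regularity), while the boundary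
  value, which for rough data need not be attained pointwise, is taken as the \<open>L\<^sup>2\<close> limit on the
  cylinders of radius \<open>r \<down> \<epsilon>\<close>.  The limits \<open>u \<rightarrow> 0\<close>, \<open>p \<rightarrow> 0\<close> as \<open>r \<rightarrow> \<infinity>\<close> are uniform in \<open>\<theta>\<close>
  and \<open>z\<close>.  The zero-mean conditions reflect the convention that only the Fourier modes \<open>k \<noteq> 0\<close>
  in \<open>z\<close> are considered.\<close>

definition stokes_solution ::
    "real \<Rightarrow> (real \<Rightarrow> real^3) \<Rightarrow> (real^3 \<Rightarrow> real^3) \<Rightarrow> (real^3 \<Rightarrow> real) \<Rightarrow> bool" where
  "stokes_solution \<epsilon> v u p \<longleftrightarrow>
     C2_on (exterior_domain \<epsilon>) u \<and> C1_on (exterior_domain \<epsilon>) p \<and>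
     (\<forall>x\<in>exterior_domain \<epsilon>. u (x + 2 *\<^sub>R axis 3 1) = u x \<and> p (x + 2 *\<^sub>R axis 3 1) = p x) \<and>
     (\<forall>x\<in>exterior_domain \<epsilon>. - laplacian u x + gradient p x = 0 \<and> divergence u x = 0) \<and>
     (\<forall>r>\<epsilon>. \<forall>\<theta>. zero_mean (\<lambda>z. u (cyl_point r \<theta> z)) \<and> zero_mean (\<lambda>z. p (cyl_point r \<theta> z))) \<and>
     ((\<lambda>r. \<integral>\<^sup>+z\<in>{-1..1}. (\<integral>\<^sup>+\<theta>\<in>{0..2*pi}.
              ennreal ((norm (u (cyl_point r \<theta> z) - v z))\<^sup>2) \<partial>lborel) \<partial>lborel) \<longlongrightarrow> 0) (at_right \<epsilon>) \<and>
     (u \<longlongrightarrow> 0) (filtercomap cyl_radius at_top) \<and>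
     (p \<longlongrightarrow> 0) (filtercomap cyl_radius at_top)"

definition inward_normal :: "real \<Rightarrow> real^3" where
  "inward_normal \<theta> = vector [- cos \<theta>, - sin \<theta>, 0]"

definition circle_force ::
    "(real^3 \<Rightarrow> real^3) \<Rightarrow> (real^3 \<Rightarrow> real) \<Rightarrow> real \<Rightarrow> real \<Rightarrow> real^3" where
  "circle_force u p r z =
     (LBINT \<theta>:{0..2*pi}. r *\<^sub>R (stress u p (cyl_point r \<theta> z) *v inward_normal \<theta>))"

text \<open>The force density on the boundary of the cylinder, again as an \<open>L\<^sup>2\<close> boundary value.\<close>

definition is_force_density ::
    "real \<Rightarrow> (real^3 \<Rightarrow> real^3) \<Rightarrow> (real^3 \<Rightarrow> real) \<Rightarrow> (real \<Rightarrow> real^3) \<Rightarrow> bool" where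
  "is_force_density \<epsilon> u p f \<longleftrightarrow> in_L2 f \<and>
     ((\<lambda>r. \<integral>\<^sup>+z\<in>{-1..1}. ennreal ((norm (circle_force u p r z - f z))\<^sup>2) \<partial>lborel) \<longlongrightarrow> 0)
       (at_right \<epsilon>)"

text \<open>The slender body PDE operator, mapping the fiber velocity to a representative of the force
  density, which is determined almost everywhere.  For data merely in \<open>H\<^sup>1\<^sup>/\<^sup>2\<close> the force density
  may only be a distribution, in which case the value is unspecified; for data in \<open>H\<^sup>1\<close> it is
  in \<open>L\<^sup>2\<close>.\<close>

definition slender_body_PDE :: "real \<Rightarrow> (real \<Rightarrow> real^3) \<Rightarrow> real \<Rightarrow> real^3" where
  "slender_body_PDE \<epsilon> v =
     (SOME f. \<exists>u p. stokes_solution \<epsilon> v u p \<and> is_force_density \<epsilon> u p f)"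


section \<open>The truncated slender body approximation\<close>

definition lambda_SB_t :: "real \<Rightarrow> int \<Rightarrow> real" where
  "lambda_SB_t \<epsilon> k =
     1 / (- (1 / (4*pi)) * (1 + 2 * ln (pi * \<epsilon> * of_int \<bar>k\<bar> / 2) + 2 * euler_mascheroni))"

definition lambda_SB_n :: "real \<Rightarrow> int \<Rightarrow> real" where
  "lambda_SB_n \<epsilon> k =
     1 / (1 / (8*pi) * (1 - 2 * ln (pi * \<epsilon> * of_int \<bar>k\<bar> / 2) - 2 * euler_mascheroni))"

text \<open>The cutoffs are real numbers, not necessarily integers.\<close>

definition modes :: "real \<Rightarrow> int set" where
  "modes N = {k. 1 \<le> \<bar>k\<bar> \<and> of_int \<bar>k\<bar> \<le> N}"

definition slender_body_approx ::
    "real \<Rightarrow> real \<Rightarrow> real \<Rightarrow> (real \<Rightarrow> real^3) \<Rightarrow> real \<Rightarrow> complex^3" where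
  "slender_body_approx \<epsilon> N M v z =
     (\<Sum>k\<in>modes N. (of_real (lambda_SB_t \<epsilon> k) * fourier_coeff v k $ 3 * cis (pi * of_int k * z))
        *s axis 3 1) +
     (\<Sum>k\<in>modes M. (of_real (lambda_SB_n \<epsilon> k) * cis (pi * of_int k * z))
        *s (fourier_coeff v k $ 1 *s axis 1 1 + fourier_coeff v k $ 2 *s axis 2 1))"

definition complexify :: "real^3 \<Rightarrow> complex^3" where
  "complexify w = (\<chi> j. complex_of_real (w $ j))"

definition approx_error :: "real \<Rightarrow> real \<Rightarrow> real \<Rightarrow> (real \<Rightarrow> real^3) \<Rightarrow> real \<Rightarrow> complex^3" where
  "approx_error \<epsilon> N M v z = complexify (slender_body_PDE \<epsilon> v z) - slender_body_approx \<epsilon> N M v z"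

end

theory Submission
  imports Defs "HOL-Real_Asymp.Real_Asymp"
begin

text \<open>Both operators are diagonal in Fourier space, so the theorem reduces to the eigenvalue estimates
  \<open>|\<lambda>\<^sub>k - \<lambda>\<^sub>k\<^sup>S\<^sup>B| \<le> C x\<^sup>2\<close> below the cutoff and \<open>|\<lambda>\<^sub>k| \<le> C x\<close> above it, where
  \<open>x = \<pi>\<epsilon>|k|\<close>.  The eigenvalues of the PDE operator are explicit in terms of \<open>R = K\<^sub>0/K\<^sub>1\<close>, which satisfies
  \<open>(x R)' = 2 R - x (1 - R\<^sup>2)\<close>; the logarithm and Euler's constant enter through the expansion
  \<open>R/x = - ln (x/2) - \<gamma> + O(x\<^sup>2 ln\<^sup>2 x)\<close>.  The cutoffs keep the approximate eigenvalues away from their pole.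

  Existence is shown with Bessel series, whose \<open>L\<^sup>2\<close> boundary values follow from Parseval's identity and
  Tannery's theorem.  For uniqueness of the force density, the force of an arbitrary solution on the cylinder of
  radius \<open>s > \<epsilon>\<close>, tested against a Fourier mode \<open>g\<close>, is by the reciprocal theorem an integral of the velocity
  against a kernel that stays bounded as \<open>s \<down> \<epsilon>\<close>; only the \<open>L\<^sup>2\<close> boundary value of the velocity matters.\<close>

subsection \<open>Modified Bessel functions\<close>

text \<open>The errors of the expansion contain squared logarithms, yet the claim has pure powers of
  \<epsilon>: the denominators of the exact and the approximate symbol differ by O(x^2 log^2 x), and
  passing to the symbols divides by two quantities that are each at least a multiple of 1 - ln x,
  which absorbs both logarithms. Above the cutoff a, linear growth of the exact symbol is enough for
  both rates, since x/a >= 1 there. The obstacle on the PDE side is that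
  \<open>slender_body_PDE\<close> selects some force density of some classical solution, about whose
  derivatives nothing is assumed near the boundary or at infinity. Hence the selected force is
  identified only through its pairings with single modes. The test flow in such a pairing is
  normalised on the cylinder of radius s itself, so that the boundary terms match exactly for each
  s. Bessel functions enter as Laplace integrals in cosh, because one formula then gives the decay
  at infinity, the singularity at 0 and the differential equations behind all inequalities.\<close>

definition cosh_laplace :: "nat => real => real" where
 "cosh_laplace j x = (LBINT t:{0..}. cosh t ^ j * exp (- (x * cosh t)))"

text \<open>A single term of the exponential series of x c is at most its sum.\<close>

lemma power_exp_neg_le:
 assumes "(x::real) > 0" "c >= 0"
 shows "c ^ n * exp (- (x * c)) <= fact n / x ^ n"
proof -
 have "(x * c) ^ n / fact n <= (\<Sum>k. (x * c) ^ k / fact k)"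
  using assms sum_le_suminf[OF summable_exp_generic[of "x * c"], of "{n}"]
  by (auto simp: field_simps)
 then have "(x * c) ^ n / fact n <= exp (x * c)"
  by (simp add: exp_def field_simps)
 then show ?thesis
  using assms by (simp add: exp_minus field_simps power_mult_distrib)
qed

lemma set_integrable_exp_neg: "set_integrable lborel {0..} (%t::real. exp (- t))"
proof -
 have "(%t::real. exp (- t)) absolutely_integrable_on {0..}"
  using integrable_on_exp_minus_to_infinity[of 1 0]
  by (intro nonnegative_absolutely_integrable_1) auto
 then show ?thesis
  unfolding set_integrable_def by (subst (asm) integrable_completion) auto
qed

lemma integral_exp_neg: "(LBINT t:{0..}. exp (- t)) = (1::real)"
 using set_borel_integral_eq_integral(2)[OF set_integrable_exp_neg]
  integral_unique[OF has_integral_exp_minus_to_infinity[of 1 0]] by simp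

lemma cosh_ge_half_exp: "cosh (t::real) >= exp t / 2"
 by (simp add: cosh_def)

lemma inverse_cosh_le: "1 / cosh (t::real) <= 2 * exp (- t)"
 using cosh_ge_half_exp[of t] cosh_real_pos[of t] by (simp add: exp_minus field_simps)

text \<open>One extra factor cosh t is introduced and bounded together with the exponential; the
  compensating 1/cosh t <= 2 exp(-t) leaves a multiple of exp(-t) as integrable majorant.\<close>

lemma cosh_laplace_integrable:
 assumes "x > 0"
 shows "set_integrable lborel {0..} (%t::real. cosh t ^ j * exp (- (x * cosh t)))"
proof (rule set_integrable_bound)
 show "set_integrable lborel {0..} (%t::real. (2 * fact (Suc j) / x ^ Suc j) * exp (- t))"
  using set_integrable_exp_neg by auto
 show "AE t in lborel. t \<in> {0..} --> norm (cosh t ^ j * exp (- (x * cosh t)))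
   <= norm ((2 * fact (Suc j) / x ^ Suc j) * exp (- t))"
 proof (intro AE_I2 impI)
  fix t :: real assume "t \<in> {0..}"
  have "cosh t ^ j * exp (- (x * cosh t)) = cosh t ^ Suc j * exp (- (x * cosh t)) * (1 / cosh t)"
   using cosh_real_pos[of t] by simp
  also have "... <= (fact (Suc j) / x ^ Suc j) * (2 * exp (- t))"
   using cosh_real_pos[of t] assms
   by (intro mult_mono power_exp_neg_le inverse_cosh_le) auto
  also have "... = (2 * fact (Suc j) / x ^ Suc j) * exp (- t)"
   by (simp only: times_divide_eq_left times_divide_eq_right mult_ac)
  also have "... <= norm ..." by (simp only: real_norm_def abs_ge_self)
  finally show "norm (cosh t ^ j * exp (- (x * cosh t)))
   <= norm ((2 * fact (Suc j) / x ^ Suc j) * exp (- t))"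
   using cosh_real_pos[of t] by (simp only: real_norm_def abs_mult power_abs abs_exp_cancel abs_of_pos)
 qed
qed (auto simp: set_borel_measurable_def cosh_def)

lemma exp_second_order_bound: "\<bar>exp u - 1 - u\<bar> <= u\<^sup>2 * exp \<bar>u::real\<bar>"
proof -
 have 1: "exp u - 1 - u >= 0"
  using exp_ge_add_one_self[of u] by linarith
 have "(1 - u) * exp u <= exp (- u) * exp u"
  using exp_ge_add_one_self[of "- u"] by (intro mult_right_mono) auto
 then have 2: "exp u - 1 <= u * exp u" by (simp add: exp_minus algebra_simps)
 have "exp u - 1 - u <= u * (exp u - 1)" using 2 by (simp add: algebra_simps)
 also have "u * (exp u - 1) <= u * u * exp \<bar>u\<bar>"
 proof (cases "u >= 0")
  case True
  then show ?thesis using mult_left_mono[OF 2, of u] by (simp add: algebra_simps)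
 next
  case False
  have "u * (exp u - 1) <= u * u"
   using False 1 by (intro mult_left_mono_neg) linarith+
  also have "... <= u * u * exp \<bar>u\<bar>"
   using mult_left_mono[of 1 "exp \<bar>u\<bar>" "u * u"] by simp
  finally show ?thesis .
 qed
 finally show ?thesis using 1 by (simp add: power2_eq_square)
qed

text \<open>Differentiation under the integral with an explicit remainder. The Taylor error of
  exp(-h cosh t) is (h cosh t)^2 exp(|h| cosh t); as |h| <= x/2, half of the decay rate x absorbs
  the exponential, and the square raises the index to j + 2.\<close>

lemma cosh_laplace_diff_quotient:
 assumes x: "x > 0" and h: "\<bar>h\<bar> <= x / 2" "h \<noteq> 0"
 shows "\<bar>(cosh_laplace j (x + h) - cosh_laplace j x) / h + cosh_laplace (Suc j) x\<bar>
  <= \<bar>h\<bar> * cosh_laplace (j + 2) (x / 2)"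
proof -
 have xh: "x + h > 0" using assms by linarith
 let ?e = "%j x t. cosh t ^ j * exp (- (x * cosh t)) :: real"
 note int = cosh_laplace_integrable[OF xh, of j] cosh_laplace_integrable[OF x, of j]
  cosh_laplace_integrable[OF x, of "Suc j"]
 have int': "set_integrable lborel {0..} (%t. (?e j (x + h) t - ?e j x t) / h + ?e (Suc j) x t)"
  using int by (intro set_integral_add(1) set_integrable_divide set_integral_diff(1)) auto
 have eq: "(cosh_laplace j (x + h) - cosh_laplace j x) / h + cosh_laplace (Suc j) x
   = (LBINT t:{0..}. (?e j (x + h) t - ?e j x t) / h + ?e (Suc j) x t)"
  unfolding cosh_laplace_def using int
  by (subst set_integral_add(2)) (auto simp: set_integral_diff(2) intro!: set_integrable_divide set_integral_diff(1))
 have "\<bar>(cosh_laplace j (x + h) - cosh_laplace j x) / h + cosh_laplace (Suc j) x\<bar>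
   <= (LBINT t:{0..}. \<bar>(?e j (x + h) t - ?e j x t) / h + ?e (Suc j) x t\<bar>)"
  unfolding eq using set_integral_norm_bound[OF int'] by simp
 also have "... <= (LBINT t:{0..}. \<bar>h\<bar> * ?e (j + 2) (x / 2) t)"
 proof (rule set_integral_mono)
  show "set_integrable lborel {0..} (%t. \<bar>(?e j (x + h) t - ?e j x t) / h + ?e (Suc j) x t\<bar>)"
   using int' by (rule set_integrable_abs)
  show "set_integrable lborel {0..} (%t. \<bar>h\<bar> * ?e (j + 2) (x / 2) t)"
   by (intro set_integrable_mult_right cosh_laplace_integrable) (use x in simp)
  fix t :: real
  let ?c = "cosh t"
  have c: "?c > 0" by (rule cosh_real_pos)
  define w where "w = exp (- (h * ?c)) - 1 + h * ?c"
  have w: "\<bar>w\<bar> <= (h * ?c)\<^sup>2 * exp (\<bar>h\<bar> * ?c)"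
   using exp_second_order_bound[of "- (h * ?c)"] c by (simp add: w_def abs_mult)
  have "(?e j (x + h) t - ?e j x t) / h + ?e (Suc j) x t = ?c ^ j * exp (- (x * ?c)) * w / h"
  proof -
   have "exp (- ((x + h) * ?c)) = exp (- (x * ?c)) * exp (- (h * ?c))"
    by (simp add: exp_add[symmetric] algebra_simps)
   moreover have "(?c ^ j * (E * F) - ?c ^ j * E) / h + ?c ^ Suc j * E = ?c ^ j * E * (F - 1 + h * ?c) / h"
    for E F :: real
    using h by (simp add: add_divide_distrib diff_divide_distrib algebra_simps)
   ultimately show ?thesis by (simp only: w_def)
  qed
  then have "\<bar>(?e j (x + h) t - ?e j x t) / h + ?e (Suc j) x t\<bar>
    = ?c ^ j * exp (- (x * ?c)) * \<bar>w\<bar> / \<bar>h\<bar>"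
   using c by (simp add: abs_mult)
  also have "... <= ?c ^ j * exp (- (x * ?c)) * ((h * ?c)\<^sup>2 * exp (x / 2 * ?c)) / \<bar>h\<bar>"
  proof (intro divide_right_mono mult_left_mono)
   have "exp (\<bar>h\<bar> * ?c) <= exp (x / 2 * ?c)"
    using h c by (simp only: exp_le_cancel_iff) (intro mult_right_mono, auto)
   then show "\<bar>w\<bar> <= (h * ?c)\<^sup>2 * exp (x / 2 * ?c)"
    using w mult_left_mono[of "exp (\<bar>h\<bar> * ?c)" "exp (x / 2 * ?c)" "(h * ?c)\<^sup>2"] by auto
  qed (use c in auto)
  also have "... = \<bar>h\<bar> * (?c ^ (j + 2) * (exp (- (x * ?c)) * exp (x / 2 * ?c)))"
  proof -
   have "a * E * ((h * c)\<^sup>2 * F) / \<bar>h\<bar> = \<bar>h\<bar> * (a * c\<^sup>2 * (E * F))" for a E F c :: real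
    using h by (simp add: power2_eq_square abs_if)
   then show ?thesis by (simp only: power_add)
  qed
  also have "exp (- (x * ?c)) * exp (x / 2 * ?c) = exp (- (x / 2 * ?c))"
   by (simp add: exp_add[symmetric] field_simps)
  finally show "\<bar>(?e j (x + h) t - ?e j x t) / h + ?e (Suc j) x t\<bar> <= \<bar>h\<bar> * ?e (j + 2) (x / 2) t" .
 qed
 also have "... = \<bar>h\<bar> * cosh_laplace (j + 2) (x / 2)"
  by (simp add: cosh_laplace_def)
 finally show ?thesis .
qed

lemma DERIV_cosh_laplace:
 assumes x: "x > 0"
 shows "(cosh_laplace j has_real_derivative - cosh_laplace (Suc j) x) (at x)"
proof -
 let ?q = "%h. (cosh_laplace j (x + h) - cosh_laplace j x) / h"
 have "((%h. ?q h - (- cosh_laplace (Suc j) x)) \<longlongrightarrow> 0) (at 0)"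
 proof (rule Lim_null_comparison)
  show "\<forall>\<^sub>F h in at 0. norm (?q h - (- cosh_laplace (Suc j) x)) <= \<bar>h\<bar> * cosh_laplace (j + 2) (x / 2)"
   unfolding eventually_at
   using cosh_laplace_diff_quotient[OF x] x by (intro exI[of _ "x / 2"]) auto
  show "((%h. \<bar>h\<bar> * cosh_laplace (j + 2) (x / 2)) \<longlongrightarrow> 0) (at 0)"
   by (auto intro!: tendsto_eq_intros)
 qed
 then show ?thesis
  unfolding DERIV_def by (rule LIM_zero_cancel)
qed

lemma cosh_laplace_nonneg: "cosh_laplace j x >= 0"
 unfolding cosh_laplace_def set_lebesgue_integral_def
 by (intro integral_nonneg_AE AE_I2) auto

text \<open>Since cosh t >= 1, the exponent x - x cosh t decreases in x for every t. This is the
  source of the exponential decay of K1 and, termwise, of the Bessel series.\<close>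

lemma cosh_laplace_scaled_antimono:
 assumes "0 < x" "x <= y"
 shows "exp y * cosh_laplace j y <= exp x * cosh_laplace j x"
proof -
 have "exp y * cosh_laplace j y = (LBINT t:{0..}. exp y * (cosh t ^ j * exp (- (y * cosh t))))"
  by (simp add: cosh_laplace_def)
 also have "... <= (LBINT t:{0..}. exp x * (cosh t ^ j * exp (- (x * cosh t))))"
 proof (rule set_integral_mono)
  fix t :: real
  have "y + - (y * cosh t) <= x + - (x * cosh t)"
   using mult_right_mono[OF assms(2), of "cosh t - 1"] cosh_real_ge_1[of t] by (simp add: algebra_simps)
  then have "exp y * exp (- (y * cosh t)) <= exp x * exp (- (x * cosh t))"
   by (simp only: exp_add[symmetric] exp_le_cancel_iff)
  then show "exp y * (cosh t ^ j * exp (- (y * cosh t))) <= exp x * (cosh t ^ j * exp (- (x * cosh t)))"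
   using mult_left_mono[of _ _ "cosh t ^ j"] by (simp add: mult.left_commute)
 qed (use assms cosh_laplace_integrable in auto)
 also have "... = exp x * cosh_laplace j x"
  by (simp add: cosh_laplace_def)
 finally show ?thesis .
qed

lemma set_integral_FTC_atLeast:
 fixes F f :: "real => real"
 assumes F: "!!t. (F has_real_derivative f t) (at t)" and f: "continuous_on UNIV f"
  and int: "set_integrable lborel {a..} f" and lim: "(F \<longlongrightarrow> T) at_top"
 shows "(LBINT t:{a..}. f t) = T - F a"
proof -
 have "((%b. LBINT t:{a..b}. f t) \<longlongrightarrow> (LBINT t:{a..}. f t)) at_top"
  by (rule tendsto_set_lebesgue_integral_at_top) (auto simp: int)
 moreover have "\<forall>\<^sub>F b in at_top. F b - F a = (LBINT t:{a..b}. f t)"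
  using eventually_ge_at_top[of a]
 proof eventually_elim
  case (elim b)
  then show ?case
   unfolding set_lebesgue_integral_def
   using F f by (subst integral_FTC_atLeastAtMost)
    (auto intro: has_vector_derivative_at_within continuous_on_subset
     simp: has_real_derivative_iff_has_vector_derivative)
 qed
 ultimately have "((%b. F b - F a) \<longlongrightarrow> (LBINT t:{a..}. f t)) at_top"
  by (rule tendsto_cong[THEN iffD2, rotated])
 moreover have "((%b. F b - F a) \<longlongrightarrow> T - F a) at_top"
  by (intro tendsto_intros lim)
 ultimately show ?thesis
  by (rule tendsto_unique[rotated]) auto
qed

text \<open>Integrates the derivative of sinh t exp(-x cosh t) and uses cosh^2 = 1 + sinh^2. This is
  the modified Bessel equation of order zero, and it closes the system of derivatives of
  \<open>K0\<close> and \<open>K1\<close>.\<close>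

lemma cosh_laplace_2:
 assumes x: "x > 0"
 shows "cosh_laplace 2 x = cosh_laplace 0 x + cosh_laplace 1 x / x"
proof -
 let ?e = "%j t. cosh t ^ j * exp (- (x * cosh t)) :: real"
 let ?f = "%t. ?e 1 t - x * (?e 2 t - ?e 0 t)"
 note int = cosh_laplace_integrable[OF x, of 0] cosh_laplace_integrable[OF x, of 1]
  cosh_laplace_integrable[OF x, of 2]
 have "(LBINT t:{0..}. ?f t) = 0 - sinh 0 * exp (- (x * cosh 0))"
 proof (rule set_integral_FTC_atLeast)
  fix t :: real
  show "((%t. sinh t * exp (- (x * cosh t))) has_real_derivative ?f t) (at t)"
   by (auto intro!: derivative_eq_intros simp: cosh_square_eq algebra_simps power2_eq_square[symmetric])
 next
  show "set_integrable lborel {0..} ?f"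
   using int by (intro set_integral_diff(1) set_integrable_mult_right) auto
  show "((%t. sinh t * exp (- (x * cosh t))) \<longlongrightarrow> 0) at_top"
   using x unfolding sinh_def cosh_def real_scaleR_def by real_asymp
 qed (auto intro!: continuous_intros)
 moreover have "(LBINT t:{0..}. ?f t) = cosh_laplace 1 x - x * (cosh_laplace 2 x - cosh_laplace 0 x)"
  unfolding cosh_laplace_def using int
  by (subst set_integral_diff(2)) (auto simp: set_integral_diff(2) intro!: set_integral_diff(1))
 ultimately show ?thesis using x by (simp add: field_simps)
qed

definition K0 :: "real => real" where "K0 = cosh_laplace 0"
definition K1 :: "real => real" where "K1 = cosh_laplace 1"

lemma DERIV_K0: "x > 0 ==> (K0 has_real_derivative - K1 x) (at x)"
 using DERIV_cosh_laplace[of x 0] by (simp add: K0_def K1_def)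

lemma DERIV_K1: "x > 0 ==> (K1 has_real_derivative - K0 x - K1 x / x) (at x)"
 using DERIV_cosh_laplace[of x 1] cosh_laplace_2[of x] by (simp add: numeral_2_eq_2 K0_def K1_def)

lemma sinh_laplace_integral:
 assumes x: "(x::real) > 0"
 shows "set_integrable lborel {0..} (%t. sinh t * exp (- (x * cosh t)))"
  and "(LBINT t:{0..}. sinh t * exp (- (x * cosh t))) = exp (- x) / x"
proof -
 show *: "set_integrable lborel {0..} (%t. sinh t * exp (- (x * cosh t)))"
 proof (rule set_integrable_bound[OF cosh_laplace_integrable[OF x, of 1]])
  show "AE t in lborel. t \<in> {0..} --> norm (sinh t * exp (- (x * cosh t)))
    <= norm (cosh t ^ 1 * exp (- (x * cosh t)))"
   by (intro AE_I2) (auto simp: abs_mult sinh_def cosh_def)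
 qed (auto simp: set_borel_measurable_def cosh_def sinh_def)
 have "(LBINT t:{0..}. sinh t * exp (- (x * cosh t))) = 0 - - (exp (- (x * cosh 0)) / x)"
 proof (rule set_integral_FTC_atLeast[OF _ _ *])
  show "((%t. - (exp (- (x * cosh t)) / x)) has_real_derivative sinh t * exp (- (x * cosh t))) (at t)" for t
   using x by (auto intro!: derivative_eq_intros)
  show "((%t. - (exp (- (x * cosh t)) / x)) \<longlongrightarrow> 0) at_top"
   using x unfolding cosh_def real_scaleR_def by real_asymp
 qed (auto intro!: continuous_intros)
 then show "(LBINT t:{0..}. sinh t * exp (- (x * cosh t))) = exp (- x) / x"
  by simp
qed

text \<open>Splits cosh t = sinh t + exp(-t): the first part integrates exactly to exp(-x)/x, the
  second contributes between 0 and 1.\<close>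

lemma K1_bounds:
 assumes x: "x > 0"
 shows "exp (- x) / x <= K1 x" and "K1 x <= exp (- x) / x + 1"
proof -
 note int = cosh_laplace_integrable[OF x, of 1] sinh_laplace_integral(1)[OF x]
 have "K1 x - exp (- x) / x = (LBINT t:{0..}. cosh t ^ 1 * exp (- (x * cosh t)) - sinh t * exp (- (x * cosh t)))"
  using int by (subst set_integral_diff(2)) (auto simp: K1_def cosh_laplace_def sinh_laplace_integral[OF x])
 also have "... = (LBINT t:{0..}. exp (- t) * exp (- (x * cosh t)))"
  by (simp add: cosh_minus_sinh[symmetric] algebra_simps)
 finally have eq: "K1 x - exp (- x) / x = (LBINT t:{0..}. exp (- t) * exp (- (x * cosh t)))" .
 have "(LBINT t:{0..}. exp (- t) * exp (- (x * cosh t))) >= 0"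
  unfolding set_lebesgue_integral_def by (intro integral_nonneg_AE AE_I2) auto
 with eq show "exp (- x) / x <= K1 x" by linarith
 have le: "exp (- t) * exp (- (x * cosh t)) <= exp (- t)" for t
  using x cosh_real_pos[of t] mult_left_mono[of "exp (- (x * cosh t))" 1 "exp (-t)"] by simp
 have "(LBINT t:{0..}. exp (- t) * exp (- (x * cosh t))) <= (LBINT t:{0..}. exp (- t))"
 proof (rule set_integral_mono)
  show "set_integrable lborel {0..} (%t. exp (- t) * exp (- (x * cosh t)))"
   by (rule set_integrable_bound[OF set_integrable_exp_neg])
    (use le in \<open>auto simp: set_borel_measurable_def cosh_def\<close>)
 qed (use le set_integrable_exp_neg in auto)
 with eq show "K1 x <= exp (- x) / x + 1"
  using integral_exp_neg by linarith
qed

lemma K1_pos: "x > 0 ==> K1 x > 0"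
 using K1_bounds(1)[of x] by (smt (verit) divide_pos_pos exp_gt_zero)

lemma K0_pos:
 assumes "x > 0" shows "K0 x > 0"
proof -
 have "\<exists>y. (K0 has_real_derivative y) (at z) & y < 0" if "x <= z" for z
  using DERIV_K0[of z] K1_pos[of z] that assms by (intro exI[of _ "- K1 z"]) auto
 then have "K0 (x + 1) < K0 x"
  by (intro DERIV_neg_imp_decreasing[of x "x + 1"]) auto
 then show ?thesis using cosh_laplace_nonneg[of 0 "x + 1"] by (simp add: K0_def)
qed

lemma cosh_laplace_prod_tendsto_0:
 "((%x. x ^ m * cosh_laplace i x * cosh_laplace j x) \<longlongrightarrow> 0) at_top"
proof (rule Lim_null_comparison)
 let ?C = "exp 1 * cosh_laplace i 1 * (exp 1 * cosh_laplace j 1)"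
 have le: "cosh_laplace i x <= exp 1 * cosh_laplace i 1 * exp (- x)" if "x >= 1" for i x
  using cosh_laplace_scaled_antimono[of 1 x i] that by (simp add: exp_minus field_simps)
 show "\<forall>\<^sub>F x in at_top. norm (x ^ m * cosh_laplace i x * cosh_laplace j x) <= ?C * (x ^ m * exp (- (2 * x)))"
  using eventually_ge_at_top[of 1]
 proof eventually_elim
  case (elim x)
  have "cosh_laplace i x * cosh_laplace j x
    <= exp 1 * cosh_laplace i 1 * exp (- x) * (exp 1 * cosh_laplace j 1 * exp (- x))"
   using elim by (intro mult_mono le) (auto simp: cosh_laplace_nonneg)
  also have "... = ?C * exp (- (2 * x))"
   by (simp add: exp_add[symmetric] algebra_simps flip: exp_add)
  finally have "x ^ m * (cosh_laplace i x * cosh_laplace j x) <= x ^ m * (?C * exp (- (2 * x)))"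
   using elim by (intro mult_left_mono) auto
  then show ?case
   using elim by (simp add: abs_mult cosh_laplace_nonneg mult_ac)
 qed
 show "((%x. ?C * (x ^ m * exp (- (2 * x)))) \<longlongrightarrow> 0) at_top"
 proof (rule tendsto_mult_right_zero)
  show "((%x::real. x ^ m * exp (- (2 * x))) \<longlongrightarrow> 0) at_top"
   by real_asymp
 qed
qed

section \<open>Inequalities for the ratio of K0 and K1 from monotone combinations\<close>

lemma nonneg_of_decreasing_to_0:
 fixes G :: "real => real"
 assumes "!!x. x >= a ==> (G has_real_derivative g x) (at x)" "!!x. x >= a ==> g x <= 0"
  "(G \<longlongrightarrow> 0) at_top"
 shows "G a >= 0"
proof (rule tendsto_upperbound[OF assms(3)])
 show "\<forall>\<^sub>F x in at_top. G x <= G a"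
  using eventually_ge_at_top[of a]
 proof eventually_elim
  case (elim x)
  then show ?case
   using assms(1,2) by (intro DERIV_nonpos_imp_nonincreasing[of a x G]) auto
 qed
qed auto

lemma nonneg_of_increasing_from_0:
 fixes G :: "real => real"
 assumes "!!x. 0 < x ==> x <= b ==> (G has_real_derivative g x) (at x)"
  "!!x. 0 < x ==> x <= b ==> g x >= 0"
  "(G \<longlongrightarrow> 0) (at_right 0)" "0 < b"
 shows "G b >= 0"
proof (rule tendsto_upperbound[OF assms(3)])
 show "\<forall>\<^sub>F x in at_right 0. G x <= G b"
 proof -
  have "\<forall>\<^sub>F x in at_right 0. 0 < x & x < b"
   using assms(4) by (auto simp: eventually_at_right_field)
  then show ?thesis
  proof eventually_elim
   case (elim x)
   then show ?case
    using assms(1,2) by (intro DERIV_nonneg_imp_nondecreasing[of x b G]) (meson dual_order.trans less_le_trans less_imp_le)+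
  qed
 qed
qed auto

definition bessel_ratio :: "real => real" where
 "bessel_ratio x = K0 x / K1 x"

abbreviation "R \<equiv> bessel_ratio"

text \<open>By the Bessel relations this is the derivative of x R(x). It is the denominator of the
  tangential symbol, so its positivity and its lower bounds are needed.\<close>

definition bessel_defect :: "real => real" where
 "bessel_defect x = 2 * R x - x * (1 - (R x)\<^sup>2)"

lemma K0_eq: "x > 0 ==> K0 x = R x * K1 x"
 using K1_pos[of x] by (simp add: bessel_ratio_def)

lemma R_pos: "x > 0 ==> R x > 0"
 by (simp add: bessel_ratio_def K0_pos K1_pos)

lemma DERIV_mult_R:
 assumes "x > 0"
 shows "((%x. x * R x) has_real_derivative bessel_defect x) (at x)"
 unfolding bessel_ratio_def bessel_defect_def using assms K1_pos[of x]
 by (auto intro!: derivative_eq_intros DERIV_K0 DERIV_K1 simp: field_simps power2_eq_square)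

text \<open>After multiplication by K1^2 the difference of both sides is a combination of products
  of K0 and K1 that tends to 0 at infinity, so it is enough that it decreases. The derivative of the
  part without c is -(K0^2 + K1^2) - 2 K0 K1 / x.\<close>

lemma bessel_defect_ge:
 assumes a: "a > 0"
 shows "bessel_defect a >= a / (a + 2)"
proof -
 \<comment> \<open>The largest c with c (1 + 2/x) <= 1 for all x >= a, the condition under which
   \<open>?G\<close> decreases.\<close>
 define c where "c = a / (a + 2)"
 have c: "0 < c" using a by (simp add: c_def)
 let ?G = "%x. 2 * (K0 x * K1 x) + x * ((K0 x)\<^sup>2 - (K1 x)\<^sup>2) - c * (K1 x)\<^sup>2"
 have "?G a >= 0"
 proof (rule nonneg_of_decreasing_to_0[where G="?G"])
  fix x assume "x >= a"
  then have x: "x > 0" using a by simp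
  show "(?G has_real_derivative (- (K1 x)\<^sup>2 - (K0 x)\<^sup>2 - 2 * K0 x * K1 x / x
    + c * (2 * K0 x * K1 x + 2 * (K1 x)\<^sup>2 / x))) (at x)"
   using x by (auto intro!: derivative_eq_intros DERIV_K0 DERIV_K1 simp: field_simps power2_eq_square)
  have "c * (1 + 2 / x) <= c * (1 + 2 / a)"
   using x a c \<open>x >= a\<close> by (intro mult_left_mono add_left_mono divide_left_mono) auto
  also have "... = 1"
  proof -
   have "1 + 2 / a = (a + 2) / a" using a by (simp add: field_simps)
   then show ?thesis using a by (simp add: c_def)
  qed
  finally have cx: "c + 2 * c / x <= 1" by (simp add: algebra_simps)
  have c1: "c <= 1" using cx c x by (smt (verit) divide_pos_pos)
  have "c * (2 * K0 x * K1 x) <= c * ((K0 x)\<^sup>2 + (K1 x)\<^sup>2)"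
   using c sum_squares_bound[of "K0 x" "K1 x"] by (intro mult_left_mono) auto
  also have "c * ((K0 x)\<^sup>2 + (K1 x)\<^sup>2) + 2 * c / x * (K1 x)\<^sup>2 <= (K0 x)\<^sup>2 + (K1 x)\<^sup>2"
   using mult_right_mono[OF cx, of "(K1 x)\<^sup>2"] mult_right_mono[OF c1, of "(K0 x)\<^sup>2"]
   by (simp add: algebra_simps)
  finally have "c * (2 * K0 x * K1 x) + 2 * c / x * (K1 x)\<^sup>2 <= (K0 x)\<^sup>2 + (K1 x)\<^sup>2" by simp
  moreover have "2 * K0 x * K1 x / x >= 0"
   using x K0_pos[OF x] K1_pos[OF x] by simp
  ultimately show "- (K1 x)\<^sup>2 - (K0 x)\<^sup>2 - 2 * K0 x * K1 x / x
    + c * (2 * K0 x * K1 x + 2 * (K1 x)\<^sup>2 / x) <= 0"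
   by (simp add: algebra_simps)
 next
  have "((%x. 2 * (x ^ 0 * cosh_laplace 0 x * cosh_laplace 1 x) + (x ^ 1 * cosh_laplace 0 x * cosh_laplace 0 x - x ^ 1 * cosh_laplace 1 x * cosh_laplace 1 x)
    - c * (x ^ 0 * cosh_laplace 1 x * cosh_laplace 1 x)) \<longlongrightarrow> 2 * 0 + (0 - 0) - c * 0) at_top"
   by (intro tendsto_intros cosh_laplace_prod_tendsto_0)
  then show "(?G \<longlongrightarrow> 0) at_top"
   by (simp add: algebra_simps power2_eq_square K0_def K1_def)
 qed
 then have "c * (K1 a)\<^sup>2 <= bessel_defect a * (K1 a)\<^sup>2"
  by (simp add: bessel_defect_def K0_eq[OF a] algebra_simps power2_eq_square)
 then have "c <= bessel_defect a"
  using K1_pos[OF a] mult_le_cancel_right_pos[of "(K1 a)\<^sup>2" c "bessel_defect a"] by simp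
 then show ?thesis by (simp add: c_def)
qed

lemma bessel_defect_pos: "x > 0 ==> bessel_defect x > 0"
 using bessel_defect_ge[of x] by (smt (verit) divide_pos_pos)

text \<open>x^2 (K1^2 - K0^2) has the derivative -2 x K0^2 and vanishes at infinity.\<close>

lemma one_minus_R_sq_nonneg:
 assumes a: "a > 0"
 shows "(R a)\<^sup>2 <= 1"
proof -
 let ?G = "%x. x\<^sup>2 * ((K1 x)\<^sup>2 - (K0 x)\<^sup>2)"
 have "?G a >= 0"
 proof (rule nonneg_of_decreasing_to_0[where G="?G"])
  fix x assume "x >= a"
  then have x: "x > 0" using a by simp
  show "(?G has_real_derivative - (2 * x * (K0 x)\<^sup>2)) (at x)"
   using x by (auto intro!: derivative_eq_intros DERIV_K0 DERIV_K1 simp: field_simps power2_eq_square)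
  show "- (2 * x * (K0 x)\<^sup>2) <= 0" using x by simp
 next
  have "((%x. (x ^ 2 * cosh_laplace 1 x * cosh_laplace 1 x - x ^ 2 * cosh_laplace 0 x * cosh_laplace 0 x)) \<longlongrightarrow> 0 - 0) at_top"
   by (intro tendsto_intros cosh_laplace_prod_tendsto_0)
  then show "(?G \<longlongrightarrow> 0) at_top"
   by (simp add: algebra_simps power2_eq_square K0_def K1_def)
 qed
 then have "0 <= (a * K1 a)\<^sup>2 * (1 - (R a)\<^sup>2)"
  by (simp add: K0_eq[OF a] algebra_simps power2_eq_square)
 then show ?thesis
  using K1_pos[OF a] a by (simp add: zero_le_mult_iff)
qed

lemma R_le_1: "x > 0 ==> R x <= 1"
 using one_minus_R_sq_nonneg[of x] by (simp add: abs_square_le_1)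

lemma bessel_defect_le: "x > 0 ==> bessel_defect x <= 2 * R x"
 unfolding bessel_defect_def using one_minus_R_sq_nonneg[of x] by simp

text \<open>Positivity of \<open>bessel_defect\<close> says x (1 - R^2) < 2 R, and 1 - R <= 1 - R^2
  because 0 < R <= 1.\<close>

lemma R_ge:
 assumes "x > 0" shows "R x >= x / (x + 2)"
proof -
 have "x * (1 - R x) <= x * (1 - (R x)\<^sup>2)"
  using R_pos[OF assms] R_le_1[OF assms] assms mult_left_mono[of "R x" 1 "R x"]
  by (intro mult_left_mono) (auto simp: power2_eq_square)
 also have "... <= 2 * R x"
  using bessel_defect_pos[OF assms] by (simp add: bessel_defect_def)
 finally show ?thesis using assms by (simp add: field_simps)
qed

text \<open>A quantitative form of R^2 <= 1, again through a combination that decreases to 0; the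
  mixed term K0 K1 of its derivative is reduced to K0^2 by \<open>R_ge\<close>. It keeps
  \<open>normal_denom\<close> away from 0 at infinity, where R tends to 1.\<close>

lemma one_minus_R_sq_ge:
 assumes a: "a > 0"
 shows "a * (1 - (R a)\<^sup>2) >= 2 * a / (2 * a + 3) * (R a)\<^sup>2"
proof -
 \<comment> \<open>Chosen so that 2 c x + 4 c <= 2 x + c, with equality at x = a.\<close>
 define c where "c = 2 * a / (2 * a + 3)"
 have c: "0 < c" "c * (2 * a + 3) = 2 * a" using a by (simp_all add: c_def)
 let ?G = "%x. x\<^sup>2 * ((K1 x)\<^sup>2 - (K0 x)\<^sup>2) - c * (x * (K0 x)\<^sup>2)"
 have "?G a >= 0"
 proof (rule nonneg_of_decreasing_to_0[where G="?G"])
  fix x assume xa: "x >= a"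
  then have x: "x > 0" using a by simp
  show "(?G has_real_derivative (- (2 * x * (K0 x)\<^sup>2) - c * (K0 x)\<^sup>2 + 2 * c * x * K0 x * K1 x)) (at x)"
   using x by (auto intro!: derivative_eq_intros DERIV_K0 DERIV_K1 simp: field_simps power2_eq_square)
  have "x * K1 x <= (x + 2) * K0 x"
   using R_ge[OF x] K1_pos[OF x] x by (simp add: bessel_ratio_def field_simps)
  then have "2 * c * K0 x * (x * K1 x) <= 2 * c * K0 x * ((x + 2) * K0 x)"
   using c K0_pos[OF x] by (intro mult_left_mono) auto
  also have "... = (2 * c * x + 4 * c) * (K0 x)\<^sup>2" by (simp add: power2_eq_square algebra_simps)
  also have "... <= (2 * x + c) * (K0 x)\<^sup>2"
  proof (rule mult_right_mono)
   have "c <= 1" using c a by (simp add: c_def)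
   have "c * (2 * x + 3) = 2 * a + c * 2 * (x - a)"
    using c by (simp add: algebra_simps)
   also have "... <= 2 * a + 1 * 2 * (x - a)"
    using \<open>c <= 1\<close> xa by (intro add_left_mono mult_right_mono) auto
   finally show "2 * c * x + 4 * c <= 2 * x + c" by (simp add: algebra_simps)
  qed simp
  finally show "- (2 * x * (K0 x)\<^sup>2) - c * (K0 x)\<^sup>2 + 2 * c * x * K0 x * K1 x <= 0"
   by (simp add: algebra_simps)
 next
  have "((%x. (x ^ 2 * cosh_laplace 1 x * cosh_laplace 1 x - x ^ 2 * cosh_laplace 0 x * cosh_laplace 0 x) - c * (x ^ 1 * cosh_laplace 0 x * cosh_laplace 0 x)) \<longlongrightarrow> 0 - 0 - c * 0) at_top"
   by (intro tendsto_intros cosh_laplace_prod_tendsto_0)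
  then show "(?G \<longlongrightarrow> 0) at_top"
   by (simp add: algebra_simps power2_eq_square K0_def K1_def)
 qed
 then have "0 <= (a * (K1 a)\<^sup>2) * (a * (1 - (R a)\<^sup>2) - c * (R a)\<^sup>2)"
  by (simp add: K0_eq[OF a] algebra_simps power2_eq_square)
 moreover have "a * (K1 a)\<^sup>2 > 0" using K1_pos[OF a] a by simp
 ultimately have "0 <= a * (1 - (R a)\<^sup>2) - c * (R a)\<^sup>2"
  by (simp only: zero_le_mult_iff) linarith
 then show ?thesis by (simp add: c_def)
qed

lemma one_minus_R_sq_lower:
 assumes "0 < a" "a <= x"
 shows "x * (1 - (R x)\<^sup>2) >= 2 * a / (2 * a + 3) * (a / (a + 2))\<^sup>2"
proof -
 have x: "x > 0" using assms by simp
 have "a / (a + 2) <= x / (x + 2)" using assms by (simp add: field_simps)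
 then have "(a / (a + 2))\<^sup>2 <= (R x)\<^sup>2"
  using R_ge[OF x] assms by (intro power_mono) auto
 moreover have "2 * a / (2 * a + 3) <= 2 * x / (2 * x + 3)" using assms by (simp add: field_simps)
 ultimately have "2 * a / (2 * a + 3) * (a / (a + 2))\<^sup>2 <= 2 * x / (2 * x + 3) * (R x)\<^sup>2"
  using assms by (intro mult_mono) auto
 also have "... <= x * (1 - (R x)\<^sup>2)" by (rule one_minus_R_sq_ge[OF x])
 finally show ?thesis .
qed

lemma bessel_defect_lower:
 assumes "0 < a" "a <= x"
 shows "bessel_defect x >= a / (a + 2)"
proof -
 have "a / (a + 2) <= x / (x + 2)" using assms by (simp add: field_simps)
 then show ?thesis using bessel_defect_ge[of x] assms by simp
qed

section \<open>The logarithmic behaviour at zero and Euler's constant\<close>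

lemma Gamma_integral_Ioi:
 assumes "x > (0::real)"
 shows "((%t. t powr (x - 1) * exp (- t)) has_integral Gamma x) {0<..}"
proof -
 have *: "((%t. t powr (x - 1) * exp (- t)) has_integral Gamma x) {0..}"
  using Gamma_integral_real[OF assms] by (simp add: exp_minus divide_inverse)
 show ?thesis
  by (rule has_integral_spike_set_eq[THEN iffD1, OF _ _ *]; rule negligible_subset[of "{0}"]) auto
qed

text \<open>The integral is the derivative of the Gamma function at 1, which is the Digamma value
  there. It is reached from difference quotients of Gamma with steps 1/(n + 1) by dominated
  convergence; the majorant also gives absolute integrability.\<close>

lemma ln_exp_integral:
 shows "((%t::real. ln t * exp (- t)) has_integral (- euler_mascheroni :: real)) {0<..}"
  and "(%t::real. ln t * exp (- t)) absolutely_integrable_on {0<..}"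
proof -
 define a :: "nat => real" where "a n = 1 / (real n + 1)" for n
 have a: "0 < a n" "a n <= 1" for n by (auto simp: a_def)
 have a0: "a \<longlonglongrightarrow> 0" unfolding a_def by real_asymp
 define f where "f n t = (t powr a n - 1) / a n * exp (- t)" for n t
 \<comment> \<open>One majorant for all quotients: the term in t^(-1/2) dominates -ln t for t < 1,
   and the term in t^2 dominates t^a ln t for t >= 1, as the steps a are at most 1.\<close>
 define w :: "real => real" where
  "w t = 2 * (t powr (1/2 - 1) * exp (- t)) + t powr (3 - 1) * exp (- t)" for t
 have fint: "(f n has_integral (Gamma (1 + a n) - Gamma 1) / a n) {0<..}" for n
 proof -
  have "((%t. (t powr (1 + a n - 1) * exp (- t) - t powr (1 - 1) * exp (- t)) / a n)
    has_integral (Gamma (1 + a n) - Gamma 1) / a n) {0<..}"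
   using a[of n] by (intro has_integral_divide has_integral_diff Gamma_integral_Ioi) auto
  then show ?thesis
   by (rule has_integral_eq[rotated]) (auto simp: f_def algebra_simps diff_divide_distrib)
 qed
 have wint: "w integrable_on {0<..}"
  using has_integral_add[OF has_integral_mult_right[OF Gamma_integral_Ioi[of "1/2"], of 2] Gamma_integral_Ioi[of 3]]
  unfolding w_def by (auto simp: integrable_on_def)
 have bound: "norm (f n t) <= w t" if "t \<in> {0<..}" for n t
 proof -
  have t: "t > 0" using that by simp
  have "\<bar>(t powr a n - 1) / a n\<bar> <= 2 * t powr (1/2 - 1) + t powr (3 - 1)"
  proof (cases "t >= 1")
   case True
   have "- (a n * ln t) + 1 <= exp (- (a n * ln t))"
    using exp_ge_add_one_self[of "- (a n * ln t)"] by simp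
   then have "(1 - a n * ln t) * exp (a n * ln t) <= exp (- (a n * ln t)) * exp (a n * ln t)"
    by (intro mult_right_mono) auto
   then have "t powr a n - 1 <= a n * (ln t * t powr a n)"
    using t by (simp add: powr_def exp_minus algebra_simps)
   also have "ln t * t powr a n <= t * t powr 1"
    using True a[of n] ln_le_minus_one[OF t] by (intro mult_mono powr_mono) auto
   also have "... = t powr 2" using t by (simp add: powr_numeral power2_eq_square)
   finally have "(t powr a n - 1) / a n <= t powr (3 - 1)"
    using a[of n] by (simp add: divide_le_eq mult.commute)
   moreover have "t powr a n >= 1" using True a[of n] by (simp add: ge_one_powr_ge_zero)
   moreover have "t powr (1/2 - 1) >= 0" by (rule powr_ge_zero)
   moreover have "(t powr a n - 1) / a n >= 0" using calculation(2) a[of n] by simp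
   ultimately show ?thesis by (simp only: abs_of_nonneg)
  next
   case False
   have "t powr a n = exp (a n * ln t)" using t by (simp add: powr_def)
   then have 1: "1 - t powr a n <= - (a n * ln t)"
    using exp_ge_add_one_self[of "a n * ln t"] by linarith
   have "- ln t = 2 * ln (t powr (- (1/2)))" using t by (simp add: ln_powr)
   then have "- ln t <= 2 * t powr (- (1/2))"
    using ln_le_minus_one[of "t powr (- (1/2))"] t by simp
   then have "a n * - ln t <= a n * (2 * t powr (- (1/2)))"
    using a[of n] by (intro mult_left_mono) auto
   with 1 have "1 - t powr a n <= a n * (2 * t powr (1/2 - 1))" by simp
   then have "(1 - t powr a n) / a n <= 2 * t powr (1/2 - 1)"
    using a[of n] by (simp add: divide_le_eq mult.commute)
   moreover have "t powr (3 - 1) >= 0" by (rule powr_ge_zero)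
   moreover have "t powr a n <= 1"
    using False t a[of n] powr_mono2[of "a n" t 1] by simp
   moreover have "\<bar>(t powr a n - 1) / a n\<bar> = (1 - t powr a n) / a n"
    using a[of n] calculation(3) by (simp add: abs_of_nonpos divide_nonpos_pos minus_divide_left)
   ultimately show ?thesis by linarith
  qed
  then have "\<bar>(t powr a n - 1) / a n\<bar> * exp (- t) <= (2 * t powr (1/2 - 1) + t powr (3 - 1)) * exp (- t)"
   by (intro mult_right_mono) auto
  then show ?thesis unfolding f_def w_def by (simp only: real_norm_def abs_mult abs_exp_cancel distrib_right mult.assoc)
 qed
 have lim: "(%n. f n t) \<longlonglongrightarrow> ln t * exp (- t)" if "t \<in> {0<..}" for t
 proof -
  have t: "t > 0" using that by simp
  have "((%x. exp (x * ln t)) has_real_derivative ln t) (at 0)"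
   by (auto intro!: derivative_eq_intros)
  then have "((%h. (t powr h - 1) / h) \<longlongrightarrow> ln t) (at 0)"
  proof -
   assume "((%x. exp (x * ln t)) has_real_derivative ln t) (at 0)"
   then have "((%h. (exp ((0 + h) * ln t) - exp (0 * ln t)) / h) \<longlongrightarrow> ln t) (at 0)"
    by (simp only: DERIV_def)
   moreover have "t powr h = exp ((0 + h) * ln t)" for h using t by (simp add: powr_def)
   moreover have "exp (0 * ln t) = 1" by simp
   ultimately show ?thesis by (simp only:)
  qed
  then have "((%n. (t powr a n - 1) / a n) \<longlongrightarrow> ln t) sequentially"
   using a a0 t by (intro filterlim_compose[of "%h. (t powr h - 1) / h" _ "at 0" a])
    (auto simp: filterlim_at intro!: always_eventually less_imp_neq[symmetric])
  then show ?thesis unfolding f_def by (intro tendsto_intros)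
 qed
 have int: "(%t::real. ln t * exp (- t)) integrable_on {0<..}"
  and lim2: "(%n. integral {0<..} (f n)) \<longlonglongrightarrow> integral {0<..} (%t::real. ln t * exp (- t))"
  using dominated_convergence[OF has_integral_integrable[OF fint] wint bound lim] by auto
 have "((%h. (Gamma (1 + h) - Gamma 1) / h) \<longlongrightarrow> - euler_mascheroni) (at (0::real))"
 proof -
  have "(Gamma has_real_derivative Gamma 1 * Digamma 1) (at 1)"
   by (rule has_field_derivative_Gamma) (use Gamma_eq_zero_iff[of "1::real"] in simp)
  then show ?thesis by (simp only: DERIV_def Gamma_1 Digamma_1 mult_1)
 qed
 then have "(%n. (Gamma (1 + a n) - Gamma 1) / a n) \<longlonglongrightarrow> - euler_mascheroni"
  using a a0 by (intro filterlim_compose[of "%h. (Gamma (1 + h) - Gamma 1) / h" _ "at 0" a])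
   (auto simp: filterlim_at intro!: always_eventually less_imp_neq[symmetric])
 moreover have "integral {0<..} (f n) = (Gamma (1 + a n) - Gamma 1) / a n" for n
  using fint by (rule integral_unique)
 ultimately have "(%n. integral {0<..} (f n)) \<longlonglongrightarrow> - euler_mascheroni" by simp
 then have "integral {0<..} (%t::real. ln t * exp (- t)) = - euler_mascheroni"
  by (rule LIMSEQ_unique[OF lim2])
 then show "((%t::real. ln t * exp (- t)) has_integral (- euler_mascheroni :: real)) {0<..}"
  using int by (simp add: has_integral_integrable_integral)
 have "norm (ln t * exp (- t)) <= w t" if "t \<in> {0<..}" for t
  using tendsto_norm[OF lim[OF that]] bound[OF that] by (intro LIMSEQ_le_const2) auto
 then show "(%t::real. ln t * exp (- t)) absolutely_integrable_on {0<..}"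
  by (intro absolutely_integrable_integrable_bound[OF _ int wint])
qed

lemma ln_exp_absolutely_integrable: "(%t::real. ln t * exp (- t)) absolutely_integrable_on {0..}"
 by (rule absolutely_integrable_spike_set[OF ln_exp_integral(2)]; rule negligible_subset[of "{0}"]) auto

text \<open>With s = y exp t this is the exponential integral, that is, the integral of exp(-s)/s
  from y to infinity. The function \<open>h\<close> in the proof is that tail, written by parts
  against ln s; Euler's constant is the normalisation that makes it vanish at infinity.\<close>

lemma exp_exp_integral:
 fixes y :: real
 assumes y: "y > 0"
 shows "set_integrable lborel {0..} (%t. exp (- (y * exp t)))"
  and "(LBINT t:{0..}. exp (- (y * exp t)))
   = - euler_mascheroni - integral {0..y} (%t. ln t * exp (- t)) - ln y * exp (- y)"
proof -
 let ?f = "%t::real. ln t * exp (- t)"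
 note abs = ln_exp_absolutely_integrable
 have whole: "integral {0..} ?f = - euler_mascheroni"
 proof (rule integral_unique)
  show "(?f has_integral - euler_mascheroni) {0..}"
   by (rule has_integral_spike_set_eq[THEN iffD1, OF _ _ ln_exp_integral(1)];
     rule negligible_subset[of "{0}"]) auto
 qed
 have fint: "?f integrable_on {a..b}" if "0 <= a" for a b
  by (rule set_lebesgue_integral_eq_integral(1), rule set_integrable_subset[OF abs]) (use that in auto)
 define J where "J b = integral {0..b} ?f" for b
 have Jlim: "(J \<longlongrightarrow> - euler_mascheroni) at_top"
 proof -
  have "((%b. LINT t:{0..b}|lebesgue. ?f t) \<longlongrightarrow> (LINT t:{0..}|lebesgue. ?f t)) at_top"
   by (rule tendsto_set_lebesgue_integral_at_top) (auto simp: abs)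
  moreover have "(LINT t:{0..b}|lebesgue. ?f t) = J b" for b
   unfolding J_def by (rule set_lebesgue_integral_eq_integral(2), rule set_integrable_subset[OF abs]) auto
  ultimately show ?thesis
   using whole set_lebesgue_integral_eq_integral(2)[OF abs] by simp
 qed
 have Jderiv: "(J has_real_derivative ln s * exp (- s)) (at s)" if s: "s > 0" for s
 proof -
  have eq: "J b = J (s/2) + integral {s/2..b} ?f" if "b >= s/2" for b
   unfolding J_def using that s fint[of 0 b] Henstock_Kurzweil_Integration.integral_combine[of 0 "s/2" b ?f] by simp
  have "((%b. integral {s/2..b} ?f) has_real_derivative ?f s) (at s within {s/2..2 * s})"
   using s by (intro integral_has_real_derivative) (auto intro!: continuous_intros)
  then have "((%b. J (s/2) + integral {s/2..b} ?f) has_real_derivative ?f s) (at s)"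
   using s at_within_Icc_at[of "s/2" s "2 * s"] by (auto intro!: derivative_eq_intros)
  from this open_greaterThan[of "s/2"] show ?thesis
   proof (rule has_field_derivative_transform_within_open)
   show "s \<in> {s/2<..}" using s by simp
   show "J (s/2) + integral {s/2..b} ?f = J b" if "b \<in> {s/2<..}" for b
    using that by (intro eq[symmetric]) simp
  qed
 qed
 define h where "h s = - euler_mascheroni - J s - ln s * exp (- s)" for s
 have hderiv: "(h has_real_derivative - exp (- s) / s) (at s)" if s: "s > 0" for s
  unfolding h_def using s by (auto intro!: derivative_eq_intros Jderiv simp: field_simps)
 have hlim: "(h \<longlongrightarrow> 0) at_top"
 proof -
  have "(h \<longlongrightarrow> - euler_mascheroni - (- euler_mascheroni) - 0) at_top"
   unfolding h_def
  proof (intro tendsto_intros Jlim)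
   show "((%s::real. ln s * exp (- s)) \<longlongrightarrow> 0) at_top" by real_asymp
  qed
  then show ?thesis by simp
 qed
 show int: "set_integrable lborel {0..} (%t. exp (- (y * exp t)))"
 proof (rule set_integrable_bound)
  show "set_integrable lborel {0..} (%t. (1 / y) * exp (- t))"
   using set_integrable_exp_neg by (rule set_integrable_mult_right[rotated])
  show "AE t in lborel. t \<in> {0..} --> norm (exp (- (y * exp t))) <= norm ((1 / y) * exp (- t))"
   proof (intro AE_I2 impI)
   fix t :: real
   have "exp t * exp (- (y * exp t)) <= 1 / y"
    using power_exp_neg_le[of y "exp t" 1] y by simp
   then have "exp (- t) * (exp t * exp (- (y * exp t))) <= exp (- t) * (1 / y)"
    by (intro mult_left_mono) auto
   then show "norm (exp (- (y * exp t))) <= norm ((1 / y) * exp (- t))"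
    using y by (simp add: exp_minus field_simps)
  qed
 qed (auto simp: set_borel_measurable_def)
 have "(LBINT t:{0..}. exp (- (y * exp t))) = 0 - (- h (y * exp 0))"
 proof (rule set_integral_FTC_atLeast[where F="%t. - h (y * exp t)", OF _ _ int])
  fix t :: real
  have "((%t. h (y * exp t)) has_real_derivative - exp (- (y * exp t)) / (y * exp t) * (y * exp t)) (at t)"
   using y by (intro DERIV_chain'[OF _ hderiv]) (auto intro!: derivative_eq_intros)
  then show "((%t. - h (y * exp t)) has_real_derivative exp (- (y * exp t))) (at t)"
   using y by (auto intro!: derivative_eq_intros)
 next
  have "filterlim (%t. y * exp t) at_top at_top" using y by real_asymp
  from filterlim_compose[OF hlim this] show "((%t. - h (y * exp t)) \<longlongrightarrow> 0) at_top"
   by (drule_tac tendsto_minus) simp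
 qed (auto intro!: continuous_intros)
 then show "(LBINT t:{0..}. exp (- (y * exp t)))
   = - euler_mascheroni - integral {0..y} (%t. ln t * exp (- t)) - ln y * exp (- y)"
  by (simp add: h_def J_def)
qed

lemma exp_exp_integral_tendsto:
 "((%y::real. (LBINT t:{0..}. exp (- (y * exp t))) + ln y) \<longlongrightarrow> - euler_mascheroni) (at_right 0)"
proof -
 let ?f = "%t::real. ln t * exp (- t)"
 have "?f integrable_on {0..1}"
  by (rule set_lebesgue_integral_eq_integral(1), rule set_integrable_subset[OF ln_exp_absolutely_integrable]) auto
 then have "continuous_on {0..1} (%b. integral {0..b} ?f)"
  by (rule indefinite_integral_continuous_1)
 then have "((%b. integral {0..b} ?f) \<longlongrightarrow> integral {0..0} ?f) (at 0 within {0..1})"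
  by (auto simp only: continuous_on_def atLeastAtMost_iff zero_le_one order_refl)
 then have J0: "((%b. integral {0..b} ?f) \<longlongrightarrow> 0) (at_right 0)"
  by (simp add: at_within_Icc_at_right)
 have "((%y::real. - euler_mascheroni - integral {0..y} ?f + ln y * (1 - exp (- y)))
   \<longlongrightarrow> - euler_mascheroni - 0 + 0) (at_right 0)"
 proof (intro tendsto_intros J0)
  show "((%y::real. ln y * (1 - exp (- y))) \<longlongrightarrow> 0) (at_right 0)" by real_asymp
 qed
 then have lim: "((%y::real. - euler_mascheroni - integral {0..y} ?f + ln y * (1 - exp (- y)))
   \<longlongrightarrow> - euler_mascheroni) (at_right 0)" by simp
 show ?thesis
 proof (rule Lim_transform_eventually[OF lim])
  show "\<forall>\<^sub>F y in at_right (0::real). - euler_mascheroni - integral {0..y} ?f + ln y * (1 - exp (- y))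
    = (LBINT t:{0..}. exp (- (y * exp t))) + ln y"
   using eventually_at_right_less[of "0::real"]
   by eventually_elim (simp add: exp_exp_integral algebra_simps)
 qed
qed

text \<open>Replaces cosh t by exp t / 2: the dropped factor exp(-(x/2) exp(-t)) differs from 1 by
  at most (x/2) exp(-t), and this integrates to x/2.\<close>

lemma K0_exp_exp_bound:
 assumes x: "x > 0"
 shows "\<bar>K0 x - (LBINT t:{0..}. exp (- (x / 2 * exp t)))\<bar> <= x / 2"
proof -
 have int1: "set_integrable lborel {0..} (%t::real. exp (- (x * cosh t)))"
  using cosh_laplace_integrable[OF x, of 0] by simp
 have int2: "set_integrable lborel {0..} (%t::real. exp (- (x / 2 * exp t)))"
  by (rule exp_exp_integral) (use x in simp)
 have le: "0 <= exp (- (x / 2 * exp t)) - exp (- (x * cosh t))"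
  "exp (- (x / 2 * exp t)) - exp (- (x * cosh t)) <= x / 2 * exp (- t)" for t :: real
 proof -
  let ?a = "exp (- (x / 2 * exp t))" and ?b = "exp (- (x / 2 * exp (- t)))"
  have eq: "exp (- (x * cosh t)) = ?a * ?b"
   by (simp add: cosh_def exp_add[symmetric] algebra_simps add_divide_distrib)
  have b: "1 - x / 2 * exp (- t) <= ?b" "?b <= 1"
   using exp_ge_add_one_self[of "- (x / 2 * exp (- t))"] x by simp_all
  have a: "0 < ?a" "?a <= 1" using x by simp_all
  show "0 <= ?a - exp (- (x * cosh t))" unfolding eq using mult_left_mono[OF b(2), of ?a] a by simp
  have "?a - ?a * ?b = ?a * (1 - ?b)" by (simp add: algebra_simps)
  also have "... <= 1 * (x / 2 * exp (- t))" using a b by (intro mult_mono) auto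
  finally show "?a - exp (- (x * cosh t)) <= x / 2 * exp (- t)" unfolding eq by simp
 qed
 have d: "(LBINT t:{0..}. exp (- (x / 2 * exp t))) - K0 x
   = (LBINT t:{0..}. exp (- (x / 2 * exp t)) - exp (- (x * cosh t)))"
  using int1 int2 by (simp add: set_integral_diff(2) K0_def cosh_laplace_def)
 have "0 <= (LBINT t:{0..}. exp (- (x / 2 * exp t)) - exp (- (x * cosh t)))"
  unfolding set_lebesgue_integral_def by (intro integral_nonneg_AE AE_I2) (use le in auto)
 moreover have "(LBINT t:{0..}. exp (- (x / 2 * exp t)) - exp (- (x * cosh t)))
   <= (LBINT t:{0..}. x / 2 * exp (- t))"
  by (rule set_integral_mono)
   (use le int1 int2 set_integrable_exp_neg in \<open>auto intro: set_integral_diff(1)\<close>)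
 moreover have "(LBINT t:{0..}. x / 2 * exp (- t)) = x / 2"
  using integral_exp_neg by simp
 ultimately show ?thesis using d by linarith
qed

lemma K0_tendsto: "((%x. K0 x + ln (x / 2)) \<longlongrightarrow> - euler_mascheroni) (at_right 0)"
proof -
 let ?g = "%y::real. (LBINT t:{0..}. exp (- (y * exp t))) + ln y"
 have "filterlim (%x::real. x / 2) (at_right 0) (at_right 0)" by real_asymp
 from filterlim_compose[OF exp_exp_integral_tendsto this]
 have 1: "((%x. ?g (x / 2)) \<longlongrightarrow> - euler_mascheroni) (at_right 0)" by simp
 have "((%x. (K0 x + ln (x / 2)) - ?g (x / 2)) \<longlongrightarrow> 0) (at_right 0)"
 proof (rule Lim_null_comparison)
  show "\<forall>\<^sub>F x in at_right 0. norm ((K0 x + ln (x / 2)) - ?g (x / 2)) <= x / 2"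
   using eventually_at_right_less[of "0::real"]
   by eventually_elim (use K0_exp_exp_bound in auto)
  show "((%x::real. x / 2) \<longlongrightarrow> 0) (at_right 0)" by real_asymp
 qed
 from tendsto_add[OF this 1] show ?thesis by simp
qed

lemma mult_K1_tendsto: "((%x. x * K1 x) \<longlongrightarrow> 1) (at_right 0)"
proof (rule tendsto_sandwich)
 show "\<forall>\<^sub>F x in at_right 0. exp (- x) <= x * K1 x"
  using eventually_at_right_less[of "0::real"]
  by eventually_elim (use K1_bounds(1) in \<open>auto simp: divide_le_eq mult.commute\<close>)
 show "\<forall>\<^sub>F x in at_right 0. x * K1 x <= exp (- x) + x"
  using eventually_at_right_less[of "0::real"]
 proof eventually_elim
  case (elim x)
  show ?case using mult_left_mono[OF K1_bounds(2)[OF elim], of x] elim by (simp add: algebra_simps)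
 qed
 show "((%x::real. exp (- x)) \<longlongrightarrow> 1) (at_right 0)" by real_asymp
 show "((%x::real. exp (- x) + x) \<longlongrightarrow> 1) (at_right 0)" by real_asymp
qed

lemma DERIV_mult_K1: "x > 0 ==> ((%x. x * K1 x) has_real_derivative - (x * K0 x)) (at x)"
 by (auto intro!: derivative_eq_intros DERIV_K1 simp: field_simps)

lemma mult_K1_le_1:
 assumes "x > 0" shows "x * K1 x <= 1"
proof -
 have "0 <= 1 - x * K1 x"
 proof (rule nonneg_of_increasing_from_0[where G="%x. 1 - x * K1 x" and g="%x. x * K0 x"])
  show "((%x. 1 - x * K1 x) has_real_derivative y * K0 y) (at y)" if "0 < y" for y
   by (rule DERIV_cong[OF DERIV_diff[OF DERIV_const DERIV_mult_K1[OF that]]]) simp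
  show "0 <= y * K0 y" if "0 < y" for y using K0_pos[OF that] that by simp
  show "((%x. 1 - x * K1 x) \<longlongrightarrow> 0) (at_right 0)"
   using tendsto_diff[OF tendsto_const[of 1] mult_K1_tendsto] by simp
 qed (use assms in auto)
 then show ?thesis by simp
qed

lemma mult_K1_ge:
 assumes "0 < x" "x <= 1" shows "x * K1 x >= K1 1"
proof -
 have "1 * K1 1 <= x * K1 x"
 proof (rule DERIV_nonpos_imp_nonincreasing[OF assms(2), where f="%x. x * K1 x"])
  fix y assume "x <= y" "y <= 1"
  then show "\<exists>z. ((%x. x * K1 x) has_real_derivative z) (at y) & z <= 0"
   using DERIV_mult_K1[of y] K0_pos[of y] assms by (intro exI[of _ "- (y * K0 y)"]) auto
 qed
 then show ?thesis by simp
qed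

lemma K0_log_bound:
 assumes "0 < x" "x <= 1" shows "K0 x <= K0 1 - ln x"
proof -
 have "K0 x + ln x <= K0 1 + ln 1"
 proof (rule DERIV_nonneg_imp_nondecreasing[OF assms(2), where f="%x. K0 x + ln x"])
  fix y assume "x <= y" "y <= 1"
  then have y: "y > 0" using assms by simp
  have "((%x. K0 x + ln x) has_real_derivative - K1 y + 1 / y) (at y)"
   using y by (auto intro!: derivative_eq_intros DERIV_K0)
  moreover have "- K1 y + 1 / y >= 0" using mult_K1_le_1[OF y] y by (simp add: field_simps)
  ultimately show "\<exists>z. ((%x. K0 x + ln x) has_real_derivative z) (at y) & z >= 0" by blast
 qed
 then show ?thesis by simp
qed

text \<open>Integrates (x K1)' = -x K0 from 0, where x K1 tends to 1. The right-hand side is the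
  exact integral over [0, x] of y (K0(1) - ln y), the bound for y K0(y) from
  \<open>K0_log_bound\<close>.\<close>

lemma mult_K1_expansion:
 assumes "0 < x" "x <= 1"
 shows "1 - x * K1 x <= (K0 1 * 2 + 1) / 4 * x\<^sup>2 - x\<^sup>2 / 2 * ln x"
proof -
 let ?A = "K0 1"
 let ?G = "%x. ((?A * 2 + 1) / 4 * x\<^sup>2 - x\<^sup>2 / 2 * ln x) - (1 - x * K1 x)"
 have "0 <= ?G x"
 proof (rule nonneg_of_increasing_from_0[where G="?G" and g="%x. x * (?A - ln x - K0 x)"])
  fix y assume y: "0 < y" "y <= x"
  show "(?G has_real_derivative y * (?A - ln y - K0 y)) (at y)"
   using y by (auto intro!: derivative_eq_intros DERIV_K1 simp: field_simps power2_eq_square)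
  show "0 <= y * (?A - ln y - K0 y)"
   using K0_log_bound[of y] y assms by simp
 next
  have "((%x::real. (?A * 2 + 1) / 4 * x\<^sup>2 - x\<^sup>2 / 2 * ln x) \<longlongrightarrow> 0) (at_right 0)"
   by real_asymp
  from tendsto_diff[OF this tendsto_diff[OF tendsto_const[of 1] mult_K1_tendsto]]
  show "(?G \<longlongrightarrow> 0) (at_right 0)" by simp
 qed (use assms in auto)
 then show ?thesis by simp
qed

text \<open>The remainder vanishes at 0 by \<open>K0_tendsto\<close> and has the derivative (1 - y
  K1(y))/y, which is nonnegative and bounded by \<open>mult_K1_expansion\<close>; integrating from 0
  gives both inequalities.\<close>

lemma K0_expansion:
 assumes "0 < x" "x <= 1"
 shows "0 <= K0 x + ln (x / 2) + euler_mascheroni"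
  and "K0 x + ln (x / 2) + euler_mascheroni <= (K0 1 * 2 + 2) / 8 * x\<^sup>2 - x\<^sup>2 / 4 * ln x"
proof -
 let ?A = "K0 1"
 let ?E = "%x. K0 x + ln (x / 2) + euler_mascheroni"
 let ?H = "%x. (?A * 2 + 2) / 8 * x\<^sup>2 - x\<^sup>2 / 4 * ln x"
 have E: "(?E has_real_derivative - K1 y + 1 / y) (at y)" if "y > 0" for y
  using that by (auto intro!: derivative_eq_intros DERIV_K0)
 have Elim: "(?E \<longlongrightarrow> 0) (at_right 0)"
  using tendsto_add[OF K0_tendsto tendsto_const[of euler_mascheroni]] by simp
 show "0 <= ?E x"
 proof (rule nonneg_of_increasing_from_0[where G="?E" and g="%y. - K1 y + 1 / y"])
  show "0 <= - K1 y + 1 / y" if "0 < y" for y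
   using mult_K1_le_1[OF that] that by (simp add: field_simps)
 qed (use assms E Elim in auto)
 have "0 <= ?H x - ?E x"
 proof (rule nonneg_of_increasing_from_0[where G="%x. ?H x - ?E x"
    and g="%y. (((?A * 2 + 1) / 4 * y\<^sup>2 - y\<^sup>2 / 2 * ln y) - (1 - y * K1 y)) / y"])
  fix y assume y: "0 < y" "y <= x"
  show "((%x. ?H x - ?E x) has_real_derivative
    (((?A * 2 + 1) / 4 * y\<^sup>2 - y\<^sup>2 / 2 * ln y) - (1 - y * K1 y)) / y) (at y)"
   using y by (auto intro!: derivative_eq_intros DERIV_K0 simp: field_simps power2_eq_square)
  show "0 <= (((?A * 2 + 1) / 4 * y\<^sup>2 - y\<^sup>2 / 2 * ln y) - (1 - y * K1 y)) / y"
   using mult_K1_expansion[of y] y assms by simp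
 next
  have "(?H \<longlongrightarrow> 0) (at_right 0)" by real_asymp
  from tendsto_diff[OF this Elim] show "((%x. ?H x - ?E x) \<longlongrightarrow> 0) (at_right 0)" by simp
 qed (use assms in auto)
 then show "?E x <= ?H x" by simp
qed

text \<open>The leading part of K0 at zero. In x = pi \<epsilon> |k| the slender body symbols are 4
  pi / (2 \<open>log_term\<close> - 1) and 8 pi / (2 \<open>log_term\<close> + 1).\<close>

definition log_term :: "real => real" where
 "log_term x = - ln (x / 2) - euler_mascheroni"

lemma euler_mascheroni_less: "(euler_mascheroni :: real) < 13/22"
 using euler_mascheroni_less_13_over_22 .

lemma log_term_abs_le:
 assumes "0 < x" "x <= 1" shows "\<bar>log_term x\<bar> <= 1 - ln x"
proof -
 have "ln x <= 0" using assms by simp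
 moreover have "log_term x = - ln x + ln 2 - euler_mascheroni"
  using assms by (simp add: log_term_def ln_div)
 moreover have "0 < (euler_mascheroni :: real)" by (rule euler_mascheroni_pos)
 moreover have "2/3 <= ln (2::real)" by (rule ln2_ge_two_thirds)
 moreover have "ln (2::real) <= 1" using ln_le_minus_one[of "2::real"] by simp
 ultimately show ?thesis using euler_mascheroni_less by linarith
qed

lemma mult_log_le_1: "0 < x ==> x * (1 - ln x) <= (1::real)"
proof -
 assume x: "0 < x"
 have "ln (1 / x) <= 1 / x - 1" using x by (intro ln_le_minus_one) simp
 then have "1 - ln x <= 1 / x" using x by (simp add: ln_div)
 then show ?thesis using x by (simp add: field_simps)
qed

text \<open>R/x = K0/(x K1), and both K0 - \<open>log_term\<close> and 1 - x K1 are O(x^2 (1 - ln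
  x)). Correcting the denominator multiplies the second error by \<open>log_term\<close>, which is
  where the second logarithm comes from.\<close>

lemma bessel_ratio_expansion:
 obtains C D :: real where "C > 0" "D > 0"
  "!!x. 0 < x ==> x <= 1 ==> \<bar>R x / x - log_term x\<bar> <= C * (x\<^sup>2 * (1 - ln x)\<^sup>2)"
  "!!x. 0 < x ==> x <= 1 ==> R x / x <= D * (1 - ln x)"
proof
 define B where "B = K0 1 + 1"
 have B: "B > 1" using K0_pos[of 1] by (simp add: B_def)
 have k: "K1 1 > 0" by (rule K1_pos) simp
 have k0: "K0 1 > 0" by (rule K0_pos) simp
 show "2 * B / K1 1 > 0" "B / K1 1 > 0" using B k by auto
 fix x :: real assume x: "0 < x" "x <= 1"
 define L where "L = 1 - ln x"
 have L: "L >= 1" using x by (simp add: L_def)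
 define P where "P = 1 - x * K1 x"
 define E where "E = K0 x - log_term x"
 have xK: "K1 1 <= x * K1 x" "0 < x * K1 x" using mult_K1_ge[OF x] k by auto
 have Rx: "R x / x = K0 x / (x * K1 x)" by (simp add: bessel_ratio_def mult.commute)
 have x2: "x\<^sup>2 >= 0" by simp
 have lnx: "ln x = 1 - L" by (simp add: L_def)
 have P: "0 <= P" "P <= B * (x\<^sup>2 * L)"
 proof -
  show "0 <= P" using mult_K1_le_1[OF x(1)] by (simp add: P_def)
  have "P <= (K0 1 * 2 + 1) / 4 * x\<^sup>2 - x\<^sup>2 / 2 * ln x"
   using mult_K1_expansion[OF x] by (simp add: P_def)
  also have "... = x\<^sup>2 * ((K0 1 * 2 + 1) / 4 + (L - 1) / 2)"
   by (simp add: lnx algebra_simps add_divide_distrib diff_divide_distrib)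
  also have "... <= x\<^sup>2 * (B * L)"
  proof (rule mult_left_mono[OF _ x2])
   have "K0 1 * 1 <= K0 1 * L" using K0_pos[of 1] L by (intro mult_left_mono) auto
   moreover have "B * L = K0 1 * L + L" by (simp add: B_def algebra_simps)
   moreover have "(K0 1 * 2 + 1) / 4 + (L - 1) / 2 = K0 1 / 2 + L / 2 - 1 / 4" by (simp add: field_simps)
   ultimately show "(K0 1 * 2 + 1) / 4 + (L - 1) / 2 <= B * L"
    using L k0 by linarith
  qed
  finally show "P <= B * (x\<^sup>2 * L)" by (simp add: algebra_simps)
 qed
 have E: "0 <= E" "E <= B * (x\<^sup>2 * L)"
 proof -
  have "E <= (K0 1 * 2 + 2) / 8 * x\<^sup>2 - x\<^sup>2 / 4 * ln x" "0 <= E"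
   using K0_expansion[OF x] by (simp_all add: E_def log_term_def)
  note this(1)
  also have "(K0 1 * 2 + 2) / 8 * x\<^sup>2 - x\<^sup>2 / 4 * ln x = x\<^sup>2 * ((K0 1 * 2 + 2) / 8 + (L - 1) / 4)"
   by (simp add: lnx algebra_simps add_divide_distrib diff_divide_distrib)
  also have "... <= x\<^sup>2 * (B * L)"
  proof (rule mult_left_mono[OF _ x2])
   have "K0 1 * 1 <= K0 1 * L" using K0_pos[of 1] L by (intro mult_left_mono) auto
   moreover have "B * L = K0 1 * L + L" by (simp add: B_def algebra_simps)
   moreover have "(K0 1 * 2 + 2) / 8 + (L - 1) / 4 = K0 1 / 4 + L / 4" by (simp add: field_simps)
   ultimately show "(K0 1 * 2 + 2) / 8 + (L - 1) / 4 <= B * L"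
    using L k0 by linarith
  qed
  finally show "E <= B * (x\<^sup>2 * L)" by (simp add: algebra_simps)
  show "0 <= E" by fact
 qed
 have l: "\<bar>log_term x\<bar> <= L" using log_term_abs_le[OF x] by (simp add: L_def)
 have "R x / x - log_term x = (E + log_term x * P) / (x * K1 x)"
 proof -
  have "k / y - l = ((k - l) + l * (1 - y)) / y" if "y > 0" for k y l :: real
   using that by (simp add: field_simps)
  from this[OF xK(2)] show ?thesis by (simp only: Rx E_def P_def)
 qed
 also have "\<bar>(E + log_term x * P) / (x * K1 x)\<bar> <= (2 * B * (x\<^sup>2 * L\<^sup>2)) / K1 1"
  if "True"
 proof -
  have "\<bar>log_term x * P\<bar> <= L * (B * (x\<^sup>2 * L))"
   unfolding abs_mult using l P L by (intro mult_mono) auto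
  moreover have "1 * (B * (x\<^sup>2 * L)) <= L * (B * (x\<^sup>2 * L))"
   using L B by (intro mult_right_mono) auto
  ultimately have "\<bar>E + log_term x * P\<bar> <= 2 * B * (x\<^sup>2 * L\<^sup>2)"
   using E abs_triangle_ineq[of E "log_term x * P"] by (simp add: power2_eq_square mult_ac)
  then show ?thesis
   unfolding abs_divide using xK k B by (intro frac_le) auto
 qed
 finally show "\<bar>R x / x - log_term x\<bar> <= 2 * B / K1 1 * (x\<^sup>2 * (1 - ln x)\<^sup>2)"
  by (simp add: L_def)
 have "K0 x <= K0 1 + (L - 1)" using K0_log_bound[OF x] by (simp add: L_def)
 also have "... <= B * L"
 proof -
  have "K0 1 <= K0 1 * L" using k0 L by (simp add: mult_le_cancel_left1)
  moreover have "B * L = K0 1 * L + L" by (simp add: B_def algebra_simps)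
  ultimately show ?thesis using L by argo
 qed
 finally have "K0 x / (x * K1 x) <= B * L / K1 1"
  using xK k K0_pos[OF x(1)] by (intro frac_le) auto
 then show "R x / x <= B / K1 1 * (1 - ln x)" by (simp add: Rx L_def)
qed

section \<open>The exact symbols and their comparison with the slender body symbols\<close>

definition lambda_PDE_t :: "real => real" where
 "lambda_PDE_t x = 4 * pi * x / bessel_defect x"

definition defect_quot :: "real => real" where
 "defect_quot x = x * bessel_defect x / (x * R x + 2)"

definition normal_denom :: "real => real" where
 "normal_denom x = 2 * (x * (1 - (R x)\<^sup>2)) + 2 * bessel_defect x / (x * R x + 2)"

text \<open>Eigenvalue for the two transverse directions at x = pi \<epsilon> |k|. That these closed
  forms are the eigenvalues is established in \<open>profile_boundary\<close>, where they are the
  values of the force profiles on the boundary.\<close>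

definition lambda_PDE_n :: "real => real" where
 "lambda_PDE_n x = 2 * pi * x * (4 - defect_quot x) / normal_denom x"

lemma defect_quot_bounds:
 assumes "x > 0"
 shows "0 <= defect_quot x" "defect_quot x <= 2"
proof -
 note * = bessel_defect_pos[OF assms] bessel_defect_le[OF assms] R_pos[OF assms]
 then have xR: "x * R x > 0" using assms by simp
 show "0 <= defect_quot x" using * xR assms by (simp add: defect_quot_def)
 have "x * bessel_defect x <= x * (2 * R x)" using * assms by (intro mult_left_mono) auto
 then show "defect_quot x <= 2" using xR by (simp add: defect_quot_def field_simps)
qed

lemma normal_denom_ge:
 assumes "x > 0"
 shows "normal_denom x >= 2 * (x * (1 - (R x)\<^sup>2))"
 using bessel_defect_pos[OF assms] R_pos[OF assms] assms by (simp add: normal_denom_def)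

lemma lambda_PDE_t_linear:
 assumes a: "a > 0"
 obtains C where "C > 0" "!!x. x >= a ==> \<bar>lambda_PDE_t x\<bar> <= C * x"
proof
 show "4 * pi / (a / (a + 2)) > 0" using a by simp
 fix x assume x: "x >= a"
 have "4 * pi * x / bessel_defect x <= 4 * pi * x / (a / (a + 2))"
  using bessel_defect_lower[OF a x] a x by (intro divide_left_mono) (auto intro!: mult_pos_pos divide_pos_pos bessel_defect_pos)
 then show "\<bar>lambda_PDE_t x\<bar> <= 4 * pi / (a / (a + 2)) * x"
  using bessel_defect_pos[of x] a x by (simp add: lambda_PDE_t_def abs_of_nonneg mult_ac)
qed

lemma normal_denom_lower:
 assumes a: "a > 0"
 obtains c where "c > 0" "!!x. x >= a ==> normal_denom x >= c"
proof
 show "2 * (2 * a / (2 * a + 3) * (a / (a + 2))\<^sup>2) > 0" using a by simp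
 show "2 * (2 * a / (2 * a + 3) * (a / (a + 2))\<^sup>2) <= normal_denom x" if "x >= a" for x
  using one_minus_R_sq_lower[OF a that] normal_denom_ge[of x] a that by linarith
qed

lemma lambda_PDE_n_linear:
 assumes a: "a > 0"
 obtains C where "C > 0" "!!x. x >= a ==> \<bar>lambda_PDE_n x\<bar> <= C * x"
proof -
 obtain c where c: "c > 0" "!!x. x >= a ==> normal_denom x >= c"
  using normal_denom_lower[OF a] by blast
 show thesis
 proof
  show "8 * pi / c > 0" using c by simp
  fix x assume x: "x >= a"
  then have x0: "x > 0" using a by simp
  have "0 <= lambda_PDE_n x"
   using defect_quot_bounds[OF x0] c(1) c(2)[OF x] x0 by (simp add: lambda_PDE_n_def)
  moreover have "lambda_PDE_n x <= (2 * pi * x * 4) / c"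
   unfolding lambda_PDE_n_def
   using defect_quot_bounds[OF x0] c(1) c(2)[OF x] x0 by (intro frac_le mult_left_mono) auto
  ultimately show "\<bar>lambda_PDE_n x\<bar> <= 8 * pi / c * x" by simp
 qed
qed

text \<open>Denominators are compared. With q = \<open>bessel_defect\<close> / x the tangential
  symbol is 4 pi / q and its approximation 4 pi / w, and |q - w| <= F x^2 L^2 with L = 1 - ln x.
  Since q and w are both at least a multiple of L, the logarithms cancel in the difference of the
  quotients. The transverse case has the same structure once denominators are cleared.\<close>

lemma slender_body_eigenvalue_estimate:
 obtains C :: real where "C > 0"
  "!!x. 0 < x ==> x <= 1/4 ==> \<bar>lambda_PDE_t x - 4 * pi / (2 * log_term x - 1)\<bar> <= C * x\<^sup>2"
  "!!x. 0 < x ==> x <= 73/100 ==> \<bar>lambda_PDE_n x - 8 * pi / (2 * log_term x + 1)\<bar> <= C * x\<^sup>2"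
proof -
 obtain C D where C: "C > 0" and D: "D > 0"
  and CR: "!!x. 0 < x ==> x <= 1 ==> \<bar>R x / x - log_term x\<bar> <= C * (x\<^sup>2 * (1 - ln x)\<^sup>2)"
  and DR: "!!x. 0 < x ==> x <= 1 ==> R x / x <= D * (1 - ln x)"
  using bessel_ratio_expansion by blast
 define F where "F = 2 * C + D\<^sup>2"
 have F: "F > 0" using C D by (simp add: F_def add_pos_pos)
 define q where "q x = bessel_defect x / x" for x
 define w where "w x = 2 * log_term x - 1" for x
 define L where "L x = 1 - ln x" for x :: real
 have L1: "L x >= 1" if "0 < x" "x <= 1" for x using that by (simp add: L_def)
 have Rle: "R x <= D * (x * L x)" if "0 < x" "x <= 1" for x
  using DR[OF that] that by (simp add: L_def field_simps)
 have R2: "(R x)\<^sup>2 <= D\<^sup>2 * (x\<^sup>2 * (L x)\<^sup>2)" if "0 < x" "x <= 1" for x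
  using power_mono[OF Rle[OF that], of 2] R_pos[OF that(1)] by (simp add: power_mult_distrib)
 have xL: "x\<^sup>2 * (L x)\<^sup>2 <= 1" if "0 < x" "x <= 1" for x
 proof -
  have "0 <= x * L x" using L1[OF that] that by (intro mult_nonneg_nonneg) auto
  moreover have "x * L x <= 1" using mult_log_le_1[OF that(1)] by (simp add: L_def)
  ultimately have "(x * L x)\<^sup>2 <= 1\<^sup>2" by (intro power_mono) auto
  then show ?thesis by (simp add: power_mult_distrib)
 qed
 have qw: "\<bar>q x - w x\<bar> <= F * (x\<^sup>2 * (L x)\<^sup>2)" if "0 < x" "x <= 1" for x
 proof -
  have "q x = 2 * (R x / x) - 1 + (R x)\<^sup>2"
   using that by (simp add: q_def bessel_defect_def field_simps)
  moreover have "\<bar>q - (2 * l - 1)\<bar> <= 2 * \<bar>r - l\<bar> + s" if "q = 2 * r - 1 + s" "0 <= s" for q r l s :: real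
  proof -
   have "q - (2 * l - 1) = 2 * (r - l) + s" using that by simp
   moreover have "\<bar>2 * (r - l)\<bar> = 2 * \<bar>r - l\<bar>" by (simp only: abs_mult abs_numeral)
   moreover have "\<bar>s\<bar> = s" using that by simp
   ultimately show ?thesis using abs_triangle_ineq[of "2 * (r - l)" s] by (simp only:)
  qed
  ultimately have "\<bar>q x - w x\<bar> <= 2 * \<bar>R x / x - log_term x\<bar> + (R x)\<^sup>2"
   unfolding w_def using zero_le_power2 by blast
  also have "... <= 2 * (C * (x\<^sup>2 * (L x)\<^sup>2)) + D\<^sup>2 * (x\<^sup>2 * (L x)\<^sup>2)"
   using CR[OF that] R2[OF that] by (simp add: L_def)
  finally show ?thesis by (simp add: F_def algebra_simps)
 qed
 have q3: "q x >= 1/3" if "0 < x" "x <= 1" for x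
 proof -
  have "1/3 <= 1 / (x + 2)" using that by simp
  also have "... = (x / (x + 2)) / x" using that by simp
  also have "... <= q x" unfolding q_def using bessel_defect_ge[OF that(1)] that by (intro divide_right_mono) auto
  finally show ?thesis .
 qed
 have logt: "log_term x = - ln x + ln 2 - euler_mascheroni" if "0 < x" for x
  using that by (simp add: log_term_def ln_div)
 have w2: "w x + 2 >= L x / 2" if "0 < x" "x <= 1" for x
 proof -
  have "ln x <= 0" using that by simp
  then show ?thesis
   using logt[OF that(1)] euler_mascheroni_less ln2_ge_two_thirds
   unfolding w_def L_def by argo
 qed
 \<comment> \<open>The zero of w lies near x = 0.68. For x <= 1/4 one has -ln x >= 2 ln 2, and with
   ln 2 >= 2/3 and Euler's constant below 13/22 this leaves the margin L/2.\<close>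
 have w1: "w x >= L x / 2" if "0 < x" "x <= 1/4" for x
 proof -
  have "ln x <= ln (1 / 4)" using that by simp
  also have "ln (1 / 4 :: real) = - 2 * ln 2" using ln_realpow[of 2 2] by (simp add: ln_div)
  finally show ?thesis
   using logt[OF that(1)] euler_mascheroni_less ln2_ge_two_thirds
   unfolding w_def L_def by argo
 qed
 define G where "G = 2 * (7 + 3 * F)"
 have G: "G > 0" using F by (simp add: G_def)
 \<comment> \<open>q is compared with w + 2 up to the additive constant F + 2, which q >= 1/3 then
   absorbs. No case distinction in x is necessary.\<close>
 have qL: "L x <= G * q x" if "0 < x" "x <= 1" for x
 proof -
  have "L x / 2 <= w x + 2" by (rule w2[OF that])
  moreover have "F * (x\<^sup>2 * (L x)\<^sup>2) <= F" using mult_left_le[OF xL[OF that]] F by simp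
  moreover have "w x - q x <= \<bar>q x - w x\<bar>" by simp
  ultimately have "L x <= 2 * q x + 2 * (F + 2) * 1" using qw[OF that] by argo
  also have "... <= 2 * q x + 2 * (F + 2) * (3 * q x)"
   using q3[OF that] F by (intro add_left_mono mult_left_mono) auto
  finally show ?thesis by (simp add: G_def algebra_simps)
 qed
 define Ct where "Ct = 4 * pi * F * (2 * G)"
 define H where "H = 4 * F + 3 * D + 12 * D\<^sup>2"
 define Cn where "Cn = pi * H * (6 * G)"
 have t: "\<bar>lambda_PDE_t x - 4 * pi / (2 * log_term x - 1)\<bar> <= Ct * x\<^sup>2" if x: "0 < x" "x <= 1/4" for x
 proof -
  have x1: "x <= 1" using x by simp
  have qp: "q x > 0" using q3[OF x(1) x1] by linarith
  have Lp: "L x > 0" using L1[OF x(1) x1] by linarith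
  have wp: "w x > 0" using w1[OF x] Lp by linarith
  have "lambda_PDE_t x = 4 * pi / q x" using x by (simp add: lambda_PDE_t_def q_def)
  then have "lambda_PDE_t x - 4 * pi / (2 * log_term x - 1) = 4 * pi * (w x - q x) / (q x * w x)"
   using qp wp unfolding w_def[symmetric] by (simp add: field_simps)
  then have "\<bar>lambda_PDE_t x - 4 * pi / (2 * log_term x - 1)\<bar> = 4 * pi * \<bar>q x - w x\<bar> / (q x * w x)"
   using qp wp by (simp add: abs_mult abs_minus_commute)
  also have "... <= 4 * pi * (F * (x\<^sup>2 * (L x)\<^sup>2)) / ((L x / G) * (L x / 2))"
  proof (intro frac_le mult_left_mono mult_mono qw x x1)
   show "L x / G <= q x" using qL[OF x(1) x1] G by (simp add: divide_le_eq mult.commute)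
   show "L x / 2 <= w x" by (rule w1[OF x])
  qed (use Lp G F qp in auto)
  also have "... = Ct * x\<^sup>2"
   using Lp G by (simp add: Ct_def power2_eq_square)
  finally show ?thesis .
 qed
 have n: "\<bar>lambda_PDE_n x - 8 * pi / (2 * log_term x + 1)\<bar> <= Cn * x\<^sup>2" if x: "0 < x" "x <= 73/100" for x
 proof -
  have x1: "x <= 1" using x by simp
  have qp: "q x > 0" using q3[OF x(1) x1] by linarith
  have L1x: "L x >= 1" using L1[OF x(1) x1] .
  define v where "v = 2 * log_term x + 1"
  have vw: "v = w x + 2" by (simp add: v_def w_def)
  have v2: "v >= L x / 2" using w2[OF x(1) x1] by (simp add: vw)
  have v3: "\<bar>v\<bar> <= 3 * L x" using log_term_abs_le[OF x(1) x1] L1x unfolding v_def L_def by argo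
  define Y where "Y = x * R x"
  have Y: "0 < Y" "Y <= D * (x\<^sup>2 * L x)" "Y <= 1"
  proof -
   show "0 < Y" using R_pos[OF x(1)] x by (simp add: Y_def)
   show "Y <= D * (x\<^sup>2 * L x)"
    using mult_left_mono[OF Rle[OF x(1) x1], of x] x by (simp add: Y_def power2_eq_square mult_ac)
   show "Y <= 1" using mult_mono[OF x1 R_le_1[OF x(1)]] R_pos[OF x(1)] by (simp add: Y_def)
  qed
  define N where "N = (1 - (R x)\<^sup>2) + q x / (Y + 2)"
  have N: "N >= q x / 3"
  proof -
   have "q x / 3 <= q x / (Y + 2)" using qp Y by (intro divide_left_mono) auto
   then show ?thesis using one_minus_R_sq_nonneg[OF x(1)] by (simp add: N_def)
  qed
  have NL: "N >= L x / (3 * G)"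
  proof -
   have "G * q x <= G * (3 * N)" using N G by (intro mult_left_mono) auto
   with qL[OF x(1) x1] have "L x <= G * (3 * N)" by (rule order_trans)
   then show ?thesis using G by (simp add: divide_le_eq mult_ac)
  qed
  have Np: "N > 0" using N qp by linarith
  have nd: "normal_denom x = 2 * x * N"
  proof -
   have "bessel_defect x = q x * x" using x by (simp add: q_def)
   then show ?thesis
    by (simp add: normal_denom_def N_def Y_def algebra_simps)
  qed
  define u where "u = defect_quot x"
  have u: "u = x\<^sup>2 * q x / (Y + 2)"
   using x by (simp add: u_def defect_quot_def Y_def q_def power2_eq_square)
  have qle: "q x <= 2 * (D * L x)"
   using bessel_defect_le[OF x(1)] DR[OF x(1) x1] x unfolding q_def L_def by (simp add: field_simps)
  have u1: "0 <= u" "u <= x\<^sup>2 * (D * L x)"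
  proof -
   show "0 <= u" using qp Y by (simp add: u)
   have "u <= x\<^sup>2 * (2 * (D * L x)) / 2"
    unfolding u using qle qp Y D L1x by (intro frac_le mult_left_mono) auto
   then show "u <= x\<^sup>2 * (D * L x)" by simp
  qed
  have lam: "lambda_PDE_n x = pi * (4 - u) / N"
   using x Np by (simp add: lambda_PDE_n_def nd u_def)
  \<comment> \<open>Numerator after clearing denominators. As v = w + 2 and N is 1 + q/2 up to small
    terms, the constants 8 cancel and 4 (w - q) is left; each remaining term carries u, R^2 or Y and
    is O(x^2 L^2).\<close>
  define M where "M = (4 - u) * v - 8 * N"
  have "lambda_PDE_n x - 8 * pi / (2 * log_term x + 1) = pi * M / (N * v)"
   using Np v2 L1x unfolding lam v_def[symmetric] M_def by (simp add: field_simps)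
  then have "\<bar>lambda_PDE_n x - 8 * pi / (2 * log_term x + 1)\<bar> = pi * \<bar>M\<bar> / (N * v)"
   using Np v2 L1x by (simp add: abs_mult)
  also have "... <= pi * (H * (x\<^sup>2 * (L x)\<^sup>2)) / ((L x / (3 * G)) * (L x / 2))"
  proof (intro frac_le mult_left_mono mult_mono NL v2)
   have split: "q x / (Y + 2) = q x / 2 - (q x * Y / (Y + 2)) / 2" using Y by (simp add: field_simps)
   have "(4 - u) * (w x + 2) - 8 * ((1 - r) + (k / 2 - e / 2)) = 4 * (w x - k) - u * (w x + 2) + 8 * r + 4 * e"
    for r k e by (simp add: algebra_simps)
   then have Meq: "M = 4 * (w x - q x) - u * v + 8 * (R x)\<^sup>2 + 4 * (q x * Y / (Y + 2))"
    unfolding M_def N_def vw split by (simp only:)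
   have "\<bar>u * v\<bar> <= (x\<^sup>2 * (D * L x)) * (3 * L x)"
    unfolding abs_mult using u1 v3 D L1x by (intro mult_mono) auto
   then have b1: "\<bar>u * v\<bar> <= 3 * (D * (x\<^sup>2 * (L x)\<^sup>2))" by (simp add: power2_eq_square mult_ac)
   have "q x * Y / (Y + 2) <= (2 * (D * L x)) * (D * (x\<^sup>2 * L x)) / 2"
    using Y qle qp D L1x by (intro frac_le mult_mono) auto
   then have b2: "q x * Y / (Y + 2) <= D\<^sup>2 * (x\<^sup>2 * (L x)\<^sup>2)" by (simp add: power2_eq_square mult_ac)
   have b3: "0 <= q x * Y / (Y + 2)" using qp Y by simp
   have "\<bar>M\<bar> <= 4 * \<bar>q x - w x\<bar> + \<bar>u * v\<bar> + 8 * (R x)\<^sup>2 + 4 * (q x * Y / (Y + 2))"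
    unfolding Meq using b3 zero_le_power2[of "R x"] by argo
   also have "... <= H * (x\<^sup>2 * (L x)\<^sup>2)"
   proof -
    have H: "H * z = 4 * (F * z) + 3 * (D * z) + 12 * (D\<^sup>2 * z)" for z
     by (simp add: H_def algebra_simps)
    have "4 * a + b + 8 * r + 4 * e <= h"
     if "a <= f" "b <= 3 * d" "e <= g" "r <= g" "h = 4 * f + 3 * d + 12 * g" for a b r e h f d g :: real
     using that by argo
    from this[OF qw[OF x(1) x1] b1 b2 R2[OF x(1) x1] H] show ?thesis .
   qed
   finally show "\<bar>M\<bar> <= H * (x\<^sup>2 * (L x)\<^sup>2)" .
  qed (use L1x G Np F D in \<open>auto simp: H_def\<close>)
  also have "... = Cn * x\<^sup>2"
   using L1x G by (simp add: Cn_def power2_eq_square)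
  finally show ?thesis .
 qed
 show thesis
 proof (rule that[of "Ct + Cn"])
  have Ct: "Ct > 0" using F G by (simp add: Ct_def)
  have Cn: "Cn > 0" using F D G by (simp add: Cn_def H_def add_pos_pos)
  show "Ct + Cn > 0" using Ct Cn by simp
  show "\<bar>lambda_PDE_t x - 4 * pi / (2 * log_term x - 1)\<bar> <= (Ct + Cn) * x\<^sup>2" if "0 < x" "x <= 1/4" for x
   using t[OF that] Cn by (simp add: distrib_right add_increasing2)
  show "\<bar>lambda_PDE_n x - 8 * pi / (2 * log_term x + 1)\<bar> <= (Ct + Cn) * x\<^sup>2" if "0 < x" "x <= 73/100" for x
   using n[OF that] Ct by (simp add: distrib_right add_increasing)
 qed
qed

subsection \<open>Fourier series on the torus\<close>

text \<open>Without the factor 1/2, so \<open>fc\<close> is twice the Fourier coefficient. For real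
  zero-mean functions Parseval's identity then equates the sum of the squared moduli over positive
  frequencies with the integral of the square, without further constants.\<close>

definition fc :: "(real => real) => int => complex" where
 "fc g k = (LBINT z:{-1..1}. of_real (g z) * cis (- (pi * of_int k * z)))"

section \<open>Uniqueness of the Fourier coefficients of integrable functions\<close>

lemma set_integrable_bounded_mult:
 fixes f :: "real => complex"
 assumes f: "set_integrable lborel {-1..1} f" and p: "p \<in> borel_measurable borel"
  and B: "!!z. z \<in> {-1..1} ==> norm (p z) <= B"
 shows "set_integrable lborel {-1..1} (%z. p z * f z :: complex)"
proof (rule set_integrable_bound)
 show "set_integrable lborel {-1..1} (%z. of_real B * f z)"
  using f by (rule set_integrable_mult_right[rotated])
 have "(%z. p z * (indicat_real {-1..1} z *\<^sub>R f z)) \<in> borel_measurable lborel"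
  using f p unfolding set_integrable_def by (intro borel_measurable_times) auto
 then show "set_borel_measurable lborel {-1..1} (%z. p z * f z)"
  by (simp add: set_borel_measurable_def mult.left_commute)
 show "AE z in lborel. z \<in> {-1..1} --> norm (p z * f z) <= norm (of_real B * f z)"
 proof (intro AE_I2 impI)
  fix z :: real assume "z \<in> {-1..1}"
  from B[OF this] show "norm (p z * f z) <= norm (of_real B * f z)"
   unfolding norm_mult by (intro mult_right_mono) auto
 qed
qed

lemma cis_borel [measurable]: "(%z::real. cis (c * z)) \<in> borel_measurable borel"
 by (intro borel_measurable_continuous_onI continuous_intros)

text \<open>Formulated for complex h because the property has to be inherited by products of h with
  trigonometric polynomials.\<close>

definition all_fc_zero :: "(real => complex) => bool" where
 "all_fc_zero h \<longleftrightarrow> set_integrable lborel {-1..1} h &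
  (\<forall>k::int. (LBINT z:{-1..1}. h z * cis (- (pi * of_int k * z))) = 0)"

lemma all_fc_zero_shift:
 assumes h: "all_fc_zero h"
 shows "all_fc_zero (%z. (a * cis (pi * z) + b * cis (- (pi * z))) * h z)"
proof -
 have int: "set_integrable lborel {-1..1} h" using h by (simp add: all_fc_zero_def)
 have i: "set_integrable lborel {-1..1} (%z. h z * cis (c * z))" for c
  using set_integrable_bounded_mult[OF int cis_borel, of c 1] by (simp add: mult.commute)
 have "set_integrable lborel {-1..1} (%z. (a * cis (pi * z) + b * cis (- (pi * z))) * h z)"
  using set_integral_add(1)[OF set_integrable_mult_right[OF i[of pi], of a] set_integrable_mult_right[OF i[of "- pi"], of b]]
  by (simp add: algebra_simps)
 moreover have "(LBINT z:{-1..1}. (a * cis (pi * z) + b * cis (- (pi * z))) * h z * cis (- (pi * of_int k * z))) = 0" for k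
 proof -
  have "(a * cis (pi * z) + b * cis (- (pi * z))) * h z * cis (- (pi * of_int k * z))
    = a * (h z * cis (- (pi * of_int (k - 1) * z))) + b * (h z * cis (- (pi * of_int (k + 1) * z)))" for z
  proof -
   have "cis (pi * z) * cis (- (pi * of_int k * z)) = cis (- (pi * of_int (k - 1) * z))"
    "cis (- (pi * z)) * cis (- (pi * of_int k * z)) = cis (- (pi * of_int (k + 1) * z))"
    unfolding cis_mult by (simp_all add: algebra_simps)
   moreover have "(a * u + b * v) * h' * w = a * (h' * (u * w)) + b * (h' * (v * w))" for u v w h' :: complex
    by (simp add: algebra_simps)
   ultimately show ?thesis by (simp only:)
  qed
  moreover have "(LBINT z:{-1..1}. a * (h z * cis (- (pi * of_int (k - 1) * z))) + b * (h z * cis (- (pi * of_int (k + 1) * z)))) = 0"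
  proof -
   have j: "set_integrable lborel {-1..1} (%z. d * (h z * cis (- (pi * of_int m * z))))" for d m
    using i[of "- (pi * of_int m)"] by (intro set_integrable_mult_right) simp
   have "(LBINT z:{-1..1}. h z * cis (- (pi * of_int m * z))) = 0" for m
    using h by (simp add: all_fc_zero_def)
   then show ?thesis using j by (subst set_integral_add(2)) (auto simp del: of_int_add of_int_diff)
  qed
  ultimately show ?thesis by simp
 qed
 ultimately show ?thesis by (simp add: all_fc_zero_def)
qed

lemma all_fc_zero_add:
 assumes "all_fc_zero f" "all_fc_zero g"
 shows "all_fc_zero (%z. f z + g z)"
proof -
 have i: "set_integrable lborel {-1..1} (%z. h z * cis (- (pi * of_int k * z)))" if "all_fc_zero h" for h k
 proof -
  have "set_integrable lborel {-1..1} (%z. cis (- (pi * of_int k) * z) * h z)"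
   by (rule set_integrable_bounded_mult[OF _ cis_borel, where B=1]) (use that in \<open>auto simp: all_fc_zero_def\<close>)
  moreover have "(%z. cis (- (pi * of_int k) * z) * h z) = (%z. h z * cis (- (pi * of_int k * z)))"
   by (rule ext) (simp add: mult.commute)
  ultimately show ?thesis by (simp only:)
 qed
 show ?thesis
  using assms i[OF assms(1)] i[OF assms(2)]
  by (simp add: all_fc_zero_def distrib_right set_integral_add)
qed

text \<open>On the unit circle a real-linear function of cis(pi z) is a combination of cis(pi z) and
  cis(-pi z), which only shifts frequencies. The function h is arbitrary in the induction, so a
  product is treated by applying one hypothesis after the other.\<close>

lemma all_fc_zero_polynomial:
 assumes "real_polynomial_function q" "all_fc_zero h"
 shows "all_fc_zero (%z. of_real (q (cis (pi * z))) * h z)"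
 using assms
proof (induction q arbitrary: h)
 case (linear f)
 then interpret bounded_linear f by simp
 have f: "f w = Re w * f 1 + Im w * f \<i>" for w
  by (metis add complex_eq_iff complex_scaleR mult.commute scaleR scaleR_conv_of_real complex_eq real_scaleR_def mult.right_neutral)
 define a where "a = Complex (f 1 / 2) (- f \<i> / 2)"
 define b where "b = Complex (f 1 / 2) (f \<i> / 2)"
 have "of_real (f (cis (pi * z))) = a * cis (pi * z) + b * cis (- (pi * z))" for z
  unfolding f[of "cis _"] a_def b_def by (simp add: complex_eq_iff algebra_simps)
 then show ?case using all_fc_zero_shift[OF linear.prems] by simp
next
 case (const c)
 have "all_fc_zero (%z. of_real c * h z)"
  using const by (simp add: all_fc_zero_def mult.assoc)
 then show ?case by simp
next
 case (add f g)
 then show ?case using all_fc_zero_add[OF add.IH(1)[OF add.prems] add.IH(2)[OF add.prems]]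
  by (simp add: distrib_right)
next
 case (mult f g)
 show ?case using mult.IH(1)[OF mult.IH(2)[OF mult.prems]] by (simp add: mult.assoc)
qed

text \<open>Stone-Weierstrass on the unit circle: F is replaced by a polynomial with uniform error
  e. The polynomial contributes 0, and the rest is at most e times the L^1 norm of h.\<close>

lemma all_fc_zero_continuous:
 assumes F: "continuous_on (sphere 0 1) (F :: complex => real)" and h: "all_fc_zero h"
  and Fm: "(%z. F (cis (pi * z))) \<in> borel_measurable borel"
 shows "(LBINT z:{-1..1}. of_real (F (cis (pi * z))) * h z) = 0"
proof -
 have int: "set_integrable lborel {-1..1} h" using h by (simp add: all_fc_zero_def)
 let ?N = "LBINT z:{-1..1}. norm (h z)"
 have N: "set_integrable lborel {-1..1} (%z. norm (h z))" using int by (rule set_integrable_norm)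
 have N0: "?N >= 0" unfolding set_lebesgue_integral_def by (intro integral_nonneg_AE AE_I2) auto
 have "norm (LBINT z:{-1..1}. of_real (F (cis (pi * z))) * h z) <= e * ?N" if e: "e > 0" for e
 proof -
  obtain q where q: "real_polynomial_function q" "!!w. w \<in> sphere 0 1 ==> \<bar>F w - q w\<bar> < e"
   using Stone_Weierstrass_real_polynomial_function[OF _ F e] by auto
  have qz: "all_fc_zero (%z. of_real (q (cis (pi * z))) * h z)"
   by (rule all_fc_zero_polynomial[OF q(1) h])
  then have q0: "(LBINT z:{-1..1}. of_real (q (cis (pi * z))) * h z) = 0"
   and qi: "set_integrable lborel {-1..1} (%z. of_real (q (cis (pi * z))) * h z)"
   unfolding all_fc_zero_def by (auto dest: spec[of _ 0])
  have qm: "(%z. q (cis (pi * z))) \<in> borel_measurable borel"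
   by (intro borel_measurable_continuous_onI continuous_on_compose2[OF continuous_on_polymonial_function[of q UNIV]])
    (use q(1) in \<open>auto intro!: continuous_intros simp: real_polynomial_function_eq\<close>)
  have di: "set_integrable lborel {-1..1} (%z. of_real (F (cis (pi * z)) - q (cis (pi * z))) * h z)"
  proof (rule set_integrable_bounded_mult[OF int, where B=e])
   show "(%z. of_real (F (cis (pi * z)) - q (cis (pi * z))) :: complex) \<in> borel_measurable borel"
    using Fm qm by measurable
   show "norm (of_real (F (cis (pi * z)) - q (cis (pi * z))) :: complex) <= e" for z
    using q(2)[of "cis (pi * z)"] by (simp del: of_real_diff)
  qed
  have "(LBINT z:{-1..1}. of_real (F (cis (pi * z))) * h z)
    = (LBINT z:{-1..1}. of_real (F (cis (pi * z)) - q (cis (pi * z))) * h z + of_real (q (cis (pi * z))) * h z)"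
   by (simp add: algebra_simps)
  also have "... = (LBINT z:{-1..1}. of_real (F (cis (pi * z)) - q (cis (pi * z))) * h z)"
   by (subst set_integral_add(2)[OF di qi]) (simp only: q0 add_0_right)
  finally have eq: "(LBINT z:{-1..1}. of_real (F (cis (pi * z))) * h z)
    = (LBINT z:{-1..1}. of_real (F (cis (pi * z)) - q (cis (pi * z))) * h z)" .
  have "norm (LBINT z:{-1..1}. of_real (F (cis (pi * z)) - q (cis (pi * z))) * h z)
    <= (LBINT z:{-1..1}. norm (of_real (F (cis (pi * z)) - q (cis (pi * z))) * h z))"
   using set_integral_norm_bound[OF di] by simp
  also have "... <= (LBINT z:{-1..1}. e * norm (h z))"
  proof (rule set_integral_mono)
   show "set_integrable lborel {-1..1} (%z. norm (of_real (F (cis (pi * z)) - q (cis (pi * z))) * h z))"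
    using di by (rule set_integrable_norm)
   show "set_integrable lborel {-1..1} (%z. e * norm (h z))"
    using N by (rule set_integrable_mult_right[rotated])
   show "norm (of_real (F (cis (pi * z)) - q (cis (pi * z))) * h z) <= e * norm (h z)" for z
    unfolding norm_mult using q(2)[of "cis (pi * z)"] by (intro mult_right_mono) (auto simp del: of_real_diff)
  qed
  also have "... = e * ?N" by simp
  finally show ?thesis unfolding eq .
 qed
 note le = this
 have "norm (LBINT z:{-1..1}. of_real (F (cis (pi * z))) * h z) <= 0"
 proof (rule field_le_epsilon)
  fix d :: real assume d: "d > 0"
  have "d / (?N + 1) * ?N <= d"
   using N0 d by (simp add: field_simps)
  moreover have "d / (?N + 1) > 0" using N0 d by simp
  ultimately show "norm (LBINT z:{-1..1}. of_real (F (cis (pi * z))) * h z) <= 0 + d"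
   using le[of "d / (?N + 1)"] by linarith
 qed
 then show ?thesis by simp
qed

lemma cis_pi_mem_arc:
 assumes "-1 < z" "z <= 1" "-1 < x" "x <= 1"
 shows "cis (pi * z) \<in> (%y. cis (pi * y)) ` {x..1} \<longleftrightarrow> z \<in> {x..1}"
proof
 assume "cis (pi * z) \<in> (%y. cis (pi * y)) ` {x..1}"
 then obtain y where y: "y \<in> {x..1}" "cis (pi * z) = cis (pi * y)" by auto
 have "Arg (cis (pi * w)) = pi * w" if "-1 < w" "w <= 1" for w
 proof (rule cis_Arg_unique)
  show "sgn (cis (pi * w)) = cis (pi * w)" by (simp add: sgn_div_norm)
  show "- pi < pi * w" using mult_strict_left_mono[OF that(1) pi_gt_zero] by simp
  show "pi * w <= pi" using mult_left_mono[OF that(2), of pi] by simp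
 qed
 then have "pi * z = pi * y" using y assms by (metis atLeastAtMost_iff less_le_trans)
 then show "z \<in> {x..1}" using y by simp
qed auto

text \<open>The indicator of an arc is the pointwise limit of the functions \<open>F n\<close> of
  the distance to the arc, and dominated convergence applies. The point -1 stays excluded because
  cis(pi z) identifies it with 1.\<close>

lemma all_fc_zero_interval:
 assumes h: "all_fc_zero h" and x: "-1 < x" "x <= 1"
 shows "(LBINT z:{x..1}. h z) = 0"
proof -
 have int: "set_integrable lborel {-1..1} h" using h by (simp add: all_fc_zero_def)
 define A where "A = (%y. cis (pi * y)) ` {x..1}"
 have "compact A" unfolding A_def by (intro compact_continuous_image continuous_intros) auto
 then have A: "closed A" by (rule compact_imp_closed)
 have A_ne: "A \<noteq> {}" using x by (auto simp: A_def)
 define F where "F n w = max 0 (1 - real n * infdist w A)" for n w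
 have Fc: "continuous_on UNIV (F n)" for n
  unfolding F_def by (intro continuous_intros continuous_on_infdist)
 have Fm: "(%z. F n (cis (pi * z))) \<in> borel_measurable borel" for n
  by (intro borel_measurable_continuous_onI continuous_on_compose2[OF Fc]) (auto intro!: continuous_intros)
 have zero: "(LBINT z:{-1..1}. of_real (F n (cis (pi * z))) * h z) = 0" for n
  by (rule all_fc_zero_continuous[OF continuous_on_subset[OF Fc] h Fm]) auto
 have F01: "0 <= F n w" "F n w <= 1" for n w
  by (auto simp: F_def infdist_nonneg)
 have Flim: "(%n. F n w) \<longlonglongrightarrow> indicator A w" for w
 proof (cases "w \<in> A")
  case True
  then show ?thesis using A A_ne by (simp add: F_def in_closed_iff_infdist_zero)
 next
  case False
  then have "infdist w A > 0" using A A_ne infdist_nonneg[of w A]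
   by (simp add: in_closed_iff_infdist_zero less_le)
  then have "\<forall>\<^sub>F n in sequentially. F n w = 0"
   unfolding F_def by (auto intro!: eventually_sequentiallyI[of "nat \<lceil>1 / infdist w A\<rceil>"] simp: field_simps nat_ceiling_le_eq)
  then show ?thesis using False by (simp add: tendsto_eventually)
 qed
 have "(%n. LBINT z:{-1..1}. of_real (F n (cis (pi * z))) * h z) \<longlonglongrightarrow> (LBINT z:{-1..1}. indicator {x..1} z * h z)"
  unfolding set_lebesgue_integral_def
 proof (rule integral_dominated_convergence)
  have hm: "(%z. indicat_real {-1..1} z *\<^sub>R h z) \<in> borel_measurable lborel"
   using int by (simp add: set_integrable_def)
  show "(%z. indicat_real {-1..1} z *\<^sub>R (indicator {x..1} z * h z)) \<in> borel_measurable lborel"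
  proof -
   have "(%z. indicator {x..1} z * (indicat_real {-1..1} z *\<^sub>R h z)) \<in> borel_measurable lborel"
    using hm by measurable
   then show ?thesis by (simp add: mult.left_commute)
  qed
  show "(%z. indicat_real {-1..1} z *\<^sub>R (of_real (F n (cis (pi * z))) * h z)) \<in> borel_measurable lborel" for n
  proof -
   have "(%z. of_real (F n (cis (pi * z))) * (indicat_real {-1..1} z *\<^sub>R h z)) \<in> borel_measurable lborel"
    using hm Fm[of n] by measurable
   then show ?thesis by (simp add: mult.left_commute)
  qed
  show "integrable lborel (%z. norm (indicat_real {-1..1} z *\<^sub>R h z))"
   using int by (simp add: set_integrable_def del: norm_scaleR)
  have ne: "AE z in lborel. z \<noteq> (-1::real)"
   by (rule AE_lborel_singleton)
  show "AE z in lborel. (%n. indicat_real {-1..1} z *\<^sub>R (of_real (F n (cis (pi * z))) * h z))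
    \<longlonglongrightarrow> indicat_real {-1..1} z *\<^sub>R (indicator {x..1} z * h z)"
   using ne
  proof eventually_elim
   case (elim z)
   show ?case
   proof (cases "z \<in> {-1..1}")
    case True
    then have z: "-1 < z" "z <= 1" using elim by auto
    have eq: "indicator A (cis (pi * z)) = indicat_real {x..1} z"
     by (simp only: indicator_def A_def cis_pi_mem_arc[OF z x])
    have "(%n. complex_of_real (F n (cis (pi * z))) * h z) \<longlonglongrightarrow> of_real (indicat_real {x..1} z) * h z"
     by (intro tendsto_intros) (use Flim[of "cis (pi * z)"] eq in simp)
    moreover have "complex_of_real (indicat_real {x..1} z) = indicator {x..1} z"
     by (simp add: indicator_def)
    ultimately show ?thesis by (intro tendsto_scaleR tendsto_const) simp
   qed auto
  qed
  show "AE z in lborel. norm (indicat_real {-1..1} z *\<^sub>R (of_real (F n (cis (pi * z))) * h z))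
    <= norm (indicat_real {-1..1} z *\<^sub>R h z)" for n
  proof (intro AE_I2)
   fix z :: real
   show "norm (indicat_real {-1..1} z *\<^sub>R (of_real (F n (cis (pi * z))) * h z))
    <= norm (indicat_real {-1..1} z *\<^sub>R h z)"
    using F01[of n "cis (pi * z)"] mult_right_mono[of "F n (cis (pi * z))" 1 "norm (h z)"]
    by (simp add: norm_mult mult_left_mono)
  qed
 qed
 then have "(LBINT z:{-1..1}. indicator {x..1} z * h z) = 0"
  by (simp add: zero LIMSEQ_const_iff)
 moreover have "(LBINT z:{-1..1}. indicator {x..1} z * h z) = (LBINT z:{x..1}. h z)"
  unfolding set_lebesgue_integral_def
  by (rule Bochner_Integration.integral_cong) (use x in \<open>auto simp: indicator_def\<close>)
 ultimately show ?thesis by simp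
qed

text \<open>The positive and the negative part of G, used as densities, define finite measures that
  agree on all rays, hence are equal; their densities then agree almost everywhere.\<close>

lemma AE_zero_if_upper_integrals_zero:
 fixes G :: "real => real"
 assumes G: "integrable lborel G" and zero: "!!x. (\<integral>z. indicator {x<..} z * G z \<partial>lborel) = 0"
 shows "AE z in lborel. G z = 0"
proof -
 have Gm [measurable]: "G \<in> borel_measurable borel" using G by simp
 have ip: "integrable lborel (%z. max 0 (G z))" "integrable lborel (%z. max 0 (- G z))"
  using G by (auto intro!: integrable_max)
 have i2: "integrable lborel (%z. indicator {x<..} z * max 0 (G z))"
  "integrable lborel (%z. indicator {x<..} z * max 0 (- G z))" for x
  using integrable_mult_indicator[OF _ ip(1), of "{x<..}"] integrable_mult_indicator[OF _ ip(2), of "{x<..}"]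
  by auto
 define M where "M = density lborel (%z. ennreal (max 0 (G z)))"
 define N where "N = density lborel (%z. ennreal (max 0 (- G z)))"
 have eM: "emeasure M {x<..} = ennreal (\<integral>z. indicator {x<..} z * max 0 (G z) \<partial>lborel)" for x
 proof -
  have "emeasure M {x<..} = (\<integral>\<^sup>+z. ennreal (indicator {x<..} z * max 0 (G z)) \<partial>lborel)"
   unfolding M_def by (subst emeasure_density) (auto intro!: nn_integral_cong split: split_indicator)
  also have "... = ennreal (\<integral>z. indicator {x<..} z * max 0 (G z) \<partial>lborel)"
   by (rule nn_integral_eq_integral[OF i2(1)]) auto
  finally show ?thesis .
 qed
 have eN: "emeasure N {x<..} = ennreal (\<integral>z. indicator {x<..} z * max 0 (- G z) \<partial>lborel)" for x
 proof -
  have "emeasure N {x<..} = (\<integral>\<^sup>+z. ennreal (indicator {x<..} z * max 0 (- G z)) \<partial>lborel)"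
   unfolding N_def by (subst emeasure_density) (auto intro!: nn_integral_cong split: split_indicator)
  also have "... = ennreal (\<integral>z. indicator {x<..} z * max 0 (- G z) \<partial>lborel)"
   by (rule nn_integral_eq_integral[OF i2(2)]) auto
  finally show ?thesis .
 qed
 have eq: "(\<integral>z. indicator {x<..} z * max 0 (G z) \<partial>lborel) = (\<integral>z. indicator {x<..} z * max 0 (- G z) \<partial>lborel)" for x
 proof -
  have "(\<integral>z. indicator {x<..} z * max 0 (G z) \<partial>lborel) - (\<integral>z. indicator {x<..} z * max 0 (- G z) \<partial>lborel)
    = (\<integral>z. indicator {x<..} z * max 0 (G z) - indicator {x<..} z * max 0 (- G z) \<partial>lborel)"
   using i2 by simp
  also have "... = (\<integral>z. indicator {x<..} z * G z \<partial>lborel)"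
   by (rule Bochner_Integration.integral_cong) (auto simp: max_def)
  finally show ?thesis using zero by simp
 qed
 have "M = N"
  by (rule measure_eqI_lessThan) (auto simp: eM eN eq, auto simp: M_def N_def)
 then have "AE z in lborel. ennreal (max 0 (G z)) = ennreal (max 0 (- G z))"
  unfolding M_def N_def by (intro sigma_finite_measure.density_unique[OF lborel.sigma_finite_measure_axioms]) auto
 then show ?thesis
  by eventually_elim (auto simp: max_def split: if_splits)
qed

text \<open>Nonnegative k are enough since g is real and \<open>fc g (- k)\<close> is the conjugate
  of \<open>fc g k\<close>. The integrals over [x, 1] vanish for x > -1; letting x decrease to -1
  extends this to all rays.\<close>

theorem fc_unique:
 assumes g: "set_integrable lborel {-1..1} g" and zero: "!!k. k >= 0 ==> fc g k = 0"
 shows "AE z in lborel. z \<in> {-1..1} --> g z = 0"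
proof -
 have int: "set_integrable lborel {-1..1} (%z. complex_of_real (g z))"
  using g integrable_of_real[where 'a=complex, of lborel "%z. indicat_real {-1..1} z *\<^sub>R g z"]
  by (simp add: set_integrable_def scaleR_conv_of_real)
 have neg: "fc g (- k) = cnj (fc g k)" for k
 proof -
  have "cnj (fc g k) = (\<integral>z. cnj (indicat_real {-1..1} z *\<^sub>R (of_real (g z) * cis (- (pi * of_int k * z)))) \<partial>lborel)"
   unfolding fc_def set_lebesgue_integral_def by (rule Bochner_Integration.integral_cnj[symmetric])
  also have "... = fc g (- k)"
   unfolding fc_def set_lebesgue_integral_def by (rule Bochner_Integration.integral_cong) (auto simp: cis_cnj)
  finally show ?thesis by simp
 qed
 have "fc g k = 0" for k
 proof (cases "k >= 0")
  case False
  then have "fc g (- k) = 0" by (intro zero) simp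
  then show ?thesis using neg[of k] by simp
 qed (rule zero)
 then have h: "all_fc_zero (%z. complex_of_real (g z))"
  using int by (simp add: all_fc_zero_def fc_def)
 define G where "G = (%z. indicat_real {-1..1} z * g z)"
 have G: "integrable lborel G" using g by (simp add: set_integrable_def G_def)
 then have Gm [measurable]: "G \<in> borel_measurable borel" by simp
 have up: "(\<integral>z. indicator {x..1} z * g z \<partial>lborel) = 0" if "-1 < x" "x <= 1" for x
 proof -
  have "(LBINT z:{x..1}. complex_of_real (g z)) = 0" by (rule all_fc_zero_interval[OF h that])
  moreover have "(LBINT z:{x..1}. complex_of_real (g z)) = complex_of_real (\<integral>z. indicator {x..1} z * g z \<partial>lborel)"
   unfolding set_lebesgue_integral_def integral_complex_of_real[symmetric] by (simp add: scaleR_conv_of_real)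
  ultimately show ?thesis by simp
 qed
 have zero_gt: "(\<integral>z. indicator {x<..} z * G z \<partial>lborel) = 0" if "x > -1" for x
 proof (cases "x <= 1")
  case True
  have "(\<integral>z. indicator {x<..} z * G z \<partial>lborel) = (\<integral>z. indicator {x..1} z * g z \<partial>lborel)"
  proof (rule integral_cong_AE)
   show "(%z. indicator {x..1} z * g z) \<in> borel_measurable lborel"
   proof -
    have "(%z. indicator {x..1} z * G z) \<in> borel_measurable lborel" by measurable
    moreover have "(%z. indicator {x..1} z * G z) = (%z. indicator {x..1} z * g z)"
     using that by (auto simp: G_def indicator_def)
    ultimately show ?thesis by simp
   qed
   have "AE z in lborel. z \<noteq> x" by (rule AE_lborel_singleton)
   then show "AE z in lborel. indicator {x<..} z * G z = indicator {x..1} z * g z"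
    by eventually_elim (use that True in \<open>auto simp: G_def indicator_def\<close>)
  qed measurable
  then show ?thesis using up[OF that True] by simp
 next
  case False
  have "(%z. indicator {x<..} z * G z) = (%z. 0)" using False by (auto simp: G_def indicator_def)
  then show ?thesis by simp
 qed
 have lim: "(%n. \<integral>z. indicator {-1 + 1 / (real n + 1)<..} z * G z \<partial>lborel) \<longlonglongrightarrow> (\<integral>z. indicator {-1<..} z * G z \<partial>lborel)"
 proof (rule integral_dominated_convergence)
  show "integrable lborel (%z. norm (G z))" using G by simp
  show "AE z in lborel. (%n. indicator {-1 + 1 / (real n + 1)<..} z * G z) \<longlonglongrightarrow> indicator {-1<..} z * G z"
  proof (intro AE_I2 tendsto_mult tendsto_const)
   fix z :: real
   have "(%n. -1 + 1 / (real n + 1)) \<longlonglongrightarrow> -1" by real_asymp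
   then have "\<forall>\<^sub>F n in sequentially. -1 + 1 / (real n + 1) < z" if "z > -1"
    using that by (rule order_tendstoD)
   moreover have "\<not> -1 + 1 / (real n + 1) < z" if "\<not> z > -1" for n
   proof -
    have "1 / (real n + 1) > 0" by simp
    then show ?thesis using that by linarith
   qed
   ultimately show "(%n. indicat_real {-1 + 1 / (real n + 1)<..} z) \<longlonglongrightarrow> indicator {-1<..} z"
    by (cases "z > -1") (auto simp: indicator_def intro!: tendsto_eventually elim!: eventually_mono)
  qed
  show "AE z in lborel. norm (indicator {-1 + 1 / (real n + 1)<..} z * G z) <= norm (G z)" for n
   by (intro AE_I2) (auto simp: indicator_def)
 qed measurable
 have all: "(\<integral>z. indicator {x<..} z * G z \<partial>lborel) = 0" for x
 proof (cases "x > -1")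
  case False
  have "(\<integral>z. indicator {-1 + 1 / (real n + 1)<..} z * G z \<partial>lborel) = 0" for n
   by (rule zero_gt) simp
  then have "(\<integral>z. indicator {-1<..} z * G z \<partial>lborel) = 0"
   using lim by (simp add: LIMSEQ_const_iff)
  moreover have "(\<integral>z. indicator {x<..} z * G z \<partial>lborel) = (\<integral>z. indicator {-1<..} z * G z \<partial>lborel)"
  proof (rule integral_cong_AE)
   have "AE z in lborel. z \<noteq> (-1::real)" by (rule AE_lborel_singleton)
   then show "AE z in lborel. indicator {x<..} z * G z = indicator {-1<..} z * G z"
    by eventually_elim (use False in \<open>auto simp: G_def indicator_def\<close>)
  qed measurable
  ultimately show ?thesis by simp
 qed (rule zero_gt)
 have "AE z in lborel. G z = 0"
  by (rule AE_zero_if_upper_integrals_zero[OF G all])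
 then show ?thesis by eventually_elim (auto simp: G_def)
qed

section \<open>Riesz-Fischer and Parseval for real zero-mean functions\<close>

definition sq_integrable :: "(real => real) => bool" where
 "sq_integrable g \<longleftrightarrow> g \<in> borel_measurable borel & set_integrable lborel {-1..1} (%z. (g z)\<^sup>2)"

text \<open>Index n stands for frequency n + 1, so that index 0 is the lowest nonzero frequency. The
  real part joins the frequencies n + 1 and -(n + 1), and a real zero-mean function is a sum of
  modes with complex amplitudes.\<close>

definition mode :: "complex => nat => real => real" where
 "mode c n z = Re (c * cis (pi * real (Suc n) * z))"

definition mode_sum :: "(nat => complex) => nat => real => real" where
 "mode_sum c N z = (\<Sum>n<N. mode (c n) n z)"

lemma sq_integrable_mult:
 assumes "sq_integrable f" "sq_integrable g"
 shows "set_integrable lborel {-1..1} (%z. f z * g z)"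
proof (rule set_integrable_bound)
 show "set_integrable lborel {-1..1} (%z. (f z)\<^sup>2 + (g z)\<^sup>2)"
  using assms by (intro set_integral_add(1)) (auto simp: sq_integrable_def)
 show "set_borel_measurable lborel {-1..1} (%z. f z * g z)"
  using assms by (auto simp: sq_integrable_def set_borel_measurable_def)
 show "AE z in lborel. z \<in> {-1..1} --> norm (f z * g z) <= norm ((f z)\<^sup>2 + (g z)\<^sup>2)"
 proof (intro AE_I2 impI)
  fix z
  have "2 * (\<bar>f z\<bar> * \<bar>g z\<bar>) <= (f z)\<^sup>2 + (g z)\<^sup>2"
   using sum_squares_bound[of "\<bar>f z\<bar>" "\<bar>g z\<bar>"] by simp
  moreover have "0 <= \<bar>f z\<bar> * \<bar>g z\<bar>" by simp
  ultimately have "\<bar>f z\<bar> * \<bar>g z\<bar> <= (f z)\<^sup>2 + (g z)\<^sup>2" by argo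
  then show "norm (f z * g z) <= norm ((f z)\<^sup>2 + (g z)\<^sup>2)"
   by (simp add: abs_mult)
 qed
qed

lemma sq_integrable_continuous: "continuous_on UNIV f ==> sq_integrable f"
 unfolding sq_integrable_def
 by (auto intro!: borel_measurable_continuous_onI borel_integrable_atLeastAtMost' continuous_intros
   intro: continuous_on_subset)

lemma sq_integrable_integrable:
 assumes "sq_integrable f" shows "set_integrable lborel {-1..1} f"
 using sq_integrable_mult[OF assms sq_integrable_continuous[of "%_. 1"]] by simp

lemma sq_integrable_add:
 assumes "sq_integrable f" "sq_integrable g"
 shows "sq_integrable (%z. f z + g z)"
proof -
 have "set_integrable lborel {-1..1} (%z. (f z)\<^sup>2 + (g z)\<^sup>2 + 2 * (f z * g z))"
  using assms by (intro set_integral_add(1) set_integrable_mult_right sq_integrable_mult) (auto simp: sq_integrable_def)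
 then show ?thesis using assms by (auto simp: sq_integrable_def power2_sum algebra_simps)
qed

lemma sq_integrable_cmult: "sq_integrable f ==> sq_integrable (%z. c * f z)"
 by (auto simp: sq_integrable_def power_mult_distrib)

lemma sq_integrable_diff:
 assumes "sq_integrable f" "sq_integrable g"
 shows "sq_integrable (%z. f z - g z)"
 using sq_integrable_add[OF assms(1) sq_integrable_cmult[OF assms(2), of "-1"]] by simp

lemma continuous_on_mode: "continuous_on S (mode c n)"
 unfolding mode_def by (intro continuous_intros)

lemma continuous_on_mode_sum: "continuous_on S (mode_sum c N)"
 unfolding mode_sum_def by (intro continuous_intros continuous_on_mode)

lemma sq_integrable_mode: "sq_integrable (mode c n)"
 by (intro sq_integrable_continuous continuous_on_mode)

lemma sq_integrable_mode_sum: "sq_integrable (mode_sum c N)"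
 by (intro sq_integrable_continuous continuous_on_mode_sum)

lemma set_integral_sum_real:
 fixes f :: "'i => real => real"
 assumes "!!i. i \<in> I ==> set_integrable lborel A (f i)"
 shows "(LBINT z:A. \<Sum>i\<in>I. f i z) = (\<Sum>i\<in>I. LBINT z:A. f i z)"
 using assms unfolding set_lebesgue_integral_def set_integrable_def
 by (simp add: sum_distrib_left Bochner_Integration.integral_sum)

lemma integral_Re_cis:
 "(LBINT z:{-1..1}. Re (c * cis (pi * of_int k * z))) = (if k = 0 then 2 * Re c else 0)"
proof (cases "k = 0")
 case False
 define w where "w = pi * of_int k"
 have w: "w \<noteq> 0" using False by (simp add: w_def)
 let ?F = "%z. (Re c * sin (w * z) + Im c * cos (w * z)) / w"
 have "(LBINT z:{-1..1}. Re (c * cis (w * z))) = ?F 1 - ?F (-1)"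
  unfolding set_lebesgue_integral_def
 proof (rule integral_FTC_atLeastAtMost)
  fix z :: real
  have "((%z. Re c * sin (w * z) + Im c * cos (w * z)) has_real_derivative
    (Re c * (cos (w * z) * w) + Im c * (- sin (w * z) * w))) (at z within {-1..1})"
   by (auto intro!: derivative_eq_intros)
  from DERIV_cdivide[OF this, of w]
  have "(?F has_real_derivative (Re c * (cos (w * z) * w) + Im c * (- sin (w * z) * w)) / w) (at z within {-1..1})" .
  also have "(Re c * (cos (w * z) * w) + Im c * (- sin (w * z) * w)) / w = Re (c * cis (w * z))"
   using w by (simp add: add_divide_distrib diff_divide_distrib)
  finally show "(?F has_vector_derivative Re (c * cis (w * z))) (at z within {-1..1})"
   by (simp only: has_real_derivative_iff_has_vector_derivative)
 qed (auto intro!: continuous_intros)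
 then show ?thesis using False by (simp add: w_def)
next
 case True
 then show ?thesis by (simp add: set_lebesgue_integral_def)
qed

text \<open>The product of two real parts splits into frequencies n + m + 2 and n - m, of which only
  the second can be 0.\<close>

lemma mode_orthogonal:
 "(LBINT z:{-1..1}. mode a n z * mode b m z) = (if n = m then Re (a * cnj b) else 0)"
proof -
 have "mode a n z * mode b m z = (1/2) * Re ((a * b) * cis (pi * of_int (int n + int m + 2) * z))
   + (1/2) * Re ((a * cnj b) * cis (pi * of_int (int n - int m) * z))" for z
 proof -
  let ?x = "a * cis (pi * real (Suc n) * z)" and ?y = "b * cis (pi * real (Suc m) * z)"
  have "(a * b) * cis (pi * of_int (int n + int m + 2) * z) = ?x * ?y"
  proof -
   have "cis (pi * of_int (int n + int m + 2) * z) = cis (pi * real (Suc n) * z) * cis (pi * real (Suc m) * z)"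
    by (simp add: cis_mult algebra_simps)
   then show ?thesis by (simp only: mult_ac)
  qed
  moreover have "(a * cnj b) * cis (pi * of_int (int n - int m) * z) = ?x * cnj ?y"
  proof -
   have "cis (pi * of_int (int n - int m) * z) = cis (pi * real (Suc n) * z) * cnj (cis (pi * real (Suc m) * z))"
    by (simp add: cis_mult cis_cnj algebra_simps)
   then show ?thesis by (simp only: mult_ac complex_cnj_mult)
  qed
  moreover have "Re x * Re y = (1/2) * Re (x * y) + (1/2) * Re (x * cnj y)" for x y
   by (simp add: algebra_simps)
  ultimately show ?thesis unfolding mode_def by (simp only:)
 qed
 moreover have int: "set_integrable lborel {-1..1} (%z. (1/2) * Re (c * cis (pi * of_int k * z)))" for c k
  by (intro borel_integrable_atLeastAtMost' continuous_intros)
 ultimately have "(LBINT z:{-1..1}. mode a n z * mode b m z)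
   = (1/2) * (LBINT z:{-1..1}. Re ((a * b) * cis (pi * of_int (int n + int m + 2) * z)))
   + (1/2) * (LBINT z:{-1..1}. Re ((a * cnj b) * cis (pi * of_int (int n - int m) * z)))"
  by (simp only: set_integral_add(2)[OF int int] set_integral_mult_right)
 also have "... = (if n = m then Re (a * cnj b) else 0)"
  unfolding integral_Re_cis by auto
 finally show ?thesis .
qed

lemma mode_sum_norm:
 assumes "finite F"
 shows "(LBINT z:{-1..1}. (\<Sum>n\<in>F. mode (c n) n z)\<^sup>2) = (\<Sum>n\<in>F. (cmod (c n))\<^sup>2)"
proof -
 have "(LBINT z:{-1..1}. (\<Sum>n\<in>F. mode (c n) n z)\<^sup>2)
   = (LBINT z:{-1..1}. \<Sum>n\<in>F. \<Sum>m\<in>F. mode (c n) n z * mode (c m) m z)"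
  by (simp add: power2_eq_square sum_product)
 also have "... = (\<Sum>n\<in>F. LBINT z:{-1..1}. \<Sum>m\<in>F. mode (c n) n z * mode (c m) m z)"
  by (intro set_integral_sum_real borel_integrable_atLeastAtMost' continuous_intros continuous_on_mode)
 also have "... = (\<Sum>n\<in>F. \<Sum>m\<in>F. LBINT z:{-1..1}. mode (c n) n z * mode (c m) m z)"
  by (intro sum.cong set_integral_sum_real sq_integrable_mult sq_integrable_mode refl)
 also have "... = (\<Sum>n\<in>F. Re (c n * cnj (c n)))"
  unfolding mode_orthogonal using assms by (simp add: sum.delta)
 also have "... = (\<Sum>n\<in>F. (cmod (c n))\<^sup>2)"
  by (simp add: complex_mult_cnj cmod_power2)
 finally show ?thesis .
qed

lemma mode_sum_diff:
 "N <= M ==> mode_sum c M z - mode_sum c N z = (\<Sum>n\<in>{N..<M}. mode (c n) n z)"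
 by (simp add: mode_sum_def lessThan_atLeast0 sum_diff_nat_ivl)

lemma mode_sum_diff_norm:
 "N <= M ==> (LBINT z:{-1..1}. (mode_sum c M z - mode_sum c N z)\<^sup>2) = (\<Sum>n\<in>{N..<M}. (cmod (c n))\<^sup>2)"
 using mode_sum_norm[of "{N..<M}" c] by (simp add: mode_sum_diff)

lemma integral_mult_mode:
 assumes g: "set_integrable lborel {-1..1} g"
 shows "(LBINT z:{-1..1}. g z * mode c n z) = Re (c * cnj (fc g (int (Suc n))))"
proof -
 have int: "set_integrable lborel {-1..1} (%z. complex_of_real (g z))"
  using g integrable_of_real[where 'a=complex, of lborel "%z. indicat_real {-1..1} z *\<^sub>R g z"]
  by (simp add: set_integrable_def scaleR_conv_of_real)
 have i2: "set_integrable lborel {-1..1} (%z. c * (cis (pi * real (Suc n) * z) * complex_of_real (g z)))"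
  by (intro set_integrable_mult_right set_integrable_bounded_mult[OF int cis_borel, where B=1]) auto
 have "cnj (fc g (int (Suc n)))
   = (\<integral>z. cnj (indicat_real {-1..1} z *\<^sub>R (of_real (g z) * cis (- (pi * of_int (int (Suc n)) * z)))) \<partial>lborel)"
  unfolding fc_def set_lebesgue_integral_def by (rule Bochner_Integration.integral_cnj[symmetric])
 also have "... = (LBINT z:{-1..1}. cis (pi * real (Suc n) * z) * complex_of_real (g z))"
  unfolding set_lebesgue_integral_def
  by (rule Bochner_Integration.integral_cong) (auto simp: cis_cnj mult.commute)
 finally have "c * cnj (fc g (int (Suc n))) = (LBINT z:{-1..1}. c * (cis (pi * real (Suc n) * z) * complex_of_real (g z)))"
  by (simp only: set_integral_mult_right)
 then have "Re (c * cnj (fc g (int (Suc n))))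
   = (\<integral>z. Re (indicat_real {-1..1} z *\<^sub>R (c * (cis (pi * real (Suc n) * z) * complex_of_real (g z)))) \<partial>lborel)"
  using i2 unfolding set_lebesgue_integral_def set_integrable_def by (simp only: integral_Re)
 also have "... = (LBINT z:{-1..1}. g z * mode c n z)"
  unfolding set_lebesgue_integral_def mode_def
  by (rule Bochner_Integration.integral_cong) (auto simp: algebra_simps)
 finally show ?thesis by simp
qed

lemma fc_0: "fc g 0 = complex_of_real (LBINT z:{-1..1}. g z)"
 unfolding fc_def set_lebesgue_integral_def integral_complex_of_real[symmetric]
 by (simp add: scaleR_conv_of_real)

lemma complex_eq_of_pairing: "(!!d. Re (d * cnj x) = Re (d * cnj y)) ==> x = y"
proof -
 assume h: "!!d. Re (d * cnj x) = Re (d * cnj y)"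
 from h[of 1] h[of "\<i>"] show "x = y" by (simp add: complex_eq_iff)
qed

lemma fc_mode_sum:
 "fc (mode_sum c N) 0 = 0"
 "fc (mode_sum c N) (int (Suc m)) = (if m < N then c m else 0)"
proof -
 have "(LBINT z:{-1..1}. mode_sum c N z) = (\<Sum>n<N. LBINT z:{-1..1}. mode (c n) n z)"
  unfolding mode_sum_def by (intro set_integral_sum_real sq_integrable_integrable sq_integrable_mode)
 also have "... = 0"
 proof (rule sum.neutral, rule ballI)
  fix n
  show "(LBINT z:{-1..1}. mode (c n) n z) = 0"
   using integral_Re_cis[of "c n" "int (Suc n)"] by (simp only: mode_def of_int_of_nat_eq) simp
 qed
 finally show "fc (mode_sum c N) 0 = 0" by (simp add: fc_0)
 show "fc (mode_sum c N) (int (Suc m)) = (if m < N then c m else 0)"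
 proof (rule complex_eq_of_pairing)
  fix d
  have "Re (d * cnj (fc (mode_sum c N) (int (Suc m)))) = (LBINT z:{-1..1}. mode_sum c N z * mode d m z)"
   by (rule integral_mult_mode[OF sq_integrable_integrable[OF sq_integrable_mode_sum], symmetric])
  also have "... = (LBINT z:{-1..1}. \<Sum>n<N. mode (c n) n z * mode d m z)"
   by (simp add: mode_sum_def sum_distrib_right)
  also have "... = (\<Sum>n<N. LBINT z:{-1..1}. mode (c n) n z * mode d m z)"
   by (intro set_integral_sum_real sq_integrable_mult sq_integrable_mode)
  also have "... = Re (d * cnj (if m < N then c m else 0))"
   unfolding mode_orthogonal by (auto simp: sum.delta algebra_simps)
  finally show "Re (d * cnj (fc (mode_sum c N) (int (Suc m)))) = Re (d * cnj (if m < N then c m else 0))" .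
 qed
qed

text \<open>Young's inequality |g| <= t/2 + g^2/(2 t), integrated over a period of length 2. With t
  free it serves in place of the Cauchy-Schwarz inequality wherever L^2 smallness has to give L^1
  smallness.\<close>

lemma integral_abs_le:
 assumes g: "sq_integrable g" and t: "t > 0"
 shows "(LBINT z:{-1..1}. \<bar>g z\<bar>) <= t + (LBINT z:{-1..1}. (g z)\<^sup>2) / (2 * t)"
proof -
 have g2: "set_integrable lborel {-1..1} (%z. (1 / (2 * t)) * (g z)\<^sup>2)"
  using g by (auto simp: sq_integrable_def)
 have c: "set_integrable lborel {-1..1} (%z::real. t / 2)"
  by (rule borel_integrable_atLeastAtMost'[OF continuous_on_const])
 have "(LBINT z:{-1..1}. \<bar>g z\<bar>) <= (LBINT z:{-1..1}. t / 2 + (1 / (2 * t)) * (g z)\<^sup>2)"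
 proof (rule set_integral_mono)
  show "set_integrable lborel {-1..1} (%z. \<bar>g z\<bar>)"
   using sq_integrable_integrable[OF g] by (rule set_integrable_abs)
  show "set_integrable lborel {-1..1} (%z. t / 2 + (1 / (2 * t)) * (g z)\<^sup>2)"
   using c g2 by (rule set_integral_add(1))
  fix z
  have "2 * t * \<bar>g z\<bar> <= t\<^sup>2 + (g z)\<^sup>2"
   using sum_squares_bound[of t "\<bar>g z\<bar>"] by simp
  then show "\<bar>g z\<bar> <= t / 2 + (1 / (2 * t)) * (g z)\<^sup>2"
   using t by (simp add: field_simps power2_eq_square)
 qed
 also have "... = t + (LBINT z:{-1..1}. (g z)\<^sup>2) / (2 * t)"
 proof -
  have "(LBINT z:{-1..(1::real)}. t / 2) = t" by (simp add: set_lebesgue_integral_def)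
  then show ?thesis by (simp only: set_integral_add(2)[OF c g2] set_integral_mult_right) simp
 qed
 finally show ?thesis .
qed

lemma fc_norm_le:
 assumes g: "set_integrable lborel {-1..1} g"
 shows "cmod (fc g k) <= (LBINT z:{-1..1}. \<bar>g z\<bar>)"
proof -
 have int: "set_integrable lborel {-1..1} (%z. complex_of_real (g z))"
  using g integrable_of_real[where 'a=complex, of lborel "%z. indicat_real {-1..1} z *\<^sub>R g z"]
  by (simp add: set_integrable_def scaleR_conv_of_real)
 have i: "set_integrable lborel {-1..1} (%z. cis (- (pi * of_int k) * z) * complex_of_real (g z))"
  by (intro set_integrable_bounded_mult[OF int cis_borel, where B=1]) auto
 have eq: "fc g k = (LBINT z:{-1..1}. cis (- (pi * of_int k) * z) * complex_of_real (g z))"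
  unfolding fc_def by (simp add: mult.commute)
 show ?thesis
  unfolding eq using set_integral_norm_bound[OF i] by (simp add: norm_mult)
qed

lemma fc_diff:
 assumes "set_integrable lborel {-1..1} f" "set_integrable lborel {-1..1} g"
 shows "fc (%z. f z - g z) k = fc f k - fc g k"
proof -
 have i: "set_integrable lborel {-1..1} (%z. complex_of_real (g z) * cis (- (pi * of_int k * z)))"
  if g: "set_integrable lborel {-1..1} g" for g
 proof -
  have int: "set_integrable lborel {-1..1} (%z. complex_of_real (g z))"
   using g integrable_of_real[where 'a=complex, of lborel "%z. indicat_real {-1..1} z *\<^sub>R g z"]
   by (simp add: set_integrable_def scaleR_conv_of_real)
  have "set_integrable lborel {-1..1} (%z. cis (- (pi * of_int k) * z) * complex_of_real (g z))"
   by (intro set_integrable_bounded_mult[OF int cis_borel, where B=1]) auto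
  moreover have "(%z. cis (- (pi * of_int k) * z) * complex_of_real (g z)) = (%z. complex_of_real (g z) * cis (- (pi * of_int k * z)))"
   by (rule ext) (simp add: mult.commute)
  ultimately show ?thesis by (simp only:)
 qed
 show ?thesis
  unfolding fc_def using i[OF assms(1)] i[OF assms(2)]
  by (simp add: left_diff_distrib set_integral_diff(2))
qed

lemma fc_limit:
 assumes h: "sq_integrable h" and lim: "(%N. LBINT z:{-1..1}. (h z - mode_sum c N z)\<^sup>2) \<longlonglongrightarrow> 0"
 shows "(%N. fc (mode_sum c N) k) \<longlonglongrightarrow> fc h k"
proof (rule LIMSEQ_I)
 fix r :: real assume r: "r > 0"
 \<comment> \<open>With the squared L^2 error below 2 t^2 the second summand of
   \<open>integral_abs_le\<close> is below t as well, and t + t = r.\<close>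
 define t where "t = r / 2"
 have t: "t > 0" using r by (simp add: t_def)
 have "\<forall>\<^sub>F N in sequentially. (LBINT z:{-1..1}. (h z - mode_sum c N z)\<^sup>2) < 2 * t * t"
  using lim t by (intro order_tendstoD) auto
 then obtain N0 where N0: "!!N. N >= N0 ==> (LBINT z:{-1..1}. (h z - mode_sum c N z)\<^sup>2) < 2 * t * t"
  by (auto simp: eventually_sequentially)
 show "\<exists>no. \<forall>n\<ge>no. norm (fc (mode_sum c n) k - fc h k) < r"
 proof (intro exI allI impI)
  fix N assume N: "N >= N0"
  have d: "sq_integrable (%z. h z - mode_sum c N z)"
   by (intro sq_integrable_diff h sq_integrable_mode_sum)
  have "norm (fc (mode_sum c N) k - fc h k) = cmod (fc (%z. h z - mode_sum c N z) k)"
   by (simp add: fc_diff sq_integrable_integrable h sq_integrable_mode_sum norm_minus_commute)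
  also have "... <= (LBINT z:{-1..1}. \<bar>h z - mode_sum c N z\<bar>)"
   by (rule fc_norm_le[OF sq_integrable_integrable[OF d]])
  also have "... <= t + (LBINT z:{-1..1}. (h z - mode_sum c N z)\<^sup>2) / (2 * t)"
   by (rule integral_abs_le[OF d t])
  also have "... < t + t" using N0[OF N] t by (simp add: divide_less_eq mult_ac)
  also have "... = r" by (simp add: t_def)
  finally show "norm (fc (mode_sum c N) k - fc h k) < r" .
 qed
qed

lemma nn_integral_set_real:
 assumes "set_integrable lborel A f" "!!z. f z >= (0::real)"
 shows "(\<integral>\<^sup>+z\<in>A. ennreal (f z) \<partial>lborel) = ennreal (LBINT z:A. f z)"
proof -
 have "(\<integral>\<^sup>+z\<in>A. ennreal (f z) \<partial>lborel) = (\<integral>\<^sup>+z. ennreal (indicat_real A z *\<^sub>R f z) \<partial>lborel)"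
  by (intro nn_integral_cong) (auto split: split_indicator)
 also have "... = ennreal (\<integral>z. indicat_real A z *\<^sub>R f z \<partial>lborel)"
  using assms by (intro nn_integral_eq_integral) (auto simp: set_integrable_def)
 finally show ?thesis by (simp add: set_lebesgue_integral_def)
qed

text \<open>Along a subsequence with geometrically small L^2 increments the partial sums converge
  almost everywhere. Fatou's lemma bounds the distance from the limit to every partial sum by the
  tail of the coefficients, so the full sequence converges in L^2.\<close>

lemma riesz_fischer_limit:
 assumes sum: "summable (%n. (cmod (c n))\<^sup>2)"
 obtains h where "\<forall>z. h (z + 2) = h z" "sq_integrable h"
  "(%N. LBINT z:{-1..1}. (h z - mode_sum c N z)\<^sup>2) \<longlonglongrightarrow> 0"
proof -
 let ?a = "%n. (cmod (c n))\<^sup>2"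
 have "\<exists>N. \<forall>n\<ge>N. \<forall>m. norm (sum ?a {n..<m}) < (1/4) ^ j" for j :: nat
  using sum unfolding summable_Cauchy by simp
 then obtain N0 where N0: "!!j n m. n >= N0 j ==> norm (sum ?a {n..<m}) < (1/4) ^ (j::nat)"
  by metis
 \<comment> \<open>Summing the thresholds makes N monotone while it still dominates each of them;
   the summand j gives N j >= j.\<close>
 define N where "N j = (\<Sum>i\<le>j. N0 i) + j" for j
 have NN0: "N0 j <= N j" for j
  unfolding N_def using member_le_sum[of j "{..j}" N0] by simp
 have Nj: "j <= N j" for j by (simp add: N_def)
 have NS: "N j <= N (Suc j)" for j by (simp add: N_def)
 define g where "g j = mode_sum c (N j)" for j
 have gm [measurable]: "g j \<in> borel_measurable borel" for j
  using sq_integrable_mode_sum by (simp add: g_def sq_integrable_def)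
 have gsq: "sq_integrable (g j)" for j unfolding g_def by (rule sq_integrable_mode_sum)
 have D: "(LBINT z:{-1..1}. \<bar>g (Suc j) z - g j z\<bar>) <= 2 * (1/2) ^ j" for j
 proof -
  have "(LBINT z:{-1..1}. (g (Suc j) z - g j z)\<^sup>2) <= (1/4) ^ j"
   unfolding g_def mode_sum_diff_norm[OF NS] using N0[OF NN0, of j "N (Suc j)"] by simp
  also have "(1/4::real) ^ j = (1/2) ^ j * (1/2) ^ j"
   by (simp add: power_mult_distrib[symmetric])
  finally have I: "(LBINT z:{-1..1}. (g (Suc j) z - g j z)\<^sup>2) <= (1/2) ^ j * (1/2) ^ j" .
  have "X <= 2 * p" if "p > 0" "I <= p * p" "X <= p + I / (2 * p)" for X I p :: real
  proof -
   have "I / (2 * p) <= p * p / (2 * p)" using that by (intro divide_right_mono) auto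
   also have "... = p / 2" using that by simp
   finally show ?thesis using that by argo
  qed
  from this[OF _ I integral_abs_le[OF sq_integrable_diff[OF gsq gsq]]] show ?thesis by simp
 qed
 have "(\<integral>\<^sup>+z. (\<Sum>j. ennreal \<bar>g (Suc j) z - g j z\<bar> * indicator {-1..1} z) \<partial>lborel)
   = (\<Sum>j. \<integral>\<^sup>+z\<in>{-1..1}. ennreal \<bar>g (Suc j) z - g j z\<bar> \<partial>lborel)"
  by (rule nn_integral_suminf) measurable
 also have "... = (\<Sum>j. ennreal (LBINT z:{-1..1}. \<bar>g (Suc j) z - g j z\<bar>))"
  by (intro suminf_cong nn_integral_set_real set_integrable_abs sq_integrable_integrable sq_integrable_diff gsq) auto
 also have "... <= (\<Sum>j. ennreal (2 * (1/2) ^ j))"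
  using D by (intro suminf_le) auto
 also have "... = ennreal (\<Sum>j. 2 * (1/2) ^ j)"
  by (intro suminf_ennreal2 summable_mult summable_geometric) auto
 also have "... < \<infinity>" by simp
 finally have "AE z in lborel. (\<Sum>j. ennreal \<bar>g (Suc j) z - g j z\<bar> * indicator {-1..1} z) \<noteq> \<infinity>"
  by (intro nn_integral_PInf_AE) auto
 then have conv: "AE z in lborel. z \<in> {-1..1} --> convergent (%j. g j z)"
 proof eventually_elim
  case (elim z)
  show ?case
  proof
   assume z: "z \<in> {-1..1}"
   then have "(\<Sum>j. ennreal \<bar>g (Suc j) z - g j z\<bar>) \<noteq> \<infinity>" using elim by simp
   then have "summable (%j. \<bar>g (Suc j) z - g j z\<bar>)"
    by (intro summable_suminf_not_top) auto
   then have "summable (%j. g (Suc j) z - g j z)" by (rule summable_rabs_cancel)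
   then have "convergent (%n. \<Sum>j<n. g (Suc j) z - g j z)" by (simp add: summable_iff_convergent)
   then have "convergent (%n. g n z - g 0 z)" by (simp only: sum_lessThan_telescope[of "%j. g j z"])
   then have "convergent (%n. (g n z - g 0 z) + g 0 z)" by (intro convergent_add convergent_const)
   then show "convergent (%j. g j z)" by simp
  qed
 qed
 \<comment> \<open>\<open>lim\<close> is taken at every z, also where the sequence diverges;
   therefore h is Borel and 2-periodic everywhere and not only almost everywhere.\<close>
 define h where "h z = lim (%j. g j z)" for z
 have hm [measurable]: "h \<in> borel_measurable borel"
  unfolding h_def by measurable
 have hlim: "AE z in lborel. z \<in> {-1..1} --> (%j. g j z) \<longlonglongrightarrow> h z"
  using conv by eventually_elim (auto simp: h_def convergent_LIMSEQ_iff)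
 have per: "h (z + 2) = h z" for z
 proof -
  have "mode (c n) n (z + 2) = mode (c n) n z" for n
  proof -
   have "cis (pi * real (Suc n) * (z + 2)) = cis (pi * real (Suc n) * z) * cis (2 * pi * real (Suc n))"
    by (simp add: cis_mult algebra_simps)
   also have "cis (2 * pi * real (Suc n)) = 1"
   proof -
    have "2 * pi * real (Suc n) = 2 * real (Suc n) * pi" by simp
    then show ?thesis by (simp only: complex_eq_iff cis.sel cos_2npi sin_2npi one_complex.sel)
   qed
   finally show ?thesis unfolding mode_def by (simp only: mult_1_right)
  qed
  then show ?thesis by (simp add: h_def g_def mode_sum_def)
 qed
 define T where "T n = (\<Sum>i. ?a (i + n))" for n
 have T0: "T \<longlonglongrightarrow> 0"
  unfolding T_def using sum by (rule suminf_exist_split2)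
 have Tge: "sum ?a {n..<m} <= T n" for n m
 proof -
  have "sum ?a {n..<m} = (\<Sum>i<m - n. ?a (i + n))"
   by (rule sum.reindex_bij_witness[of _ "%i. i + n" "%i. i - n"]) auto
  also have "... <= T n"
   unfolding T_def using sum by (intro sum_le_suminf) (auto intro: summable_ignore_initial_segment)
  finally show ?thesis .
 qed
 have fatou: "(\<integral>\<^sup>+z\<in>{-1..1}. ennreal ((h z - mode_sum c n z)\<^sup>2) \<partial>lborel) <= ennreal (T n)" for n
 proof -
  have mm [measurable]: "mode_sum c n \<in> borel_measurable borel"
   using sq_integrable_mode_sum by (simp add: sq_integrable_def)
  have "(\<integral>\<^sup>+z\<in>{-1..1}. ennreal ((h z - mode_sum c n z)\<^sup>2) \<partial>lborel)
    = (\<integral>\<^sup>+z. liminf (%j. ennreal ((g j z - mode_sum c n z)\<^sup>2) * indicator {-1..1} z) \<partial>lborel)"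
  proof (rule nn_integral_cong_AE)
   show "AE z in lborel. ennreal ((h z - mode_sum c n z)\<^sup>2) * indicator {-1..1} z
     = liminf (%j. ennreal ((g j z - mode_sum c n z)\<^sup>2) * indicator {-1..1} z)"
    using hlim
   proof eventually_elim
    case (elim z)
    show ?case
    proof (cases "z \<in> {-1..1}")
     case True
     then have "(%j. ennreal ((g j z - mode_sum c n z)\<^sup>2)) \<longlonglongrightarrow> ennreal ((h z - mode_sum c n z)\<^sup>2)"
      using elim by (intro tendsto_ennrealI tendsto_intros) auto
     then have "liminf (%j. ennreal ((g j z - mode_sum c n z)\<^sup>2)) = ennreal ((h z - mode_sum c n z)\<^sup>2)"
      by (rule lim_imp_Liminf[OF trivial_limit_sequentially])
     then show ?thesis using True by simp
    qed (simp add: Liminf_const)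
   qed
  qed
  also have "... <= liminf (%j. \<integral>\<^sup>+z\<in>{-1..1}. ennreal ((g j z - mode_sum c n z)\<^sup>2) \<partial>lborel)"
   by (rule nn_integral_liminf) measurable
  also have "... <= liminf (%j. ennreal (T n))"
  proof (rule Liminf_mono)
   show "\<forall>\<^sub>F j in sequentially. (\<integral>\<^sup>+z\<in>{-1..1}. ennreal ((g j z - mode_sum c n z)\<^sup>2) \<partial>lborel) <= ennreal (T n)"
    using eventually_ge_at_top[of n]
   proof eventually_elim
    case (elim j)
    have "(\<integral>\<^sup>+z\<in>{-1..1}. ennreal ((g j z - mode_sum c n z)\<^sup>2) \<partial>lborel)
      = ennreal (LBINT z:{-1..1}. (g j z - mode_sum c n z)\<^sup>2)"
     using sq_integrable_diff[OF gsq sq_integrable_mode_sum, of j c n]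
     by (intro nn_integral_set_real) (auto simp: sq_integrable_def)
    also have "(LBINT z:{-1..1}. (g j z - mode_sum c n z)\<^sup>2) = sum ?a {n..<N j}"
     unfolding g_def using elim Nj[of j] by (intro mode_sum_diff_norm) simp
    also have "ennreal ... <= ennreal (T n)" using Tge by (rule ennreal_leI)
    finally show ?case .
   qed
  qed
  finally show ?thesis by (simp add: Liminf_const)
 qed
 have T_nonneg: "T n >= 0" for n using Tge[of n n] by simp
 have dsq: "sq_integrable (%z. h z - mode_sum c n z)" for n
 proof -
  have mm [measurable]: "mode_sum c n \<in> borel_measurable borel"
   using sq_integrable_mode_sum by (simp add: sq_integrable_def)
  have "integrable lborel (%z. indicat_real {-1..1} z *\<^sub>R (h z - mode_sum c n z)\<^sup>2)"
  proof (rule integrableI_nonneg)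
   have "(\<integral>\<^sup>+z. ennreal (indicat_real {-1..1} z *\<^sub>R (h z - mode_sum c n z)\<^sup>2) \<partial>lborel)
     = (\<integral>\<^sup>+z\<in>{-1..1}. ennreal ((h z - mode_sum c n z)\<^sup>2) \<partial>lborel)"
    by (intro nn_integral_cong) (auto split: split_indicator)
   also have "... < \<infinity>" using fatou[of n] by (rule le_less_trans) simp
   finally show "(\<integral>\<^sup>+z. ennreal (indicat_real {-1..1} z *\<^sub>R (h z - mode_sum c n z)\<^sup>2) \<partial>lborel) < \<infinity>" .
  qed auto
  then show ?thesis by (simp add: sq_integrable_def set_integrable_def)
 qed
 have "sq_integrable (%z. (h z - mode_sum c 0 z) + mode_sum c 0 z)"
  by (intro sq_integrable_add dsq sq_integrable_mode_sum)
 then have hsq: "sq_integrable h" by simp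
 have "(%n. LBINT z:{-1..1}. (h z - mode_sum c n z)\<^sup>2) \<longlonglongrightarrow> 0"
 proof (rule tendsto_sandwich[OF _ _ tendsto_const T0])
  show "\<forall>\<^sub>F n in sequentially. 0 <= (LBINT z:{-1..1}. (h z - mode_sum c n z)\<^sup>2)"
   by (intro always_eventually allI) (auto simp: set_lebesgue_integral_def intro!: integral_nonneg_AE)
  have "(LBINT z:{-1..1}. (h z - mode_sum c n z)\<^sup>2) <= T n" for n
  proof -
   have "ennreal (LBINT z:{-1..1}. (h z - mode_sum c n z)\<^sup>2) <= ennreal (T n)"
    using fatou[of n] dsq[of n] by (subst nn_integral_set_real[symmetric]) (auto simp: sq_integrable_def)
   then show ?thesis using T_nonneg[of n] by (simp add: ennreal_le_iff)
  qed
  then show "\<forall>\<^sub>F n in sequentially. (LBINT z:{-1..1}. (h z - mode_sum c n z)\<^sup>2) <= T n"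
   by simp
 qed
 with per hsq show thesis by (intro that) auto
qed

theorem riesz_fischer:
 assumes "summable (%n. (cmod (c n))\<^sup>2)"
 obtains h where "\<forall>z. h (z + 2) = h z" "sq_integrable h" "fc h 0 = 0"
  "\<forall>n. fc h (int (Suc n)) = c n" "(%N. LBINT z:{-1..1}. (h z - mode_sum c N z)\<^sup>2) \<longlonglongrightarrow> 0"
proof -
 obtain h where h: "\<forall>z. h (z + 2) = h z" "sq_integrable h"
  and lim: "(%N. LBINT z:{-1..1}. (h z - mode_sum c N z)\<^sup>2) \<longlonglongrightarrow> 0"
  using riesz_fischer_limit[OF assms] by blast
 have "fc h 0 = 0"
  using fc_limit[OF h(2) lim, of 0] by (simp only: fc_mode_sum LIMSEQ_const_iff)
 moreover have "fc h (int (Suc n)) = c n" for n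
 proof (rule LIMSEQ_unique[OF fc_limit[OF h(2) lim]])
  show "(%N. fc (mode_sum c N) (int (Suc n))) \<longlonglongrightarrow> c n"
   unfolding fc_mode_sum by (rule tendsto_eventually) (use eventually_gt_at_top[of n] in \<open>eventually_elim, simp\<close>)
 qed
 ultimately show thesis by (intro that[OF h(1) h(2) _ _ lim]) auto
qed

text \<open>Bessel's inequality makes the coefficients square summable; Riesz-Fischer yields a
  function with these coefficients that its partial sums approach in L^2; \<open>fc_unique\<close>
  identifies it with g almost everywhere.\<close>

theorem parseval:
 assumes g: "sq_integrable g" and g0: "fc g 0 = 0"
 shows "(%n. (cmod (fc g (int (Suc n))))\<^sup>2) sums (LBINT z:{-1..1}. (g z)\<^sup>2)"
proof -
 define c where "c n = fc g (int (Suc n))" for n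
 have g2: "set_integrable lborel {-1..1} (%z. (g z)\<^sup>2)" using g by (simp add: sq_integrable_def)
 have expand: "(LBINT z:{-1..1}. (g z - mode_sum c N z)\<^sup>2)
   = (LBINT z:{-1..1}. (g z)\<^sup>2) - (\<Sum>n<N. (cmod (c n))\<^sup>2)" for N
 proof -
  have i1: "set_integrable lborel {-1..1} (%z. g z * mode_sum c N z)"
   by (intro sq_integrable_mult g sq_integrable_mode_sum)
  have i2: "set_integrable lborel {-1..1} (%z. (mode_sum c N z)\<^sup>2)"
   using sq_integrable_mode_sum by (simp add: sq_integrable_def)
  have "(LBINT z:{-1..1}. g z * mode_sum c N z) = (LBINT z:{-1..1}. \<Sum>n<N. g z * mode (c n) n z)"
   by (simp add: mode_sum_def sum_distrib_left)
  also have "... = (\<Sum>n<N. LBINT z:{-1..1}. g z * mode (c n) n z)"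
   by (intro set_integral_sum_real sq_integrable_mult g sq_integrable_mode)
  also have "... = (\<Sum>n<N. (cmod (c n))\<^sup>2)"
   unfolding integral_mult_mode[OF sq_integrable_integrable[OF g]] c_def[symmetric]
   by (simp add: complex_mult_cnj cmod_power2)
  finally have cross: "(LBINT z:{-1..1}. g z * mode_sum c N z) = (\<Sum>n<N. (cmod (c n))\<^sup>2)" .
  have sq: "(LBINT z:{-1..1}. (mode_sum c N z)\<^sup>2) = (\<Sum>n<N. (cmod (c n))\<^sup>2)"
   using mode_sum_norm[of "{..<N}" c] by (simp add: mode_sum_def)
  have "(LBINT z:{-1..1}. (g z - mode_sum c N z)\<^sup>2)
    = (LBINT z:{-1..1}. ((g z)\<^sup>2 + (mode_sum c N z)\<^sup>2) - 2 * (g z * mode_sum c N z))"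
   by (simp add: power2_diff mult.assoc)
  also have "... = ((LBINT z:{-1..1}. (g z)\<^sup>2) + (LBINT z:{-1..1}. (mode_sum c N z)\<^sup>2))
    - 2 * (LBINT z:{-1..1}. g z * mode_sum c N z)"
   by (simp only: set_integral_diff(2)[OF set_integral_add(1)[OF g2 i2] set_integrable_mult_right[OF i1]]
     set_integral_add(2)[OF g2 i2] set_integral_mult_right)
  finally show ?thesis unfolding cross sq by simp
 qed
 have bessel: "(\<Sum>n<N. (cmod (c n))\<^sup>2) <= (LBINT z:{-1..1}. (g z)\<^sup>2)" for N
 proof -
  have "0 <= (LBINT z:{-1..1}. (g z - mode_sum c N z)\<^sup>2)"
   by (auto simp: set_lebesgue_integral_def intro!: integral_nonneg_AE)
  then show ?thesis unfolding expand by simp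
 qed
 have sum: "summable (%n. (cmod (c n))\<^sup>2)"
  by (rule summableI_nonneg_bounded[OF _ bessel]) auto
 obtain h where h: "sq_integrable h" "fc h 0 = 0" "\<forall>n. fc h (int (Suc n)) = c n"
  and lim: "(%N. LBINT z:{-1..1}. (h z - mode_sum c N z)\<^sup>2) \<longlonglongrightarrow> 0"
  by (rule riesz_fischer[OF sum], rule that)
 have gh: "AE z in lborel. z \<in> {-1..1} --> g z - h z = 0"
 proof (rule fc_unique)
  show "set_integrable lborel {-1..1} (%z. g z - h z)"
   by (rule sq_integrable_integrable[OF sq_integrable_diff[OF g h(1)]])
  show "fc (%z. g z - h z) k = 0" if "k >= 0" for k
  proof (cases "k = 0")
   case True
   then show ?thesis
    using fc_diff[OF sq_integrable_integrable[OF g] sq_integrable_integrable[OF h(1)], of 0] g0 h(2) by simp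
  next
   case False
   then have "k = int (Suc (nat k - 1))" using that by simp
   then obtain n where "k = int (Suc n)" by blast
   then show ?thesis
    using fc_diff[OF sq_integrable_integrable[OF g] sq_integrable_integrable[OF h(1)], of k] h(3)
    by (simp only: c_def diff_self)
  qed
 qed
 have "(LBINT z:{-1..1}. (h z - mode_sum c N z)\<^sup>2) = (LBINT z:{-1..1}. (g z - mode_sum c N z)\<^sup>2)" for N
  unfolding set_lebesgue_integral_def
 proof (rule integral_cong_AE)
  have [measurable]: "h \<in> borel_measurable borel" "g \<in> borel_measurable borel" "mode_sum c N \<in> borel_measurable borel"
   using g h sq_integrable_mode_sum by (auto simp: sq_integrable_def)
  show "(%z. indicat_real {-1..1} z *\<^sub>R (h z - mode_sum c N z)\<^sup>2) \<in> borel_measurable lborel" by measurable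
  show "(%z. indicat_real {-1..1} z *\<^sub>R (g z - mode_sum c N z)\<^sup>2) \<in> borel_measurable lborel" by measurable
  show "AE z in lborel. indicat_real {-1..1} z *\<^sub>R (h z - mode_sum c N z)\<^sup>2
    = indicat_real {-1..1} z *\<^sub>R (g z - mode_sum c N z)\<^sup>2"
   using gh by eventually_elim (auto simp: indicator_def)
 qed
 with lim have "(%N. (LBINT z:{-1..1}. (g z)\<^sup>2) - (\<Sum>n<N. (cmod (c n))\<^sup>2)) \<longlonglongrightarrow> 0"
  by (simp only: expand)
 from tendsto_diff[OF tendsto_const[of "LBINT z:{-1..1}. (g z)\<^sup>2"] this]
 show ?thesis by (simp add: sums_def c_def)
qed

subsection \<open>Bessel series and Stokes fields\<close>

text \<open>This is K_n(x) / x^n. In this scaling the derivative is -x times the next member, so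
  functions of kap r have Cartesian derivatives of the same kind with polynomial factors, free of
  square roots and angles.\<close>

fun bessel_L :: "nat => real => real" where
 "bessel_L 0 x = K0 x"
| "bessel_L (Suc 0) x = K1 x / x"
| "bessel_L (Suc (Suc n)) x = (bessel_L n x + 2 * (real n + 1) * bessel_L (Suc n) x) / x\<^sup>2"

lemma bessel_L_pos: "x > 0 ==> bessel_L n x > 0"
proof (induction n rule: induct_nat_012)
 case (ge2 n)
 have "0 < bessel_L n x + 2 * (real n + 1) * bessel_L (Suc n) x"
  by (rule add_pos_pos, use ge2 in simp, rule mult_pos_pos) (use ge2 in simp_all)
 then show ?case using ge2 by simp
qed (simp_all add: K0_pos K1_pos)

lemma DERIV_bessel_L:
 assumes x: "x > 0"
 shows "(bessel_L n has_real_derivative - (x * bessel_L (Suc n) x)) (at x)"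
proof (induction n rule: induct_nat_012)
 case 0
 have "(K0 has_real_derivative - (x * bessel_L (Suc 0) x)) (at x)"
  using DERIV_K0[OF x] x by simp
 moreover have "bessel_L 0 = K0" by (rule ext) simp
 ultimately show ?case by (simp only:)
next
 case 1
 have "((%x. K1 x / x) has_real_derivative - (x * bessel_L (Suc (Suc 0)) x)) (at x)"
  using x by (auto intro!: derivative_eq_intros DERIV_K1 simp: field_simps power2_eq_square)
 moreover have "bessel_L (Suc 0) = (%x. K1 x / x)" by (rule ext) simp
 ultimately show ?case by (simp only:)
next
 case (ge2 n)
 let ?A = "bessel_L n x" and ?B = "bessel_L (Suc n) x" and ?C = "bessel_L (Suc (Suc n)) x"
 let ?m = "2 * (real n + 1)"
 have "((%y. (bessel_L n y + ?m * bessel_L (Suc n) y) / y\<^sup>2) has_real_derivative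
   ((- (x * ?B) + ?m * - (x * ?C)) * x\<^sup>2 - (?A + ?m * ?B) * (2 * x)) / (x\<^sup>2 * x\<^sup>2)) (at x)"
 proof (rule DERIV_divide[OF DERIV_add[OF ge2(1) DERIV_cmult[OF ge2(2)]]])
  show "((%y. y\<^sup>2) has_real_derivative 2 * x) (at x)"
   by (auto intro!: derivative_eq_intros)
 qed (use x in simp)
 moreover have "bessel_L (Suc (Suc n)) = (%y. (bessel_L n y + ?m * bessel_L (Suc n) y) / y\<^sup>2)"
  by (rule ext) simp
 moreover have "((- (x * ?B) + ?m * - (x * ?C)) * x\<^sup>2 - (?A + ?m * ?B) * (2 * x)) / (x\<^sup>2 * x\<^sup>2)
   = - (x * bessel_L (Suc (Suc (Suc n))) x)"
 proof -
  have C: "?A + ?m * ?B = ?C * x\<^sup>2" using x by simp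
  have "bessel_L (Suc (Suc (Suc n))) x = (?B + (?m + 2) * ?C) / x\<^sup>2"
   by (simp only: bessel_L.simps(3)[of "Suc n"]) simp
  then show ?thesis unfolding C using x
   by (simp only:) (simp add: field_simps power2_eq_square del: bessel_L.simps)
 qed
 ultimately show ?case by (simp only:)
qed

lemma bessel_L_antimono:
 assumes "0 < x" "x <= y" shows "bessel_L n y <= bessel_L n x"
proof (rule DERIV_nonpos_imp_nonincreasing[OF assms(2)])
 fix z assume "x <= z"
 then have "z > 0" using assms by simp
 then show "\<exists>d. (bessel_L n has_real_derivative d) (at z) & d <= 0"
  using DERIV_bessel_L[of z n] bessel_L_pos[of z "Suc n"]
  by (intro exI[of _ "- (z * bessel_L (Suc n) z)"]) (auto simp del: bessel_L.simps)
qed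

lemma K1_decay: "0 < x ==> x <= y ==> K1 y <= K1 x * exp (- (y - x))"
 using cosh_laplace_scaled_antimono[of x y 1] by (simp add: K1_def exp_diff exp_minus field_simps)

text \<open>K0 <= K1, and each step of the recursion only divides by x^2 >= a^2. All decay estimates
  can therefore be taken from \<open>K1_decay\<close>.\<close>

lemma bessel_L_le_K1:
 assumes a: "a > 0"
 shows "\<exists>C\<ge>0. \<forall>x\<ge>a. bessel_L n x <= C * K1 x"
proof (induction n rule: induct_nat_012)
 case 0
 show ?case
 proof (intro exI[of _ 1] conjI allI impI)
  fix x assume "x >= a"
  then show "bessel_L 0 x <= 1 * K1 x"
   using R_le_1[of x] K1_pos[of x] a by (simp add: bessel_ratio_def)
 qed simp
next
 case 1
 show ?case
 proof (intro exI[of _ "1 / a"] conjI allI impI)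
  fix x assume x: "x >= a"
  then have "K1 x / x <= K1 x / a" using a K1_pos[of x] by (intro divide_left_mono) auto
  then show "bessel_L (Suc 0) x <= 1 / a * K1 x" by simp
 qed (use a in simp)
next
 case (ge2 n)
 then obtain C D where C: "C >= 0" "!!x. x >= a ==> bessel_L n x <= C * K1 x"
  and D: "D >= 0" "!!x. x >= a ==> bessel_L (Suc n) x <= D * K1 x" by blast
 let ?E = "(C + 2 * (real n + 1) * D) / a\<^sup>2"
 show ?case
 proof (intro exI[of _ ?E] conjI allI impI)
  show "?E >= 0" using C D by simp
  fix x assume x: "x >= a"
  have "bessel_L n x + 2 * (real n + 1) * bessel_L (Suc n) x <= C * K1 x + 2 * (real n + 1) * (D * K1 x)"
   by (intro add_mono mult_left_mono C D x) simp
  also have "... = (C + 2 * (real n + 1) * D) * K1 x" by (simp add: algebra_simps)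
  finally have "bessel_L (Suc (Suc n)) x <= (C + 2 * (real n + 1) * D) * K1 x / x\<^sup>2"
   by (simp only: bessel_L.simps) (intro divide_right_mono, auto)
  also have "... <= (C + 2 * (real n + 1) * D) * K1 x / a\<^sup>2"
   using a x C D K1_pos[of x] by (intro divide_left_mono power_mono mult_nonneg_nonneg) auto
  finally show "bessel_L (Suc (Suc n)) x <= ?E * K1 x" by simp
 qed
qed

section \<open>Bessel series: convergence, decay and termwise differentiation\<close>

definition kap :: "nat => real" where
 "kap n = pi * real (Suc n)"

lemma kap_pos [simp]: "kap n > 0"
 by (simp add: kap_def)

lemma kap_nonneg [simp]: "kap n >= 0" and kap_nz [simp]: "kap n \<noteq> 0"
 using kap_pos[of n] by linarith+

lemma kap_ge_pi: "kap n >= pi"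
 by (simp add: kap_def)

lemma kap_ge_1: "kap n >= 1"
 using kap_ge_pi[of n] pi_ge_two by linarith

lemma kap_ge: "kap n >= real n"
proof -
 have "1 * real n <= pi * real (Suc n)" using pi_ge_two by (intro mult_mono) auto
 then show ?thesis by (simp add: kap_def)
qed

lemma summable_kap_exp:
 assumes d: "d > 0"
 shows "summable (%k. kap k ^ m * exp (- (kap k * d)))"
proof -
 define C where "C = fact m / (d / 2) ^ m"
 have "summable (%k. C * exp (- (d / 2)) ^ k)"
  using d by (intro summable_mult summable_geometric) auto
 moreover have "norm (kap k ^ m * exp (- (kap k * d))) <= C * exp (- (d / 2)) ^ k" for k
 proof -
  have "kap k ^ m * exp (- (d / 2 * kap k)) <= C"
   unfolding C_def using d by (intro power_exp_neg_le) auto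
  moreover have "exp (- (kap k * (d / 2))) <= exp (- (real k * (d / 2)))"
   using d kap_ge[of k] by (simp only: exp_le_cancel_iff neg_le_iff_le) (intro mult_right_mono, auto)
  ultimately have "(kap k ^ m * exp (- (d / 2 * kap k))) * exp (- (kap k * (d / 2)))
    <= C * exp (- (real k * (d / 2)))"
   using d by (intro mult_mono) (auto simp: C_def)
  moreover have "exp (- (d / 2 * kap k)) * exp (- (kap k * (d / 2))) = exp (- (kap k * d))"
   by (simp add: exp_add[symmetric] field_simps)
  moreover have "exp (- (real k * (d / 2))) = exp (- (d / 2)) ^ k"
   by (simp add: exp_of_nat_mult[symmetric] mult.commute)
  ultimately show ?thesis by (simp add: mult.assoc)
 qed
 ultimately show ?thesis by (rule summable_comparison_test'[where N=0])
qed

text \<open>Absolute convergence at every radius above rr, for all orders n and all powers of the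
  wave number, so that the class is stable under every derivative.\<close>

definition admissible :: "real => (nat => complex) => bool" where
 "admissible rr c \<longleftrightarrow> (\<forall>r>rr. \<forall>n j. summable (%k. kap k ^ j * bessel_L n (kap k * r) * cmod (c k)))"

text \<open>j counts powers of the wave number and l quarter turns of the phase. A z-derivative
  raises j and l by one; a transverse derivative raises n by one and j by two and brings out minus
  the coordinate.\<close>

definition bessel_term :: "nat => nat => nat => (nat => complex) => nat => real => real => real" where
 "bessel_term n j l c k r z = kap k ^ j * bessel_L n (kap k * r) * Re (\<i> ^ l * c k * cis (kap k * z))"

definition bessel_series :: "nat => nat => nat => (nat => complex) => real => real => real" where
 "bessel_series n j l c r z = (\<Sum>k. bessel_term n j l c k r z)"

definition bessel_bound :: "nat => nat => (nat => complex) => real => real" where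
 "bessel_bound n j c r = (\<Sum>k. kap k ^ j * bessel_L n (kap k * r) * cmod (c k))"

lemma bessel_term_bound:
 assumes "0 < s" "s <= r"
 shows "\<bar>bessel_term n j l c k r z\<bar> <= kap k ^ j * bessel_L n (kap k * s) * cmod (c k)"
proof -
 have "\<bar>Re (\<i> ^ l * c k * cis (kap k * z))\<bar> <= cmod (c k)"
  using abs_Re_le_cmod[of "\<i> ^ l * c k * cis (kap k * z)"] by (simp add: norm_mult norm_power)
 moreover have "bessel_L n (kap k * r) <= bessel_L n (kap k * s)"
  using assms by (intro bessel_L_antimono) auto
 moreover have "bessel_L n (kap k * r) >= 0"
  using bessel_L_pos[of "kap k * r" n] assms by simp
 ultimately show ?thesis
  unfolding bessel_term_def abs_mult power_abs by (intro mult_mono) auto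
qed

lemma bessel_term_summable:
 assumes c: "admissible rr c" and r: "0 <= rr" "rr < r"
 shows "summable (%k. bessel_term n j l c k r z)"
proof (rule summable_comparison_test'[where N=0])
 show "summable (%k. kap k ^ j * bessel_L n (kap k * r) * cmod (c k))"
  using c r by (simp add: admissible_def)
 show "norm (bessel_term n j l c k r z) <= kap k ^ j * bessel_L n (kap k * r) * cmod (c k)" for k
  using bessel_term_bound[of r r] r by simp
qed

lemma bessel_series_le_bound:
 assumes c: "admissible rr c" and r: "0 <= rr" "rr < r"
 shows "\<bar>bessel_series n j l c r z\<bar> <= bessel_bound n j c r"
proof -
 have s: "summable (%k. kap k ^ j * bessel_L n (kap k * r) * cmod (c k))"
  using c r by (simp add: admissible_def)
 have le: "norm (bessel_term n j l c k r z) <= kap k ^ j * bessel_L n (kap k * r) * cmod (c k)" for k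
  using bessel_term_bound[of r r] r by simp
 have "norm (\<Sum>k. bessel_term n j l c k r z) <= (\<Sum>k. kap k ^ j * bessel_L n (kap k * r) * cmod (c k))"
  by (rule norm_suminf_le[OF le s])
 then show ?thesis by (simp add: bessel_series_def bessel_bound_def)
qed

lemma bessel_bound_nonneg:
 assumes c: "admissible rr c" and r: "0 <= rr" "rr < r"
 shows "bessel_bound n j c r >= 0"
 using bessel_series_le_bound[OF assms, of n j 0 0] by linarith

text \<open>Every term is compared with its value at s = rr + 1. All wave numbers are at least 1, so
  the gain exp(-(r - s)) is uniform in k. The remaining factor K1(kap s) is rewritten as kap s times
  \<open>bessel_L 1\<close>, which admissibility with exponent j + 1 can sum.\<close>

lemma bessel_bound_decay:
 assumes c: "admissible rr c" and r: "0 <= rr"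
 shows "((%r. r ^ q * bessel_bound n j c r) \<longlongrightarrow> 0) at_top"
proof -
 define s where "s = rr + 1"
 have s: "s > rr" "s > 0" using r by (auto simp: s_def)
 obtain C where C: "C >= 0" "!!x. x >= s ==> bessel_L n x <= C * K1 x"
  using bessel_L_le_K1[OF s(2), of n] by blast
 define B where "B = (\<Sum>k. kap k ^ Suc j * bessel_L 1 (kap k * s) * cmod (c k)) * (C * s)"
 have sm: "summable (%k. kap k ^ Suc j * bessel_L 1 (kap k * s) * cmod (c k))"
  using c s unfolding admissible_def by blast
 have le: "bessel_bound n j c r <= B * exp (- (r - s))" if "r >= s" for r
 proof -
  have "kap k ^ j * bessel_L n (kap k * r) * cmod (c k)
    <= (kap k ^ Suc j * bessel_L 1 (kap k * s) * cmod (c k)) * (C * s * exp (- (r - s)))" for k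
  proof -
   have "1 * s <= kap k * r" using kap_ge_1[of k] that s by (intro mult_mono) auto
   then have "bessel_L n (kap k * r) <= C * K1 (kap k * r)" using C by simp
   also have "... <= C * (K1 (kap k * s) * exp (- (kap k * r - kap k * s)))"
    using s that C by (intro mult_left_mono K1_decay) auto
   also have "... <= C * (K1 (kap k * s) * exp (- (r - s)))"
   proof (intro mult_left_mono)
    have "1 * (r - s) <= kap k * (r - s)" using kap_ge_1[of k] that by (intro mult_right_mono) auto
    then show "exp (- (kap k * r - kap k * s)) <= exp (- (r - s))" by (simp add: algebra_simps)
   qed (use C K1_pos[of "kap k * s"] s in auto)
   also have "... = bessel_L 1 (kap k * s) * kap k * (C * s * exp (- (r - s)))"
    using s by simp
   finally have "kap k ^ j * cmod (c k) * bessel_L n (kap k * r)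
     <= kap k ^ j * cmod (c k) * (bessel_L 1 (kap k * s) * kap k * (C * s * exp (- (r - s))))"
    by (intro mult_left_mono) auto
   then show ?thesis by (simp only: power_Suc mult_ac)
  qed
  then have "bessel_bound n j c r <= (\<Sum>k. (kap k ^ Suc j * bessel_L 1 (kap k * s) * cmod (c k)) * (C * s * exp (- (r - s))))"
   unfolding bessel_bound_def using c s that sm
   by (intro suminf_le summable_mult2) (auto simp: admissible_def)
  also have "... = B * exp (- (r - s))"
   unfolding B_def by (subst suminf_mult2[OF sm, symmetric]) (simp add: mult_ac)
  finally show ?thesis .
 qed
 show ?thesis
 proof (rule Lim_null_comparison)
  show "\<forall>\<^sub>F r in at_top. norm (r ^ q * bessel_bound n j c r) <= B * exp s * (r ^ q * exp (- r))"
   using eventually_ge_at_top[of s]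
  proof eventually_elim
   case (elim r)
   have "bessel_bound n j c r >= 0"
    using bessel_bound_nonneg[OF c, of r n j] elim s assms by simp
   moreover have "r ^ q * bessel_bound n j c r <= r ^ q * (B * exp (- (r - s)))"
    using elim s le[OF elim] by (intro mult_left_mono) auto
   moreover have "r ^ q * (B * exp (- (r - s))) = B * exp s * (r ^ q * exp (- r))"
   proof -
    have "exp (- (r - s)) = exp s * exp (- r)" by (simp add: exp_add[symmetric])
    then show ?thesis by (simp only: mult_ac)
   qed
   moreover have "norm (r ^ q * bessel_bound n j c r) = r ^ q * bessel_bound n j c r"
    using elim s calculation(1) by simp
   ultimately show ?case by argo
  qed
  show "((%r. B * exp s * (r ^ q * exp (- r))) \<longlongrightarrow> 0) at_top"
  proof (rule tendsto_mult_right_zero)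
   show "((%r::real. r ^ q * exp (- r)) \<longlongrightarrow> 0) at_top" by real_asymp
  qed
 qed
qed

lemma bessel_series_uniform_limit:
 assumes c: "admissible rr c" and s: "0 <= rr" "rr < s"
 shows "uniform_limit {p. fst p >= s} (%N p. \<Sum>k<N. bessel_term n j l c k (fst p) (snd p))
  (%p. bessel_series n j l c (fst p) (snd p)) sequentially"
 unfolding bessel_series_def
proof (rule Weierstrass_m_test)
 show "summable (%k. kap k ^ j * bessel_L n (kap k * s) * cmod (c k))"
  using c s by (simp add: admissible_def)
 show "norm (bessel_term n j l c k (fst p) (snd p)) <= kap k ^ j * bessel_L n (kap k * s) * cmod (c k)"
  if "p \<in> {p. fst p >= s}" for k p
  using bessel_term_bound[of s "fst p"] s that by simp
qed

lemma bessel_series_recurrence: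
 assumes c: "admissible rr c" and r: "0 <= rr" "rr < r"
 shows "r\<^sup>2 * bessel_series (Suc (Suc n)) (Suc (Suc j)) l c r z
  = bessel_series n j l c r z + 2 * (real n + 1) * bessel_series (Suc n) j l c r z"
proof -
 have "r\<^sup>2 * bessel_term (Suc (Suc n)) (Suc (Suc j)) l c k r z
   = bessel_term n j l c k r z + 2 * (real n + 1) * bessel_term (Suc n) j l c k r z" for k
 proof -
  have "(kap k * r)\<^sup>2 * bessel_L (Suc (Suc n)) (kap k * r) = bessel_L n (kap k * r) + 2 * (real n + 1) * bessel_L (Suc n) (kap k * r)"
   using r by simp
  then have "r\<^sup>2 * (kap k ^ j * (kap k)\<^sup>2 * bessel_L (Suc (Suc n)) (kap k * r) * w)
    = kap k ^ j * bessel_L n (kap k * r) * w + 2 * (real n + 1) * (kap k ^ j * bessel_L (Suc n) (kap k * r) * w)" for w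
   by (simp add: power_mult_distrib algebra_simps del: bessel_L.simps)
  from this[of "Re (\<i> ^ l * c k * cis (kap k * z))"] show ?thesis
   unfolding bessel_term_def power_Suc power2_eq_square by (simp only: mult_ac)
 qed
 then show ?thesis
  unfolding bessel_series_def
  by (simp add: suminf_mult[symmetric] suminf_add bessel_term_summable[OF c r] summable_mult)
qed

lemma bessel_series_phase:
 assumes c: "admissible rr c" and r: "0 <= rr" "rr < r"
 shows "bessel_series n j (Suc (Suc l)) c r z = - bessel_series n j l c r z"
proof -
 have i: "\<i> ^ Suc (Suc l) = - (\<i> ^ l)" by simp
 have "bessel_term n j (Suc (Suc l)) c k r z = - bessel_term n j l c k r z" for k
  unfolding bessel_term_def i by (simp only: mult_minus_left uminus_complex.sel mult_minus_right)
 then show ?thesis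
  unfolding bessel_series_def by (simp add: suminf_minus bessel_term_summable[OF c r])
qed

section \<open>Fields on the exterior domain and a symbolic calculus for them\<close>

lemma vec3_eq_iff: "(x::'a^3) = y \<longleftrightarrow> x$1 = y$1 & x$2 = y$2 & x$3 = y$3"
 by (simp add: vec_eq_iff forall_3)

lemma vec_nth_has_derivative [derivative_intros]:
 "((%x::real^'n. x$i) has_derivative (%h. h$i)) F"
 by (rule bounded_linear_imp_has_derivative[OF bounded_linear_vec_nth])

lemma cyl_radius_nonneg: "cyl_radius x >= 0"
 by (simp add: cyl_radius_def)

lemma cyl_radius_sq: "(cyl_radius x)\<^sup>2 = (x$1)\<^sup>2 + (x$2)\<^sup>2"
 by (simp add: cyl_radius_def)

lemma continuous_on_cyl_radius: "continuous_on S cyl_radius"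
 unfolding cyl_radius_def by (intro continuous_intros)

lemma open_exterior_domain: "open (exterior_domain rr)"
 unfolding exterior_domain_def by (rule open_Collect_less[OF continuous_on_const continuous_on_cyl_radius])

lemma cyl_radius_cyl_point [simp]: "r >= 0 ==> cyl_radius (cyl_point r th z) = r"
proof -
 assume "r >= 0"
 have "(r * cos th)\<^sup>2 + (r * sin th)\<^sup>2 = r\<^sup>2 * ((cos th)\<^sup>2 + (sin th)\<^sup>2)"
  by (simp only: power_mult_distrib distrib_left)
 then show ?thesis using \<open>r >= 0\<close> by (simp add: cyl_radius_def cyl_point_def)
qed

lemma cyl_point_nth [simp]:
 "cyl_point r th z $ 1 = r * cos th" "cyl_point r th z $ 2 = r * sin th" "cyl_point r th z $ 3 = z"
 by (simp_all add: cyl_point_def)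

lemma cyl_radius_has_derivative:
 assumes "cyl_radius x > 0"
 shows "(cyl_radius has_derivative (%h. (x$1 * h$1 + x$2 * h$2) / cyl_radius x)) (at x)"
proof -
 have pos: "(x$1)\<^sup>2 + (x$2)\<^sup>2 > 0" using assms by (simp add: cyl_radius_def)
 have "((%x::real^3. (x$1)\<^sup>2 + (x$2)\<^sup>2) has_derivative (%h. 2 * (x$1 * h$1 + x$2 * h$2))) (at x)"
  by (auto intro!: derivative_eq_intros simp: algebra_simps)
 have q: "((%x::real^3. sqrt ((x$1)\<^sup>2 + (x$2)\<^sup>2)) has_derivative
   (%h. (2 * (x$1 * h$1 + x$2 * h$2)) * (inverse (sqrt ((x$1)\<^sup>2 + (x$2)\<^sup>2)) / 2))) (at x)"
  by (rule DERIV_compose_FDERIV[where f=sqrt and g="%x::real^3. (x$1)\<^sup>2 + (x$2)\<^sup>2", OF DERIV_real_sqrt[OF pos]]) fact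
 have e: "(%h::real^3. (2 * (x$1 * h$1 + x$2 * h$2)) * (inverse (sqrt ((x$1)\<^sup>2 + (x$2)\<^sup>2)) / 2))
   = (%h. (x$1 * h$1 + x$2 * h$2) / cyl_radius x)"
 proof -
  have "(2 * a) * (inverse s / 2) = a / s" for a s :: real
   by (cases "s = 0") (simp_all add: field_simps)
  then show ?thesis by (simp only: cyl_radius_def)
 qed
 have f: "cyl_radius = (%x. sqrt ((x$1)\<^sup>2 + (x$2)\<^sup>2))" by (rule ext) (simp add: cyl_radius_def)
 show ?thesis using q unfolding e unfolding f .
qed

definition bessel_field :: "nat => nat => nat => (nat => complex) => real^3 => real" where
 "bessel_field n j l c x = bessel_series n j l c (cyl_radius x) (x$3)"

lemma bessel_term_has_derivative:
 assumes r: "cyl_radius x > 0"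
 shows "((%x. bessel_term n j l c k (cyl_radius x) (x$3)) has_derivative
  (%h. - bessel_term (Suc n) (Suc (Suc j)) l c k (cyl_radius x) (x$3) * (x$1 * h$1 + x$2 * h$2)
   + bessel_term n (Suc j) (Suc l) c k (cyl_radius x) (x$3) * h$3)) (at x)"
proof -
 let ?r = "cyl_radius x" and ?k = "kap k"
 have kr: "?k * ?r > 0" using r by simp
 have "((%x. bessel_L n (?k * cyl_radius x)) has_derivative
   (%h. (?k * ((x$1 * h$1 + x$2 * h$2) / ?r)) * - (?k * ?r * bessel_L (Suc n) (?k * ?r)))) (at x)"
  by (rule DERIV_compose_FDERIV[OF DERIV_bessel_L[OF kr] has_derivative_mult_right[OF cyl_radius_has_derivative[OF r]]])
 then have 1: "((%x. bessel_L n (?k * cyl_radius x)) has_derivative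
   (%h. - (?k\<^sup>2 * bessel_L (Suc n) (?k * ?r)) * (x$1 * h$1 + x$2 * h$2))) (at x)"
  using r by (simp add: power2_eq_square mult_ac del: bessel_L.simps)
 let ?w = "\<i> ^ l * c k"
 have "((%z. Re (?w * cis (?k * z))) has_real_derivative ?k * Re (\<i> * ?w * cis (?k * (x$3)))) (at (x$3))"
  by (auto intro!: derivative_eq_intros simp: algebra_simps)
 then have 2: "((%x::real^3. Re (?w * cis (?k * x$3))) has_derivative
   (%h. h$3 * (?k * Re (\<i> * ?w * cis (?k * x$3))))) (at x)"
  by (rule DERIV_compose_FDERIV[where f="%z. Re (?w * cis (?k * z))" and g="%x. x$3", OF _ vec_nth_has_derivative])
 define K Ln Lp W W' where "K = ?k ^ j" and "Ln = bessel_L n (?k * ?r)" and "Lp = bessel_L (Suc n) (?k * ?r)"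
  and "W = Re (?w * cis (?k * x$3))" and "W' = Re (\<i> * ?w * cis (?k * x$3))"
 have D: "((%x. ?k ^ j * (bessel_L n (?k * cyl_radius x) * Re (?w * cis (?k * x$3)))) has_derivative
   (%h. K * (Ln * (h$3 * (?k * W')) + (- (?k\<^sup>2 * Lp) * (x$1 * h$1 + x$2 * h$2)) * W))) (at x)"
  unfolding K_def Ln_def Lp_def W_def W'_def by (rule has_derivative_mult_right[OF has_derivative_mult[OF 1 2]])
 have t1: "bessel_term (Suc n) (Suc (Suc j)) l c k ?r (x$3) = ?k * (?k * K) * Lp * W"
  by (simp only: bessel_term_def K_def Lp_def W_def power_Suc)
 have t2: "bessel_term n (Suc j) (Suc l) c k ?r (x$3) = ?k * K * Ln * W'"
  by (simp only: bessel_term_def K_def Ln_def W'_def power_Suc mult.assoc)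
 have eq: "(%h::real^3. K * (Ln * (h$3 * (?k * W')) + (- (?k\<^sup>2 * Lp) * (x$1 * h$1 + x$2 * h$2)) * W))
   = (%h. - (?k * (?k * K) * Lp * W) * (x$1 * h$1 + x$2 * h$2) + ?k * K * Ln * W' * h$3)"
  by (rule ext) (simp add: algebra_simps power2_eq_square)
 have f: "(%x. bessel_term n j l c k (cyl_radius x) (x$3))
   = (%x. ?k ^ j * (bessel_L n (?k * cyl_radius x) * Re (?w * cis (?k * x$3))))"
  unfolding bessel_term_def by (simp only: mult.assoc)
 show ?thesis
  unfolding t1 t2 f using D[unfolded eq] .
qed

text \<open>Termwise differentiation on a ball around x that stays outside the cylinder of radius s,
  halfway between rr and the radius of x; there the differentiated series converge
  uniformly.\<close>

lemma bessel_field_has_derivative: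
 assumes c: "admissible rr c" and rr: "0 <= rr" and x: "cyl_radius x > rr"
 shows "(bessel_field n j l c has_derivative
  (%h. - bessel_field (Suc n) (Suc (Suc j)) l c x * (x$1 * h$1 + x$2 * h$2)
   + bessel_field n (Suc j) (Suc l) c x * h$3)) (at x)"
proof -
 define s where "s = (cyl_radius x + rr) / 2"
 have s: "rr < s" "s < cyl_radius x" using x by (auto simp: s_def field_simps)
 have "open {y. s < cyl_radius y}"
  by (rule open_Collect_less[OF continuous_on_const continuous_on_cyl_radius])
 then obtain \<delta>0 where \<delta>0: "\<delta>0 > 0" "ball x \<delta>0 \<subseteq> {y. s < cyl_radius y}"
  using s unfolding open_contains_ball by blast
 define \<delta> where "\<delta> = min \<delta>0 1"
 have \<delta>: "\<delta> > 0" using \<delta>0 by (simp add: \<delta>_def)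
 define S where "S = ball x \<delta>"
 have S: "s < cyl_radius y" "norm y <= norm x + 1" if "y \<in> S" for y
 proof -
  have d: "dist x y < \<delta>" using that by (simp add: S_def)
  then show "s < cyl_radius y" using \<delta>0 by (auto simp: \<delta>_def)
  have "norm y <= norm x + norm (y - x)" using norm_triangle_sub[of y x] by simp
  then show "norm y <= norm x + 1" using d by (simp add: \<delta>_def dist_norm norm_minus_commute)
 qed
 \<comment> \<open>On the ball the coordinates are at most norm x + 1, so a uniform error d in both
   differentiated series changes the derivative by at most d B norm h.\<close>
 define B where "B = 2 * (norm x + 1) + 1"
 have B: "B > 0" unfolding B_def using norm_ge_zero[of x] by argo
 let ?t = "%n j l k (y::real^3). bessel_term n j l c k (cyl_radius y) (y$3)"
 let ?f' = "%k y (h::real^3). - ?t (Suc n) (Suc (Suc j)) l k y * (y$1 * h$1 + y$2 * h$2) + ?t n (Suc j) (Suc l) k y * h$3"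
 let ?g' = "%y (h::real^3). - bessel_field (Suc n) (Suc (Suc j)) l c y * (y$1 * h$1 + y$2 * h$2)
   + bessel_field n (Suc j) (Suc l) c y * h$3"
 have ul: "\<forall>\<^sub>F N in sequentially. \<forall>y\<in>S. \<bar>(\<Sum>k<N. ?t n j l k y) - bessel_field n j l c y\<bar> < e"
  if "e > 0" for e n j l
 proof -
  have "\<forall>\<^sub>F N in sequentially. \<forall>p\<in>{p. fst p >= s}. dist (\<Sum>k<N. bessel_term n j l c k (fst p) (snd p)) (bessel_series n j l c (fst p) (snd p)) < e"
   by (rule uniform_limitD[OF bessel_series_uniform_limit[OF c rr s(1)] that])
  then show ?thesis
  proof eventually_elim
   case (elim N)
   show ?case
   proof
    fix y assume "y \<in> S"
    then show "\<bar>(\<Sum>k<N. ?t n j l k y) - bessel_field n j l c y\<bar> < e"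
    proof -
     assume "y \<in> S"
     then have "(cyl_radius y, y$3) \<in> {p. fst p >= s}" using S(1)[of y] by simp
     from bspec[OF elim this] show ?thesis
      by (simp only: fst_conv snd_conv dist_real_def bessel_field_def)
    qed
   qed
  qed
 qed
 have "\<exists>g. \<forall>y\<in>S. (%k. ?t n j l k y) sums (g y) & (g has_derivative ?g' y) (at y within S)"
 proof (rule has_derivative_series)
  show "convex S" by (simp add: S_def)
  show "x \<in> S" using \<delta> by (simp add: S_def)
  show "(%k. ?t n j l k x) sums bessel_field n j l c x"
   unfolding bessel_field_def bessel_series_def using bessel_term_summable[OF c rr x] by (rule summable_sums)
  show "((%y. ?t n j l k y) has_derivative ?f' k y) (at y within S)" if "y \<in> S" for k y
   by (rule has_derivative_at_withinI[OF bessel_term_has_derivative]) (use S(1)[OF that] s rr in simp)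
  fix e :: real assume e: "e > 0"
  define d where "d = e / B"
  have d: "d > 0" using e B by (simp add: d_def)
  show "\<forall>\<^sub>F N in sequentially. \<forall>y\<in>S. \<forall>h. norm (sum (%k. ?f' k y h) {..<N} - ?g' y h) <= e * norm h"
   using ul[OF d, of "Suc n" "Suc (Suc j)" l] ul[OF d, of n "Suc j" "Suc l"]
  proof eventually_elim
   case (elim N)
   show ?case
   proof (intro ballI allI)
    fix y h assume y: "y \<in> S"
    define P where "P = (\<Sum>k<N. ?t (Suc n) (Suc (Suc j)) l k y) - bessel_field (Suc n) (Suc (Suc j)) l c y"
    define Q where "Q = (\<Sum>k<N. ?t n (Suc j) (Suc l) k y) - bessel_field n (Suc j) (Suc l) c y"
    have "\<bar>P\<bar> < d" unfolding P_def by (rule bspec[OF elim(1) y])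
    moreover have "\<bar>Q\<bar> < d" unfolding Q_def by (rule bspec[OF elim(2) y])
    ultimately have P: "\<bar>P\<bar> <= d" "\<bar>Q\<bar> <= d" by simp_all
    have "sum (%k. ?f' k y h) {..<N} = - (\<Sum>k<N. ?t (Suc n) (Suc (Suc j)) l k y) * (y$1 * h$1 + y$2 * h$2)
      + (\<Sum>k<N. ?t n (Suc j) (Suc l) k y) * h$3"
     by (simp only: sum.distrib sum_distrib_right[symmetric] sum_negf)
    moreover have "(- A * a + B * b) - (- A' * a + B' * b) = - (A - A') * a + (B - B') * b" for A A' B B' a b :: real
     by (simp add: algebra_simps)
    ultimately have "sum (%k. ?f' k y h) {..<N} - ?g' y h = - P * (y$1 * h$1 + y$2 * h$2) + Q * h$3"
     unfolding P_def Q_def by (simp only:)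
    then have "norm (sum (%k. ?f' k y h) {..<N} - ?g' y h)
      <= \<bar>P\<bar> * (\<bar>y$1\<bar> * \<bar>h$1\<bar> + \<bar>y$2\<bar> * \<bar>h$2\<bar>) + \<bar>Q\<bar> * \<bar>h$3\<bar>"
    proof -
     have "\<bar>- P * (a * b + c * d) + Q * e\<bar> <= \<bar>P\<bar> * (\<bar>a\<bar> * \<bar>b\<bar> + \<bar>c\<bar> * \<bar>d\<bar>) + \<bar>Q\<bar> * \<bar>e\<bar>" for a b c d e
     proof -
      have "\<bar>a * b + c * d\<bar> <= \<bar>a\<bar> * \<bar>b\<bar> + \<bar>c\<bar> * \<bar>d\<bar>"
       using abs_triangle_ineq[of "a * b" "c * d"] by (simp only: abs_mult)
      then have "\<bar>P\<bar> * \<bar>a * b + c * d\<bar> <= \<bar>P\<bar> * (\<bar>a\<bar> * \<bar>b\<bar> + \<bar>c\<bar> * \<bar>d\<bar>)"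
       by (intro mult_left_mono) auto
      moreover have "\<bar>- P * (a * b + c * d) + Q * e\<bar> <= \<bar>P\<bar> * \<bar>a * b + c * d\<bar> + \<bar>Q\<bar> * \<bar>e\<bar>"
       using abs_triangle_ineq[of "- P * (a * b + c * d)" "Q * e"] by (simp only: abs_mult abs_minus_cancel)
      ultimately show ?thesis by simp
     qed
     then show "?thesis" if "sum (%k. ?f' k y h) {..<N} - ?g' y h = - P * (y$1 * h$1 + y$2 * h$2) + Q * h$3"
      unfolding that real_norm_def .
    qed
    also have "... <= d * ((norm x + 1) * norm h + (norm x + 1) * norm h) + d * norm h"
    proof (intro add_mono mult_mono P)
     show "\<bar>y$1\<bar> <= norm x + 1" "\<bar>y$2\<bar> <= norm x + 1"
      using S(2)[OF y] component_le_norm_cart[of y 1] component_le_norm_cart[of y 2] by linarith+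
    qed (use d component_le_norm_cart[of h] in \<open>auto intro!: add_nonneg_nonneg\<close>)
    also have "... = d * B * norm h" by (simp add: B_def algebra_simps)
    also have "d * B = e" using B by (simp add: d_def)
    finally show "norm (sum (%k. ?f' k y h) {..<N} - ?g' y h) <= e * norm h" .
   qed
  qed
 qed
 then obtain g where g: "!!y. y \<in> S ==> (%k. ?t n j l k y) sums (g y)"
  "!!y. y \<in> S ==> (g has_derivative ?g' y) (at y within S)" by blast
 have gf: "g y = bessel_field n j l c y" if "y \<in> S" for y
  using sums_unique[OF g(1)[OF that]] by (simp add: bessel_field_def bessel_series_def)
 have x: "x \<in> S" "open S" using \<delta> by (auto simp: S_def)
 have "(g has_derivative ?g' x) (at x)"
  using g(2)[OF x(1)] at_within_open[OF x] by simp
 then show ?thesis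
  by (rule has_derivative_transform_within_open[OF _ x(2) x(1)]) (simp add: gf)
qed

text \<open>A term language for combinations of Bessel series with polynomial factors in the first
  two coordinates. It is closed under \<open>d1\<close>, \<open>d2\<close> and \<open>d3\<close>, so
  regularity, periodicity, decay and zero mean are proved once by induction, and the Stokes
  equations reduce to polynomial identities between Bessel series.\<close>

datatype fld = FT nat nat nat "nat => complex" | FX fld | FY fld | Sc real fld | Add fld fld

primrec ev :: "fld => real^3 => real" where
 "ev (FT n j l c) x = bessel_field n j l c x"
| "ev (FX f) x = x$1 * ev f x"
| "ev (FY f) x = x$2 * ev f x"
| "ev (Sc a f) x = a * ev f x"
| "ev (Add f g) x = ev f x + ev g x"

primrec d1 :: "fld => fld" where
 "d1 (FT n j l c) = Sc (-1) (FX (FT (Suc n) (Suc (Suc j)) l c))"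
| "d1 (FX f) = Add f (FX (d1 f))"
| "d1 (FY f) = FY (d1 f)"
| "d1 (Sc a f) = Sc a (d1 f)"
| "d1 (Add f g) = Add (d1 f) (d1 g)"

primrec d2 :: "fld => fld" where
 "d2 (FT n j l c) = Sc (-1) (FY (FT (Suc n) (Suc (Suc j)) l c))"
| "d2 (FX f) = FX (d2 f)"
| "d2 (FY f) = Add f (FY (d2 f))"
| "d2 (Sc a f) = Sc a (d2 f)"
| "d2 (Add f g) = Add (d2 f) (d2 g)"

primrec d3 :: "fld => fld" where
 "d3 (FT n j l c) = FT n (Suc j) (Suc l) c"
| "d3 (FX f) = FX (d3 f)"
| "d3 (FY f) = FY (d3 f)"
| "d3 (Sc a f) = Sc a (d3 f)"
| "d3 (Add f g) = Add (d3 f) (d3 g)"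

primrec adf :: "real => fld => bool" where
 "adf rr (FT n j l c) = admissible rr c"
| "adf rr (FX f) = adf rr f"
| "adf rr (FY f) = adf rr f"
| "adf rr (Sc a f) = adf rr f"
| "adf rr (Add f g) = (adf rr f & adf rr g)"

text \<open>A majorant that depends on the radius alone, hence uniform in angle and height, as the
  decay condition of \<open>stokes_solution\<close> requires.\<close>

primrec bnd :: "fld => real => real" where
 "bnd (FT n j l c) r = bessel_bound n j c r"
| "bnd (FX f) r = r * bnd f r"
| "bnd (FY f) r = r * bnd f r"
| "bnd (Sc a f) r = \<bar>a\<bar> * bnd f r"
| "bnd (Add f g) r = bnd f r + bnd g r"

lemma adf_deriv [simp]: "adf rr f ==> adf rr (d1 f)" "adf rr f ==> adf rr (d2 f)" "adf rr f ==> adf rr (d3 f)"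
 by (induction f) auto

lemma ev_has_derivative:
 assumes "adf rr f" "0 <= rr" "rr < cyl_radius x"
 shows "(ev f has_derivative (%h. ev (d1 f) x * h$1 + ev (d2 f) x * h$2 + ev (d3 f) x * h$3)) (at x)"
 using assms(1)
proof (induction f)
 case (FT n j l c)
 have "(bessel_field n j l c has_derivative
  (%h. - bessel_field (Suc n) (Suc (Suc j)) l c x * (x$1 * h$1 + x$2 * h$2)
   + bessel_field n (Suc j) (Suc l) c x * h$3)) (at x)"
  using FT assms by (intro bessel_field_has_derivative[of rr]) auto
 moreover have "ev (FT n j l c) = bessel_field n j l c" by (rule ext) simp
 ultimately show ?case by (simp add: algebra_simps)
next
 case (FX f)
 have "((%x. x$1 * ev f x) has_derivative
   (%h. x$1 * (ev (d1 f) x * h$1 + ev (d2 f) x * h$2 + ev (d3 f) x * h$3) + h$1 * ev f x)) (at x)"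
  using FX by (intro has_derivative_mult vec_nth_has_derivative) auto
 moreover have "ev (FX f) = (%x. x$1 * ev f x)" by (rule ext) simp
 ultimately show ?case by (simp add: algebra_simps)
next
 case (FY f)
 have "((%x. x$2 * ev f x) has_derivative
   (%h. x$2 * (ev (d1 f) x * h$1 + ev (d2 f) x * h$2 + ev (d3 f) x * h$3) + h$2 * ev f x)) (at x)"
  using FY by (intro has_derivative_mult vec_nth_has_derivative) auto
 moreover have "ev (FY f) = (%x. x$2 * ev f x)" by (rule ext) simp
 ultimately show ?case by (simp add: algebra_simps)
next
 case (Sc a f)
 have "((%x. a * ev f x) has_derivative
   (%h. a * (ev (d1 f) x * h$1 + ev (d2 f) x * h$2 + ev (d3 f) x * h$3))) (at x)"
  using Sc by (intro has_derivative_mult_right) auto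
 moreover have "ev (Sc a f) = (%x. a * ev f x)" by (rule ext) simp
 ultimately show ?case by (simp add: algebra_simps)
next
 case (Add f g)
 have "((%x. ev f x + ev g x) has_derivative
   (%h. (ev (d1 f) x * h$1 + ev (d2 f) x * h$2 + ev (d3 f) x * h$3)
    + (ev (d1 g) x * h$1 + ev (d2 g) x * h$2 + ev (d3 g) x * h$3))) (at x)"
  using Add by (intro has_derivative_add) auto
 moreover have "ev (Add f g) = (%x. ev f x + ev g x)" by (rule ext) simp
 ultimately show ?case by (simp add: algebra_simps)
qed

lemma bnd_nonneg: "adf rr f ==> 0 <= rr ==> rr < r ==> bnd f r >= 0"
 by (induction f) (auto intro: bessel_bound_nonneg)

lemma ev_le_bnd:
 assumes "adf rr f" "0 <= rr" "rr < cyl_radius x"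
 shows "\<bar>ev f x\<bar> <= bnd f (cyl_radius x)"
 using assms(1)
proof (induction f)
 case (FT n j l c)
 then show ?case using bessel_series_le_bound[of rr c "cyl_radius x"] assms by (simp add: bessel_field_def)
next
 case (FX f)
 have "\<bar>x$1\<bar> <= cyl_radius x" unfolding cyl_radius_def by (rule real_sqrt_ge_abs1)
 then show ?case using FX assms by (auto simp: abs_mult intro!: mult_mono)
next
 case (FY f)
 have "\<bar>x$2\<bar> <= cyl_radius x" unfolding cyl_radius_def by (rule real_sqrt_ge_abs2)
 then show ?case using FY assms by (auto simp: abs_mult intro!: mult_mono)
next
 case (Sc a f)
 then show ?case by (auto simp: abs_mult intro!: mult_left_mono)
next
 case (Add f g)
 then show ?case using abs_triangle_ineq[of "ev f x" "ev g x"] by simp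
qed

text \<open>The exponent q is arbitrary in the induction, because a coordinate factor contributes
  one power of r.\<close>

lemma bnd_decay:
 assumes "adf rr f" "0 <= rr"
 shows "((%r. r ^ q * bnd f r) \<longlongrightarrow> 0) at_top"
 using assms(1)
proof (induction f arbitrary: q)
 case (FT n j l c)
 then show ?case using bessel_bound_decay[of rr c q] assms by simp
next
 case (FX f)
 then show ?case using FX.IH[of "Suc q"] by (simp add: mult_ac)
next
 case (FY f)
 then show ?case using FY.IH[of "Suc q"] by (simp add: mult_ac)
next
 case (Sc a f)
 then show ?case using tendsto_mult_right_zero[OF Sc.IH[of q], of "\<bar>a\<bar>"] by (simp add: mult_ac)
next
 case (Add f g)
 then show ?case using tendsto_add[OF Add.IH(1)[of q] Add.IH(2)[of q]] by (simp add: algebra_simps)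
qed

lemma ev_periodic: "ev f (x + 2 *\<^sub>R axis 3 1) = ev f x"
proof (induction f)
 case (FT n j l c)
 have r: "cyl_radius (x + 2 *\<^sub>R axis 3 1) = cyl_radius x"
  by (simp add: cyl_radius_def axis_def)
 have z: "(x + 2 *\<^sub>R axis 3 1) $ 3 = x$3 + 2" by (simp add: axis_def)
 have "cis (kap k * (t + 2)) = cis (kap k * t)" for k t
 proof -
  have "cis (kap k * (t + 2)) = cis (kap k * t) * cis (2 * real (Suc k) * pi)"
   by (simp add: cis_mult kap_def algebra_simps)
  also have "cis (2 * real (Suc k) * pi) = 1"
   by (simp only: complex_eq_iff cis.sel cos_2npi sin_2npi one_complex.sel)
  finally show ?thesis by simp
 qed
 then show ?case
  unfolding ev.simps bessel_field_def bessel_series_def r z bessel_term_def by simp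
qed (simp_all add: axis_def)

lemma vec_lambda_has_derivative:
 fixes f :: "'b::finite => 'a::real_normed_vector => real"
 assumes "!!i. (f i has_derivative f' i) (at x)"
 shows "((%x. \<chi> i. f i x) has_derivative (%h. \<chi> i. f' i h)) (at x)"
proof (rule has_derivative_componentwise_within[THEN iffD2], rule ballI)
 fix b :: "real^'b" assume "b \<in> Basis"
 then obtain i where "b = axis i 1" by (auto simp: Basis_vec_def)
 then show "((%x. (\<chi> i. f i x) \<bullet> b) has_derivative (%h. (\<chi> i. f' i h) \<bullet> b)) (at x)"
  using assms[of i] by (simp add: inner_axis)
qed

definition dd :: "3 => fld => fld" where
 "dd j = (if j = 1 then d1 else if j = 2 then d2 else d3)"

lemma dd_simps [simp]: "dd 1 = d1" "dd 2 = d2" "dd 3 = d3"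
 by (simp_all add: dd_def)

lemma adf_dd [simp]: "adf rr f ==> adf rr (dd j f)"
 by (simp add: dd_def)

definition vfld :: "(3 => fld) => real^3 => real^3" where
 "vfld E x = (\<chi> i. ev (E i) x)"

lemma vfld_nth [simp]: "vfld E x $ i = ev (E i) x"
 by (simp add: vfld_def)

lemma ev_has_derivative_sum:
 assumes "adf rr f" "0 <= rr" "rr < cyl_radius x"
 shows "(ev f has_derivative (%h. \<Sum>j\<in>UNIV. ev (dd j f) x * h$j)) (at x)"
 using ev_has_derivative[OF assms] by (simp add: sum_3)

lemma vfld_has_derivative:
 assumes "!!i. adf rr (E i)" "0 <= rr" "rr < cyl_radius x"
 shows "(vfld E has_derivative (%h. \<chi> i. \<Sum>j\<in>UNIV. ev (dd j (E i)) x * h$j)) (at x)"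
proof -
 have "vfld E = (%x. \<chi> i. ev (E i) x)" by (rule ext) (simp add: vfld_def)
 then show ?thesis
  using vec_lambda_has_derivative[of "%i. ev (E i)" "%i h. \<Sum>j\<in>UNIV. ev (dd j (E i)) x * h$j" x]
   ev_has_derivative_sum[OF assms(1) assms(2,3)] by simp
qed

lemma sum_axis: "(\<Sum>j\<in>UNIV. a j * axis k 1 $ j) = (a k :: real)" for k :: "'n::finite"
 by (simp add: axis_def if_distrib[of "%u. _ * u"] cong: if_cong)

lemma partial_eqI:
 assumes "(f has_derivative f') (at x)"
 shows "partial j f x = f' (axis j 1)"
 using frechet_derivative_at[OF assms] by (simp add: partial_def)

lemma partial_ev:
 assumes "adf rr f" "0 <= rr" "rr < cyl_radius x"
 shows "partial j (ev f) x = ev (dd j f) x"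
 using partial_eqI[OF ev_has_derivative_sum[OF assms], of j] by (simp add: sum_axis)

lemma partial_vfld:
 assumes "!!i. adf rr (E i)" "0 <= rr" "rr < cyl_radius x"
 shows "partial j (vfld E) x = vfld (%i. dd j (E i)) x"
 using partial_eqI[OF vfld_has_derivative[OF assms], of j] by (simp add: sum_axis vfld_def)

lemma partial_cong_open:
 assumes "open S" "x \<in> S" "!!y. y \<in> S ==> f y = g y" "g differentiable (at x)"
 shows "f differentiable (at x)" "partial j f x = partial j g x"
proof -
 have g: "(g has_derivative frechet_derivative g (at x)) (at x)"
  using assms(4) by (simp add: frechet_derivative_works)
 have f: "(f has_derivative frechet_derivative g (at x)) (at x)"
  by (rule has_derivative_transform_within_open[OF g assms(1,2)]) (simp add: assms(3))
 show "f differentiable (at x)" using f by (rule differentiableI)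
 show "partial j f x = partial j g x" using partial_eqI[OF f] by (simp add: partial_def)
qed

lemma C1_on_ev:
 assumes "adf rr f" "0 <= rr"
 shows "C1_on (exterior_domain rr) (ev f)"
 unfolding C1_on_def
proof (intro conjI ballI allI)
 show "ev f differentiable (at x)" if "x \<in> exterior_domain rr" for x
  using ev_has_derivative[OF assms] that by (auto simp: exterior_domain_def intro: differentiableI)
 fix j
 have "continuous_on (exterior_domain rr) (ev (dd j f))"
  using ev_has_derivative[OF adf_dd[OF assms(1)] assms(2)]
  by (auto intro!: continuous_at_imp_continuous_on has_derivative_continuous simp: exterior_domain_def)
 then show "continuous_on (exterior_domain rr) (partial j (ev f))"
  by (rule continuous_on_eq) (use partial_ev[OF assms] in \<open>auto simp: exterior_domain_def\<close>)
qed

lemma C1_on_vfld: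
 assumes "!!i. adf rr (E i)" "0 <= rr"
 shows "C1_on (exterior_domain rr) (vfld E)"
 unfolding C1_on_def
proof (intro conjI ballI allI)
 show "vfld E differentiable (at x)" if "x \<in> exterior_domain rr" for x
  using vfld_has_derivative[of rr E x] assms that by (auto simp: exterior_domain_def intro: differentiableI)
 fix j
 have "continuous_on (exterior_domain rr) (vfld (%i. dd j (E i)))"
  using vfld_has_derivative[of rr "%i. dd j (E i)"] assms
  by (auto intro!: continuous_at_imp_continuous_on has_derivative_continuous simp: exterior_domain_def)
 then show "continuous_on (exterior_domain rr) (partial j (vfld E))"
  by (rule continuous_on_eq) (use partial_vfld[OF assms] in \<open>auto simp: exterior_domain_def\<close>)
qed

lemma C1_on_cong:
 assumes "open S" "!!x. x \<in> S ==> f x = g x" "C1_on S g"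
 shows "C1_on S f"
 unfolding C1_on_def
proof (intro conjI ballI allI)
 have d: "g differentiable (at x)" if "x \<in> S" for x using assms(3) that by (simp add: C1_on_def)
 show "f differentiable (at x)" if "x \<in> S" for x
  by (rule partial_cong_open(1)[OF assms(1) that assms(2) d[OF that]])
 fix j
 have "continuous_on S (partial j g)" using assms(3) by (simp add: C1_on_def)
 then show "continuous_on S (partial j f)"
  by (rule continuous_on_eq) (simp add: partial_cong_open(2)[OF assms(1) _ assms(2) d])
qed

lemma C2_on_vfld:
 assumes "!!i. adf rr (E i)" "0 <= rr"
 shows "C2_on (exterior_domain rr) (vfld E)"
 unfolding C2_on_def
proof (intro conjI allI)
 show "C1_on (exterior_domain rr) (vfld E)" using assms by (rule C1_on_vfld)
 fix j
 have "C1_on (exterior_domain rr) (vfld (%i. dd j (E i)))" using assms by (intro C1_on_vfld) auto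
 then show "C1_on (exterior_domain rr) (partial j (vfld E))"
  by (rule C1_on_cong[OF open_exterior_domain, rotated])
   (use partial_vfld[OF assms] in \<open>auto simp: exterior_domain_def\<close>)
qed

lemma laplacian_vfld:
 assumes E: "!!i. adf rr (E i)" "0 <= rr" and x: "rr < cyl_radius x"
 shows "laplacian (vfld E) x $ i = ev (d1 (d1 (E i))) x + ev (d2 (d2 (E i))) x + ev (d3 (d3 (E i))) x"
proof -
 have xS: "x \<in> exterior_domain rr" using x by (simp add: exterior_domain_def)
 have "partial j (partial j (vfld E)) x = vfld (%i. dd j (dd j (E i))) x" for j
 proof -
  have "partial j (partial j (vfld E)) x = partial j (vfld (%i. dd j (E i))) x"
  proof (rule partial_cong_open(2)[OF open_exterior_domain xS])
   show "partial j (vfld E) y = vfld (%i. dd j (E i)) y" if "y \<in> exterior_domain rr" for y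
    using that partial_vfld[OF E] by (simp add: exterior_domain_def)
   show "vfld (%i. dd j (E i)) differentiable (at x)"
    using vfld_has_derivative[of rr "%i. dd j (E i)" x] E x by (auto intro: differentiableI)
  qed
  also have "... = vfld (%i. dd j (dd j (E i))) x"
   using E x by (intro partial_vfld) auto
  finally show ?thesis .
 qed
 then show ?thesis by (simp add: laplacian_def sum_3)
qed

lemma jacobian_vfld:
 assumes "!!i. adf rr (E i)" "0 <= rr" "rr < cyl_radius x"
 shows "jacobian (vfld E) x $ i $ j = ev (dd j (E i)) x"
 using frechet_derivative_at[OF vfld_has_derivative[of rr E x, OF assms], symmetric]
 by (simp add: jacobian_def matrix_def sum_axis flip: axis_def)

lemma divergence_vfld:
 assumes "!!i. adf rr (E i)" "0 <= rr" "rr < cyl_radius x"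
 shows "divergence (vfld E) x = ev (d1 (E 1)) x + ev (d2 (E 2)) x + ev (d3 (E 3)) x"
 by (simp add: divergence_def trace_def sum_3 jacobian_vfld[OF assms])

text \<open>Antiderivative in z: division by the wave number and three more quarter turns of phase
  undo \<open>d3\<close>, since four quarter turns are the identity.\<close>

primrec anti :: "fld => fld" where
 "anti (FT n j l c) = FT n j (Suc (Suc (Suc l))) (%k. c k / kap k)"
| "anti (FX f) = FX (anti f)"
| "anti (FY f) = FY (anti f)"
| "anti (Sc a f) = Sc a (anti f)"
| "anti (Add f g) = Add (anti f) (anti g)"

lemma bessel_series_anti: "bessel_series n (Suc j) (Suc (Suc (Suc (Suc l)))) (%k. c k / complex_of_real (kap k)) r z = bessel_series n j l c r z"
proof -
 have "bessel_term n (Suc j) (Suc (Suc (Suc (Suc l)))) (%k. c k / complex_of_real (kap k)) k r z = bessel_term n j l c k r z" for k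
 proof -
  have i: "\<i> ^ Suc (Suc (Suc (Suc l))) = \<i> ^ l" by simp
  have "Re (\<i> ^ l * (c k / of_real (kap k)) * cis (kap k * z)) = Re (\<i> ^ l * c k * cis (kap k * z)) / kap k"
  proof -
   have "\<i> ^ l * (c k / of_real (kap k)) * cis (kap k * z) = (\<i> ^ l * c k * cis (kap k * z)) / of_real (kap k)" by simp
   then show ?thesis by (simp only: Re_divide_of_real)
  qed
  then show ?thesis unfolding bessel_term_def i by simp
 qed
 then show ?thesis by (simp add: bessel_series_def)
qed

lemma ev_d3_anti: "ev (d3 (anti f)) x = ev f x"
proof (induction f)
 case (FT n j l c)
 show ?case
  unfolding anti.simps d3.simps ev.simps bessel_field_def by (rule bessel_series_anti)
qed simp_all

lemma admissible_div_kap: "admissible rr c ==> 0 <= rr ==> admissible rr (%k. c k / of_real (kap k))"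
 unfolding admissible_def
proof (intro allI impI)
 fix r n j assume c: "\<forall>r>rr. \<forall>n j. summable (%k. kap k ^ j * bessel_L n (kap k * r) * cmod (c k))" and r: "rr < r" "0 <= rr"
 show "summable (%k. kap k ^ j * bessel_L n (kap k * r) * cmod (c k / of_real (kap k)))"
 proof (rule summable_comparison_test'[where N=0])
  show "summable (%k. kap k ^ j * bessel_L n (kap k * r) * cmod (c k))" using c r by blast
  fix k
  have "cmod (c k / of_real (kap k)) <= cmod (c k)"
   using kap_ge_1[of k] by (simp add: norm_divide divide_le_eq mult_left_le_one_le mult_le_cancel_left1)
  then show "norm (kap k ^ j * bessel_L n (kap k * r) * cmod (c k / of_real (kap k)))
    <= kap k ^ j * bessel_L n (kap k * r) * cmod (c k)"
   using bessel_L_pos[of "kap k * r" n] r by (simp add: abs_mult mult_left_mono)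
 qed
qed

lemma adf_anti: "adf rr f ==> 0 <= rr ==> adf rr (anti f)"
 by (induction f) (simp_all add: admissible_div_kap)

lemma cyl_point_shift: "cyl_point r th z = cyl_point r th 0 + z *\<^sub>R axis 3 1"
 by (simp add: vec3_eq_iff axis_def)

lemma ev_z_derivative:
 assumes "adf rr f" "0 <= rr" "rr < r"
 shows "((%z. ev f (cyl_point r th z)) has_real_derivative ev (d3 f) (cyl_point r th z)) (at z within S)"
proof -
 have "((%z. cyl_point r th 0 + z *\<^sub>R axis 3 1) has_derivative (%h. h *\<^sub>R axis 3 1)) (at z)"
  by (auto intro!: derivative_eq_intros)
 then have 1: "((%z. cyl_point r th z) has_derivative (%h. h *\<^sub>R axis 3 1)) (at z)"
  by (simp only: cyl_point_shift[symmetric])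
 have 2: "(ev f has_derivative (%h. \<Sum>j\<in>UNIV. ev (dd j f) (cyl_point r th z) * h$j)) (at (cyl_point r th z))"
  using assms by (intro ev_has_derivative_sum) auto
 from has_derivative_compose[OF 1 2]
 have "((%z. ev f (cyl_point r th z)) has_derivative (%h. ev (d3 f) (cyl_point r th z) * h)) (at z)"
  by (simp add: sum_3 axis_def)
 then show ?thesis
  unfolding has_field_derivative_def by (rule has_derivative_at_withinI)
qed

text \<open>The integral over a period is the increment of \<open>anti f\<close>, which is itself
  periodic.\<close>

lemma ev_zero_mean:
 assumes "adf rr f" "0 <= rr" "rr < r"
 shows "set_integrable lborel {-1..1} (%z. ev f (cyl_point r th z))"
  and "(LBINT z:{-1..1}. ev f (cyl_point r th z)) = 0"
proof -
 have c: "continuous_on {-1..1} (%z. ev f (cyl_point r th z))"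
  by (rule DERIV_continuous_on[OF ev_z_derivative[OF assms]])
 then show "set_integrable lborel {-1..1} (%z. ev f (cyl_point r th z))"
  by (rule borel_integrable_atLeastAtMost')
 have "(LBINT z:{-1..1}. ev f (cyl_point r th z)) = ev (anti f) (cyl_point r th 1) - ev (anti f) (cyl_point r th (-1))"
  unfolding set_lebesgue_integral_def
 proof (rule integral_FTC_atLeastAtMost[OF _ _ c])
  show "((%z. ev (anti f) (cyl_point r th z)) has_vector_derivative ev f (cyl_point r th z)) (at z within {-1..1})" for z
   using ev_z_derivative[OF adf_anti[OF assms(1,2)] assms(2,3), of th z "{-1..1}"]
   by (simp add: ev_d3_anti has_real_derivative_iff_has_vector_derivative)
 qed simp
 also have "cyl_point r th 1 = cyl_point r th (-1) + 2 *\<^sub>R axis 3 1"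
  by (simp add: vec3_eq_iff axis_def)
 finally show "(LBINT z:{-1..1}. ev f (cyl_point r th z)) = 0"
  by (simp only: ev_periodic diff_self)
qed

lemma set_integral_vec_nth:
 fixes g :: "real => real^'n"
 assumes "set_integrable M A g"
 shows "set_integrable M A (%z. g z $ i)" "(LINT z:A|M. g z) $ i = (LINT z:A|M. g z $ i)"
proof -
 have i: "integrable M (%z. indicat_real A z *\<^sub>R g z)" using assms by (simp add: set_integrable_def)
 from integrable_bounded_linear[OF bounded_linear_vec_nth[of i] this]
 show "set_integrable M A (%z. g z $ i)" by (simp add: set_integrable_def)
 from integral_bounded_linear[OF bounded_linear_vec_nth[of i] i]
 show "(LINT z:A|M. g z) $ i = (LINT z:A|M. g z $ i)" by (simp add: set_lebesgue_integral_def)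
qed

lemma vfld_zero_mean:
 assumes "!!i. adf rr (E i)" "0 <= rr" "rr < r"
 shows "zero_mean (%z. vfld E (cyl_point r th z))"
proof -
 have "continuous_on {-1..1} (%z. vfld E (cyl_point r th z))"
  unfolding vfld_def by (intro continuous_on_vec_lambda DERIV_continuous_on[OF ev_z_derivative[OF assms]])
 then have "set_integrable lborel {-1..1} (%z. vfld E (cyl_point r th z))"
  by (rule borel_integrable_atLeastAtMost')
 then show ?thesis
  unfolding zero_mean_def by (simp add: vec_eq_iff set_integral_vec_nth ev_zero_mean[OF assms])
qed

lemma tendsto_cyl_radius:
 assumes "(g \<longlongrightarrow> (0::real)) at_top" "!!x. rr < cyl_radius x ==> norm (f x) <= g (cyl_radius x)"
 shows "(f \<longlongrightarrow> 0) (filtercomap cyl_radius at_top)"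
proof (rule Lim_null_comparison)
 show "((%x. g (cyl_radius x)) \<longlongrightarrow> 0) (filtercomap cyl_radius at_top)"
  by (rule filterlim_compose[OF assms(1) filterlim_filtercomap])
 show "\<forall>\<^sub>F x in filtercomap cyl_radius at_top. norm (f x) <= g (cyl_radius x)"
  using eventually_filtercomapI[OF eventually_gt_at_top[of rr], of cyl_radius]
  by eventually_elim (rule assms(2))
qed

lemma ev_decay:
 assumes "adf rr f" "0 <= rr"
 shows "(ev f \<longlongrightarrow> 0) (filtercomap cyl_radius at_top)"
proof (rule tendsto_cyl_radius[of "bnd f" rr])
 show "(bnd f \<longlongrightarrow> 0) at_top" using bnd_decay[OF assms, of 0] by simp
qed (use ev_le_bnd[OF assms] in auto)

lemma vfld_decay:
 assumes "!!i. adf rr (E i)" "0 <= rr"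
 shows "(vfld E \<longlongrightarrow> 0) (filtercomap cyl_radius at_top)"
 by (rule vec_tendstoI) (use ev_decay[OF assms] in \<open>simp add: vfld_def\<close>)

text \<open>A family of decaying Stokes flows, linear in its amplitudes. Each transverse direction
  has three amplitudes per mode (a, b, e) and the axial one has two (a3, b3), as many as there are
  boundary conditions to meet in \<open>profile_boundary\<close>. Pressure is carried by e1, e2 and
  b3 only.\<close>

definition stokes_field :: "(nat => complex) => (nat => complex) => (nat => complex) =>
  (nat => complex) => (nat => complex) => (nat => complex) => (nat => complex) => (nat => complex) => 3 => fld" where
 "stokes_field a1 b1 e1 a2 b2 e2 a3 b3 i =
  (let g = Add (FX (Add (Sc 2 (FT (Suc (Suc 0)) (Suc (Suc 0)) 0 b1)) (Sc 2 (FT (Suc 0) (Suc (Suc 0)) 0 e1))))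
     (Add (FY (Add (Sc 2 (FT (Suc (Suc 0)) (Suc (Suc 0)) 0 b2)) (Sc 2 (FT (Suc 0) (Suc (Suc 0)) 0 e2))))
      (Add (FT (Suc 0) (Suc 0) (Suc 0) a3) (Add (Sc 2 (FT (Suc 0) (Suc 0) (Suc 0) b3)) (FT 0 (Suc 0) (Suc 0) b3))));
     h = (%a b. Add (FT 0 0 0 a) (Add (Sc (-1) (FT 0 0 0 b)) (Sc (-2) (FT (Suc 0) 0 0 b))));
     k = (%a b e. Add (Add (Sc 2 (FT (Suc 0) (Suc 0) (Suc 0) e)) (Sc (-1) (FT (Suc 0) (Suc 0) (Suc 0) a)))
        (Add (Sc (-1) (FT (Suc 0) (Suc 0) (Suc 0) b)) (Sc (-2) (FT 0 (Suc 0) (Suc 0) e))))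
   in if i = 1 then Add (h a1 b1) (FX g)
    else if i = 2 then Add (h a2 b2) (FY g)
    else Add (Add (FX (k a1 b1 e1)) (FY (k a2 b2 e2)))
        (Add (FT 0 0 0 a3) (Add (FX (FX (FT (Suc 0) (Suc (Suc 0)) 0 b3))) (FY (FY (FT (Suc 0) (Suc (Suc 0)) 0 b3))))))"

definition stokes_pressure :: "(nat => complex) => (nat => complex) => (nat => complex) => fld" where
 "stokes_pressure e1 e2 b3 = Add (FX (Sc 4 (FT (Suc 0) (Suc (Suc 0)) 0 e1)))
  (Add (FY (Sc 4 (FT (Suc 0) (Suc (Suc 0)) 0 e2))) (Sc 2 (FT 0 (Suc 0) (Suc 0) b3)))"

text \<open>Removes the sum of squares of the transverse coordinates. Together with the phase rule
  it is the only relation between the series used to verify the equations.\<close>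

lemma bessel_field_recurrence:
 assumes "admissible rr c" "0 <= rr" "rr < cyl_radius x"
 shows "((x$1)\<^sup>2 + (x$2)\<^sup>2) * bessel_field (Suc (Suc n)) (Suc (Suc j)) l c x
  = bessel_field n j l c x + 2 * (real n + 1) * bessel_field (Suc n) j l c x"
 using bessel_series_recurrence[OF assms] by (simp add: bessel_field_def flip: cyl_radius_sq)

lemma bessel_field_phase:
 assumes "admissible rr c" "0 <= rr" "rr < cyl_radius x"
 shows "bessel_field n j (Suc (Suc l)) c x = - bessel_field n j l c x"
 using bessel_series_phase[OF assms] by (simp add: bessel_field_def)

context
 fixes rr a1 b1 e1 a2 b2 e2 a3 b3 and x :: "real^3"
 assumes adm: "admissible rr a1" "admissible rr b1" "admissible rr e1" "admissible rr a2" "admissible rr b2"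
  "admissible rr e2" "admissible rr a3" "admissible rr b3" and rho: "0 <= rr" "rr < cyl_radius x"
begin

lemma stokes_field_divergence:
 "ev (d1 (stokes_field a1 b1 e1 a2 b2 e2 a3 b3 1)) x + ev (d2 (stokes_field a1 b1 e1 a2 b2 e2 a3 b3 2)) x
  + ev (d3 (stokes_field a1 b1 e1 a2 b2 e2 a3 b3 3)) x = 0"
proof -
 note rec = bessel_field_recurrence[OF _ rho] and ph = adm[THEN bessel_field_phase[OF _ rho]]
 note r = rec[OF adm(2), of "Suc 0" "Suc (Suc 0)" 0]
  rec[OF adm(5), of "Suc 0" "Suc (Suc 0)" 0]
  rec[OF adm(3), of 0 "Suc (Suc 0)" 0]
  rec[OF adm(6), of 0 "Suc (Suc 0)" 0]
  rec[OF adm(7), of 0 "Suc 0" "Suc 0"]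
  rec[OF adm(8), of 0 "Suc 0" "Suc 0"]
 show ?thesis
  unfolding stokes_field_def Let_def using r by (simp add: ph) algebra
qed

lemma stokes_field_laplacian_1:
 "ev (d1 (d1 (stokes_field a1 b1 e1 a2 b2 e2 a3 b3 1))) x + ev (d2 (d2 (stokes_field a1 b1 e1 a2 b2 e2 a3 b3 1))) x
  + ev (d3 (d3 (stokes_field a1 b1 e1 a2 b2 e2 a3 b3 1))) x = ev (d1 (stokes_pressure e1 e2 b3)) x"
proof -
 note rec = bessel_field_recurrence[OF _ rho] and ph = adm[THEN bessel_field_phase[OF _ rho]]
 note r = rec[OF adm(1), of 0 "Suc (Suc 0)" 0]
  rec[OF adm(2), of 0 "Suc (Suc 0)" 0]
  rec[OF adm(2), of "Suc 0" "Suc (Suc 0)" 0]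
  rec[OF adm(2), of "Suc (Suc 0)" "Suc (Suc (Suc (Suc 0)))" 0]
  rec[OF adm(5), of "Suc (Suc 0)" "Suc (Suc (Suc (Suc 0)))" 0]
  rec[OF adm(3), of "Suc 0" "Suc (Suc (Suc (Suc 0)))" 0]
  rec[OF adm(6), of "Suc 0" "Suc (Suc (Suc (Suc 0)))" 0]
  rec[OF adm(7), of "Suc 0" "Suc (Suc (Suc 0))" "Suc 0"]
  rec[OF adm(8), of "Suc 0" "Suc (Suc (Suc 0))" "Suc 0"]
  rec[OF adm(8), of 0 "Suc (Suc (Suc 0))" "Suc 0"]
 show ?thesis
  unfolding stokes_field_def stokes_pressure_def Let_def using r by (simp add: ph) algebra
qed

lemma stokes_field_laplacian_2:
 "ev (d1 (d1 (stokes_field a1 b1 e1 a2 b2 e2 a3 b3 2))) x + ev (d2 (d2 (stokes_field a1 b1 e1 a2 b2 e2 a3 b3 2))) x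
  + ev (d3 (d3 (stokes_field a1 b1 e1 a2 b2 e2 a3 b3 2))) x = ev (d2 (stokes_pressure e1 e2 b3)) x"
proof -
 note rec = bessel_field_recurrence[OF _ rho] and ph = adm[THEN bessel_field_phase[OF _ rho]]
 note r = rec[OF adm(4), of 0 "Suc (Suc 0)" 0]
  rec[OF adm(5), of 0 "Suc (Suc 0)" 0]
  rec[OF adm(5), of "Suc 0" "Suc (Suc 0)" 0]
  rec[OF adm(2), of "Suc (Suc 0)" "Suc (Suc (Suc (Suc 0)))" 0]
  rec[OF adm(5), of "Suc (Suc 0)" "Suc (Suc (Suc (Suc 0)))" 0]
  rec[OF adm(3), of "Suc 0" "Suc (Suc (Suc (Suc 0)))" 0]
  rec[OF adm(6), of "Suc 0" "Suc (Suc (Suc (Suc 0)))" 0]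
  rec[OF adm(7), of "Suc 0" "Suc (Suc (Suc 0))" "Suc 0"]
  rec[OF adm(8), of "Suc 0" "Suc (Suc (Suc 0))" "Suc 0"]
  rec[OF adm(8), of 0 "Suc (Suc (Suc 0))" "Suc 0"]
 show ?thesis
  unfolding stokes_field_def stokes_pressure_def Let_def using r by (simp add: ph) algebra
qed

lemma stokes_field_laplacian_3:
 "ev (d1 (d1 (stokes_field a1 b1 e1 a2 b2 e2 a3 b3 3))) x + ev (d2 (d2 (stokes_field a1 b1 e1 a2 b2 e2 a3 b3 3))) x
  + ev (d3 (d3 (stokes_field a1 b1 e1 a2 b2 e2 a3 b3 3))) x = ev (d3 (stokes_pressure e1 e2 b3)) x"
proof -
 note rec = bessel_field_recurrence[OF _ rho] and ph = adm[THEN bessel_field_phase[OF _ rho]]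
 note r = rec[OF adm(1), of "Suc 0" "Suc (Suc (Suc 0))" "Suc 0"]
  rec[OF adm(2), of "Suc 0" "Suc (Suc (Suc 0))" "Suc 0"]
  rec[OF adm(3), of "Suc 0" "Suc (Suc (Suc 0))" "Suc 0"]
  rec[OF adm(4), of "Suc 0" "Suc (Suc (Suc 0))" "Suc 0"]
  rec[OF adm(5), of "Suc 0" "Suc (Suc (Suc 0))" "Suc 0"]
  rec[OF adm(6), of "Suc 0" "Suc (Suc (Suc 0))" "Suc 0"]
  rec[OF adm(3), of 0 "Suc (Suc (Suc 0))" "Suc 0"]
  rec[OF adm(6), of 0 "Suc (Suc (Suc 0))" "Suc 0"]
  rec[OF adm(7), of 0 "Suc (Suc 0)" 0]
  rec[OF adm(8), of "Suc 0" "Suc (Suc (Suc (Suc 0)))" 0]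
  rec[OF adm(8), of 0 "Suc (Suc 0)" 0]
 show ?thesis
  unfolding stokes_field_def stokes_pressure_def Let_def using r by (simp add: ph) algebra
qed

end

lemma adf_stokes_field:
 assumes "admissible rr a1" "admissible rr b1" "admissible rr e1" "admissible rr a2" "admissible rr b2"
  "admissible rr e2" "admissible rr a3" "admissible rr b3"
 shows "adf rr (stokes_field a1 b1 e1 a2 b2 e2 a3 b3 i)" "adf rr (stokes_pressure e1 e2 b3)"
 using assms by (simp_all add: stokes_field_def stokes_pressure_def Let_def)

text \<open>Every requirement except the boundary value holds for arbitrary admissible amplitudes;
  the boundary value depends on their choice and stays a hypothesis.\<close>

lemma stokes_solution_stokes_field:
 fixes rr :: real
 assumes adm: "admissible rr a1" "admissible rr b1" "admissible rr e1" "admissible rr a2" "admissible rr b2"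
  "admissible rr e2" "admissible rr a3" "admissible rr b3" and rho: "0 <= rr"
 defines "u \<equiv> vfld (stokes_field a1 b1 e1 a2 b2 e2 a3 b3)" and "p \<equiv> ev (stokes_pressure e1 e2 b3)"
 assumes bd: "((%r. \<integral>\<^sup>+z\<in>{-1..1}. (\<integral>\<^sup>+th\<in>{0..2*pi}.
       ennreal ((norm (u (cyl_point r th z) - v z))\<^sup>2) \<partial>lborel) \<partial>lborel) \<longlongrightarrow> 0) (at_right rr)"
 shows "stokes_solution rr v u p"
proof -
 note aE = adf_stokes_field(1)[OF adm] and aP = adf_stokes_field(2)[OF adm]
 have pde: "- laplacian u x + gradient p x = 0 & divergence u x = 0" if "x \<in> exterior_domain rr" for x
 proof
  have x: "rr < cyl_radius x" using that by (simp add: exterior_domain_def)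
  have "laplacian u x $ i = gradient p x $ i" for i
   unfolding u_def laplacian_vfld[OF aE rho x] gradient_def p_def vec_lambda_beta partial_ev[OF aP rho x]
   using exhaust_3[of i] stokes_field_laplacian_1[OF adm rho x] stokes_field_laplacian_2[OF adm rho x]
    stokes_field_laplacian_3[OF adm rho x] by auto
  then show "- laplacian u x + gradient p x = 0" by (simp add: vec_eq_iff)
  show "divergence u x = 0"
   unfolding u_def divergence_vfld[OF aE rho x] by (rule stokes_field_divergence[OF adm rho x])
 qed
 have zm: "zero_mean (%z. p (cyl_point r th z))" if "r > rr" for r th
  unfolding zero_mean_def p_def by (rule ev_zero_mean(2)[OF aP rho that])
 show ?thesis
  unfolding stokes_solution_def
 proof (intro conjI)
  show "C2_on (exterior_domain rr) u" unfolding u_def by (rule C2_on_vfld[OF aE rho])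
  show "C1_on (exterior_domain rr) p" unfolding p_def by (rule C1_on_ev[OF aP rho])
  show "\<forall>x\<in>exterior_domain rr. u (x + 2 *\<^sub>R axis 3 1) = u x & p (x + 2 *\<^sub>R axis 3 1) = p x"
   by (simp add: u_def p_def vfld_def ev_periodic)
  show "\<forall>x\<in>exterior_domain rr. - laplacian u x + gradient p x = 0 & divergence u x = 0"
   using pde by blast
  show "\<forall>r>rr. \<forall>th. zero_mean (%z. u (cyl_point r th z)) & zero_mean (%z. p (cyl_point r th z))"
   using zm unfolding u_def by (auto intro: vfld_zero_mean[OF aE rho])
  show "(u \<longlongrightarrow> 0) (filtercomap cyl_radius at_top)" unfolding u_def by (rule vfld_decay[OF aE rho])
  show "(p \<longlongrightarrow> 0) (filtercomap cyl_radius at_top)" unfolding p_def by (rule ev_decay[OF aP rho])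
 qed (rule bd)
qed

subsection \<open>Solutions with prescribed boundary velocity\<close>

text \<open>This is K1(X)/K2(X). The amplitudes that follow solve the boundary conditions of one
  mode at X = kap \<epsilon>: \<open>bb\<close> comes from \<open>pB\<close> = 0, \<open>aa\<close>
  from \<open>pW\<close> = 0 and \<open>be\<close> from \<open>pH\<close> = 1; likewise
  \<open>at'\<close> from \<open>pU\<close> = 0 and \<open>bt\<close> from \<open>pZ\<close> =
  1.\<close>

definition cQ :: "real => real" where "cQ X = X / (X * R X + 2)"
definition be :: "real => real" where "be X = 1 / (normal_denom X * K1 X)"
definition bb :: "real => real" where "bb X = - (be X * X * cQ X)"
definition om :: "real => real" where "om X = 2 * be X * X * R X"
definition aa :: "real => real" where "aa X = 2 * be X - bb X - om X"
definition bt :: "real => real" where "bt X = - 1 / (bessel_defect X * K1 X)"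
definition at' :: "real => real" where "at' X = - (bt X * (2 + X * R X))"

lemma normal_denom_pos:
 assumes "X > 0" shows "normal_denom X > 0"
proof -
 have "0 < X * R X" using R_pos[OF assms] assms by simp
 then have "2 * bessel_defect X / (X * R X + 2) > 0" using bessel_defect_pos[OF assms] by simp
 moreover have "2 * (X * (1 - (R X)\<^sup>2)) >= 0" using one_minus_R_sq_nonneg[OF assms] assms by simp
 ultimately show ?thesis unfolding normal_denom_def by linarith
qed

lemma cQ_bounds:
 assumes "X > 0" shows "0 <= cQ X" "cQ X <= 1"
proof -
 have R: "R X > 0" "R X >= X / (X + 2)" using R_pos[OF assms] R_ge[OF assms] by auto
 then show "0 <= cQ X" using assms by (simp add: cQ_def)
 have "X * (X / (X + 2)) <= X * R X" using R assms by (intro mult_left_mono) auto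
 moreover have "X <= X * (X / (X + 2)) + 2" using assms by (simp add: field_simps)
 ultimately have "X <= X * R X + 2" by linarith
 moreover have "0 < X * R X + 2" using R assms by (simp add: add_pos_pos)
 ultimately show "cQ X <= 1" by (simp add: cQ_def)
qed

lemma X_cQ_minus_R:
 assumes "X > 0" shows "X * cQ X - X * R X = - defect_quot X"
proof -
 have "0 < X * R X + 2" using R_pos[OF assms] assms by (simp add: add_pos_pos)
 then show ?thesis
  unfolding cQ_def defect_quot_def bessel_defect_def
  by (simp add: field_simps power2_eq_square)
qed

lemma be_K1: "X > 0 ==> be X * K1 X = 1 / normal_denom X"
 using K1_pos[of X] by (simp add: be_def)

lemma bt_K1: "X > 0 ==> bt X * K1 X = - 1 / bessel_defect X"
 using K1_pos[of X] by (simp add: bt_def)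

text \<open>Profiles of one mode with x = kap r and X = kap \<epsilon>. For transverse data,
  \<open>pH\<close> is the part of the velocity parallel to the data, \<open>pB\<close> the extra
  radial part and \<open>pW\<close> the axial part; for axial data, \<open>pU\<close> is the radial
  and \<open>pZ\<close> the axial velocity. \<open>fN\<close> and \<open>fT\<close> are the forces
  on the circle of radius r.\<close>

definition pH :: "real => real => real" where
 "pH x X = aa X * bessel_L 0 x - bb X * bessel_L 0 x - 2 * (bb X * bessel_L 1 x)"
definition pB :: "real => real => real" where
 "pB x X = 2 * (bb X * (x\<^sup>2 * bessel_L 2 x)) + 2 * (be X * (x\<^sup>2 * bessel_L 1 x))"
definition pU :: "real => real => real" where
 "pU x X = x * (at' X * bessel_L 1 x + 2 * (bt X * bessel_L 1 x) + bt X * bessel_L 0 x)"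
definition pW :: "real => real => real" where
 "pW x X = x * (2 * (be X * bessel_L 1 x) - aa X * bessel_L 1 x - bb X * bessel_L 1 x - 2 * (be X * bessel_L 0 x))"
definition pZ :: "real => real => real" where
 "pZ x X = at' X * bessel_L 0 x + x\<^sup>2 * (bt X * bessel_L 1 x)"
definition fN :: "real => real => real" where
 "fN x X = pi * (x\<^sup>2 * (3 * (aa X * bessel_L 1 x) + bb X * bessel_L 1 x + 2 * (be X * bessel_L 1 x) + 4 * (be X * bessel_L 0 x)))"
definition fT :: "real => real => real" where
 "fT x X = 4 * pi * (x\<^sup>2 * (at' X * bessel_L 1 x + bt X * bessel_L 1 x + bt X * bessel_L 0 x))"

lemma bessel_L_simps:
 assumes "x > 0"
 shows "bessel_L 0 x = R x * K1 x" "bessel_L 1 x = K1 x / x" "x\<^sup>2 * bessel_L 2 x = R x * K1 x + 2 * (K1 x / x)"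
 using assms by (simp_all add: K0_eq numeral_2_eq_2)

text \<open>K1(x) is factored out and everything else is expressed through R. What remains is an
  algebraic factor times \<open>be X\<close> K1(x) or \<open>bt X\<close> K1(x), the only places
  where exponentially large and small quantities meet.\<close>

lemma profile_reduced:
 assumes x: "x > 0" and X: "X > 0"
 shows "pH x X = (be X * K1 x) * ((2 + 2 * (X * cQ X) - 2 * (X * R X)) * R x + 2 * (X * cQ X) / x)"
  and "pB x X = (be X * K1 x) * (2 * x - 2 * (X * cQ X) * (R x + 2 / x))"
  and "pU x X = (bt X * K1 x) * (x * R x - X * R X)"
  and "pW x X = 2 * (be X * K1 x) * (X * R X - x * R x)"
  and "pZ x X = (bt X * K1 x) * (x - (2 + X * R X) * R x)"
  and "fN x X = pi * x * (be X * K1 x) * (8 - 2 * defect_quot X + 4 * (x * R x - X * R X))"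
  and "fT x X = 4 * pi * x * (bt X * K1 x) * (x * R x - X * R X - 1)"
proof -
 note L = bessel_L_simps[OF x]
 show "pH x X = (be X * K1 x) * ((2 + 2 * (X * cQ X) - 2 * (X * R X)) * R x + 2 * (X * cQ X) / x)"
  unfolding pH_def L aa_def bb_def om_def by (simp add: algebra_simps)
 show "pB x X = (be X * K1 x) * (2 * x - 2 * (X * cQ X) * (R x + 2 / x))"
  unfolding pB_def L bb_def using x by (simp add: algebra_simps power2_eq_square)
 show "pU x X = (bt X * K1 x) * (x * R x - X * R X)"
  unfolding pU_def L at'_def using x by (simp add: field_simps)
 show "pW x X = 2 * (be X * K1 x) * (X * R X - x * R x)"
  unfolding pW_def L aa_def bb_def om_def using x by (simp add: field_simps)
 show "pZ x X = (bt X * K1 x) * (x - (2 + X * R X) * R x)"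
  unfolding pZ_def L at'_def using x by (simp add: field_simps power2_eq_square)
 have d: "defect_quot X = X * R X - X * cQ X" using X_cQ_minus_R[OF X] by simp
 show "fN x X = pi * x * (be X * K1 x) * (8 - 2 * defect_quot X + 4 * (x * R x - X * R X))"
  unfolding fN_def L aa_def bb_def om_def d using x by (simp add: field_simps power2_eq_square)
 show "fT x X = 4 * pi * x * (bt X * K1 x) * (x * R x - X * R X - 1)"
  unfolding fT_def L at'_def using x by (simp add: field_simps power2_eq_square)
qed

text \<open>The values at x = X of the brackets in \<open>pH\<close> and \<open>pB\<close>. The
  first is compared with the closed form of \<open>normal_denom\<close> after multiplication by X R
  + 2, using c (X R + 2) = X for c = \<open>cQ X\<close>.\<close>

lemma normal_denom_eq:
 assumes X: "X > 0"
 shows "normal_denom X = (2 + 2 * (X * cQ X) - 2 * (X * R X)) * R X + 2 * cQ X"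
  "2 * X - 2 * (X * cQ X) * (R X + 2 / X) = 0"
proof -
 define Y where "Y = X * R X + 2"
 have Y: "Y > 0" using R_pos[OF X] X by (simp add: Y_def add_pos_pos)
 have XR: "X * R X = Y - 2" by (simp add: Y_def)
 have c: "cQ X * Y = X" using Y by (simp add: cQ_def Y_def)
 have dq: "X * cQ X = X * R X - defect_quot X" using X_cQ_minus_R[OF X] by simp
 have dqY: "defect_quot X * Y = X * bessel_defect X" using Y by (simp add: defect_quot_def Y_def)
 have bd: "bessel_defect X = 2 * R X - X + X * R X * R X"
  by (simp add: bessel_defect_def power2_eq_square algebra_simps)
 have "normal_denom X * Y = (2 * X - 2 * X * R X * R X) * Y + 2 * bessel_defect X"
 proof -
  have "2 * bessel_defect X / Y * Y = 2 * bessel_defect X" using Y by simp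
  then show ?thesis unfolding normal_denom_def Y_def[symmetric] by algebra
 qed
 also have "... = ((2 + 2 * (X * cQ X) - 2 * (X * R X)) * R X + 2 * cQ X) * Y"
 proof -
  have "(2 * X - 2 * X * r * r) * (X * r + 2) + 2 * b = ((2 + 2 * (X * q) - 2 * (X * r)) * r + 2 * q) * (X * r + 2)"
   if "q * (X * r + 2) = X" "b = 2 * r - X + X * r * r" for q r b
  proof -
   have "((2 + 2 * (X * q) - 2 * (X * r)) * r + 2 * q) * (X * r + 2)
     = (2 - 2 * (X * r)) * r * (X * r + 2) + 2 * (X * r + 1) * (q * (X * r + 2))"
    by (simp add: algebra_simps)
   then show ?thesis unfolding that by (simp add: algebra_simps)
  qed
  then show ?thesis using c bd unfolding Y_def by blast
 qed
 finally show "normal_denom X = (2 + 2 * (X * cQ X) - 2 * (X * R X)) * R X + 2 * cQ X"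
  using Y by simp
 have "(R X + 2 / X) * X = Y" using X by (simp add: Y_def field_simps)
 then have "(X * cQ X) * (R X + 2 / X) = X" using c by (metis mult.commute mult.assoc)
 then show "2 * X - 2 * (X * cQ X) * (R X + 2 / X) = 0" by simp
qed

lemma profile_boundary:
 assumes X: "X > 0"
 shows "pH X X = 1" "pB X X = 0" "pU X X = 0" "pW X X = 0" "pZ X X = 1"
  "fN X X = lambda_PDE_n X" "fT X X = lambda_PDE_t X"
proof -
 note p = profile_reduced[OF X X] and nd = normal_denom_pos[OF X] and bd = bessel_defect_pos[OF X]
 have c: "2 * (X * cQ X) / X = 2 * cQ X" using X by simp
 show "pH X X = 1" unfolding p be_K1[OF X] c normal_denom_eq(1)[OF X, symmetric] using nd by simp
 show "pB X X = 0" unfolding p normal_denom_eq(2)[OF X] by simp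
 show "pU X X = 0" "pW X X = 0" unfolding p by simp_all
 have "X - (2 + X * R X) * R X = - bessel_defect X"
  by (simp add: bessel_defect_def power2_eq_square algebra_simps)
 then show "pZ X X = 1" unfolding p bt_K1[OF X] using bd by simp
 show "fN X X = lambda_PDE_n X" unfolding p be_K1[OF X] lambda_PDE_n_def by (simp add: algebra_simps diff_divide_distrib)
 show "fT X X = lambda_PDE_t X" unfolding p bt_K1[OF X] lambda_PDE_t_def by simp
qed

lemma coeff_bounds:
 assumes a: "a > 0"
 obtains C where "C > 0" "!!X. X >= a ==> \<bar>be X * K1 X\<bar> <= C" "!!X. X >= a ==> \<bar>bt X * K1 X\<bar> <= C"
proof -
 obtain c where c: "c > 0" "!!X. X >= a ==> normal_denom X >= c" using normal_denom_lower[OF a] by blast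
 have d: "a / (a + 2) > 0" using a by simp
 show thesis
 proof
  show "1 / c + 1 / (a / (a + 2)) > 0" using divide_pos_pos[OF zero_less_one c(1)] divide_pos_pos[OF zero_less_one d] by (rule add_pos_pos)
  fix X assume X: "X >= a"
  have "1 / normal_denom X <= 1 / c" using c(1) c(2)[OF X] by (intro divide_left_mono) auto
  moreover have "1 / normal_denom X > 0" using c(1) c(2)[OF X] by simp
  ultimately show "\<bar>be X * K1 X\<bar> <= 1 / c + 1 / (a / (a + 2))"
   using be_K1[of X] X a d c(1) by (simp add: add_increasing2)
  have "1 / bessel_defect X <= 1 / (a / (a + 2))"
   using bessel_defect_lower[OF a X] d less_le_trans[OF d bessel_defect_lower[OF a X]]
   by (intro divide_left_mono mult_pos_pos zero_le_one)
  moreover have "1 / bessel_defect X > 0" using bessel_defect_pos[of X] X a by simp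
  moreover have "\<bar>bt X * K1 X\<bar> = 1 / bessel_defect X"
   using bt_K1[of X] X a bessel_defect_pos[of X] by simp
  ultimately show "\<bar>bt X * K1 X\<bar> <= 1 / c + 1 / (a / (a + 2))"
   using c(1) by (simp only:) (rule add_increasing, auto)
 qed
qed

text \<open>The amplitudes contain the factor 1/K1(X), which is exponentially large; only their
  products with K1(X) are of polynomial size.\<close>

lemma coeff_linear_bounds:
 assumes a: "a > 0"
 obtains C where "C > 0" "!!X f. X >= a ==> f \<in> {aa, bb, be, at', bt} ==> \<bar>f X\<bar> * K1 X <= C * (1 + X)"
proof -
 obtain C where C: "C > 0" "!!X. X >= a ==> \<bar>be X * K1 X\<bar> <= C" "!!X. X >= a ==> \<bar>bt X * K1 X\<bar> <= C"
  using coeff_bounds[OF a] by blast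
 show thesis
 proof (rule that[of "3 * C"])
  show "3 * C > 0" using C by simp
  fix X f assume Xa: "X >= a" and f: "f \<in> {aa, bb, be, at', bt}"
  have X: "X > 0" using Xa a by simp
  have k: "K1 X > 0" by (rule K1_pos[OF X])
  have XR: "0 <= X * R X" "X * R X <= X"
   using R_pos[OF X] R_le_1[OF X] X by (auto simp: mult_left_le)
  have XQ: "0 <= X * cQ X" "X * cQ X <= X"
   using cQ_bounds[OF X] X by (auto simp: mult_left_le)
  have 1: "\<bar>be X * K1 X * t\<bar> <= 3 * C * (1 + X)" "\<bar>bt X * K1 X * t\<bar> <= 3 * C * (1 + X)" if "\<bar>t\<bar> <= 3 * (1 + X)" for t
  proof -
   show "\<bar>be X * K1 X * t\<bar> <= 3 * C * (1 + X)"
    using mult_mono[OF C(2)[OF Xa] that] C(1) by (simp add: abs_mult mult_ac)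
   show "\<bar>bt X * K1 X * t\<bar> <= 3 * C * (1 + X)"
    using mult_mono[OF C(3)[OF Xa] that] C(1) by (simp add: abs_mult mult_ac)
  qed
  have "\<bar>f X * K1 X\<bar> <= 3 * C * (1 + X)"
  proof -
   have "be X * K1 X = be X * K1 X * 1" "bt X * K1 X = bt X * K1 X * 1"
    "bb X * K1 X = be X * K1 X * - (X * cQ X)"
    "aa X * K1 X = be X * K1 X * (2 + X * cQ X - 2 * (X * R X))"
    "at' X * K1 X = bt X * K1 X * - (2 + X * R X)"
    by (simp_all add: bb_def aa_def om_def at'_def algebra_simps)
   moreover have "\<bar>1\<bar> <= 3 * (1 + X)" "\<bar>- (X * cQ X)\<bar> <= 3 * (1 + X)"
    "\<bar>2 + X * cQ X - 2 * (X * R X)\<bar> <= 3 * (1 + X)" "\<bar>- (2 + X * R X)\<bar> <= 3 * (1 + X)"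
    unfolding abs_le_iff using XR XQ X by argo+
   ultimately show ?thesis using f 1 by (elim insertE emptyE) (metis | simp)+
  qed
  then show "\<bar>f X\<bar> * K1 X <= 3 * C * (1 + X)" using k by (simp add: abs_mult)
 qed
qed

section \<open>Amplitudes along the modes and trigonometric series with multipliers\<close>

definition cseq :: "(real => real) => real => (nat => complex) => nat => complex" where
 "cseq f rr V k = of_real (f (kap k * rr)) * V k"

text \<open>Relative to K1(kap rr), the value K1(kap r) gains exp(-kap (r - rr)), which beats the
  linear growth of f K1 and every power of the wave number. Bounded data are therefore enough away
  from the boundary.\<close>

lemma admissible_cseq:
 assumes rr: "rr > 0" and f: "f \<in> {aa, bb, be, at', bt}" and V: "!!k. cmod (V k) <= B"
 shows "admissible rr (cseq f rr V)"
 unfolding admissible_def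
proof (intro allI impI)
 fix r n j assume r: "rr < r"
 obtain C where C: "C > 0" "!!X f. X >= rr ==> f \<in> {aa, bb, be, at', bt} ==> \<bar>f X\<bar> * K1 X <= C * (1 + X)"
  using coeff_linear_bounds[OF rr] by blast
 obtain D where D: "D >= 0" "!!x. x >= rr ==> bessel_L n x <= D * K1 x"
  using bessel_L_le_K1[OF rr, of n] by blast
 have B: "B >= 0" using V[of 0] norm_ge_zero[of "V 0"] by linarith
 show "summable (%k. kap k ^ j * bessel_L n (kap k * r) * cmod (cseq f rr V k))"
 proof (rule summable_comparison_test'[where N=0])
  show "summable (%k. (D * C * B * (1 + rr)) * (kap k ^ Suc j * exp (- (kap k * (r - rr)))))"
   using r by (intro summable_mult summable_kap_exp) auto
  fix k
  let ?X = "kap k * rr"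
  have X: "?X >= rr" "?X > 0" using kap_ge_1[of k] rr by (auto simp: mult_le_cancel_right1)
  have x: "kap k * r >= ?X" using r by (intro mult_left_mono) auto
  have k1: "K1 ?X > 0" by (rule K1_pos[OF X(2)])
  have "bessel_L n (kap k * r) <= D * K1 (kap k * r)" by (rule D(2)[OF order_trans[OF X(1) x]])
  also have "... <= D * (K1 ?X * exp (- (kap k * r - ?X)))"
   using D(1) X x by (intro mult_left_mono K1_decay) auto
  finally have 1: "bessel_L n (kap k * r) <= D * K1 ?X * exp (- (kap k * (r - rr)))"
   by (simp add: algebra_simps)
  have 2: "0 <= bessel_L n (kap k * r)" using bessel_L_pos[of "kap k * r" n] r rr by simp
  have "bessel_L n (kap k * r) * cmod (cseq f rr V k) <= (D * K1 ?X * exp (- (kap k * (r - rr)))) * (\<bar>f ?X\<bar> * B)"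
   using 1 2 V[of k] by (intro mult_mono) (auto simp: cseq_def norm_mult intro!: mult_left_mono)
  also have "... = D * exp (- (kap k * (r - rr))) * B * (\<bar>f ?X\<bar> * K1 ?X)" by (simp add: mult_ac)
  also have "... <= D * exp (- (kap k * (r - rr))) * B * (C * (1 + ?X))"
   using C(2)[OF X(1) f] D B by (intro mult_left_mono) auto
  also have "... <= D * exp (- (kap k * (r - rr))) * B * (C * (kap k * (1 + rr)))"
   using C D B kap_ge_1[of k] rr by (intro mult_left_mono) (auto simp: algebra_simps)
  finally have "kap k ^ j * (bessel_L n (kap k * r) * cmod (cseq f rr V k))
    <= kap k ^ j * (D * exp (- (kap k * (r - rr))) * B * (C * (kap k * (1 + rr))))"
   by (intro mult_left_mono) auto
  then show "norm (kap k ^ j * bessel_L n (kap k * r) * cmod (cseq f rr V k))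
    <= (D * C * B * (1 + rr)) * (kap k ^ Suc j * exp (- (kap k * (r - rr))))"
   using 2 by (simp add: abs_mult mult_ac)
 qed
qed

lemma admissible_finite:
 assumes "finite {k. c k \<noteq> 0}"
 shows "admissible rr c"
 unfolding admissible_def
proof (intro allI impI)
 fix r n j
 show "summable (%k. kap k ^ j * bessel_L n (kap k * r) * cmod (c k))"
  by (rule summable_finite[OF assms]) auto
qed

definition sol_field :: "real => (nat => complex) => (nat => complex) => (nat => complex) => 3 => fld" where
 "sol_field rr V1 V2 V3 = stokes_field (cseq aa rr V1) (cseq bb rr V1) (cseq be rr V1)
   (cseq aa rr V2) (cseq bb rr V2) (cseq be rr V2) (cseq at' rr V3) (cseq bt rr V3)"

definition sol_pressure :: "real => (nat => complex) => (nat => complex) => (nat => complex) => fld" where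
 "sol_pressure rr V1 V2 V3 = stokes_pressure (cseq be rr V1) (cseq be rr V2) (cseq bt rr V3)"

text \<open>On a fixed cylinder each ingredient of the Bessel solution has this form, with a radial
  profile as the multiplier f.\<close>

definition wave :: "(nat => real) => nat => (nat => complex) => real => real" where
 "wave f l V z = (\<Sum>k. f k * Re (\<i> ^ l * V k * cis (kap k * z)))"

definition wave_ok :: "(nat => real) => (nat => complex) => bool" where
 "wave_ok f V \<longleftrightarrow> summable (%k. \<bar>f k\<bar> * cmod (V k))"

lemma wave_summable: "wave_ok f V ==> summable (%k. f k * Re (\<i> ^ l * V k * cis (kap k * z)))"
proof (rule summable_comparison_test'[where N=0 and g="%k. \<bar>f k\<bar> * cmod (V k)"])
 fix k
 have "\<bar>Re (\<i> ^ l * V k * cis (kap k * z))\<bar> <= cmod (V k)"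
  using abs_Re_le_cmod[of "\<i> ^ l * V k * cis (kap k * z)"] by (simp add: norm_mult norm_power)
 then show "norm (f k * Re (\<i> ^ l * V k * cis (kap k * z))) <= \<bar>f k\<bar> * cmod (V k)"
  unfolding real_norm_def abs_mult by (intro mult_left_mono) auto
qed (simp add: wave_ok_def)

lemma wave_ok_add: "wave_ok f V ==> wave_ok g V ==> wave_ok (%k. f k + g k) V"
 unfolding wave_ok_def
proof (rule summable_comparison_test'[where N=0 and g="%k. \<bar>f k\<bar> * cmod (V k) + \<bar>g k\<bar> * cmod (V k)"])
 show "norm (\<bar>f k + g k\<bar> * cmod (V k)) <= \<bar>f k\<bar> * cmod (V k) + \<bar>g k\<bar> * cmod (V k)" for k
  using mult_right_mono[OF abs_triangle_ineq[of "f k" "g k"], of "cmod (V k)"] by (simp add: distrib_right)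
qed (rule summable_add)

lemma wave_ok_cmult: "wave_ok f V ==> wave_ok (%k. c * f k) V"
 unfolding wave_ok_def abs_mult mult.assoc by (rule summable_mult)

lemma wave_add: "wave_ok f V ==> wave_ok g V ==> wave f l V z + wave g l V z = wave (%k. f k + g k) l V z"
 unfolding wave_def distrib_right by (rule suminf_add[OF wave_summable wave_summable])

lemma wave_cmult: "wave_ok f V ==> c * wave f l V z = wave (%k. c * f k) l V z"
 unfolding wave_def using suminf_mult[OF wave_summable, of f V c l z] by (simp only: mult.assoc)

lemma bessel_series_wave:
 "bessel_series n j l (cseq f rr V) r z = wave (%k. kap k ^ j * bessel_L n (kap k * r) * f (kap k * rr)) l V z"
proof -
 have "Re (\<i> ^ l * (of_real a * v) * e) = a * Re (\<i> ^ l * v * e)" for a v e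
 proof -
  have "\<i> ^ l * (of_real a * v) * e = of_real a * (\<i> ^ l * v * e)" by simp
  then show ?thesis by (simp only: Re_complex_of_real Re_complex_div_eq_0 times_complex.sel Im_complex_of_real)
 qed
 then show ?thesis
  unfolding bessel_series_def wave_def bessel_term_def cseq_def by (simp only: mult.assoc)
qed

lemma wave_ok_bessel:
 assumes "admissible rr' (cseq f rr V)" "0 <= rr'" "rr' < r"
 shows "wave_ok (%k. kap k ^ j * bessel_L n (kap k * r) * f (kap k * rr)) V"
proof -
 have "summable (%k. kap k ^ j * bessel_L n (kap k * r) * cmod (cseq f rr V k))"
  using assms unfolding admissible_def by blast
 moreover have "kap k ^ j * bessel_L n (kap k * r) * cmod (cseq f rr V k)
   = \<bar>kap k ^ j * bessel_L n (kap k * r) * f (kap k * rr)\<bar> * cmod (V k)" for k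
  using bessel_L_pos[of "kap k * r" n] assms by (simp add: cseq_def norm_mult abs_mult)
 ultimately show ?thesis by (simp only: wave_ok_def)
qed

subsection \<open>Integrals over cylinders and the reciprocal theorem\<close>

lemma cyl_point_eq:
 "cyl_point r th z = (r * cos th) *\<^sub>R axis 1 1 + (r * sin th) *\<^sub>R axis 2 1 + z *\<^sub>R axis 3 1"
 by (simp add: vec3_eq_iff axis_def)

lemma has_derivative_partial:
 fixes f :: "real^3 => real"
 assumes "f differentiable (at x)"
 shows "(f has_derivative (%h. partial 1 f x * h$1 + partial 2 f x * h$2 + partial 3 f x * h$3)) (at x)"
proof -
 have d: "(f has_derivative frechet_derivative f (at x)) (at x)"
  using assms by (simp add: frechet_derivative_works)
 interpret bounded_linear "frechet_derivative f (at x)" using d by (rule has_derivative_bounded_linear)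
 have "frechet_derivative f (at x) h = partial 1 f x * h$1 + partial 2 f x * h$2 + partial 3 f x * h$3" for h
 proof -
  have "h = h$1 *\<^sub>R axis 1 1 + h$2 *\<^sub>R axis 2 1 + h$3 *\<^sub>R axis 3 1"
   by (simp add: vec3_eq_iff axis_def)
  then have "frechet_derivative f (at x) h
    = frechet_derivative f (at x) (h$1 *\<^sub>R axis 1 1 + h$2 *\<^sub>R axis 2 1 + h$3 *\<^sub>R axis 3 1)" by simp
  then show ?thesis by (simp only: add scaleR partial_def real_scaleR_def mult.commute[of "h $ _"])
 qed
 then have "frechet_derivative f (at x) = (%h. partial 1 f x * h$1 + partial 2 f x * h$2 + partial 3 f x * h$3)"
  by (rule ext)
 then show ?thesis using d by (simp only:)
qed

lemma cyl_derivatives: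
 fixes f :: "real^3 => real"
 assumes "f differentiable (at (cyl_point r th z))"
 shows "((%s. f (cyl_point s th z)) has_real_derivative
   (cos th * partial 1 f (cyl_point r th z) + sin th * partial 2 f (cyl_point r th z))) (at r within A)"
  and "((%s. f (cyl_point r s z)) has_real_derivative
   (r * (cos th * partial 2 f (cyl_point r th z) - sin th * partial 1 f (cyl_point r th z)))) (at th within A)"
  and "((%s. f (cyl_point r th s)) has_real_derivative partial 3 f (cyl_point r th z)) (at z within A)"
proof -
 note F = has_derivative_partial[OF assms]
 have 1: "((%s. cyl_point s th z) has_derivative (%h. (h * cos th) *\<^sub>R axis 1 1 + (h * sin th) *\<^sub>R axis 2 1)) (at r)"
  unfolding cyl_point_eq by (auto intro!: derivative_eq_intros)
 show "((%s. f (cyl_point s th z)) has_real_derivative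
   (cos th * partial 1 f (cyl_point r th z) + sin th * partial 2 f (cyl_point r th z))) (at r within A)"
  unfolding has_field_derivative_def
  by (rule has_derivative_at_withinI, rule has_derivative_eq_rhs[OF has_derivative_compose[OF 1 F]])
   (simp add: fun_eq_iff axis_def algebra_simps)
 have c: "((%s. r * cos s) has_derivative (%h. r * - sin th * h)) (at th)"
  "((%s. r * sin s) has_derivative (%h. r * cos th * h)) (at th)"
  by (intro has_field_derivative_imp_has_derivative DERIV_cmult DERIV_cos DERIV_sin)+
 have 2: "((%s. cyl_point r s z) has_derivative
   (%h. (r * - sin th * h) *\<^sub>R axis 1 1 + (r * cos th * h) *\<^sub>R axis 2 1 + 0)) (at th)"
  unfolding cyl_point_eq
  by (intro has_derivative_add has_derivative_scaleR_left c has_derivative_const)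
 show "((%s. f (cyl_point r s z)) has_real_derivative
   (r * (cos th * partial 2 f (cyl_point r th z) - sin th * partial 1 f (cyl_point r th z)))) (at th within A)"
  unfolding has_field_derivative_def
  by (rule has_derivative_at_withinI, rule has_derivative_eq_rhs[OF has_derivative_compose[OF 2 F]])
   (simp add: fun_eq_iff axis_def algebra_simps)
 have 3: "((%s. cyl_point r th s) has_derivative (%h. h *\<^sub>R axis 3 1)) (at z)"
  unfolding cyl_point_eq by (auto intro!: derivative_eq_intros)
 show "((%s. f (cyl_point r th s)) has_real_derivative partial 3 f (cyl_point r th z)) (at z within A)"
  unfolding has_field_derivative_def
  by (rule has_derivative_at_withinI, rule has_derivative_eq_rhs[OF has_derivative_compose[OF 3 F]])
   (simp add: fun_eq_iff axis_def algebra_simps)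
qed

text \<open>The surface factor r is left out; it is written explicitly where fluxes and forces need
  it.\<close>

definition ring_integral :: "(real => real) => (real^3 => real) => real => real" where
 "ring_integral a F r = integral (cbox (-1, 0) (1, 2*pi)) (%(z, th). a th * F (cyl_point r th z))"

lemma continuous_on_ring:
 fixes F :: "real^3 => 'a::real_normed_vector" and A :: "'b::t2_space set"
 assumes "continuous_on (exterior_domain rr) F" "0 <= rr"
  "continuous_on A r" "continuous_on A t" "continuous_on A z" "!!x. x \<in> A ==> r x > rr"
 shows "continuous_on A (%x. F (cyl_point (r x) (t x) (z x)))"
proof (rule continuous_on_compose2[OF assms(1)])
 show "continuous_on A (%x. cyl_point (r x) (t x) (z x))"
  unfolding cyl_point_eq
  by (intro continuous_on_add continuous_on_scaleR continuous_on_mult continuous_on_cos continuous_on_sin continuous_on_const assms)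
 show "(%x. cyl_point (r x) (t x) (z x)) ` A \<subseteq> exterior_domain rr"
 proof safe
  fix x assume "x \<in> A"
  then have "rr < r x" by (rule assms(6))
  then show "cyl_point (r x) (t x) (z x) \<in> exterior_domain rr"
   using assms(2) by (simp add: exterior_domain_def)
 qed
qed

context
 fixes rr r :: real
 assumes rho: "0 <= rr" "rr < r"
begin

lemma ring_continuous:
 assumes "continuous_on (exterior_domain rr) F" "continuous_on UNIV a"
 shows "continuous_on A (%(z, th). a th * F (cyl_point r th z) :: real)"
 unfolding case_prod_unfold using rho
 by (intro continuous_on_mult continuous_on_ring[OF assms(1) rho(1)] continuous_on_compose2[OF assms(2)]
   continuous_intros) auto

lemma ring_integrable:
 assumes "continuous_on (exterior_domain rr) F" "continuous_on UNIV a"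
 shows "(%(z, th). a th * F (cyl_point r th z) :: real) integrable_on cbox (u, v) (w, y)"
 by (rule integrable_continuous[OF ring_continuous[OF assms]])

lemma ring_integral_add:
 assumes "continuous_on (exterior_domain rr) F" "continuous_on (exterior_domain rr) G" "continuous_on UNIV a"
 shows "ring_integral a (%x. F x + G x) r = ring_integral a F r + ring_integral a G r"
 using integral_add[OF ring_integrable[OF assms(1,3)] ring_integrable[OF assms(2,3)], of "-1" 0 1 "2*pi"]
 unfolding ring_integral_def by (simp add: case_prod_unfold distrib_left)

lemma ring_integral_diff:
 assumes "continuous_on (exterior_domain rr) F" "continuous_on (exterior_domain rr) G" "continuous_on UNIV a"
 shows "ring_integral a (%x. F x - G x) r = ring_integral a F r - ring_integral a G r"
 using integral_diff[OF ring_integrable[OF assms(1,3)] ring_integrable[OF assms(2,3)], of "-1" 0 1 "2*pi"]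
 unfolding ring_integral_def by (simp add: case_prod_unfold right_diff_distrib)

lemma ring_integral_add_weight:
 assumes "continuous_on (exterior_domain rr) F" "continuous_on UNIV a" "continuous_on UNIV b"
 shows "ring_integral (%t. a t + b t) F r = ring_integral a F r + ring_integral b F r"
 using integral_add[OF ring_integrable[OF assms(1,2)] ring_integrable[OF assms(1,3)], of "-1" 0 1 "2*pi"]
 unfolding ring_integral_def by (simp add: case_prod_unfold distrib_right)

lemma ring_integral_cmult: "ring_integral a (%x. c * F x) r = c * ring_integral a F r"
proof -
 have "(%(z, th). a th * (c * F (cyl_point r th z))) = (%p. c * (%(z, th). a th * F (cyl_point r th z)) p)"
  by (auto simp: fun_eq_iff)
 then show ?thesis unfolding ring_integral_def by (simp only: integral_mult_right)
qed

lemma ring_integral_cmult_weight: "ring_integral (%t. c * a t) F r = c * ring_integral a F r"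
proof -
 have "(%(z, th). c * a th * F (cyl_point r th z)) = (%p. c * (%(z, th). a th * F (cyl_point r th z)) p)"
  by (auto simp: fun_eq_iff)
 then show ?thesis unfolding ring_integral_def by (simp only: integral_mult_right)
qed

lemma ring_integral_cong:
 "(!!t z. F (cyl_point r t z) = G (cyl_point r t z)) ==> ring_integral a F r = ring_integral a G r"
 by (simp add: ring_integral_def)

lemma ring_integral_bound:
 assumes "continuous_on (exterior_domain rr) F" "continuous_on UNIV a" "continuous_on (exterior_domain rr) G"
  "!!t z. \<bar>a t * F (cyl_point r t z)\<bar> <= G (cyl_point r t z)"
 shows "\<bar>ring_integral a F r\<bar> <= ring_integral (%_. 1) G r"
proof -
 have "norm (ring_integral a F r) <= ring_integral (%_. 1) G r"
  unfolding ring_integral_def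
  by (rule integral_norm_bound_integral[OF ring_integrable[OF assms(1,2)] ring_integrable[OF assms(3)]])
   (use assms(4) in auto)
 then show ?thesis by simp
qed

lemma ring_integral_const: "ring_integral (%_. 1) (%_. c) r = 4 * pi * c"
 unfolding ring_integral_def by (simp add: case_prod_unfold content_Pair)

lemma ring_integral_iterated:
 assumes "continuous_on (exterior_domain rr) F" "continuous_on UNIV a"
 shows "ring_integral a F r = integral {-1..1} (%z. integral {0..2*pi} (%t. a t * F (cyl_point r t z)))"
  and "ring_integral a F r = integral {0..2*pi} (%t. a t * integral {-1..1} (%z. F (cyl_point r t z)))"
proof -
 show 1: "ring_integral a F r = integral {-1..1} (%z. integral {0..2*pi} (%t. a t * F (cyl_point r t z)))"
  using integral_prod_continuous[OF ring_continuous[OF assms, of "cbox (-1, 0) (1, 2*pi)"]]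
  by (simp add: ring_integral_def)
 show "ring_integral a F r = integral {0..2*pi} (%t. a t * integral {-1..1} (%z. F (cyl_point r t z)))"
  unfolding 1 using integral_swap_continuous[of "-1::real" 0 1 "2*pi" "%z t. a t * F (cyl_point r t z)"]
   ring_continuous[OF assms, of "cbox (-1, 0) (1, 2*pi)"]
  by (simp add: case_prod_unfold)
qed

end

lemma C1_onD:
 assumes "C1_on S f" shows "x \<in> S ==> f differentiable (at x)" "continuous_on S f" "continuous_on S (partial j f)"
 using assms unfolding C1_on_def
 by (auto intro: continuous_at_imp_continuous_on differentiable_imp_continuous_within)

lemma cyl_point_exterior: "0 <= rr ==> rr < r ==> cyl_point r t z \<in> exterior_domain rr"
 by (simp add: exterior_domain_def)

text \<open>The \<theta>-derivative of a F integrates to 0 over the closed circle; cos \<theta>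
  times the second minus sin \<theta> times the first partial derivative is the tangential
  derivative of F.\<close>

lemma ring_integral_parts_theta:
 fixes F :: "real^3 => real"
 assumes F: "C1_on (exterior_domain rr) F" and rho: "0 <= rr" "rr < r"
  and a: "!!t. (a has_real_derivative a' t) (at t)" "continuous_on UNIV a'" "a 0 = a (2*pi)"
 shows "ring_integral a' F r + r * (ring_integral (%t. a t * cos t) (partial 2 F) r
   - ring_integral (%t. a t * sin t) (partial 1 F) r) = 0"
proof -
 have ca: "continuous_on UNIV a" using a(1) by (auto intro: DERIV_continuous_on)
 note cF = C1_onD(2)[OF F] C1_onD(3)[OF F]
 have cac: "continuous_on UNIV (%t. a t * cos t)" "continuous_on UNIV (%t. a t * sin t)"
  using ca by (auto intro!: continuous_intros)
 let ?B = "cbox (-1, 0) (1, 2*pi) :: (real \<times> real) set"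
 let ?h = "%(z, t). a' t * F (cyl_point r t z) + r * (a t * cos t * partial 2 F (cyl_point r t z) - a t * sin t * partial 1 F (cyl_point r t z))"
 note c = ring_continuous[OF rho cF(1) a(2), of ?B] ring_continuous[OF rho cF(2)[of 2] cac(1), of ?B]
  ring_continuous[OF rho cF(2)[of 1] cac(2), of ?B]
 have ch: "continuous_on ?B ?h"
  using c unfolding case_prod_unfold
  by (intro continuous_on_add continuous_on_mult_left continuous_on_diff)
 have "integral ?B ?h = integral (cbox (-1) 1) (%z. integral (cbox 0 (2*pi)) (%t. ?h (z, t)))"
  by (rule integral_prod_continuous[OF ch])
 also have "... = integral (cbox (-1) 1) (%z::real. 0 :: real)"
 proof (rule Henstock_Kurzweil_Integration.integral_cong)
  fix z :: real
  have "((%t. ?h (z, t)) has_integral (a (2*pi) * F (cyl_point r (2*pi) z) - a 0 * F (cyl_point r 0 z))) {0..2*pi}"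
  proof (rule fundamental_theorem_of_calculus)
   fix t :: real
   have d: "F differentiable (at (cyl_point r t z))" by (rule C1_onD(1)[OF F cyl_point_exterior[OF rho]])
   show "((%t. a t * F (cyl_point r t z)) has_vector_derivative ?h (z, t)) (at t within {0..2*pi})"
    unfolding has_real_derivative_iff_has_vector_derivative[symmetric]
    using DERIV_mult'[OF has_field_derivative_at_within[OF a(1)] cyl_derivatives(2)[OF d]]
    by (simp add: algebra_simps)
  qed simp
  moreover have "cyl_point r (2*pi) z = cyl_point r 0 z" by (simp add: cyl_point_def)
  ultimately show "integral (cbox 0 (2*pi)) (%t. ?h (z, t)) = 0"
   using a(3) by (simp add: integral_unique)
 qed
 finally have "integral ?B ?h = 0" by simp
 moreover have "integral ?B ?h = ring_integral a' F r + r * (ring_integral (%t. a t * cos t) (partial 2 F) r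
   - ring_integral (%t. a t * sin t) (partial 1 F) r)"
 proof -
  note i = c[THEN integrable_continuous]
  show ?thesis
   unfolding ring_integral_def
   by (subst integral_diff[OF i(2,3), symmetric], subst integral_mult_right[symmetric],
    subst integral_add[OF i(1) integrable_on_mult_right[OF integrable_diff[OF i(2,3)]], symmetric])
    (simp add: case_prod_unfold)
 qed
 ultimately show ?thesis by simp
qed

lemma ring_integral_parts_z:
 fixes F :: "real^3 => real"
 assumes F: "C1_on (exterior_domain rr) F" and rho: "0 <= rr" "rr < r" and a: "continuous_on UNIV a"
  and per: "!!x. x \<in> exterior_domain rr ==> F (x + 2 *\<^sub>R axis 3 1) = F x"
 shows "ring_integral a (partial 3 F) r = 0"
proof -
 have "integral {-1..1} (%z. partial 3 F (cyl_point r t z)) = 0" for t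
 proof -
  have "((%z. partial 3 F (cyl_point r t z)) has_integral (F (cyl_point r t 1) - F (cyl_point r t (-1)))) {-1..1}"
  proof (rule fundamental_theorem_of_calculus)
   fix z :: real
   have d: "F differentiable (at (cyl_point r t z))" by (rule C1_onD(1)[OF F cyl_point_exterior[OF rho]])
   show "((%z. F (cyl_point r t z)) has_vector_derivative partial 3 F (cyl_point r t z)) (at z within {-1..1})"
    unfolding has_real_derivative_iff_has_vector_derivative[symmetric] by (rule cyl_derivatives(3)[OF d])
  qed simp
  moreover have "cyl_point r t 1 = cyl_point r t (-1) + 2 *\<^sub>R axis 3 1"
   by (simp add: vec3_eq_iff axis_def)
  ultimately show ?thesis using per[OF cyl_point_exterior[OF rho]] by (simp add: integral_unique)
 qed
 then show ?thesis unfolding ring_integral_iterated(2)[OF rho C1_onD(3)[OF F] a] by simp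
qed

lemma DERIV_ring_integral:
 fixes F :: "real^3 => real"
 assumes F: "C1_on (exterior_domain rr) F" and rho: "0 <= rr" "rr < r" and a: "continuous_on UNIV a"
 shows "(ring_integral a F has_real_derivative
   (ring_integral (%t. a t * cos t) (partial 1 F) r + ring_integral (%t. a t * sin t) (partial 2 F) r)) (at r)"
proof -
 note cF = C1_onD(2)[OF F] C1_onD(3)[OF F]
 have cac: "continuous_on UNIV (%t. a t * cos t)" "continuous_on UNIV (%t. a t * sin t)"
  using a by (auto intro!: continuous_intros)
 let ?B = "cbox (-1, 0) (1, 2*pi) :: (real \<times> real) set"
 let ?h = "%s (z, t). a t * cos t * partial 1 F (cyl_point s t z) + a t * sin t * partial 2 F (cyl_point s t z)"
 have "((%s. integral ?B (%(z, t). a t * F (cyl_point s t z))) has_field_derivative integral ?B (?h r)) (at r within {rr<..})"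
 proof (rule leibniz_rule_field_derivative)
  fix s :: real and p :: "real \<times> real" assume s: "s \<in> {rr<..}"
  obtain z t where p: "p = (z, t)" by (cases p)
  have d: "F differentiable (at (cyl_point s t z))" using s by (intro C1_onD(1)[OF F cyl_point_exterior[OF rho(1)]]) auto
  show "((%s. (%(z, t). a t * F (cyl_point s t z)) p) has_field_derivative ?h s p) (at s within {rr<..})"
   using DERIV_cmult[OF cyl_derivatives(1)[OF d], of "a t" "{rr<..}"] by (simp add: p algebra_simps)
 next
  fix s assume "s \<in> {rr<..}"
  then show "(%(z, t). a t * F (cyl_point s t z)) integrable_on ?B"
   using rho by (intro ring_integrable[OF _ _ cF(1) a]) auto
 next
  show "continuous_on ({rr<..} \<times> ?B) (%(s, p). ?h s p)"
  proof -
   have 1: "continuous_on ({rr<..} \<times> ?B) (%x. a (snd (snd x)))"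
    by (rule continuous_on_compose2[OF a]) (auto intro!: continuous_intros)
   have 2: "continuous_on ({rr<..} \<times> ?B) (%x. partial j F (cyl_point (fst x) (snd (snd x)) (fst (snd x))))" for j
    by (rule continuous_on_ring[OF cF(2) rho(1)]) (auto intro!: continuous_intros)
   have 3: "continuous_on ({rr<..} \<times> ?B) (%x. cos (snd (snd x)))" "continuous_on ({rr<..} \<times> ?B) (%x. sin (snd (snd x)))"
    by (auto intro!: continuous_intros)
   show ?thesis
    unfolding case_prod_unfold by (intro continuous_on_add continuous_on_mult 1 2 3)
  qed
 qed (use rho in auto)
 moreover have "integral ?B (?h r) = ring_integral (%t. a t * cos t) (partial 1 F) r + ring_integral (%t. a t * sin t) (partial 2 F) r"
  unfolding ring_integral_def
  by (subst integral_add[OF ring_integrable[OF rho cF(2) cac(1)] ring_integrable[OF rho cF(2) cac(2)], symmetric])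
   (simp add: case_prod_unfold)
 moreover have "at r within {rr<..} = at r" using rho by (intro at_within_open) auto
 ultimately show ?thesis by (simp add: ring_integral_def[abs_def])
qed

lemma C1_on_const: "C1_on S (%_. c)"
 by (simp add: C1_on_def partial_def frechet_derivative_const)

lemma C1_on_add:
 fixes f g :: "real^3 => real"
 assumes "C1_on S f" "C1_on S g"
 shows "x \<in> S ==> partial j (%x. f x + g x) x = partial j f x + partial j g x"
  and "C1_on S (%x. f x + g x)"
proof -
 have d: "((%x. f x + g x) has_derivative (%h. frechet_derivative f (at x) h + frechet_derivative g (at x) h)) (at x)"
  if "x \<in> S" for x
  using assms that by (intro has_derivative_add) (simp_all add: C1_on_def frechet_derivative_works)
 have p: "partial j (%x. f x + g x) x = partial j f x + partial j g x" if "x \<in> S" for x j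
  using partial_eqI[OF d[OF that]] by (simp add: partial_def)
 then show "x \<in> S ==> partial j (%x. f x + g x) x = partial j f x + partial j g x" .
 show "C1_on S (%x. f x + g x)"
  unfolding C1_on_def
 proof (intro conjI ballI allI)
  show "(%x. f x + g x) differentiable (at x)" if "x \<in> S" for x using d[OF that] by (rule differentiableI)
  show "continuous_on S (partial j (%x. f x + g x))" for j
   by (rule continuous_on_eq[OF continuous_on_add[OF C1_onD(3)[OF assms(1)] C1_onD(3)[OF assms(2)]]]) (simp add: p)
 qed
qed

lemma C1_on_mult:
 fixes f g :: "real^3 => real"
 assumes "C1_on S f" "C1_on S g"
 shows "x \<in> S ==> partial j (%x. f x * g x) x = f x * partial j g x + partial j f x * g x"
  and "C1_on S (%x. f x * g x)"
proof -
 have d: "((%x. f x * g x) has_derivative (%h. f x * frechet_derivative g (at x) h + frechet_derivative f (at x) h * g x)) (at x)"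
  if "x \<in> S" for x
  using assms that by (intro has_derivative_mult) (simp_all add: C1_on_def frechet_derivative_works)
 have p: "partial j (%x. f x * g x) x = f x * partial j g x + partial j f x * g x" if "x \<in> S" for x j
  using partial_eqI[OF d[OF that]] by (simp add: partial_def)
 then show "x \<in> S ==> partial j (%x. f x * g x) x = f x * partial j g x + partial j f x * g x" .
 show "C1_on S (%x. f x * g x)"
  unfolding C1_on_def
 proof (intro conjI ballI allI)
  show "(%x. f x * g x) differentiable (at x)" if "x \<in> S" for x using d[OF that] by (rule differentiableI)
  show "continuous_on S (partial j (%x. f x * g x))" for j
   by (rule continuous_on_eq[OF continuous_on_add[OF continuous_on_mult[OF C1_onD(2)[OF assms(1)] C1_onD(3)[OF assms(2)]]
      continuous_on_mult[OF C1_onD(3)[OF assms(1)] C1_onD(2)[OF assms(2)]]]]) (simp add: p)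
 qed
qed

lemma C1_on_diff:
 fixes f g :: "real^3 => real"
 assumes "C1_on S f" "C1_on S g"
 shows "x \<in> S ==> partial j (%x. f x - g x) x = partial j f x - partial j g x"
  and "C1_on S (%x. f x - g x)"
proof -
 have m: "C1_on S (%x. (-1) * g x)" by (rule C1_on_mult(2)[OF C1_on_const assms(2)])
 have "partial j (%x. (-1) * g x) x = (-1) * partial j g x" if "x \<in> S"
  using C1_on_mult(1)[OF C1_on_const assms(2) that, of j "-1"]
  by (simp add: partial_def frechet_derivative_const)
 then show "x \<in> S ==> partial j (%x. f x - g x) x = partial j f x - partial j g x"
  using C1_on_add(1)[OF assms(1) m, of x j] by simp
 show "C1_on S (%x. f x - g x)"
  using C1_on_add(2)[OF assms(1) m] by simp
qed

lemma C1_on_nth: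
 fixes f :: "real^3 => real^3"
 assumes "C1_on S f"
 shows "x \<in> S ==> partial j (%x. f x $ i) x = partial j f x $ i" and "C1_on S (%x. f x $ i)"
proof -
 have d: "((%x. f x $ i) has_derivative (%h. frechet_derivative f (at x) h $ i)) (at x)" if "x \<in> S" for x
  using assms that by (intro bounded_linear.has_derivative[OF bounded_linear_vec_nth]) (simp add: C1_on_def frechet_derivative_works)
 have p: "partial j (%x. f x $ i) x = partial j f x $ i" if "x \<in> S" for x j
  using partial_eqI[OF d[OF that]] by (simp add: partial_def)
 then show "x \<in> S ==> partial j (%x. f x $ i) x = partial j f x $ i" .
 show "C1_on S (%x. f x $ i)"
  unfolding C1_on_def
 proof (intro conjI ballI allI)
  show "(%x. f x $ i) differentiable (at x)" if "x \<in> S" for x using d[OF that] by (rule differentiableI)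
  show "continuous_on S (partial j (%x. f x $ i))" for j
   by (rule continuous_on_eq[OF continuous_on_component[OF C1_onD(3)[OF assms]]]) (simp add: p)
 qed
qed

section \<open>Stokes systems and the reciprocal flux\<close>

lemma exterior_shift: "x + t *\<^sub>R axis 3 1 \<in> exterior_domain rr \<longleftrightarrow> x \<in> exterior_domain rr"
 by (simp add: exterior_domain_def cyl_radius_def axis_def)

lemma partial_periodic:
 fixes f :: "real^3 => real"
 assumes f: "C1_on (exterior_domain rr) f" and per: "!!x. x \<in> exterior_domain rr ==> f (x + 2 *\<^sub>R axis 3 1) = f x"
  and x: "x \<in> exterior_domain rr"
 shows "partial j f (x + 2 *\<^sub>R axis 3 1) = partial j f x"
proof -
 let ?a = "2 *\<^sub>R axis 3 1 :: real^3"
 have "f differentiable (at (x + ?a))" using f x by (simp add: C1_on_def exterior_shift)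
 then have d: "(f has_derivative frechet_derivative f (at (x + ?a))) (at (x + ?a))"
  by (simp add: frechet_derivative_works)
 have s: "((%y. y + ?a) has_derivative (%h. h)) (at x)" by (auto intro!: derivative_eq_intros)
 have "((%y. f (y + ?a)) has_derivative frechet_derivative f (at (x + ?a))) (at x)"
  using has_derivative_compose[OF s d] by simp
 then have "(f has_derivative frechet_derivative f (at (x + ?a))) (at x)"
  by (rule has_derivative_transform_within_open[OF _ open_exterior_domain x]) (rule per)
 from partial_eqI[OF this] show ?thesis by (simp add: partial_def)
qed

text \<open>Equations, smoothness and periodicity alone, with no boundary value, decay or mean
  condition. Differences of solutions and single-mode test flows both belong to this class.\<close>

definition stokes_system :: "real => (3 => real^3 => real) => (real^3 => real) => bool" where
 "stokes_system rr U P \<longleftrightarrow>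
   (\<forall>i. C1_on (exterior_domain rr) (U i)) & (\<forall>i j. C1_on (exterior_domain rr) (partial j (U i))) &
   C1_on (exterior_domain rr) P &
   (\<forall>x\<in>exterior_domain rr. \<forall>i. U i (x + 2 *\<^sub>R axis 3 1) = U i x) &
   (\<forall>x\<in>exterior_domain rr. P (x + 2 *\<^sub>R axis 3 1) = P x) &
   (\<forall>x\<in>exterior_domain rr. \<forall>i. partial 1 (partial 1 (U i)) x + partial 2 (partial 2 (U i)) x
    + partial 3 (partial 3 (U i)) x = partial i P x) &
   (\<forall>x\<in>exterior_domain rr. partial 1 (U 1) x + partial 2 (U 2) x + partial 3 (U 3) x = 0)"

lemma jacobian_nth:
 assumes "C1_on S u" "x \<in> S"
 shows "Defs.jacobian u x $ i $ j = partial j (%x. u x $ i) x"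
 using C1_on_nth(1)[OF assms, of j i] by (simp add: Defs.jacobian_def matrix_def partial_def)

lemma stokes_solution_system:
 assumes "stokes_solution rr v u p"
 shows "stokes_system rr (%i x. u x $ i) p" "C1_on (exterior_domain rr) u"
proof -
 let ?S = "exterior_domain rr"
 have C2: "C1_on ?S u" "!!j. C1_on ?S (partial j u)" and p: "C1_on ?S p"
  and per: "\<forall>x\<in>?S. u (x + 2 *\<^sub>R axis 3 1) = u x & p (x + 2 *\<^sub>R axis 3 1) = p x"
  and pde: "\<forall>x\<in>?S. - laplacian u x + gradient p x = 0 & divergence u x = 0"
  using assms by (auto simp: stokes_solution_def C2_on_def)
 show "C1_on ?S u" by (rule C2)
 have n: "C1_on ?S (%x. partial j u x $ i)" for i j by (rule C1_on_nth(2)[OF C2(2)])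
 have pj: "C1_on ?S (partial j (%x. u x $ i))" for i j
  by (rule C1_on_cong[OF open_exterior_domain _ n[of j i]]) (rule C1_on_nth(1)[OF C2(1)])
 have pp: "partial j (partial j (%x. u x $ i)) x = partial j (partial j u) x $ i" if "x \<in> ?S" for i j x
  using partial_cong_open(2)[OF open_exterior_domain that C1_on_nth(1)[OF C2(1)] C1_onD(1)[OF n that]]
   C1_on_nth(1)[OF C2(2) that] by simp
 show "stokes_system rr (%i x. u x $ i) p"
  unfolding stokes_system_def
 proof (intro conjI allI ballI)
  show "C1_on ?S (%x. u x $ i)" for i by (rule C1_on_nth(2)[OF C2(1)])
  fix x assume x: "x \<in> ?S"
  show "partial 1 (partial 1 (%x. u x $ i)) x + partial 2 (partial 2 (%x. u x $ i)) x
    + partial 3 (partial 3 (%x. u x $ i)) x = partial i p x" for i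
  proof -
   have "laplacian u x $ i = gradient p x $ i"
    using pde x by (metis add.commute add.right_inverse add_left_cancel minus_add_cancel)
   then show ?thesis by (simp add: laplacian_def sum_3 gradient_def pp[OF x])
  qed
  show "partial 1 (%x. u x $ 1) x + partial 2 (%x. u x $ 2) x + partial 3 (%x. u x $ 3) x = 0"
   using bspec[OF pde x] by (simp add: divergence_def trace_def sum_3 jacobian_nth[OF C2(1) x])
 qed (use p pj per in auto)
qed

text \<open>The divergence theorem on a periodic shell in differential form: integration by parts in
  \<theta> and z turns the r-derivative of the flux into the integral of the divergence.\<close>

lemma flux_constant:
 fixes F :: "3 => real^3 => real"
 assumes F: "!!j. C1_on (exterior_domain rr) (F j)" and rho: "0 <= rr"
  and per: "!!x. x \<in> exterior_domain rr ==> F 3 (x + 2 *\<^sub>R axis 3 1) = F 3 x"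
  and div: "!!x. x \<in> exterior_domain rr ==> partial 1 (F 1) x + partial 2 (F 2) x + partial 3 (F 3) x = 0"
 obtains c where "!!r. r > rr ==> r * (ring_integral cos (F 1) r + ring_integral sin (F 2) r) = c"
proof -
 let ?J = "%r. r * (ring_integral cos (F 1) r + ring_integral sin (F 2) r)"
 have "(?J has_real_derivative 0) (at r)" if r: "rr < r" for r
 proof -
  note c = C1_onD(3)[OF F]
  have cc: "continuous_on UNIV (%t. cos t * cos t :: real)" "continuous_on UNIV (%t. sin t * sin t :: real)"
   "continuous_on UNIV (cos :: real => real)" "continuous_on UNIV (sin :: real => real)" "continuous_on UNIV (%_. 1 :: real)"
   "continuous_on UNIV (%t::real. - sin t)"
   by (auto intro!: continuous_intros simp: continuous_on_eq_continuous_at isCont_cos isCont_sin)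
  have D: "(?J has_real_derivative (1 * (ring_integral cos (F 1) r + ring_integral sin (F 2) r)
    + (ring_integral (%t. cos t * cos t) (partial 1 (F 1)) r + ring_integral (%t. cos t * sin t) (partial 2 (F 1)) r
    + (ring_integral (%t. sin t * cos t) (partial 1 (F 2)) r + ring_integral (%t. sin t * sin t) (partial 2 (F 2)) r)) * r)) (at r)"
   by (intro DERIV_mult DERIV_add DERIV_ident DERIV_ring_integral[OF F rho r] cc)
  have 1: "ring_integral cos (F 1) r + r * (ring_integral (%t. sin t * cos t) (partial 2 (F 1)) r
    - ring_integral (%t. sin t * sin t) (partial 1 (F 1)) r) = 0"
   by (rule ring_integral_parts_theta[OF F rho r DERIV_sin cc(3)]) simp
  have 2: "ring_integral (%t. - sin t) (F 2) r + r * (ring_integral (%t. cos t * cos t) (partial 2 (F 2)) r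
    - ring_integral (%t. cos t * sin t) (partial 1 (F 2)) r) = 0"
   by (rule ring_integral_parts_theta[OF F rho r DERIV_cos cc(6)]) simp
  have 3: "ring_integral (%t. - sin t) (F 2) r = - ring_integral sin (F 2) r"
   using ring_integral_cmult_weight[OF rho r, of "-1" sin] by simp
  have 4: "ring_integral (%t. cos t * cos t) G r + ring_integral (%t. sin t * sin t) G r = ring_integral (%_. 1) G r"
   if "continuous_on (exterior_domain rr) G" for G
   using ring_integral_add_weight[OF rho r that cc(1,2)] by (simp flip: power2_eq_square)
  have 5: "ring_integral (%_. 1) (partial 1 (F 1)) r + ring_integral (%_. 1) (partial 2 (F 2)) r
    + ring_integral (%_. 1) (partial 3 (F 3)) r = 0"
  proof -
   have "ring_integral (%_. 1) (%x. partial 1 (F 1) x + partial 2 (F 2) x + partial 3 (F 3) x) r = 0"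
    using div[OF cyl_point_exterior[OF rho r]] by (simp add: ring_integral_def case_prod_unfold)
   then show ?thesis
    by (simp add: ring_integral_add[OF rho r] c cc(5) continuous_on_add)
  qed
  have 6: "ring_integral (%_. 1) (partial 3 (F 3)) r = 0"
   by (rule ring_integral_parts_z[OF F rho r cc(5) per])
  have sc: "(%t::real. sin t * cos t) = (%t. cos t * sin t)" by (simp add: fun_eq_iff)
  have "1 * (ring_integral cos (F 1) r + ring_integral sin (F 2) r)
    + (ring_integral (%t. cos t * cos t) (partial 1 (F 1)) r + ring_integral (%t. cos t * sin t) (partial 2 (F 1)) r
    + (ring_integral (%t. sin t * cos t) (partial 1 (F 2)) r + ring_integral (%t. sin t * sin t) (partial 2 (F 2)) r)) * r = 0"
   using 1 2 3 4[OF c, of 1 1] 4[OF c, of 2 2] 5 6 unfolding sc by algebra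
  then show ?thesis using D by simp
 qed
 then have "!!r. r \<in> {rr<..} ==> (?J has_real_derivative 0) (at r within {rr<..})"
  by (auto intro: has_field_derivative_at_within)
 then obtain c where "!!r. r \<in> {rr<..} ==> ?J r = c"
  using has_field_derivative_zero_constant[of "{rr<..}" ?J] by auto
 then show thesis using that by auto
qed

text \<open>The vector field of the reciprocal theorem, with plain gradients instead of symmetric
  ones. It is divergence free by the equations and the incompressibility of both flows; the
  transposed gradient in the stress is handled by \<open>transposed_strain\<close>.\<close>

definition green_field :: "(3 => real^3 => real) => (real^3 => real) => (3 => real^3 => real) => (real^3 => real) => 3 => real^3 => real" where
 "green_field U P W Q j x =
   (U 1 x * partial j (W 1) x - W 1 x * partial j (U 1) x) + (U 2 x * partial j (W 2) x - W 2 x * partial j (U 2) x)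
   + (U 3 x * partial j (W 3) x - W 3 x * partial j (U 3) x) - Q x * U j x + P x * W j x"

lemma stokes_systemD:
 assumes "stokes_system rr U P"
 shows "C1_on (exterior_domain rr) (U i)" "C1_on (exterior_domain rr) (partial j (U i))" "C1_on (exterior_domain rr) P"
  "x \<in> exterior_domain rr ==> U i (x + 2 *\<^sub>R axis 3 1) = U i x"
  "x \<in> exterior_domain rr ==> P (x + 2 *\<^sub>R axis 3 1) = P x"
  "x \<in> exterior_domain rr ==> partial j (U i) (x + 2 *\<^sub>R axis 3 1) = partial j (U i) x"
  "x \<in> exterior_domain rr ==> partial 1 (partial 1 (U i)) x + partial 2 (partial 2 (U i)) x
    + partial 3 (partial 3 (U i)) x = partial i P x"
  "x \<in> exterior_domain rr ==> partial 1 (U 1) x + partial 2 (U 2) x + partial 3 (U 3) x = 0"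
 using assms partial_periodic[of rr "U i" x j] unfolding stokes_system_def by auto

lemma green_field_C1:
 assumes U: "stokes_system rr U P" and W: "stokes_system rr W Q"
 shows "C1_on (exterior_domain rr) (green_field U P W Q j)"
proof -
 note C = stokes_systemD(1,2,3)[OF U] stokes_systemD(1,2,3)[OF W]
 show ?thesis unfolding green_field_def[abs_def] by (intro C1_on_add(2) C1_on_diff(2) C1_on_mult(2) C)
qed

lemma green_field_divergence:
 assumes U: "stokes_system rr U P" and W: "stokes_system rr W Q" and x: "x \<in> exterior_domain rr"
 shows "partial 1 (green_field U P W Q 1) x + partial 2 (green_field U P W Q 2) x + partial 3 (green_field U P W Q 3) x = 0"
proof -
 note C = stokes_systemD(1,2,3)[OF U] stokes_systemD(1,2,3)[OF W]
 note rules = C1_on_add[where S="exterior_domain rr"] C1_on_diff[where S="exterior_domain rr"] C1_on_mult[where S="exterior_domain rr"]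
 have p: "partial j (green_field U P W Q j) x =
   (U 1 x * partial j (partial j (W 1)) x - W 1 x * partial j (partial j (U 1)) x)
   + (U 2 x * partial j (partial j (W 2)) x - W 2 x * partial j (partial j (U 2)) x)
   + (U 3 x * partial j (partial j (W 3)) x - W 3 x * partial j (partial j (U 3)) x)
   - (Q x * partial j (U j) x + partial j Q x * U j x) + (P x * partial j (W j) x + partial j P x * W j x)" for j
  unfolding green_field_def[abs_def] by (simp add: rules C x algebra_simps)
 note eqs = stokes_systemD(7,8)[OF U x] stokes_systemD(7,8)[OF W x]
 have "(U 1 x * (a1+a2+a3) - W 1 x * (b1+b2+b3)) + (U 2 x * (a4+a5+a6) - W 2 x * (b4+b5+b6))
   + (U 3 x * (a7+a8+a9) - W 3 x * (b7+b8+b9)) - Q x * (d1+d2+d3) - (q1 * U 1 x + q2 * U 2 x + q3 * U 3 x)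
   + P x * (e1+e2+e3) + (p1 * W 1 x + p2 * W 2 x + p3 * W 3 x) = 0"
  if "a1+a2+a3 = q1" "a4+a5+a6 = q2" "a7+a8+a9 = q3" "b1+b2+b3 = p1" "b4+b5+b6 = p2" "b7+b8+b9 = p3"
   "d1+d2+d3 = 0" "e1+e2+e3 = 0" for a1 a2 a3 a4 a5 a6 a7 a8 a9 b1 b2 b3 b4 b5 b6 b7 b8 b9 d1 d2 d3 e1 e2 e3 q1 q2 q3 p1 p2 p3
  unfolding that by (simp add: algebra_simps)
 from this[OF eqs(3)[of 1] eqs(3)[of 2] eqs(3)[of 3] eqs(1)[of 1] eqs(1)[of 2] eqs(1)[of 3] eqs(2) eqs(4)]
 show ?thesis unfolding p by (simp add: algebra_simps)
qed

lemma cont_trig: "continuous_on UNIV (cos :: real => real)" "continuous_on UNIV (sin :: real => real)"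
 "continuous_on UNIV (%_::real. 1 :: real)"
 by (auto simp: continuous_on_eq_continuous_at isCont_cos isCont_sin)

text \<open>The increments of f over [n, n + 1] tend to 0, and by the mean value theorem they are
  values of f' at points tending to infinity.\<close>

lemma mean_value_limit_zero:
 fixes f f' :: "real => real"
 assumes d: "!!r. r > a ==> (f has_real_derivative f' r) (at r)"
  and f: "(f \<longlongrightarrow> 0) at_top" and f': "(f' \<longlongrightarrow> c) at_top"
 shows "c = 0"
proof -
 have "\<exists>x. x > real n & f (real n + 1) - f (real n) = f' x" if "real n > a" for n
  using MVT2[of "real n" "real n + 1" f f'] d that by fastforce
 then obtain x where x: "!!n. real n > a ==> x n > real n & f (real n + 1) - f (real n) = f' (x n)"
  by metis
 have ev: "\<forall>\<^sub>F n in sequentially. real n > a"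
  using filterlim_real_sequentially eventually_gt_at_top[of a] by (simp add: filterlim_iff)
 have "filterlim x at_top sequentially"
  by (rule filterlim_at_top_mono[OF filterlim_real_sequentially]) (use ev in eventually_elim, use x less_imp_le in blast)
 then have 1: "(%n. f' (x n)) \<longlonglongrightarrow> c" by (rule filterlim_compose[OF f'])
 have s: "filterlim (%n. real n + 1) at_top sequentially"
  by (rule filterlim_at_top_mono[OF filterlim_real_sequentially]) simp
 have "(%n. f (real n + 1) - f (real n)) \<longlonglongrightarrow> 0 - 0"
  by (intro tendsto_diff filterlim_compose[OF f] s filterlim_real_sequentially)
 then have 2: "(%n. f' (x n)) \<longlonglongrightarrow> 0 - 0"
  by (rule Lim_transform_eventually) (use ev in eventually_elim, use x in blast)
 show "c = 0" using LIMSEQ_unique[OF 1 2] by simp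
qed

text \<open>The flux of the Green field through the cylinder of radius \<open>r\<close> does not depend on \<open>r\<close>.  Since
  nothing is known about the decay of the derivatives of \<open>u\<close>, they are written as
  \<open>w \<cdot> \<partial>\<^sub>r u = \<partial>\<^sub>r (w \<cdot> u) - u \<cdot> \<partial>\<^sub>r w\<close>, and the total derivative averages out.\<close>

lemma green_flux_zero:
 assumes U: "stokes_system rr U P" and W: "stokes_system rr W Q" and R: "0 <= rr" "rr < s"
  and bU: "!!x i. cyl_radius x >= r0 ==> \<bar>U i x\<bar> <= 1" "!!x. cyl_radius x >= r0 ==> \<bar>P x\<bar> <= 1"
  and bW: "!!x i. cyl_radius x > rr ==> \<bar>W i x\<bar> <= \<beta> (cyl_radius x)"
   "!!x i j. cyl_radius x > rr ==> \<bar>partial j (W i) x\<bar> <= \<beta> (cyl_radius x)"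
   "!!x. cyl_radius x > rr ==> \<bar>Q x\<bar> <= \<beta> (cyl_radius x)"
  and \<beta>: "((%r. r * \<beta> r) \<longlongrightarrow> 0) at_top"
 shows "ring_integral cos (green_field U P W Q 1) s + ring_integral sin (green_field U P W Q 2) s = 0"
proof -
 let ?S = "exterior_domain rr"
 let ?F = "green_field U P W Q"
 obtain c where c: "!!r. r > rr ==> r * (ring_integral cos (?F 1) r + ring_integral sin (?F 2) r) = c"
 proof (rule flux_constant[of rr ?F])
  show "?F 3 (x + 2 *\<^sub>R axis 3 1) = ?F 3 x" if "x \<in> ?S" for x
   unfolding green_field_def using that by (simp add: stokes_systemD(4-6)[OF U] stokes_systemD(4-6)[OF W])
 qed (use green_field_C1[OF U W] green_field_divergence[OF U W] R in auto)
 define H where "H = (%x. W 1 x * U 1 x + W 2 x * U 2 x + W 3 x * U 3 x)"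
 define G where "G = (%j x. 2 * (U 1 x * partial j (W 1) x + U 2 x * partial j (W 2) x + U 3 x * partial j (W 3) x)
  - Q x * U j x + P x * W j x)"
 note C = stokes_systemD(1,2,3)[OF U] stokes_systemD(1,2,3)[OF W]
 have HC: "C1_on ?S H" unfolding H_def by (intro C1_on_add(2) C1_on_mult(2) C)
 have GC: "C1_on ?S (G j)" for j
  unfolding G_def by (intro C1_on_add(2) C1_on_diff(2) C1_on_mult(2) C1_on_const C)
 have FGH: "?F j x = G j x - partial j H x" if "x \<in> ?S" for j x
  unfolding green_field_def H_def G_def using that
  by (simp add: C1_on_add[where S="?S"] C1_on_mult[where S="?S"] C algebra_simps)
 let ?L = "ring_integral (%_. 1) H"
 let ?g = "%r. ring_integral cos (G 1) r + ring_integral sin (G 2) r"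
 let ?h = "%r. ring_integral cos (partial 1 H) r + ring_integral sin (partial 2 H) r"
 have J: "c = r * ?g r - r * ?h r" if "r > rr" for r
 proof -
  have e: "ring_integral a (?F j) r = ring_integral a (G j) r - ring_integral a (partial j H) r"
   if "continuous_on UNIV a" for a j
   using ring_integral_diff[OF R(1) \<open>r > rr\<close> C1_onD(2)[OF GC] C1_onD(3)[OF HC] that]
    FGH[OF cyl_point_exterior[OF R(1) \<open>r > rr\<close>]] by (simp add: ring_integral_def)
  show ?thesis using c[OF that] unfolding e[OF cont_trig(1)] e[OF cont_trig(2)] by argo
 qed
 have dL: "((%r. r * ?L r) has_real_derivative (?L r + r * ?h r)) (at r)" if "r > rr" for r
  using DERIV_mult'[OF DERIV_ident DERIV_ring_integral[OF HC R(1) that cont_trig(3)]] by (simp add: add.commute)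
 have b\<beta>: "((%r. K * (r * \<beta> r)) \<longlongrightarrow> 0) at_top" for K
  using tendsto_mult_right_zero[OF \<beta>] by simp
 have m: "\<bar>a * b\<bar> <= B" if "\<bar>a\<bar> <= 1" "\<bar>b\<bar> <= B" for a b B :: real
 proof -
  have "\<bar>a\<bar> * \<bar>b\<bar> <= 1 * B" using that by (intro mult_mono) auto
  then show ?thesis by (simp add: abs_mult)
 qed
 have ev: "\<forall>\<^sub>F r in at_top. r > max rr (max r0 0)" by (rule eventually_gt_at_top)
 have Hb: "\<bar>?L r\<bar> <= 4 * pi * (3 * \<beta> r)" "\<bar>?g r\<bar> <= 2 * (4 * pi * (8 * \<beta> r))" if r: "r > max rr (max r0 0)" for r
 proof -
  have rr: "r > rr" "r > r0" "r > 0" using r by auto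
  have cr: "cyl_radius (cyl_point r t z) = r" for t z using rr by simp
  have u: "\<bar>U i (cyl_point r t z)\<bar> <= 1" "\<bar>P (cyl_point r t z)\<bar> <= 1" for i t z
   using bU[of "cyl_point r t z"] rr by auto
  have w: "\<bar>W i (cyl_point r t z)\<bar> <= \<beta> r" "\<bar>partial j (W i) (cyl_point r t z)\<bar> <= \<beta> r" "\<bar>Q (cyl_point r t z)\<bar> <= \<beta> r" for i j t z
   using bW[of "cyl_point r t z"] rr by auto
  have "\<bar>1 * H (cyl_point r t z)\<bar> <= 3 * \<beta> r" for t z
   using m[OF u(1)[of 1 t z] w(1)[of 1 t z]] m[OF u(1)[of 2 t z] w(1)[of 2 t z]] m[OF u(1)[of 3 t z] w(1)[of 3 t z]]
   unfolding H_def by (simp add: mult.commute[of "W _ _"])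
  then show "\<bar>?L r\<bar> <= 4 * pi * (3 * \<beta> r)"
   using ring_integral_bound[OF R(1) rr(1) C1_onD(2)[OF HC] cont_trig(3) continuous_on_const[of _ "3 * \<beta> r"]]
   by (simp add: ring_integral_const[OF R(1) rr(1)])
  have Gb: "\<bar>G j (cyl_point r t z)\<bar> <= 8 * \<beta> r" for j t z
  proof -
   have "\<bar>2 * (a1 + a2 + a3) - a4 + a5\<bar> <= 8 * B"
    if "\<bar>a1\<bar> <= B" "\<bar>a2\<bar> <= B" "\<bar>a3\<bar> <= B" "\<bar>a4\<bar> <= B" "\<bar>a5\<bar> <= B" for a1 a2 a3 a4 a5 B :: real
    using that unfolding abs_le_iff by argo
   from this[OF m[OF u(1)[of 1 t z] w(2)[of j 1 t z]] m[OF u(1)[of 2 t z] w(2)[of j 2 t z]] m[OF u(1)[of 3 t z] w(2)[of j 3 t z]]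
     m[OF u(1)[of j t z] w(3)[of t z]] m[OF u(2)[of t z] w(1)[of j t z]]]
   show ?thesis unfolding G_def by (simp add: mult.commute[of "Q _"])
  qed
  have 1: "\<bar>cos t * G j (cyl_point r t z)\<bar> <= 8 * \<beta> r" "\<bar>sin t * G j (cyl_point r t z)\<bar> <= 8 * \<beta> r" for j t z
   by (rule m[OF _ Gb], simp)+
  have "\<bar>ring_integral cos (G 1) r\<bar> <= 4 * pi * (8 * \<beta> r)" "\<bar>ring_integral sin (G 2) r\<bar> <= 4 * pi * (8 * \<beta> r)"
   using ring_integral_bound[OF R(1) rr(1) C1_onD(2)[OF GC] cont_trig(1) continuous_on_const[of _ "8 * \<beta> r"], OF 1(1)]
    ring_integral_bound[OF R(1) rr(1) C1_onD(2)[OF GC] cont_trig(2) continuous_on_const[of _ "8 * \<beta> r"], OF 1(2)]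
   by (simp_all add: ring_integral_const[OF R(1) rr(1)])
  then show "\<bar>?g r\<bar> <= 2 * (4 * pi * (8 * \<beta> r))" by argo
 qed
 have lim1: "((%r. r * ?L r) \<longlongrightarrow> 0) at_top"
 proof (rule Lim_null_comparison[OF _ b\<beta>[of "12 * pi"]])
  show "\<forall>\<^sub>F r in at_top. norm (r * ?L r) <= 12 * pi * (r * \<beta> r)"
   using ev
  proof eventually_elim
   case (elim r)
   have "r * \<bar>?L r\<bar> <= r * (4 * pi * (3 * \<beta> r))" using elim by (intro mult_left_mono Hb(1)) auto
   then show ?case using elim by (simp add: abs_mult mult_ac)
  qed
 qed
 have lim2: "((%r. r * ?g r) \<longlongrightarrow> 0) at_top"
 proof (rule Lim_null_comparison[OF _ b\<beta>[of "64 * pi"]])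
  show "\<forall>\<^sub>F r in at_top. norm (r * ?g r) <= 64 * pi * (r * \<beta> r)"
   using ev
  proof eventually_elim
   case (elim r)
   have "r * \<bar>?g r\<bar> <= r * (2 * (4 * pi * (8 * \<beta> r)))" using elim by (intro mult_left_mono Hb(2)) auto
   then show ?case using elim by (simp add: abs_mult mult_ac)
  qed
 qed
 have lim3: "(?L \<longlongrightarrow> 0) at_top"
 proof (rule Lim_null_comparison[OF _ lim1[THEN tendsto_rabs_zero]])
  show "\<forall>\<^sub>F r in at_top. norm (?L r) <= \<bar>r * ?L r\<bar>"
   using eventually_ge_at_top[of "1::real"]
   by eventually_elim (simp add: abs_mult mult_le_cancel_right1)
 qed
 \<comment> \<open>By \<open>J\<close> this expression is the derivative of r \<open>?L\<close> r.
   It tends to -c whereas r \<open>?L\<close> r tends to 0, which forces c = 0.\<close>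
 have "((%r. ?L r + r * ?g r - c) \<longlongrightarrow> 0 + 0 - c) at_top"
  by (intro tendsto_intros lim2 lim3)
 moreover have "\<forall>\<^sub>F r in at_top. ?L r + r * ?g r - c = ?L r + r * ?h r"
  using eventually_gt_at_top[of rr]
 proof eventually_elim
  case (elim r)
  show ?case using J[OF elim] by argo
 qed
 ultimately have "((%r. ?L r + r * ?h r) \<longlongrightarrow> - c) at_top"
  by (simp add: filterlim_cong[OF refl refl])
 from mean_value_limit_zero[OF dL lim1 this] have "c = 0" by simp
 then show ?thesis using c[OF R(2)] R by simp
qed

definition strain :: "(3 => real^3 => real) => (real^3 => real) => 3 => 3 => real^3 => real" where
 "strain U P i j x = partial j (U i) x + partial i (U j) x - (if i = j then P x else 0)"

lemma continuous_on_strain: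
 assumes "stokes_system rr U P"
 shows "continuous_on (exterior_domain rr) (strain U P i j)"
 unfolding strain_def[abs_def]
 by (cases "i = j") (auto intro!: continuous_intros C1_onD(2)[OF stokes_systemD(2)[OF assms]] C1_onD(2)[OF stokes_systemD(3)[OF assms]])

lemma lift_has_derivative:
 fixes g :: "real => real"
 assumes "!!z. (g has_real_derivative g' z) (at z)"
 shows "((%x::real^3. g (x$3)) has_derivative (%h. g' (x$3) * h$3)) (at x)"
 using has_derivative_compose[OF vec_nth_has_derivative[of 3 "at x"] assms[unfolded has_field_derivative_def, of "x$3"]]
 by simp

lemma lift_C1:
 fixes g :: "real => real"
 assumes g: "!!z. (g has_real_derivative g' z) (at z)" and c: "continuous_on UNIV g'"
 shows "C1_on S (%x. g (x$3))"
  "partial 1 (%x. g (x$3)) x = 0" "partial 2 (%x. g (x$3)) x = 0" "partial 3 (%x. g (x$3)) x = g' (x$3)"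
proof -
 have p: "partial j (%x. g (x$3)) x = g' (x$3) * axis j 1 $ 3" for j x
  by (rule partial_eqI[OF lift_has_derivative[OF g]])
 show "partial 1 (%x. g (x$3)) x = 0" "partial 2 (%x. g (x$3)) x = 0" "partial 3 (%x. g (x$3)) x = g' (x$3)"
  by (simp_all add: p axis_def)
 show "C1_on S (%x. g (x$3))"
  unfolding C1_on_def
 proof (intro conjI ballI allI)
  show "(%x. g (x$3)) differentiable (at x)" for x :: "real^3"
   using lift_has_derivative[OF g] by (rule differentiableI)
  show "continuous_on S (partial j (%x. g (x$3)))" for j
   unfolding p[abs_def] by (intro continuous_intros continuous_on_compose2[OF c]) auto
 qed
qed

text \<open>With n the normal, n_j d_i - n_i d_j is tangential to the cylinder, so n_j d_i U_j
  equals n_i div U up to tangential derivatives, which are moved onto the weight. As div U = 0, only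
  g' times components of U is left and no derivative of U.\<close>

lemma transposed_strain:
 fixes g g' :: "real => real"
 assumes U: "stokes_system rr U P" and s: "0 <= rr" "rr < s"
  and g: "!!z. (g has_real_derivative g' z) (at z)" "continuous_on UNIV g'" "!!z. g (z + 2) = g z"
 defines "T \<equiv> %i. ring_integral cos (%x. g (x$3) * partial i (U 1) x) s + ring_integral sin (%x. g (x$3) * partial i (U 2) x) s"
 shows "T 1 = ring_integral cos (%x. g' (x$3) * U 3 x) s"
  and "T 2 = ring_integral sin (%x. g' (x$3) * U 3 x) s"
  and "T 3 = - ring_integral cos (%x. g' (x$3) * U 1 x) s - ring_integral sin (%x. g' (x$3) * U 2 x) s"
proof -
 let ?S = "exterior_domain rr"
 note U1 = stokes_systemD(1)[OF U] and L = lift_C1[OF g(1,2)]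
 have GC: "C1_on ?S (%x. g (x$3) * U l x)" for l by (rule C1_on_mult(2)[OF L(1) U1])
 have p: "partial 1 (%x. g (x$3) * U l x) x = g (x$3) * partial 1 (U l) x"
  "partial 2 (%x. g (x$3) * U l x) x = g (x$3) * partial 2 (U l) x"
  "partial 3 (%x. g (x$3) * U l x) x = g (x$3) * partial 3 (U l) x + g' (x$3) * U l x"
  if "x \<in> ?S" for l x
  using that by (simp_all add: C1_on_mult(1)[OF L(1) U1] L)
 have cg: "continuous_on ?S (%x. g (x$3))" by (rule C1_onD(2)[OF L(1)])
 have cg': "continuous_on ?S (%x. g' (x$3))"
  by (intro continuous_on_compose2[OF g(2)] continuous_intros) auto
 note cU = C1_onD(2)[OF U1] C1_onD(2)[OF stokes_systemD(2)[OF U]]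
 have cgU: "continuous_on ?S (%x. g (x$3) * partial j (U l) x)" "continuous_on ?S (%x. g' (x$3) * U l x)" for j l
  by (intro continuous_on_mult cg cg' cU)+
 have rp: "ring_integral a (partial 1 (%x. g (x$3) * U l x)) s = ring_integral a (%x. g (x$3) * partial 1 (U l) x) s"
  "ring_integral a (partial 2 (%x. g (x$3) * U l x)) s = ring_integral a (%x. g (x$3) * partial 2 (U l) x) s"
  "ring_integral a (partial 3 (%x. g (x$3) * U l x)) s = ring_integral a (%x. g (x$3) * partial 3 (U l) x + g' (x$3) * U l x) s" for a l
  by (rule ring_integral_cong[OF s], use p[OF cyl_point_exterior[OF s]] in simp)+
 have z: "ring_integral a (%x. g (x$3) * partial 3 (U l) x) s = - ring_integral a (%x. g' (x$3) * U l x) s"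
  if a: "continuous_on UNIV a" for a l
 proof -
  have "ring_integral a (partial 3 (%x. g (x$3) * U l x)) s = 0"
   by (rule ring_integral_parts_z[OF GC s a]) (simp add: g(3) stokes_systemD(4)[OF U])
  then show ?thesis unfolding rp ring_integral_add[OF s cgU(1) cgU(2) a] by simp
 qed
 have th: "ring_integral cos (%x. g (x$3) * partial 2 (U l) x) s = ring_integral sin (%x. g (x$3) * partial 1 (U l) x) s" for l
 proof -
  have "ring_integral (%_. 0) (%x. g (x$3) * U l x) s + s * (ring_integral (%t. 1 * cos t) (partial 2 (%x. g (x$3) * U l x)) s
   - ring_integral (%t. 1 * sin t) (partial 1 (%x. g (x$3) * U l x)) s) = 0"
   by (rule ring_integral_parts_theta[OF GC s DERIV_const]) auto
  moreover have "ring_integral (%_. 0) (%x. g (x$3) * U l x) s = 0" by (simp add: ring_integral_def case_prod_unfold)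
  ultimately show ?thesis using s by (simp add: rp)
 qed
 have dv: "ring_integral a (%x. g (x$3) * partial 1 (U 1) x) s + ring_integral a (%x. g (x$3) * partial 2 (U 2) x) s
   + ring_integral a (%x. g (x$3) * partial 3 (U 3) x) s = 0" if a: "continuous_on UNIV a" for a
 proof -
  have "ring_integral a (%x. (g (x$3) * partial 1 (U 1) x + g (x$3) * partial 2 (U 2) x) + g (x$3) * partial 3 (U 3) x) s
    = ring_integral a (%x. 0 * g (x$3)) s"
   by (rule ring_integral_cong[OF s])
    (use stokes_systemD(8)[OF U cyl_point_exterior[OF s]] in \<open>simp flip: distrib_left\<close>)
  also have "... = 0" by (simp add: ring_integral_def case_prod_unfold)
  finally show ?thesis
   using ring_integral_add[OF s continuous_on_add[OF cgU(1) cgU(1)] cgU(1) a] ring_integral_add[OF s cgU(1) cgU(1) a] by simp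
 qed
 show "T 1 = ring_integral cos (%x. g' (x$3) * U 3 x) s"
  using dv[OF cont_trig(1)] th[of 2] z[OF cont_trig(1), of 3] unfolding T_def by simp
 show "T 2 = ring_integral sin (%x. g' (x$3) * U 3 x) s"
  using dv[OF cont_trig(2)] th[of 1] z[OF cont_trig(2), of 3] unfolding T_def by simp
 show "T 3 = - ring_integral cos (%x. g' (x$3) * U 1 x) s - ring_integral sin (%x. g' (x$3) * U 2 x) s"
  using z[OF cont_trig(1), of 1] z[OF cont_trig(2), of 2] unfolding T_def by simp
qed

lemma abs_mult_le_one: "\<bar>a\<bar> <= 1 ==> \<bar>b\<bar> <= B ==> \<bar>a * b\<bar> <= B" for a b B :: real
 using mult_mono[of "\<bar>a\<bar>" 1 "\<bar>b\<bar>" B] by (simp add: abs_mult)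

text \<open>The adjoint representation of the force: paired with a test function \<open>g\<close> it is an integral of
  \<open>u\<close> itself against a bounded kernel, with \<open>W\<close> the Stokes flow having boundary value \<open>g e\<^sub>i\<close>.\<close>

lemma force_pairing_bound:
 fixes g g' :: "real => real"
 assumes U: "stokes_system rr U P" and W: "stokes_system rr W Q" and s: "0 <= rr" "rr < s"
  and g: "!!z. (g has_real_derivative g' z) (at z)" "continuous_on UNIV g'" "!!z. g (z + 2) = g z"
  and flux: "ring_integral cos (green_field U P W Q 1) s + ring_integral sin (green_field U P W Q 2) s = 0"
  and bdry: "!!l t z. W l (cyl_point s t z) = (if l = i then g z else 0)"
  and M: "!!l j t z. \<bar>partial j (W l) (cyl_point s t z)\<bar> <= M" "!!t z. \<bar>Q (cyl_point s t z)\<bar> <= M" "!!z. \<bar>g' z\<bar> <= M"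
 shows "\<bar>ring_integral cos (%x. g (x$3) * strain U P i 1 x) s + ring_integral sin (%x. g (x$3) * strain U P i 2 x) s\<bar>
  <= 6 * M * ring_integral (%_. 1) (%x. \<bar>U 1 x\<bar> + \<bar>U 2 x\<bar> + \<bar>U 3 x\<bar>) s"
proof -
 let ?S = "exterior_domain rr"
 let ?N = "%x. \<bar>U 1 x\<bar> + \<bar>U 2 x\<bar> + \<bar>U 3 x\<bar>"
 define A where "A = (%j x. U 1 x * partial j (W 1) x + U 2 x * partial j (W 2) x + U 3 x * partial j (W 3) x - Q x * U j x)"
 define B where "B = (%j x. g (x$3) * (partial j (U i) x - (if i = j then P x else 0)))"
 define T where "T = (%j x. g (x$3) * partial i (U j) x)"
 note L = lift_C1[OF g(1,2)]
 note cU = C1_onD(2)[OF stokes_systemD(1)[OF U]] C1_onD(2)[OF stokes_systemD(2)[OF U]] C1_onD(2)[OF stokes_systemD(3)[OF U]]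
 note cW = C1_onD(2)[OF stokes_systemD(2)[OF W]] C1_onD(2)[OF stokes_systemD(3)[OF W]]
 have cg: "continuous_on ?S (%x. g (x$3))" by (rule C1_onD(2)[OF L(1)])
 have cg': "continuous_on ?S (%x. g' (x$3))"
  by (intro continuous_on_compose2[OF g(2)] continuous_intros) auto
 have cA: "continuous_on ?S (A j)" for j
  unfolding A_def by (intro continuous_on_add continuous_on_diff continuous_on_mult cU cW)
 have cB: "continuous_on ?S (B j)" for j
  unfolding B_def by (cases "i = j") (auto intro!: continuous_on_diff continuous_on_mult cU cg)
 have cT: "continuous_on ?S (T j)" for j
  unfolding T_def by (intro continuous_on_mult cU cg)
 have cN: "continuous_on ?S ?N"
  by (intro continuous_on_add continuous_on_rabs cU)
 have "ring_integral a (green_field U P W Q j) s = ring_integral a (%x. A j x - B j x) s" for a j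
  by (rule ring_integral_cong[OF s])
   (use exhaust_3[of i] in \<open>auto simp: green_field_def A_def B_def bdry algebra_simps\<close>)
 \<comment> \<open>The vanishing reciprocal flux at radius s, where W = g e_i: the terms with
   derivatives of U or with P are exchanged for terms in which U itself meets derivatives of W and
   Q.\<close>
 then have 1: "ring_integral cos (B 1) s + ring_integral sin (B 2) s = ring_integral cos (A 1) s + ring_integral sin (A 2) s"
  using flux ring_integral_diff[OF s cA cB cont_trig(1), of 1] ring_integral_diff[OF s cA cB cont_trig(2), of 2] by simp
 have 2: "ring_integral a (%x. g (x$3) * strain U P i j x) s = ring_integral a (B j) s + ring_integral a (T j) s"
  if "continuous_on UNIV a" for a j
  unfolding ring_integral_add[OF s cB cT that, symmetric]
  by (rule ring_integral_cong[OF s]) (simp add: strain_def B_def T_def algebra_simps)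
 have un: "\<bar>U l (cyl_point s t z)\<bar> <= ?N (cyl_point s t z)" for l t z
  using exhaust_3[of l] by auto
 have M0: "M >= 0" using M(3)[of 0] abs_ge_zero[of "g' 0"] by linarith
 have rb: "\<bar>ring_integral a F s\<bar> <= K * ring_integral (%_. 1) ?N s"
  if a: "continuous_on UNIV a" "!!t. \<bar>a t\<bar> <= 1" and F: "continuous_on ?S F" "!!t z. \<bar>F (cyl_point s t z)\<bar> <= K * ?N (cyl_point s t z)"
  for a F K
  unfolding ring_integral_cmult[OF s, symmetric]
  by (rule ring_integral_bound[OF s F(1) a(1) continuous_on_mult[OF continuous_on_const cN]])
   (rule abs_mult_le_one[OF a(2) F(2)])
 have Ab: "\<bar>A j (cyl_point s t z)\<bar> <= (2 * M) * ?N (cyl_point s t z)" for j t z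
 proof -
  let ?x = "cyl_point s t z"
  have "\<bar>U l ?x * partial j (W l) ?x\<bar> <= \<bar>U l ?x\<bar> * M" for l
   unfolding abs_mult by (intro mult_left_mono M) auto
  moreover have "\<bar>x + y + z\<bar> <= M * (a + b + c)"
   if "\<bar>x\<bar> <= a * M" "\<bar>y\<bar> <= b * M" "\<bar>z\<bar> <= c * M" for x y z a b c :: real
  proof -
   have "M * (a + b + c) = a * M + b * M + c * M" by (simp add: algebra_simps)
   then show ?thesis using that by arith
  qed
  ultimately have "\<bar>U 1 ?x * partial j (W 1) ?x + U 2 ?x * partial j (W 2) ?x + U 3 ?x * partial j (W 3) ?x\<bar> <= M * ?N ?x"
   by blast
  moreover have "\<bar>Q ?x * U j ?x\<bar> <= M * ?N ?x"
   unfolding abs_mult using M0 by (intro mult_mono M un) auto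
  moreover have "\<bar>x - y\<bar> <= (2 * M) * w" if "\<bar>x\<bar> <= M * w" "\<bar>y\<bar> <= M * w" for x y w :: real
  proof -
   have "(2 * M) * w = M * w + M * w" by simp
   then show ?thesis using that by arith
  qed
  ultimately show ?thesis unfolding A_def by blast
 qed
 have Gb: "\<bar>g' (cyl_point s t z $ 3) * U l (cyl_point s t z)\<bar> <= M * ?N (cyl_point s t z)" for l t z
  unfolding abs_mult using M0 by (intro mult_mono M un) auto
 have cG: "continuous_on ?S (%x. g' (x$3) * U l x)" for l by (intro continuous_on_mult cg' cU)
 have ab: "\<bar>cos t\<bar> <= 1" "\<bar>sin t\<bar> <= 1" for t :: real by simp_all
 note T1 = transposed_strain[OF U s g]
 have N0: "ring_integral (%_. 1) ?N s >= 0"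
  using ring_integral_bound[OF s cN cont_trig(3) cN] by (auto intro: order_trans[OF abs_ge_zero])
 define X where "X = M * ring_integral (%_. 1) ?N s"
 have X0: "X >= 0" unfolding X_def by (intro mult_nonneg_nonneg M0 N0)
 have c: "\<bar>ring_integral cos (%x. g' (x$3) * U l x) s\<bar> <= X" "\<bar>ring_integral sin (%x. g' (x$3) * U l x) s\<bar> <= X" for l
  unfolding X_def by (rule rb[OF cont_trig(1) ab(1) cG Gb], rule rb[OF cont_trig(2) ab(2) cG Gb])
 have "\<bar>ring_integral cos (T 1) s + ring_integral sin (T 2) s\<bar> <= X + X"
  using exhaust_3[of i]
 proof (elim disjE)
  assume "i = 1" then show ?thesis using T1(1) c(1)[of 3] X0 unfolding T_def by simp
 next
  assume "i = 2" then show ?thesis using T1(2) c(2)[of 3] X0 unfolding T_def by simp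
 next
  assume "i = 3" then show ?thesis using T1(3) c(1)[of 1] c(2)[of 2] unfolding T_def by simp
 qed
 \<comment> \<open>2 M for each of the two weights; with the transposed part, bounded by 2 X, the
   total factor becomes 6.\<close>
 moreover have "\<bar>ring_integral cos (A 1) s + ring_integral sin (A 2) s\<bar> <= 4 * X"
 proof -
  have "(2 * M) * ring_integral (%_. 1) ?N s = 2 * X" by (simp add: X_def)
  then show ?thesis using rb[OF cont_trig(1) ab(1) cA Ab, of 1] rb[OF cont_trig(2) ab(2) cA Ab, of 2] by simp
 qed
 moreover have "6 * M * ring_integral (%_. 1) ?N s = 6 * X" by (simp add: X_def)
 ultimately show ?thesis unfolding 2[OF cont_trig(1)] 2[OF cont_trig(2)] using 1 by simp
qed

text \<open>The test function 1, for which the mean conditions take the place of a test flow: the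
  mean of U over cylinders is identically 0, hence so is its r-derivative; the pressure has mean 0;
  and the transposed part vanishes by \<open>transposed_strain\<close> with g = 1.\<close>

lemma mean_force_zero:
 assumes U: "stokes_system rr U P" and s: "0 <= rr" "rr < s"
  and zm: "!!r t l. r > rr ==> integral {-1..1} (%z. U l (cyl_point r t z)) = 0"
   "!!r t. r > rr ==> integral {-1..1} (%z. P (cyl_point r t z)) = 0"
 shows "ring_integral cos (strain U P i 1) s + ring_integral sin (strain U P i 2) s = 0"
proof -
 let ?S = "exterior_domain rr"
 note cU = C1_onD(2)[OF stokes_systemD(1)[OF U]] C1_onD(2)[OF stokes_systemD(2)[OF U]] C1_onD(2)[OF stokes_systemD(3)[OF U]]
 have z: "ring_integral a (U l) r = 0" "ring_integral a P r = 0" if "r > rr" "continuous_on UNIV a" for a r l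
  using zm[OF that(1)] by (simp_all add: ring_integral_iterated(2)[OF s(1) that(1) _ that(2)] cU)
 define D where "D = (%j x. if i = j then P x else 0 :: real)"
 have cD: "continuous_on ?S (D j)" for j unfolding D_def by (cases "i = j") (auto intro: cU)
 have zD: "ring_integral a (D j) s = 0" if "continuous_on UNIV a" for a j
  unfolding D_def using z(2)[OF s(2) that] by (cases "i = j") (simp_all add: ring_integral_def case_prod_unfold)
 have st: "strain U P i j = (%x. (partial j (U i) x + partial i (U j) x) - D j x)" for j
  by (simp add: strain_def D_def fun_eq_iff)
 have sp: "ring_integral a (strain U P i j) s = ring_integral a (partial j (U i)) s + ring_integral a (partial i (U j)) s"
  if "continuous_on UNIV a" for a j
  unfolding st ring_integral_diff[OF s continuous_on_add[OF cU(2) cU(2)] cD that] ring_integral_add[OF s cU(2) cU(2) that]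
  using zD[OF that] by simp
 have "((%r. 0) has_real_derivative (ring_integral (%t. 1 * cos t) (partial 1 (U i)) s + ring_integral (%t. 1 * sin t) (partial 2 (U i)) s)) (at s)"
 proof (rule has_field_derivative_transform_within_open[OF DERIV_ring_integral[OF stokes_systemD(1)[OF U] s cont_trig(3)]])
  show "open {rr<..}" "s \<in> {rr<..}" using s by auto
  show "ring_integral (%_. 1) (U i) r = 0" if "r \<in> {rr<..}" for r using z(1)[OF _ cont_trig(3)] that by simp
 qed
 from DERIV_unique[OF this DERIV_const]
 have 1: "ring_integral cos (partial 1 (U i)) s + ring_integral sin (partial 2 (U i)) s = 0" by simp
 have g1: "((%_. 1) has_real_derivative 0) (at x)" for x :: real by simp
 have T: "ring_integral cos (partial i (U 1)) s + ring_integral sin (partial i (U 2)) s = 0"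
  using transposed_strain[OF U s g1, of] exhaust_3[of i] by (auto simp: ring_integral_def case_prod_unfold)
 show ?thesis unfolding sp[OF cont_trig(1)] sp[OF cont_trig(2)] using 1 T by simp
qed

subsection \<open>Uniqueness of the force density\<close>

definition arc_integral :: "(real => real) => (real^3 => real) => real => real => real" where
 "arc_integral a F s z = integral {0..2*pi} (%t. a t * F (cyl_point s t z))"

context
 fixes rr s :: real and F :: "real^3 => real" and a :: "real => real"
 assumes s: "0 <= rr" "rr < s" and F: "continuous_on (exterior_domain rr) F" and a: "continuous_on UNIV a"
begin

lemma arc_integral_continuous: "continuous_on UNIV (arc_integral a F s)"
proof -
 have "continuous_on UNIV (%z. integral (cbox 0 (2*pi)) (%t. a t * F (cyl_point s t z)))"
  by (rule integral_continuous_on_param) (rule ring_continuous[OF s F a])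
 then show ?thesis by (simp add: arc_integral_def[abs_def])
qed

lemma arc_set_integrable: "set_integrable lborel {0..2*pi} (%t. a t * F (cyl_point s t z))"
proof (rule borel_integrable_atLeastAtMost')
 show "continuous_on {0..2*pi} (%t. a t * F (cyl_point s t z))"
  using s by (intro continuous_on_mult continuous_on_ring[OF F s(1)] continuous_on_subset[OF a]) (auto intro!: continuous_intros)
qed

lemma arc_integral_eq: "(LBINT t:{0..2*pi}. a t * F (cyl_point s t z)) = arc_integral a F s z"
 unfolding arc_integral_def by (rule set_borel_integral_eq_integral(2)[OF arc_set_integrable])

lemma ring_integral_arc:
 assumes g: "continuous_on UNIV g"
 shows "set_integrable lborel {-1..1} (%z. g z * arc_integral a F s z)"
  and "ring_integral a (%x. g (x$3) * F x) s = (LBINT z:{-1..1}. g z * arc_integral a F s z)"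
proof -
 show i: "set_integrable lborel {-1..1} (%z. g z * arc_integral a F s z)"
  by (rule borel_integrable_atLeastAtMost')
   (intro continuous_on_mult continuous_on_subset[OF g] continuous_on_subset[OF arc_integral_continuous] subset_UNIV)
 have c: "continuous_on (exterior_domain rr) (%x. g (x$3) * F x)"
  by (intro continuous_on_mult F continuous_on_compose2[OF g] continuous_intros) auto
 have "integral {0..2*pi} (%t. a t * (g (cyl_point s t z $ 3) * F (cyl_point s t z))) = g z * arc_integral a F s z" for z
  unfolding arc_integral_def integral_mult_right[symmetric] by (simp add: mult_ac)
 then show "ring_integral a (%x. g (x$3) * F x) s = (LBINT z:{-1..1}. g z * arc_integral a F s z)"
  unfolding ring_integral_iterated(1)[OF s c a] set_borel_integral_eq_integral(2)[OF i] by simp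
qed

end

text \<open>Links the nonnegative Lebesgue integrals in the boundary condition to the integrals over
  cylinders used for differentiation and integration by parts.\<close>

lemma ring_integral_nn:
 assumes s: "0 <= rr" "rr < s" and F: "continuous_on (exterior_domain rr) F" and nn: "!!x. F x >= 0"
 shows "(\<integral>\<^sup>+z\<in>{-1..1}. (\<integral>\<^sup>+t\<in>{0..2*pi}. ennreal (F (cyl_point s t z)) \<partial>lborel) \<partial>lborel)
  = ennreal (ring_integral (%_. 1) F s)"
  and "ring_integral (%_. 1) F s >= 0"
proof -
 note c = s F cont_trig(3)
 have 1: "(\<integral>\<^sup>+t\<in>{0..2*pi}. ennreal (F (cyl_point s t z)) \<partial>lborel) = ennreal (arc_integral (%_. 1) F s z)" for z
  using nn_integral_set_real[OF arc_set_integrable[OF c, of z]] nn arc_integral_eq[OF c, of z] by simp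
 have 2: "arc_integral (%_. 1) F s z >= 0" for z
  unfolding arc_integral_def using nn
  by (cases "(%t. 1 * F (cyl_point s t z)) integrable_on {0..2*pi}") (auto intro: integral_nonneg simp: not_integrable_integral)
 have 3: "ring_integral (%_. 1) F s = (LBINT z:{-1..1}. arc_integral (%_. 1) F s z)"
  using ring_integral_arc(2)[OF c cont_trig(3)] by simp
 have 4: "set_integrable lborel {-1..1} (arc_integral (%_. 1) F s)"
  using ring_integral_arc(1)[OF c cont_trig(3)] by simp
 show "(\<integral>\<^sup>+z\<in>{-1..1}. (\<integral>\<^sup>+t\<in>{0..2*pi}. ennreal (F (cyl_point s t z)) \<partial>lborel) \<partial>lborel)
  = ennreal (ring_integral (%_. 1) F s)"
  unfolding 1 3 by (rule nn_integral_set_real[OF 4 2])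
 show "ring_integral (%_. 1) F s >= 0"
  using ring_integral_bound[OF s F cont_trig(3) F] nn by (auto intro: order_trans[OF abs_ge_zero])
qed

text \<open>The sign comes from the normal pointing into the cylinder, the factor s from the arc
  length.\<close>

lemma circle_force_eq:
 assumes u: "stokes_system rr (%i x. u x $ i) p" "C1_on (exterior_domain rr) u" and s: "0 <= rr" "rr < s"
 shows "circle_force u p s z $ i = - s * (arc_integral cos (strain (%i x. u x $ i) p i 1) s z
   + arc_integral sin (strain (%i x. u x $ i) p i 2) s z)"
proof -
 let ?U = "%i x. u x $ i"
 let ?h = "%t. s *\<^sub>R (stress u p (cyl_point s t z) *v inward_normal t)"
 have st: "stress u p x $ k $ j = strain ?U p k j x" if "x \<in> exterior_domain rr" for x k j
  by (simp add: stress_def strain_def jacobian_nth[OF u(2) that] transpose_def mat_def)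
 have h: "?h t $ k = - s * (cos t * strain ?U p k 1 (cyl_point s t z) + sin t * strain ?U p k 2 (cyl_point s t z))" for t k
  by (simp add: matrix_vector_mult_def sum_3 st[OF cyl_point_exterior[OF s]] inward_normal_def algebra_simps)
 note c = s continuous_on_strain[OF u(1)]
 have i: "set_integrable lborel {0..2*pi} ?h"
 proof (rule borel_integrable_atLeastAtMost')
  have "continuous_on {0..2*pi} (%t. \<chi> k. ?h t $ k)"
   unfolding h using s
   by (intro continuous_on_vec_lambda continuous_on_mult continuous_on_add continuous_on_const
     continuous_on_ring[OF c(3) s(1)] continuous_on_cos continuous_on_sin continuous_on_id) auto
  then show "continuous_on {0..2*pi} ?h" by (simp only: vec_lambda_eta)
 qed
 have "circle_force u p s z $ i = (LBINT t:{0..2*pi}. ?h t $ i)"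
  unfolding circle_force_def by (rule set_integral_vec_nth(2)[OF i])
 also have "... = - s * ((LBINT t:{0..2*pi}. cos t * strain ?U p i 1 (cyl_point s t z)) + (LBINT t:{0..2*pi}. sin t * strain ?U p i 2 (cyl_point s t z)))"
  unfolding h set_integral_mult_right
   set_integral_add(2)[OF arc_set_integrable[OF c cont_trig(1)] arc_set_integrable[OF c cont_trig(2)]] ..
 finally show ?thesis
  unfolding arc_integral_eq[OF c cont_trig(1)] arc_integral_eq[OF c cont_trig(2)] .
qed

lemma circle_force_continuous:
 assumes u: "stokes_system rr (%i x. u x $ i) p" "C1_on (exterior_domain rr) u" and s: "0 <= rr" "rr < s"
 shows "continuous_on UNIV (%z. circle_force u p s z $ i)"
 unfolding circle_force_eq[OF assms]
 by (intro continuous_on_mult continuous_on_add continuous_on_const arc_integral_continuous[OF s continuous_on_strain[OF u(1)]] cont_trig)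

lemma circle_force_pairing:
 assumes u: "stokes_system rr (%i x. u x $ i) p" "C1_on (exterior_domain rr) u" and s: "0 <= rr" "rr < s"
  and g: "continuous_on UNIV g"
 shows "(LBINT z:{-1..1}. g z * circle_force u p s z $ i) =
  - s * (ring_integral cos (%x. g (x$3) * strain (%i x. u x $ i) p i 1 x) s
   + ring_integral sin (%x. g (x$3) * strain (%i x. u x $ i) p i 2 x) s)"
proof -
 note c = s continuous_on_strain[OF u(1)]
 note r = ring_integral_arc[OF c _ g]
 have e: "g z * circle_force u p s z $ i = - s * (g z * arc_integral cos (strain (%i x. u x $ i) p i 1) s z
   + g z * arc_integral sin (strain (%i x. u x $ i) p i 2) s z)" for z
  unfolding circle_force_eq[OF u s] by (simp add: algebra_simps)
 show ?thesis
  unfolding e set_integral_mult_right set_integral_add(2)[OF r(1)[OF cont_trig(1)] r(1)[OF cont_trig(2)]]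
   r(2)[OF cont_trig(1)] r(2)[OF cont_trig(2)] ..
qed

text \<open>t is first fixed as a small multiple of the wanted error, and then E(s) is small
  compared with t. In this form L^2 convergence yields convergence of integrals without square
  roots.\<close>

lemma weighted_tendsto_zero:
 fixes X E :: "real => real"
 assumes ev: "\<forall>\<^sub>F s in G. \<forall>t>0. \<bar>X s\<bar> <= B * (t + E s / (2 * t))" and E: "(E \<longlongrightarrow> 0) G" and B: "B >= 0"
 shows "(X \<longlongrightarrow> 0) G"
proof (rule tendstoI)
 fix e :: real assume e: "e > 0"
 define b where "b = B + 1"
 define t where "t = e / (2 * b)"
 have b: "b > 0" "B <= b" using B by (auto simp: b_def)
 have t: "t > 0" using e b by (simp add: t_def)
 have Bt: "B * t <= e / 2"
 proof -
  have "B * t <= b * t" using t b by simp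
  also have "... = e / 2" using b by (simp add: t_def)

  finally show ?thesis .
 qed
 have "((%s. B * (E s / (2 * t))) \<longlongrightarrow> B * (0 / (2 * t))) G"
  by (intro tendsto_mult tendsto_divide tendsto_const E) (use t in simp)
 then have "\<forall>\<^sub>F s in G. B * (E s / (2 * t)) < e / 2" 
  by (rule order_tendstoD(2)) (use e in simp)
 then show "\<forall>\<^sub>F s in G. dist (X s) 0 < e"
  using ev
 proof eventually_elim
  case (elim s)
  have "\<bar>X s\<bar> <= B * t + B * (E s / (2 * t))" using elim(2) t by (simp add: distrib_left)
  then show ?case using elim(1) Bt unfolding dist_real_def by argo
 qed
qed

lemma in_L2_component:
 fixes f :: "real => real^3"
 assumes "in_L2 f" shows "sq_integrable (%z. f z $ i)"
 unfolding sq_integrable_def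
proof
 have f: "f \<in> borel_measurable lborel" "set_integrable lborel {-1..1} (%z. (norm (f z))\<^sup>2)"
  using assms by (auto simp: in_L2_def)
 show m: "(%z. f z $ i) \<in> borel_measurable borel"
  using borel_measurable_continuous_on[OF continuous_on_component[OF continuous_on_id] f(1), of i] by simp
 show "set_integrable lborel {-1..1} (%z. (f z $ i)\<^sup>2)"
 proof (rule set_integrable_bound[OF f(2)])
  show "set_borel_measurable lborel {-1..1} (%z. (f z $ i)\<^sup>2)"
   unfolding set_borel_measurable_def using m by measurable
  show "AE z in lborel. z \<in> {-1..1} --> norm ((f z $ i)\<^sup>2) <= norm ((norm (f z))\<^sup>2)"
   using component_le_norm_cart by (auto simp: abs_le_square_iff[symmetric])
 qed
qed

lemma tendsto_of_ennreal_bound: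
 fixes E :: "real => real"
 assumes "(H \<longlongrightarrow> 0) G" "\<forall>\<^sub>F s in G. E s >= 0 & ennreal (E s) <= H s"
 shows "(E \<longlongrightarrow> 0) G"
proof -
 have "((%s. ennreal (E s)) \<longlongrightarrow> 0) G"
  by (rule tendsto_sandwich[OF _ _ tendsto_const assms(1)]) (use assms(2) in \<open>auto elim: eventually_mono\<close>)
 then have "((%s. ennreal (E s)) \<longlongrightarrow> ennreal 0) G" by simp
 moreover have "\<forall>\<^sub>F s in G. E s >= 0" using assms(2) by (rule eventually_mono) simp
 ultimately show ?thesis by (subst (asm) tendsto_ennreal_iff) auto
qed

text \<open>The circle force tends to f in L^2, so its component i converges when integrated against
  a bounded continuous g, by \<open>integral_abs_le\<close> and
  \<open>weighted_tendsto_zero\<close>.\<close>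

lemma pairing_tendsto:
 assumes f: "is_force_density rr u p f" and rho: "0 <= rr"
  and u: "stokes_system rr (%i x. u x $ i) p" "C1_on (exterior_domain rr) u"
  and g: "continuous_on UNIV g" "!!z. \<bar>g z\<bar> <= B"
 shows "((%s. LBINT z:{-1..1}. g z * circle_force u p s z $ i) \<longlongrightarrow> (LBINT z:{-1..1}. g z * f z $ i)) (at_right rr)"
proof -
 define d where "d = (%s z. circle_force u p s z $ i - f z $ i)"
 have fL: "in_L2 f" and lim: "((%r. \<integral>\<^sup>+z\<in>{-1..1}. ennreal ((norm (circle_force u p r z - f z))\<^sup>2) \<partial>lborel) \<longlongrightarrow> 0) (at_right rr)"
  using f by (auto simp: is_force_density_def)
 have ev: "\<forall>\<^sub>F s in at_right rr. s > rr" by (simp add: eventually_at_right_less)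
 have sf: "sq_integrable (%z. circle_force u p s z $ i)" if "s > rr" for s
  by (rule sq_integrable_continuous[OF circle_force_continuous[OF u rho that]])
 have sd: "sq_integrable (d s)" if "s > rr" for s
  unfolding d_def by (rule sq_integrable_diff[OF sf[OF that] in_L2_component[OF fL]])
 have sg: "sq_integrable g" by (rule sq_integrable_continuous[OF g(1)])
 let ?E = "%s. LBINT z:{-1..1}. (d s z)\<^sup>2"
 have E: "(?E \<longlongrightarrow> 0) (at_right rr)"
 proof (rule tendsto_of_ennreal_bound[OF lim])
  show "\<forall>\<^sub>F s in at_right rr. 0 <= ?E s & ennreal (?E s) <= (\<integral>\<^sup>+z\<in>{-1..1}. ennreal ((norm (circle_force u p s z - f z))\<^sup>2) \<partial>lborel)"
   using ev
  proof eventually_elim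
   case (elim s)
   have i: "set_integrable lborel {-1..1} (%z. (d s z)\<^sup>2)" using sd[OF elim] by (simp add: sq_integrable_def)
   have "ennreal (?E s) = (\<integral>\<^sup>+z\<in>{-1..1}. ennreal ((d s z)\<^sup>2) \<partial>lborel)"
    by (rule nn_integral_set_real[OF i, symmetric]) simp
   also have "... <= (\<integral>\<^sup>+z\<in>{-1..1}. ennreal ((norm (circle_force u p s z - f z))\<^sup>2) \<partial>lborel)"
   proof (intro nn_integral_mono mult_right_mono ennreal_leI)
    fix z
    have "\<bar>d s z\<bar> <= norm (circle_force u p s z - f z)"
     using component_le_norm_cart[of "circle_force u p s z - f z" i] by (simp add: d_def)
    then show "(d s z)\<^sup>2 <= (norm (circle_force u p s z - f z))\<^sup>2"
     using abs_le_square_iff[of "d s z" "norm (circle_force u p s z - f z)"] by simp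
   qed simp
   finally show ?case
    by (auto simp: set_lebesgue_integral_def intro!: Bochner_Integration.integral_nonneg)
  qed
 qed
 have B: "B >= 0" using g(2)[of 0] abs_ge_zero[of "g 0"] by linarith
 have "((%s. LBINT z:{-1..1}. g z * d s z) \<longlongrightarrow> 0) (at_right rr)"
 proof (rule weighted_tendsto_zero[OF _ E B])
  show "\<forall>\<^sub>F s in at_right rr. \<forall>t>0. \<bar>LBINT z:{-1..1}. g z * d s z\<bar> <= B * (t + ?E s / (2 * t))"
   using ev
  proof (eventually_elim, intro allI impI)
   fix s t :: real assume s: "rr < s" and t: "t > 0"
   have i: "set_integrable lborel {-1..1} (%z. g z * d s z)" by (rule sq_integrable_mult[OF sg sd[OF s]])
   have "\<bar>LBINT z:{-1..1}. g z * d s z\<bar> <= (LBINT z:{-1..1}. \<bar>g z * d s z\<bar>)"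
    using set_integral_norm_bound[OF i] by simp
   also have "... <= (LBINT z:{-1..1}. B * \<bar>d s z\<bar>)"
    using set_integrable_abs[OF i] set_integrable_abs[OF sq_integrable_integrable[OF sd[OF s]]]
    by (intro set_integral_mono) (auto simp: abs_mult intro!: mult_right_mono g(2))
   also have "... = B * (LBINT z:{-1..1}. \<bar>d s z\<bar>)" by simp
   also have "... <= B * (t + ?E s / (2 * t))"
    by (intro mult_left_mono integral_abs_le[OF sd[OF s] t] B)
   finally show "\<bar>LBINT z:{-1..1}. g z * d s z\<bar> <= B * (t + ?E s / (2 * t))" .
  qed
 qed
 moreover have "\<forall>\<^sub>F s in at_right rr. (LBINT z:{-1..1}. g z * d s z)
   = (LBINT z:{-1..1}. g z * circle_force u p s z $ i) - (LBINT z:{-1..1}. g z * f z $ i)"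
  using ev
 proof eventually_elim
  case (elim s)
  show ?case
   unfolding d_def right_diff_distrib
   by (rule set_integral_diff(2)[OF sq_integrable_mult[OF sg sf[OF elim]] sq_integrable_mult[OF sg in_L2_component[OF fL]]])
 qed
 ultimately have "((%s. (LBINT z:{-1..1}. g z * circle_force u p s z $ i) - (LBINT z:{-1..1}. g z * f z $ i)) \<longlongrightarrow> 0) (at_right rr)"
  by (rule Lim_transform_eventually)
 then show ?thesis by (rule LIM_zero_cancel)
qed

lemma stokes_system_diff:
 assumes U: "stokes_system rr U P" and V: "stokes_system rr V Q"
 shows "stokes_system rr (%i x. U i x - V i x) (%x. P x - Q x)"
  and "x \<in> exterior_domain rr ==> strain (%i x. U i x - V i x) (%x. P x - Q x) i j x = strain U P i j x - strain V Q i j x"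
proof -
 let ?S = "exterior_domain rr"
 note u = stokes_systemD[OF U] and v = stokes_systemD[OF V]
 have p1: "partial j (%x. U i x - V i x) x = partial j (U i) x - partial j (V i) x" if "x \<in> ?S" for i j x
  by (rule C1_on_diff(1)[OF u(1) v(1) that])
 have C: "C1_on ?S (partial j (%x. U i x - V i x))" for i j
  by (rule C1_on_cong[OF open_exterior_domain p1 C1_on_diff(2)[OF u(2) v(2)]])
 have p2: "partial j (partial j (%x. U i x - V i x)) x = partial j (partial j (U i)) x - partial j (partial j (V i)) x"
  if "x \<in> ?S" for i j x
  using partial_cong_open(2)[OF open_exterior_domain that p1 C1_onD(1)[OF C1_on_diff(2)[OF u(2) v(2)] that]]
   C1_on_diff(1)[OF u(2) v(2) that] by simp
 have pP: "partial i (%x. P x - Q x) x = partial i P x - partial i Q x" if "x \<in> ?S" for i x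
  by (rule C1_on_diff(1)[OF u(3) v(3) that])
 show "stokes_system rr (%i x. U i x - V i x) (%x. P x - Q x)"
  unfolding stokes_system_def
 proof (intro conjI allI ballI)
  fix x i assume x: "x \<in> ?S"
  show "partial 1 (partial 1 (%x. U i x - V i x)) x + partial 2 (partial 2 (%x. U i x - V i x)) x +
    partial 3 (partial 3 (%x. U i x - V i x)) x = partial i (%x. P x - Q x) x"
   using u(7)[OF x, of i] v(7)[OF x, of i] by (simp add: p2[OF x] pP[OF x])
 next
  fix x assume x: "x \<in> ?S"
  show "partial 1 (%x. U 1 x - V 1 x) x + partial 2 (%x. U 2 x - V 2 x) x + partial 3 (%x. U 3 x - V 3 x) x = 0"
   using u(8)[OF x] v(8)[OF x] by (simp add: p1[OF x])
 qed (use u v C C1_on_diff(2) in auto)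
 show "strain (%i x. U i x - V i x) (%x. P x - Q x) i j x = strain U P i j x - strain V Q i j x" if "x \<in> ?S"
  by (simp add: strain_def p1[OF that])
qed

text \<open>What is kept of the decay of a flow: boundedness far out suffices because the test flow
  decays faster than any power of the radius.\<close>

definition tame :: "(3 => real^3 => real) => (real^3 => real) => bool" where
 "tame U P \<longleftrightarrow> (\<exists>r0. \<forall>x. r0 <= cyl_radius x --> (\<forall>i. \<bar>U i x\<bar> <= 1) & \<bar>P x\<bar> <= 1)"

text \<open>M is uniform over the radii s between \<epsilon> and 2 \<epsilon> and over all tame
  flows, so the estimate survives the limit in which s decreases to \<epsilon>.\<close>

definition force_kernel_bound :: "real => (real => real) => 3 => real => bool" where
 "force_kernel_bound ee g i M \<longleftrightarrow> (\<forall>s U P. ee < s --> s <= 2 * ee --> stokes_system ee U P --> tame U P -->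
   \<bar>ring_integral cos (%x. g (x$3) * strain U P i 1 x) s + ring_integral sin (%x. g (x$3) * strain U P i 2 x) s\<bar>
   <= M * ring_integral (%_. 1) (%x. \<bar>U 1 x\<bar> + \<bar>U 2 x\<bar> + \<bar>U 3 x\<bar>) s)"

lemma stokes_solution_tame_diff:
 assumes "stokes_solution ee v u p" "stokes_solution ee v' u' p'"
 shows "tame (%i x. u x $ i - u' x $ i) (%x. p x - p' x)"
proof -
 have h: "\<forall>\<^sub>F x in filtercomap cyl_radius at_top. norm (f x) < 1/2"
  if "(f \<longlongrightarrow> 0) (filtercomap cyl_radius at_top)" for f :: "real^3 => 'a::real_normed_vector"
  using tendstoD[OF that, of "1/2"] by (simp add: dist_norm)
 have "\<forall>\<^sub>F x in filtercomap cyl_radius at_top. (\<forall>i. \<bar>u x $ i - u' x $ i\<bar> <= 1) & \<bar>p x - p' x\<bar> <= 1"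
 proof -
  have "(u \<longlongrightarrow> 0) (filtercomap cyl_radius at_top)" "(p \<longlongrightarrow> 0) (filtercomap cyl_radius at_top)"
   "(u' \<longlongrightarrow> 0) (filtercomap cyl_radius at_top)" "(p' \<longlongrightarrow> 0) (filtercomap cyl_radius at_top)"
   using assms by (auto simp: stokes_solution_def)
  from this[THEN h] show ?thesis
  proof eventually_elim
   case (elim x)
   have "\<bar>u x $ i - u' x $ i\<bar> <= 1" for i
    using component_le_norm_cart[of "u x" i] component_le_norm_cart[of "u' x" i] elim by arith
   then show ?case using elim by auto
  qed
 qed
 then show ?thesis unfolding tame_def eventually_filtercomap_at_top_linorder by blast
qed

lemma abs_le_weighted: "\<bar>a\<bar> <= t + a\<^sup>2 / (2 * t)" if "t > 0" for a t :: real
proof -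
 have "0 <= (\<bar>a\<bar> - t)\<^sup>2" by simp
 then have "2 * t * \<bar>a\<bar> <= a\<^sup>2 + t\<^sup>2 + 0" by (simp add: power2_diff algebra_simps)
 also have "... <= 2 * t * (t + a\<^sup>2 / (2 * t))" using that by (simp add: field_simps power2_eq_square)
 finally show ?thesis using that by simp
qed

text \<open>Both velocities approach the same v in L^2 on the shrinking cylinders, so v drops out by
  the triangle inequality; the passage to L^1 uses \<open>weighted_tendsto_zero\<close>.\<close>

lemma boundary_difference_tendsto:
 assumes e: "ee >= 0" and v: "v \<in> borel_measurable borel"
  and S: "stokes_solution ee v u p" "stokes_solution ee v u' p'"
 shows "((%s. ring_integral (%_. 1) (%x. \<bar>u x $ 1 - u' x $ 1\<bar> + \<bar>u x $ 2 - u' x $ 2\<bar> + \<bar>u x $ 3 - u' x $ 3\<bar>) s) \<longlongrightarrow> 0) (at_right ee)"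
proof -
 let ?S = "exterior_domain ee"
 let ?nn = "%f. \<integral>\<^sup>+z\<in>{-1..1}. (\<integral>\<^sup>+t\<in>{0..2*pi}. ennreal (f t z) \<partial>lborel) \<partial>lborel"
 let ?a = "%s t z. (norm (u (cyl_point s t z) - v z))\<^sup>2"
 let ?b = "%s t z. (norm (u' (cyl_point s t z) - v z))\<^sup>2"
 let ?D = "%x. (norm (u x - u' x))\<^sup>2"
 let ?N = "%x. \<bar>u x $ 1 - u' x $ 1\<bar> + \<bar>u x $ 2 - u' x $ 2\<bar> + \<bar>u x $ 3 - u' x $ 3\<bar>"
 have cu: "continuous_on ?S u" "continuous_on ?S u'"
  using stokes_solution_system(2)[OF S(1)] stokes_solution_system(2)[OF S(2)] by (auto intro: C1_onD(2))
 have cD: "continuous_on ?S ?D" by (intro continuous_intros cu)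
 have cN: "continuous_on ?S ?N" by (intro continuous_intros cu)
 have ev: "\<forall>\<^sub>F s in at_right ee. s > ee" by (simp add: eventually_at_right_less)
 let ?E = "ring_integral (%_. 1) ?D"
 have "((%s. 2 * ?nn (?a s) + 2 * ?nn (?b s)) \<longlongrightarrow> 2 * 0 + 2 * 0) (at_right ee)"
  using S unfolding stokes_solution_def by (intro tendsto_add ennreal_tendsto_cmult) auto
 then have lim: "((%s. 2 * ?nn (?a s) + 2 * ?nn (?b s)) \<longlongrightarrow> 0) (at_right ee)" by simp
 have E: "(?E \<longlongrightarrow> 0) (at_right ee)"
 proof (rule tendsto_of_ennreal_bound[OF lim])
  show "\<forall>\<^sub>F s in at_right ee. 0 <= ?E s & ennreal (?E s) <= 2 * ?nn (?a s) + 2 * ?nn (?b s)"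
   using ev
  proof eventually_elim
   case (elim s)
   have mu: "(%q. w (cyl_point s (snd q) (fst q))) \<in> borel_measurable (lborel \<Otimes>\<^sub>M lborel)"
    if "continuous_on ?S w" for w :: "real^3 => real^3"
   proof -
    have "continuous_on UNIV (%q. w (cyl_point s (snd q) (fst q)))"
     by (rule continuous_on_ring[OF that e]) (use elim in \<open>auto intro!: continuous_intros\<close>)
    then have "(%q. w (cyl_point s (snd q) (fst q))) \<in> borel_measurable borel"
     by (rule borel_measurable_continuous_onI)
    then show ?thesis by (simp add: lborel_prod)
   qed
   have vm: "(%q. v (fst q)) \<in> borel_measurable (lborel \<Otimes>\<^sub>M (lborel :: real measure))"
    using v by (intro measurable_compose[OF measurable_fst]) simp
   have ma: "(%(z, t). ennreal (?a s t z) * indicator {0..2*pi} t) \<in> borel_measurable (lborel \<Otimes>\<^sub>M lborel)"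
    "(%(z, t). ennreal (?b s t z) * indicator {0..2*pi} t) \<in> borel_measurable (lborel \<Otimes>\<^sub>M lborel)"
    unfolding case_prod_unfold using mu[OF cu(1)] mu[OF cu(2)] vm by measurable
   have ma1: "(%t. ennreal (?a s t z) * indicator {0..2*pi} t) \<in> borel_measurable lborel"
    "(%t. ennreal (?b s t z) * indicator {0..2*pi} t) \<in> borel_measurable lborel" for z
    using measurable_compose[OF measurable_Pair1'[of z lborel lborel] ma(1)] measurable_compose[OF measurable_Pair1'[of z lborel lborel] ma(2)]
    by simp_all
   have ma2: "(%z. (\<integral>\<^sup>+t\<in>{0..2*pi}. ennreal (?a s t z) \<partial>lborel) * indicator {-1..1} z) \<in> borel_measurable lborel"
    "(%z. (\<integral>\<^sup>+t\<in>{0..2*pi}. ennreal (?b s t z) \<partial>lborel) * indicator {-1..1} z) \<in> borel_measurable lborel"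
    using lborel.borel_measurable_nn_integral[OF ma(1)] lborel.borel_measurable_nn_integral[OF ma(2)]
    by (auto intro!: borel_measurable_times_ennreal borel_measurable_indicator)
   have pt: "ennreal (?D (cyl_point s t z)) <= 2 * ennreal (?a s t z) + 2 * ennreal (?b s t z)" for t z
   proof -
    have q: "(norm (x - y))\<^sup>2 <= 2 * (norm (x - w))\<^sup>2 + 2 * (norm (y - w))\<^sup>2" for x y w :: "real^3"
    proof -
     have "norm (x - y) <= norm (x - w) + norm (y - w)"
      using norm_triangle_ineq4[of "x - w" "y - w"] by simp
     then have "(norm (x - y))\<^sup>2 <= (norm (x - w) + norm (y - w))\<^sup>2" by (intro power_mono) auto
     also have "... <= 2 * (norm (x - w))\<^sup>2 + 2 * (norm (y - w))\<^sup>2"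
      using sum_squares_bound[of "norm (x - w)" "norm (y - w)"] by (simp add: power2_sum)
     finally show ?thesis .
    qed
    have "ennreal (?D (cyl_point s t z)) <= ennreal (2 * ?a s t z + 2 * ?b s t z)" by (intro ennreal_leI q)
    moreover have "ennreal (2 * x + 2 * y) = 2 * ennreal x + 2 * ennreal y" if "x >= 0" "y >= 0" for x y
     using that by (simp add: ennreal_plus ennreal_mult)
    ultimately show ?thesis by simp
   qed
   have "ennreal (?E s) = ?nn (%t z. ?D (cyl_point s t z))"
    by (rule ring_integral_nn(1)[OF e elim cD, symmetric]) simp
   also have "... <= (\<integral>\<^sup>+z\<in>{-1..1}. (2 * (\<integral>\<^sup>+t\<in>{0..2*pi}. ennreal (?a s t z) \<partial>lborel) + 2 * (\<integral>\<^sup>+t\<in>{0..2*pi}. ennreal (?b s t z) \<partial>lborel)) \<partial>lborel)"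
   proof (intro nn_integral_mono mult_right_mono)
    fix z
    have "(\<integral>\<^sup>+t\<in>{0..2*pi}. ennreal (?D (cyl_point s t z)) \<partial>lborel)
      <= (\<integral>\<^sup>+t. 2 * (ennreal (?a s t z) * indicator {0..2*pi} t) + 2 * (ennreal (?b s t z) * indicator {0..2*pi} t) \<partial>lborel)"
     using pt by (intro nn_integral_mono) (auto simp: indicator_def)
    also have "... = 2 * (\<integral>\<^sup>+t\<in>{0..2*pi}. ennreal (?a s t z) \<partial>lborel) + 2 * (\<integral>\<^sup>+t\<in>{0..2*pi}. ennreal (?b s t z) \<partial>lborel)"
     using ma1[of z] by (simp add: nn_integral_add nn_integral_cmult)
    finally show "(\<integral>\<^sup>+t\<in>{0..2*pi}. ennreal (?D (cyl_point s t z)) \<partial>lborel)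
     <= 2 * (\<integral>\<^sup>+t\<in>{0..2*pi}. ennreal (?a s t z) \<partial>lborel) + 2 * (\<integral>\<^sup>+t\<in>{0..2*pi}. ennreal (?b s t z) \<partial>lborel)" .
   qed simp
   also have "... = 2 * ?nn (?a s) + 2 * ?nn (?b s)"
    using ma2 by (simp add: distrib_right mult.assoc nn_integral_add nn_integral_cmult)
   finally show ?case using ring_integral_nn(2)[OF e elim cD] by simp
  qed
 qed
 \<comment> \<open>The sum of the components is at most 3 (t + D/(2 t)). Integration over a
   parameter region of area 4 pi gives the constants 12 pi for t and 3 for the integrated D/(2 t),
   and 12 pi + 3 dominates both.\<close>
 show ?thesis
 proof (rule weighted_tendsto_zero[OF _ E, of _ "12 * pi + 3"])
  show "\<forall>\<^sub>F s in at_right ee. \<forall>t>0. \<bar>ring_integral (%_. 1) ?N s\<bar> <= (12 * pi + 3) * (t + ?E s / (2 * t))"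
   using ev
  proof (eventually_elim, intro allI impI)
   fix s t :: real assume s: "ee < s" and t: "t > 0"
   note c = cont_trig(3)
   have "\<bar>ring_integral (%_. 1) ?N s\<bar> <= ring_integral (%_. 1) (%x. 3 * t + (3 / (2 * t)) * ?D x) s"
   proof (rule ring_integral_bound[OF e s cN c])
    show "continuous_on ?S (%x. 3 * t + (3 / (2 * t)) * ?D x)" by (intro continuous_intros cu)
    fix th z
    let ?x = "cyl_point s th z"
    have "\<bar>u ?x $ i - u' ?x $ i\<bar> <= t + ?D ?x / (2 * t)" for i
     using component_le_norm_cart[of "u ?x - u' ?x" i] abs_le_weighted[OF t, of "norm (u ?x - u' ?x)"] by simp
    from this[of 1] this[of 2] this[of 3]
    have "?N ?x <= 3 * (t + ?D ?x / (2 * t))" by simp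
    then show "\<bar>1 * ?N ?x\<bar> <= 3 * t + (3 / (2 * t)) * ?D ?x" by (simp add: algebra_simps)
   qed
   also have "... = 4 * pi * (3 * t) + (3 / (2 * t)) * ?E s"
    unfolding ring_integral_add[OF e s continuous_on_const continuous_on_mult[OF continuous_on_const cD] c]
     ring_integral_const[OF e s] ring_integral_cmult[OF e s] ..
   also have "... <= (12 * pi + 3) * (t + ?E s / (2 * t))"
   proof -
    have "4 * pi * (3 * a) + (3 / (2 * b)) * x <= (12 * pi + 3) * (a + x / (2 * b))"
     if "0 <= a" "0 <= x / (2 * b)" for a b x :: real
    proof -
     have "0 <= 12 * pi * (x / (2 * b))" using that(2) by (intro mult_nonneg_nonneg) auto
     then have "4 * pi * (3 * a) + 3 * (x / (2 * b)) <= (12 * pi + 3) * (a + x / (2 * b))"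
      using that(1) unfolding distrib_left distrib_right by simp
     then show ?thesis by simp
    qed
    moreover have "?E s / (2 * t) >= 0" using ring_integral_nn(2)[OF e s cD] t by simp
    ultimately show ?thesis using t by simp
   qed
   finally show "\<bar>ring_integral (%_. 1) ?N s\<bar> <= (12 * pi + 3) * (t + ?E s / (2 * t))" .
  qed
  show "12 * pi + 3 >= 0" using pi_gt_zero by simp
 qed
qed

text \<open>The difference of the solutions is a tame Stokes system. Its force pairing at radius s
  is at most s M times the L^1 norm of its velocity on that cylinder, which tends to 0, while the
  pairings converge to those of f and f'.\<close>

lemma force_density_pairing_unique:
 assumes e: "ee > 0" and v: "v \<in> borel_measurable borel"
  and S: "stokes_solution ee v u p" "stokes_solution ee v u' p'"
  and f: "is_force_density ee u p f" "is_force_density ee u' p' f'"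
  and g: "continuous_on UNIV g" "!!z. \<bar>g z\<bar> <= B" and K: "force_kernel_bound ee g i M"
 shows "(LBINT z:{-1..1}. g z * f z $ i) = (LBINT z:{-1..1}. g z * f' z $ i)"
proof -
 note s1 = stokes_solution_system[OF S(1)] and s2 = stokes_solution_system[OF S(2)]
 let ?U = "%i x. u x $ i" and ?V = "%i x. u' x $ i"
 let ?W = "%i x. u x $ i - u' x $ i" and ?P = "%x. p x - p' x"
 let ?\<Phi> = "%s. (LBINT z:{-1..1}. g z * circle_force u p s z $ i) - (LBINT z:{-1..1}. g z * circle_force u' p' s z $ i)"
 let ?N = "ring_integral (%_. 1) (%x. \<bar>u x $ 1 - u' x $ 1\<bar> + \<bar>u x $ 2 - u' x $ 2\<bar> + \<bar>u x $ 3 - u' x $ 3\<bar>)"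
 have e0: "0 <= ee" using e by simp
 have cg: "continuous_on (exterior_domain ee) (%x. g (x$3) * strain X Y i j x)" if "stokes_system ee X Y" for X Y j
  by (intro continuous_on_mult continuous_on_strain[OF that] continuous_on_compose2[OF g(1)] continuous_intros) auto
 have lim: "(?\<Phi> \<longlongrightarrow> (LBINT z:{-1..1}. g z * f z $ i) - (LBINT z:{-1..1}. g z * f' z $ i)) (at_right ee)"
  by (intro tendsto_diff pairing_tendsto[OF f(1) e0 s1 g] pairing_tendsto[OF f(2) e0 s2 g])
 have "(?\<Phi> \<longlongrightarrow> 0) (at_right ee)"
 proof (rule Lim_null_comparison)
  have "((%s. s * (M * ?N s)) \<longlongrightarrow> ee * (M * 0)) (at_right ee)"
   by (intro tendsto_mult tendsto_const tendsto_ident_at boundary_difference_tendsto[OF e0 v S])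
  then show "((%s. s * (M * ?N s)) \<longlongrightarrow> 0) (at_right ee)" by simp
  have "\<forall>\<^sub>F s in at_right ee. s \<in> {ee<..<2 * ee}" using e by (intro eventually_at_right_real) simp
  then show "\<forall>\<^sub>F s in at_right ee. norm (?\<Phi> s) <= s * (M * ?N s)"
  proof eventually_elim
   case (elim s)
   then have s: "ee < s" "s <= 2 * ee" by auto
   note r = e0 s(1)
   have d: "ring_integral a (%x. g (x$3) * strain ?W ?P i j x) s
     = ring_integral a (%x. g (x$3) * strain ?U p i j x) s - ring_integral a (%x. g (x$3) * strain ?V p' i j x) s"
    if "continuous_on UNIV a" for a j
   proof -
    have "ring_integral a (%x. g (x$3) * strain ?W ?P i j x) s
     = ring_integral a (%x. g (x$3) * strain ?U p i j x - g (x$3) * strain ?V p' i j x) s"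
     by (rule ring_integral_cong[OF r])
      (simp add: stokes_system_diff(2)[OF s1(1) s2(1) cyl_point_exterior[OF r]] right_diff_distrib)
    then show ?thesis using ring_integral_diff[OF r cg[OF s1(1)] cg[OF s2(1)] that] by simp
   qed
   have k: "\<bar>ring_integral cos (%x. g (x$3) * strain ?W ?P i 1 x) s + ring_integral sin (%x. g (x$3) * strain ?W ?P i 2 x) s\<bar> <= M * ?N s"
    using K s stokes_system_diff(1)[OF s1(1) s2(1)] stokes_solution_tame_diff[OF S]
    unfolding force_kernel_bound_def by blast
   have "?\<Phi> s = - s * (ring_integral cos (%x. g (x$3) * strain ?W ?P i 1 x) s + ring_integral sin (%x. g (x$3) * strain ?W ?P i 2 x) s)"
    unfolding circle_force_pairing[OF s1 r g(1)] circle_force_pairing[OF s2 r g(1)] d[OF cont_trig(1)] d[OF cont_trig(2)]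
    by (simp add: algebra_simps)
   then have "norm (?\<Phi> s) = s * \<bar>ring_integral cos (%x. g (x$3) * strain ?W ?P i 1 x) s + ring_integral sin (%x. g (x$3) * strain ?W ?P i 2 x) s\<bar>"
    using s e by (simp add: abs_mult)
   then show ?case using k s e by simp
  qed
 qed
 from tendsto_unique[OF _ lim this] show ?thesis by simp
qed

text \<open>Frequency zero is not a mode and has no kernel bound; here the pairing with 1 vanishes
  on every cylinder and so does its limit.\<close>

lemma force_density_mean_zero:
 assumes e: "ee >= 0" and S: "stokes_solution ee v u p" and f: "is_force_density ee u p f"
 shows "(LBINT z:{-1..1}. f z $ i) = 0"
proof -
 note s1 = stokes_solution_system[OF S]
 have zm: "zero_mean (%z. u (cyl_point r t z))" "zero_mean (%z. p (cyl_point r t z))" if "r > ee" for r t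
  using S that by (auto simp: stokes_solution_def)
 have cz: "continuous_on {-1..1} (%z. w (cyl_point r t z))" if "r > ee" "continuous_on (exterior_domain ee) w"
  for r t and w :: "real^3 => 'a::real_normed_vector"
  by (rule continuous_on_ring[OF that(2) e]) (use that in \<open>auto intro!: continuous_intros\<close>)
 have iu: "set_integrable lborel {-1..1} (%z. u (cyl_point r t z))" "set_integrable lborel {-1..1} (%z. p (cyl_point r t z))"
  if "r > ee" for r t
  by (intro borel_integrable_atLeastAtMost' cz[OF that] C1_onD(2)[OF s1(2)] C1_onD(2)[OF stokes_systemD(3)[OF s1(1)]])+
 have z1: "integral {-1..1} (%z. u (cyl_point r t z) $ l) = 0" if "r > ee" for r t l
  using zm(1)[OF that, of t] set_integral_vec_nth[OF iu(1)[OF that], of t l]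
  by (simp add: zero_mean_def set_borel_integral_eq_integral(2)[OF set_integral_vec_nth(1)[OF iu(1)[OF that]]])
 have z2: "integral {-1..1} (%z. p (cyl_point r t z)) = 0" if "r > ee" for r t
  using zm(2)[OF that, of t] by (simp add: zero_mean_def set_borel_integral_eq_integral(2)[OF iu(2)[OF that]])
 have c1: "continuous_on UNIV (%_::real. 1::real)" by simp
 have "((%s. LBINT z:{-1..1}. 1 * circle_force u p s z $ i) \<longlongrightarrow> (LBINT z:{-1..1}. 1 * f z $ i)) (at_right ee)"
  by (rule pairing_tendsto[OF f e s1 c1, of 1]) simp
 moreover have "\<forall>\<^sub>F s in at_right ee. (LBINT z:{-1..1}. 1 * circle_force u p s z $ i) = 0"
  using eventually_at_right_less[of ee]
 proof eventually_elim
  case (elim s)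
  show ?case
   unfolding circle_force_pairing[OF s1 e elim c1] using mean_force_zero[OF s1(1) e elim z1 z2] by simp
 qed
 ultimately have "((%s. 0) \<longlongrightarrow> (LBINT z:{-1..1}. 1 * f z $ i)) (at_right ee)"
  by (rule Lim_transform_eventually)
 from tendsto_unique[OF _ this tendsto_const] show ?thesis by simp
qed

subsection \<open>The force of a Bessel series solution\<close>

text \<open>Four summands cover the longest profile; shorter ones are padded with zero
  coefficients.\<close>

lemma wave_lin:
 assumes ok: "wave_ok f1 V" "wave_ok f2 V" "wave_ok f3 V" "wave_ok f4 V"
  and h: "!!k. h k = a * f1 k + b * f2 k + c * f3 k + d * f4 k"
 shows "wave h l V z = a * wave f1 l V z + b * wave f2 l V z + c * wave f3 l V z + d * wave f4 l V z"
proof -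
 have "h = (%k. ((a * f1 k + b * f2 k) + c * f3 k) + d * f4 k)" by (rule ext) (rule h)
 then show ?thesis
  by (simp only: wave_cmult[OF ok(1)] wave_cmult[OF ok(2)] wave_cmult[OF ok(3)] wave_cmult[OF ok(4)]
    wave_add wave_ok_add wave_ok_cmult ok)
qed

context
 fixes rr rr' r :: real and V1 V2 V3 :: "nat => complex"
 assumes adm: "\<forall>f\<in>{aa, bb, be, at', bt}. \<forall>V\<in>{V1, V2, V3}. admissible rr' (cseq f rr V)"
  and r: "0 <= rr'" "rr' < r"
begin

abbreviation "BW n j l f V z \<equiv> wave (%k. kap k ^ j * bessel_L n (kap k * r) * f (kap k * rr)) l V z"

lemma bessel_wave_ok:
 "f \<in> {aa, bb, be, at', bt} ==> V \<in> {V1, V2, V3} ==>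
   wave_ok (%k. kap k ^ j * bessel_L n (kap k * r) * f (kap k * rr)) V"
 by (rule wave_ok_bessel[OF _ r]) (use adm in blast)

lemma bessel_field_wave: "bessel_field n j l (cseq f rr V) (cyl_point r th z) = BW n j l f V z"
 using r by (simp add: bessel_field_def bessel_series_wave)

text \<open>rr' bounds the region of convergence and rr is the radius at which the amplitudes are
  normalised. Both equal \<epsilon> for the solution itself; for the test flows rr' = 0 while rr is
  the radius s of the cylinder under consideration.\<close>

lemma profile_waves:
 assumes V: "V \<in> {V1, V2, V3}"
 shows "wave (%k. pH (kap k * r) (kap k * rr)) l V z = BW 0 0 l aa V z - BW 0 0 l bb V z - 2 * BW (Suc 0) 0 l bb V z"
  and "wave (%k. pB (kap k * r) (kap k * rr)) l V z = 2 * r\<^sup>2 * BW (Suc (Suc 0)) (Suc (Suc 0)) l bb V z + 2 * r\<^sup>2 * BW (Suc 0) (Suc (Suc 0)) l be V z"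
  and "wave (%k. pU (kap k * r) (kap k * rr)) l V z = r * BW (Suc 0) (Suc 0) l at' V z + 2 * r * BW (Suc 0) (Suc 0) l bt V z + r * BW 0 (Suc 0) l bt V z"
  and "wave (%k. pW (kap k * r) (kap k * rr)) l V z = 2 * r * BW (Suc 0) (Suc 0) l be V z - r * BW (Suc 0) (Suc 0) l aa V z
   - r * BW (Suc 0) (Suc 0) l bb V z - 2 * r * BW 0 (Suc 0) l be V z"
  and "wave (%k. pZ (kap k * r) (kap k * rr)) l V z = BW 0 0 l at' V z + r\<^sup>2 * BW (Suc 0) (Suc (Suc 0)) l bt V z"
  and "wave (%k. fN (kap k * r) (kap k * rr)) l V z = pi * r\<^sup>2 * (3 * BW (Suc 0) (Suc (Suc 0)) l aa V z + BW (Suc 0) (Suc (Suc 0)) l bb V z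
   + 2 * BW (Suc 0) (Suc (Suc 0)) l be V z + 4 * BW 0 (Suc (Suc 0)) l be V z)"
  and "wave (%k. fT (kap k * r) (kap k * rr)) l V z = 4 * pi * r\<^sup>2 * (BW (Suc 0) (Suc (Suc 0)) l at' V z + BW (Suc 0) (Suc (Suc 0)) l bt V z
   + BW 0 (Suc (Suc 0)) l bt V z)"
proof -
 note ok = bessel_wave_ok[OF _ V]
 note s = algebra_simps power2_eq_square numeral_2_eq_2
 have Suc1: "bessel_L 1 = bessel_L (Suc 0)" "bessel_L 2 = bessel_L (Suc (Suc 0))" by (simp_all add: numeral_2_eq_2)
 show "wave (%k. pH (kap k * r) (kap k * rr)) l V z = BW 0 0 l aa V z - BW 0 0 l bb V z - 2 * BW (Suc 0) 0 l bb V z"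
  by (subst wave_lin[OF ok[of aa 0 0] ok[of bb 0 0] ok[of bb 0 "Suc 0"] ok[of aa 0 0], where a=1 and b="-1" and c="-2" and d=0])
   (simp_all add: pH_def s Suc1 del: bessel_L.simps)
 show "wave (%k. pB (kap k * r) (kap k * rr)) l V z = 2 * r\<^sup>2 * BW (Suc (Suc 0)) (Suc (Suc 0)) l bb V z + 2 * r\<^sup>2 * BW (Suc 0) (Suc (Suc 0)) l be V z"
  by (subst wave_lin[OF ok[of bb "Suc (Suc 0)" "Suc (Suc 0)"] ok[of be "Suc (Suc 0)" "Suc 0"] ok[of aa 0 0] ok[of aa 0 0],
     where a="2 * r\<^sup>2" and b="2 * r\<^sup>2" and c=0 and d=0])
   (simp_all add: pB_def s Suc1 del: bessel_L.simps)
 show "wave (%k. pU (kap k * r) (kap k * rr)) l V z = r * BW (Suc 0) (Suc 0) l at' V z + 2 * r * BW (Suc 0) (Suc 0) l bt V z + r * BW 0 (Suc 0) l bt V z"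
  by (subst wave_lin[OF ok[of at' "Suc 0" "Suc 0"] ok[of bt "Suc 0" "Suc 0"] ok[of bt "Suc 0" 0] ok[of aa 0 0],
     where a=r and b="2 * r" and c=r and d=0])
   (simp_all add: pU_def s Suc1 del: bessel_L.simps)
 show "wave (%k. pW (kap k * r) (kap k * rr)) l V z = 2 * r * BW (Suc 0) (Suc 0) l be V z - r * BW (Suc 0) (Suc 0) l aa V z
   - r * BW (Suc 0) (Suc 0) l bb V z - 2 * r * BW 0 (Suc 0) l be V z"
  by (subst wave_lin[OF ok[of be "Suc 0" "Suc 0"] ok[of aa "Suc 0" "Suc 0"] ok[of bb "Suc 0" "Suc 0"] ok[of be "Suc 0" 0],
     where a="2 * r" and b="- r" and c="- r" and d="- 2 * r"])
   (simp_all add: pW_def s Suc1 del: bessel_L.simps)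
 show "wave (%k. pZ (kap k * r) (kap k * rr)) l V z = BW 0 0 l at' V z + r\<^sup>2 * BW (Suc 0) (Suc (Suc 0)) l bt V z"
  by (subst wave_lin[OF ok[of at' 0 0] ok[of bt "Suc (Suc 0)" "Suc 0"] ok[of aa 0 0] ok[of aa 0 0],
     where a=1 and b="r\<^sup>2" and c=0 and d=0])
   (simp_all add: pZ_def s Suc1 del: bessel_L.simps)
 show "wave (%k. fN (kap k * r) (kap k * rr)) l V z = pi * r\<^sup>2 * (3 * BW (Suc 0) (Suc (Suc 0)) l aa V z + BW (Suc 0) (Suc (Suc 0)) l bb V z
   + 2 * BW (Suc 0) (Suc (Suc 0)) l be V z + 4 * BW 0 (Suc (Suc 0)) l be V z)"
  by (subst wave_lin[OF ok[of aa "Suc (Suc 0)" "Suc 0"] ok[of bb "Suc (Suc 0)" "Suc 0"] ok[of be "Suc (Suc 0)" "Suc 0"] ok[of be "Suc (Suc 0)" 0],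
     where a="3 * pi * r\<^sup>2" and b="pi * r\<^sup>2" and c="2 * pi * r\<^sup>2" and d="4 * pi * r\<^sup>2"])
   (simp_all add: fN_def s Suc1 del: bessel_L.simps)
 show "wave (%k. fT (kap k * r) (kap k * rr)) l V z = 4 * pi * r\<^sup>2 * (BW (Suc 0) (Suc (Suc 0)) l at' V z + BW (Suc 0) (Suc (Suc 0)) l bt V z
   + BW 0 (Suc (Suc 0)) l bt V z)"
  by (subst wave_lin[OF ok[of at' "Suc (Suc 0)" "Suc 0"] ok[of bt "Suc (Suc 0)" "Suc 0"] ok[of bt "Suc (Suc 0)" 0] ok[of aa 0 0],
     where a="4 * pi * r\<^sup>2" and b="4 * pi * r\<^sup>2" and c="4 * pi * r\<^sup>2" and d=0])
   (simp_all add: fT_def s Suc1 del: bessel_L.simps)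
qed

text \<open>The whole dependence on the angle sits in front of \<open>pB\<close>, \<open>pU\<close>
  and \<open>pW\<close>. These vanish at r = rr, which leaves a boundary velocity that depends on z
  alone.\<close>

lemma sol_field_eval:
 shows "ev (sol_field rr V1 V2 V3 1) (cyl_point r th z) = wave (%k. pH (kap k * r) (kap k * rr)) 0 V1 z
   + cos th * (cos th * wave (%k. pB (kap k * r) (kap k * rr)) 0 V1 z + sin th * wave (%k. pB (kap k * r) (kap k * rr)) 0 V2 z
    + wave (%k. pU (kap k * r) (kap k * rr)) (Suc 0) V3 z)"
  and "ev (sol_field rr V1 V2 V3 2) (cyl_point r th z) = wave (%k. pH (kap k * r) (kap k * rr)) 0 V2 z
   + sin th * (cos th * wave (%k. pB (kap k * r) (kap k * rr)) 0 V1 z + sin th * wave (%k. pB (kap k * r) (kap k * rr)) 0 V2 z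
    + wave (%k. pU (kap k * r) (kap k * rr)) (Suc 0) V3 z)"
  and "ev (sol_field rr V1 V2 V3 3) (cyl_point r th z) = cos th * wave (%k. pW (kap k * r) (kap k * rr)) (Suc 0) V1 z
   + sin th * wave (%k. pW (kap k * r) (kap k * rr)) (Suc 0) V2 z + wave (%k. pZ (kap k * r) (kap k * rr)) 0 V3 z"
proof -
 have m: "V1 \<in> {V1, V2, V3}" "V2 \<in> {V1, V2, V3}" "V3 \<in> {V1, V2, V3}" by auto
 have cs: "(cos th)\<^sup>2 + (sin th)\<^sup>2 = 1" by simp
 show "ev (sol_field rr V1 V2 V3 1) (cyl_point r th z) = wave (%k. pH (kap k * r) (kap k * rr)) 0 V1 z
   + cos th * (cos th * wave (%k. pB (kap k * r) (kap k * rr)) 0 V1 z + sin th * wave (%k. pB (kap k * r) (kap k * rr)) 0 V2 z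
    + wave (%k. pU (kap k * r) (kap k * rr)) (Suc 0) V3 z)"
  unfolding profile_waves(1)[OF m(1)] profile_waves(2)[OF m(1)] profile_waves(2)[OF m(2)] profile_waves(3)[OF m(3)]
  unfolding sol_field_def stokes_field_def Let_def by (simp add: bessel_field_wave algebra_simps power2_eq_square)
 show "ev (sol_field rr V1 V2 V3 2) (cyl_point r th z) = wave (%k. pH (kap k * r) (kap k * rr)) 0 V2 z
   + sin th * (cos th * wave (%k. pB (kap k * r) (kap k * rr)) 0 V1 z + sin th * wave (%k. pB (kap k * r) (kap k * rr)) 0 V2 z
    + wave (%k. pU (kap k * r) (kap k * rr)) (Suc 0) V3 z)"
  unfolding profile_waves(1)[OF m(2)] profile_waves(2)[OF m(1)] profile_waves(2)[OF m(2)] profile_waves(3)[OF m(3)]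
  unfolding sol_field_def stokes_field_def Let_def by (simp add: bessel_field_wave algebra_simps power2_eq_square)
 have q: "cos th * (cos th * a) + sin th * (sin th * a) = a" for a
  using cs by (simp add: power2_eq_square flip: mult.assoc distrib_right)
 show "ev (sol_field rr V1 V2 V3 3) (cyl_point r th z) = cos th * wave (%k. pW (kap k * r) (kap k * rr)) (Suc 0) V1 z
   + sin th * wave (%k. pW (kap k * r) (kap k * rr)) (Suc 0) V2 z + wave (%k. pZ (kap k * r) (kap k * rr)) 0 V3 z"
  unfolding profile_waves(4)[OF m(1)] profile_waves(4)[OF m(2)] profile_waves(5)[OF m(3)]
  unfolding sol_field_def stokes_field_def Let_def
  by (simp add: bessel_field_wave algebra_simps power2_eq_square)
   (use q[of "r * (r * BW (Suc 0) (Suc (Suc 0)) 0 bt V3 z)"] in \<open>simp add: mult_ac\<close>)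
qed

end

lemma stokes_system_stokes_field:
 assumes adm: "admissible rr a1" "admissible rr b1" "admissible rr e1" "admissible rr a2" "admissible rr b2"
  "admissible rr e2" "admissible rr a3" "admissible rr b3" and rho: "0 <= rr"
 shows "stokes_system rr (%i. ev (stokes_field a1 b1 e1 a2 b2 e2 a3 b3 i)) (ev (stokes_pressure e1 e2 b3))"
proof -
 let ?S = "exterior_domain rr" and ?E = "stokes_field a1 b1 e1 a2 b2 e2 a3 b3"
 note aE = adf_stokes_field(1)[OF adm] and aP = adf_stokes_field(2)[OF adm]
 have p: "partial j (ev f) x = ev (dd j f) x" if "adf rr f" "x \<in> ?S" for f j x
  using partial_ev[OF that(1) rho] that(2) by (simp add: exterior_domain_def)
 have pp: "partial k (partial j (ev f)) x = ev (dd k (dd j f)) x" if "adf rr f" "x \<in> ?S" for f j k x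
  using partial_cong_open(2)[OF open_exterior_domain that(2) p[OF that(1)] C1_onD(1)[OF C1_on_ev[OF adf_dd[OF that(1)] rho] that(2)]]
   p[OF adf_dd[OF that(1)] that(2)] by simp
 show ?thesis
  unfolding stokes_system_def
 proof (intro conjI allI ballI)
  show "C1_on ?S (ev (?E i))" for i by (rule C1_on_ev[OF aE rho])
  show "C1_on ?S (partial j (ev (?E i)))" for i j
   by (rule C1_on_cong[OF open_exterior_domain p[OF aE] C1_on_ev[OF adf_dd[OF aE] rho]])
  show "C1_on ?S (ev (stokes_pressure e1 e2 b3))" by (rule C1_on_ev[OF aP rho])
  fix x assume x: "x \<in> ?S"
  then have x': "rr < cyl_radius x" by (simp add: exterior_domain_def)
  show "partial 1 (partial 1 (ev (?E i))) x + partial 2 (partial 2 (ev (?E i))) x + partial 3 (partial 3 (ev (?E i))) x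
    = partial i (ev (stokes_pressure e1 e2 b3)) x" for i
   unfolding pp[OF aE x] p[OF aP x] dd_simps
   using exhaust_3[of i] stokes_field_laplacian_1[OF adm rho x'] stokes_field_laplacian_2[OF adm rho x']
    stokes_field_laplacian_3[OF adm rho x'] by auto
  show "partial 1 (ev (?E 1)) x + partial 2 (ev (?E 2)) x + partial 3 (ev (?E 3)) x = 0"
   unfolding p[OF aE x] dd_simps by (rule stokes_field_divergence[OF adm rho x'])
 qed (simp_all add: ev_periodic)
qed

lemma trig_integral:
 "integral {0..2*pi} (%t. k0 + k1 * cos t + k2 * sin t + k3 * (cos t * cos t) + k4 * (sin t * sin t) + k5 * (cos t * sin t))
  = pi * (2 * k0 + k3 + k4)"
proof -
 let ?F = "%t. k0 * t + k1 * sin t - k2 * cos t + k3 * ((t + cos t * sin t) / 2) + k4 * ((t - cos t * sin t) / 2) + k5 * (sin t * sin t / 2)"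
 have "((%t. k0 + k1 * cos t + k2 * sin t + k3 * (cos t * cos t) + k4 * (sin t * sin t) + k5 * (cos t * sin t))
   has_integral (?F (2*pi) - ?F 0)) {0..2*pi}"
 proof (rule fundamental_theorem_of_calculus)
  fix t :: real
  have cs: "1 = cos t * cos t + sin t * sin t" using sin_cos_squared_add[of t] by (simp add: power2_eq_square)
  have "(?F has_real_derivative (k0 + k1 * cos t + k2 * sin t + k3 * ((1 + (cos t * cos t - sin t * sin t)) / 2)
    + k4 * ((1 - (cos t * cos t - sin t * sin t)) / 2) + k5 * ((sin t * cos t + cos t * sin t) / 2))) (at t)"
   by (auto intro!: derivative_eq_intros simp: algebra_simps add_divide_distrib diff_divide_distrib)
  also have "k0 + k1 * cos t + k2 * sin t + k3 * ((1 + (cos t * cos t - sin t * sin t)) / 2)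
    + k4 * ((1 - (cos t * cos t - sin t * sin t)) / 2) + k5 * ((sin t * cos t + cos t * sin t) / 2)
   = k0 + k1 * cos t + k2 * sin t + k3 * (cos t * cos t) + k4 * (sin t * sin t) + k5 * (cos t * sin t)"
  proof -
   have "1 + (cos t * cos t - sin t * sin t) = 2 * (cos t * cos t)" "1 - (cos t * cos t - sin t * sin t) = 2 * (sin t * sin t)"
    using cs by argo+
   then show ?thesis by (simp only:) simp
  qed
  finally show "(?F has_vector_derivative (k0 + k1 * cos t + k2 * sin t + k3 * (cos t * cos t) + k4 * (sin t * sin t) + k5 * (cos t * sin t)))
    (at t within {0..2*pi})"
   unfolding has_real_derivative_iff_has_vector_derivative[symmetric] by (rule has_field_derivative_at_within)
 qed simp
 then show ?thesis by (simp add: integral_unique algebra_simps)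
qed

lemma vfld_system:
 assumes adm: "admissible rr a1" "admissible rr b1" "admissible rr e1" "admissible rr a2" "admissible rr b2"
  "admissible rr e2" "admissible rr a3" "admissible rr b3" and rho: "0 <= rr"
 shows "stokes_system rr (%i x. vfld (stokes_field a1 b1 e1 a2 b2 e2 a3 b3) x $ i) (ev (stokes_pressure e1 e2 b3))"
  "C1_on (exterior_domain rr) (vfld (stokes_field a1 b1 e1 a2 b2 e2 a3 b3))"
 using stokes_system_stokes_field[OF adm rho] C1_on_vfld[OF adf_stokes_field(1)[OF adm] rho] by simp_all

lemma arc_trig:
 assumes s: "0 <= rr" "rr < s" and F: "continuous_on (exterior_domain rr) F" "continuous_on (exterior_domain rr) G"
  and e: "!!t. cos t * F (cyl_point s t z) + sin t * G (cyl_point s t z)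
   = k0 + k1 * cos t + k2 * sin t + k3 * (cos t * cos t) + k4 * (sin t * sin t) + k5 * (cos t * sin t)"
 shows "arc_integral cos F s z + arc_integral sin G s z = pi * (2 * k0 + k3 + k4)"
proof -
 have i: "(%t. cos t * F (cyl_point s t z)) integrable_on {0..2*pi}" "(%t. sin t * G (cyl_point s t z)) integrable_on {0..2*pi}"
  using arc_set_integrable[OF s F(1) cont_trig(1)] arc_set_integrable[OF s F(2) cont_trig(2)]
  by (auto intro: set_borel_integral_eq_integral(1))
 show ?thesis
  unfolding arc_integral_def Henstock_Kurzweil_Integration.integral_add[OF i, symmetric] e by (rule trig_integral)
qed

context
 fixes rr s z :: real and a1 b1 e1 a2 b2 e2 a3 b3
 assumes adm: "admissible rr a1" "admissible rr b1" "admissible rr e1" "admissible rr a2" "admissible rr b2"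
  "admissible rr e2" "admissible rr a3" "admissible rr b3" and s: "0 <= rr" "rr < s"
begin

abbreviation "TT n j l c \<equiv> bessel_series n j l c s z"
text \<open>Scalar ingredients of the strain. A prime marks the shift of order and wave-number
  exponent produced by a transverse derivative, up to minus the coordinate; \<open>h3\<close> and
  \<open>G03\<close> come from a z-derivative.\<close>

abbreviation "h' a b \<equiv> TT (Suc 0) (Suc (Suc 0)) 0 a - TT (Suc 0) (Suc (Suc 0)) 0 b - 2 * TT (Suc (Suc 0)) (Suc (Suc 0)) 0 b"
abbreviation "G0 b e \<equiv> 2 * TT (Suc (Suc 0)) (Suc (Suc 0)) 0 b + 2 * TT (Suc 0) (Suc (Suc 0)) 0 e"
abbreviation "G0' b e \<equiv> 2 * TT (Suc (Suc (Suc 0))) (Suc (Suc (Suc (Suc 0)))) 0 b + 2 * TT (Suc (Suc 0)) (Suc (Suc (Suc (Suc 0)))) 0 e"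
abbreviation "G3 \<equiv> TT (Suc 0) (Suc 0) (Suc 0) a3 + 2 * TT (Suc 0) (Suc 0) (Suc 0) b3 + TT 0 (Suc 0) (Suc 0) b3"
abbreviation "G3' \<equiv> TT (Suc (Suc 0)) (Suc (Suc (Suc 0))) (Suc 0) a3 + 2 * TT (Suc (Suc 0)) (Suc (Suc (Suc 0))) (Suc 0) b3 + TT (Suc 0) (Suc (Suc (Suc 0))) (Suc 0) b3"
abbreviation "KK a b e \<equiv> 2 * TT (Suc 0) (Suc 0) (Suc 0) e - TT (Suc 0) (Suc 0) (Suc 0) a - TT (Suc 0) (Suc 0) (Suc 0) b - 2 * TT 0 (Suc 0) (Suc 0) e"
abbreviation "KK' a b e \<equiv> 2 * TT (Suc (Suc 0)) (Suc (Suc (Suc 0))) (Suc 0) e - TT (Suc (Suc 0)) (Suc (Suc (Suc 0))) (Suc 0) a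
  - TT (Suc (Suc 0)) (Suc (Suc (Suc 0))) (Suc 0) b - 2 * TT (Suc 0) (Suc (Suc (Suc 0))) (Suc 0) e"
abbreviation "h3 a b \<equiv> TT 0 (Suc 0) (Suc 0) a - TT 0 (Suc 0) (Suc 0) b - 2 * TT (Suc 0) (Suc 0) (Suc 0) b"
abbreviation "G03 b e \<equiv> 2 * TT (Suc (Suc 0)) (Suc (Suc (Suc 0))) (Suc 0) b + 2 * TT (Suc 0) (Suc (Suc (Suc 0))) (Suc 0) e"

text \<open>The traction is a trigonometric polynomial of degree at most two in the angle.
  Integration over the circle keeps only its constant and the two squares, and the recurrence
  removes the highest Bessel orders.\<close>

lemma stokes_field_force:
 defines "E \<equiv> stokes_field a1 b1 e1 a2 b2 e2 a3 b3" and "q \<equiv> stokes_pressure e1 e2 b3"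
 shows "circle_force (vfld E) (ev q) s z $ 1 = pi * s\<^sup>2 * (3 * TT (Suc 0) (Suc (Suc 0)) 0 a1 + TT (Suc 0) (Suc (Suc 0)) 0 b1
   + 2 * TT (Suc 0) (Suc (Suc 0)) 0 e1 + 4 * TT 0 (Suc (Suc 0)) 0 e1)"
  and "circle_force (vfld E) (ev q) s z $ 2 = pi * s\<^sup>2 * (3 * TT (Suc 0) (Suc (Suc 0)) 0 a2 + TT (Suc 0) (Suc (Suc 0)) 0 b2
   + 2 * TT (Suc 0) (Suc (Suc 0)) 0 e2 + 4 * TT 0 (Suc (Suc 0)) 0 e2)"
  and "circle_force (vfld E) (ev q) s z $ 3 = 4 * pi * s\<^sup>2 * (TT (Suc 0) (Suc (Suc 0)) 0 a3 + TT (Suc 0) (Suc (Suc 0)) 0 b3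
   + TT 0 (Suc (Suc 0)) 0 b3)"
proof -
 let ?U = "%i x. vfld E x $ i"
 note sys = vfld_system[OF adm s(1), folded E_def q_def]
 note cS = continuous_on_strain[OF sys(1)]
 have aE: "adf rr (E i)" for i unfolding E_def by (rule adf_stokes_field(1)[OF adm])
 have st: "strain ?U (ev q) i j (cyl_point s t z) = ev (dd j (E i)) (cyl_point s t z) + ev (dd i (E j)) (cyl_point s t z)
   - (if i = j then ev q (cyl_point s t z) else 0)" for i j t
  using partial_ev[OF aE s(1)] s by (simp add: strain_def)
 have bf: "bessel_field n j l c (cyl_point s t z) = TT n j l c" for n j l c t
  using s by (simp add: bessel_field_def)
 have cs: "(cos t)\<^sup>2 + (sin t)\<^sup>2 = 1" for t :: real by simp
 note rec = bessel_series_recurrence[OF _ s]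
 have r: "s\<^sup>2 * G0' b e = 2 * (TT (Suc 0) (Suc (Suc 0)) 0 b + 4 * TT (Suc (Suc 0)) (Suc (Suc 0)) 0 b)
   + 2 * (TT 0 (Suc (Suc 0)) 0 e + 2 * TT (Suc 0) (Suc (Suc 0)) 0 e)" if "admissible rr b" "admissible rr e" for b e
  using rec[OF that(1), of "Suc 0" "Suc (Suc 0)" 0 z] rec[OF that(2), of 0 "Suc (Suc 0)" 0 z] by (simp add: algebra_simps)
 have e1: "cos t * strain ?U (ev q) 1 1 (cyl_point s t z) + sin t * strain ?U (ev q) 1 2 (cyl_point s t z)
   = (s * G0 b1 e1 - s * h' a1 b1) + (2 * G3 - 2 * s\<^sup>2 * G3' - 2 * TT 0 (Suc 0) (Suc 0) b3) * cos t + 0 * sin t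
    + (3 * s * G0 b1 e1 - s * h' a1 b1 - 2 * s * (s\<^sup>2 * G0' b1 e1) - 4 * s * TT (Suc 0) (Suc (Suc 0)) 0 e1) * (cos t * cos t) + 0 * (sin t * sin t)
    + (3 * s * G0 b2 e2 - s * h' a2 b2 - 2 * s * (s\<^sup>2 * G0' b2 e2) - 4 * s * TT (Suc 0) (Suc (Suc 0)) 0 e2) * (cos t * sin t)" for t
 proof -
  define c d where c: "c = cos t" and d: "d = sin t"
  have w: "c\<^sup>2 + d\<^sup>2 - 1 = 0" by (simp add: c d)
  have x: "cyl_point s t z $ 1 = s * c" "cyl_point s t z $ 2 = s * d" by (simp_all add: c d)
  \<comment> \<open>Written with an explicit multiple of c^2 + d^2 - 1, so that it is a polynomial
    identity in which c and d are independent; the multiple vanishes for cosine and sine.\<close>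
  have "c * strain ?U (ev q) 1 1 (cyl_point s t z) + d * strain ?U (ev q) 1 2 (cyl_point s t z)
   = (s * G0 b1 e1 - s * h' a1 b1) + (2 * G3 - 2 * s\<^sup>2 * G3' - 2 * TT 0 (Suc 0) (Suc 0) b3) * c + 0 * d
    + (3 * s * G0 b1 e1 - s * h' a1 b1 - 2 * s * (s\<^sup>2 * G0' b1 e1) - 4 * s * TT (Suc 0) (Suc (Suc 0)) 0 e1) * (c * c) + 0 * (d * d)
    + (3 * s * G0 b2 e2 - s * h' a2 b2 - 2 * s * (s\<^sup>2 * G0' b2 e2) - 4 * s * TT (Suc 0) (Suc (Suc 0)) 0 e2) * (c * d)
    + (c\<^sup>2 + d\<^sup>2 - 1) * (- s * h' a1 b1 + s * G0 b1 e1 - 2 * s * (s * c) * (s * c * G0' b1 e1 + s * d * G0' b2 e2 + G3'))"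
   unfolding st unfolding E_def q_def stokes_field_def stokes_pressure_def Let_def
   by (simp add: bf x del: cyl_point_nth) algebra
  then show ?thesis unfolding w c d by simp
 qed
 have e2: "cos t * strain ?U (ev q) 2 1 (cyl_point s t z) + sin t * strain ?U (ev q) 2 2 (cyl_point s t z)
   = (s * G0 b2 e2 - s * h' a2 b2) + 0 * cos t + (2 * G3 - 2 * s\<^sup>2 * G3' - 2 * TT 0 (Suc 0) (Suc 0) b3) * sin t + 0 * (cos t * cos t)
    + (3 * s * G0 b2 e2 - s * h' a2 b2 - 2 * s * (s\<^sup>2 * G0' b2 e2) - 4 * s * TT (Suc 0) (Suc (Suc 0)) 0 e2) * (sin t * sin t)
    + (3 * s * G0 b1 e1 - s * h' a1 b1 - 2 * s * (s\<^sup>2 * G0' b1 e1) - 4 * s * TT (Suc 0) (Suc (Suc 0)) 0 e1) * (cos t * sin t)" for t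
 proof -
  define c d where c: "c = cos t" and d: "d = sin t"
  have w: "c\<^sup>2 + d\<^sup>2 - 1 = 0" by (simp add: c d)
  have x: "cyl_point s t z $ 1 = s * c" "cyl_point s t z $ 2 = s * d" by (simp_all add: c d)
  have "c * strain ?U (ev q) 2 1 (cyl_point s t z) + d * strain ?U (ev q) 2 2 (cyl_point s t z)
   = (s * G0 b2 e2 - s * h' a2 b2) + 0 * c + (2 * G3 - 2 * s\<^sup>2 * G3' - 2 * TT 0 (Suc 0) (Suc 0) b3) * d + 0 * (c * c)
    + (3 * s * G0 b2 e2 - s * h' a2 b2 - 2 * s * (s\<^sup>2 * G0' b2 e2) - 4 * s * TT (Suc 0) (Suc (Suc 0)) 0 e2) * (d * d)
    + (3 * s * G0 b1 e1 - s * h' a1 b1 - 2 * s * (s\<^sup>2 * G0' b1 e1) - 4 * s * TT (Suc 0) (Suc (Suc 0)) 0 e1) * (c * d)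
    + (c\<^sup>2 + d\<^sup>2 - 1) * (- s * h' a2 b2 + s * G0 b2 e2 - 2 * s * (s * d) * (s * c * G0' b1 e1 + s * d * G0' b2 e2 + G3'))"
   unfolding st unfolding E_def q_def stokes_field_def stokes_pressure_def Let_def
   by (simp add: bf x del: cyl_point_nth) algebra
  then show ?thesis unfolding w c d by simp
 qed
 have e3: "cos t * strain ?U (ev q) 3 1 (cyl_point s t z) + sin t * strain ?U (ev q) 3 2 (cyl_point s t z)
   = (s * (TT (Suc 0) (Suc (Suc 0)) (Suc (Suc 0)) a3 + 2 * TT (Suc 0) (Suc (Suc 0)) (Suc (Suc 0)) b3 + TT 0 (Suc (Suc 0)) (Suc (Suc 0)) b3)
    - s * TT (Suc 0) (Suc (Suc 0)) 0 a3 + 2 * s * TT (Suc 0) (Suc (Suc 0)) 0 b3 - s * (s\<^sup>2 * TT (Suc (Suc 0)) (Suc (Suc (Suc (Suc 0)))) 0 b3))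
    + (KK a1 b1 e1 - s\<^sup>2 * KK' a1 b1 e1 + h3 a1 b1 + s\<^sup>2 * G03 b1 e1) * cos t
    + (KK a2 b2 e2 - s\<^sup>2 * KK' a2 b2 e2 + h3 a2 b2 + s\<^sup>2 * G03 b2 e2) * sin t
    + 0 * (cos t * cos t) + 0 * (sin t * sin t) + 0 * (cos t * sin t)" for t
 proof -
  define c d where c: "c = cos t" and d: "d = sin t"
  have w: "c\<^sup>2 + d\<^sup>2 - 1 = 0" by (simp add: c d)
  have x: "cyl_point s t z $ 1 = s * c" "cyl_point s t z $ 2 = s * d" by (simp_all add: c d)
  have "c * strain ?U (ev q) 3 1 (cyl_point s t z) + d * strain ?U (ev q) 3 2 (cyl_point s t z)
   = (s * (TT (Suc 0) (Suc (Suc 0)) (Suc (Suc 0)) a3 + 2 * TT (Suc 0) (Suc (Suc 0)) (Suc (Suc 0)) b3 + TT 0 (Suc (Suc 0)) (Suc (Suc 0)) b3)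
    - s * TT (Suc 0) (Suc (Suc 0)) 0 a3 + 2 * s * TT (Suc 0) (Suc (Suc 0)) 0 b3 - s * (s\<^sup>2 * TT (Suc (Suc 0)) (Suc (Suc (Suc (Suc 0)))) 0 b3))
    + (KK a1 b1 e1 - s\<^sup>2 * KK' a1 b1 e1 + h3 a1 b1 + s\<^sup>2 * G03 b1 e1) * c
    + (KK a2 b2 e2 - s\<^sup>2 * KK' a2 b2 e2 + h3 a2 b2 + s\<^sup>2 * G03 b2 e2) * d
    + 0 * (c * c) + 0 * (d * d) + 0 * (c * d)
    + (c\<^sup>2 + d\<^sup>2 - 1) * (- s * (s * c * KK' a1 b1 e1 + s * d * KK' a2 b2 e2) - s * TT (Suc 0) (Suc (Suc 0)) 0 a3 + 2 * s * TT (Suc 0) (Suc (Suc 0)) 0 b3 - s * s * s * (c\<^sup>2 + d\<^sup>2 + 1) * TT (Suc (Suc 0)) (Suc (Suc (Suc (Suc 0)))) 0 b3 + s * (s * c * G03 b1 e1 + s * d * G03 b2 e2 + (TT (Suc 0) (Suc (Suc 0)) (Suc (Suc 0)) a3 + 2 * TT (Suc 0) (Suc (Suc 0)) (Suc (Suc 0)) b3 + TT 0 (Suc (Suc 0)) (Suc (Suc 0)) b3)))"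
   unfolding st unfolding E_def q_def stokes_field_def stokes_pressure_def Let_def
   by (simp add: bf x del: cyl_point_nth) algebra
  then show ?thesis unfolding w c d by simp
 qed
 show "circle_force (vfld E) (ev q) s z $ 1 = pi * s\<^sup>2 * (3 * TT (Suc 0) (Suc (Suc 0)) 0 a1 + TT (Suc 0) (Suc (Suc 0)) 0 b1
   + 2 * TT (Suc 0) (Suc (Suc 0)) 0 e1 + 4 * TT 0 (Suc (Suc 0)) 0 e1)"
  unfolding circle_force_eq[OF sys s] arc_trig[OF s cS cS e1] r[OF adm(2,3)] by (simp add: algebra_simps power2_eq_square)
 show "circle_force (vfld E) (ev q) s z $ 2 = pi * s\<^sup>2 * (3 * TT (Suc 0) (Suc (Suc 0)) 0 a2 + TT (Suc 0) (Suc (Suc 0)) 0 b2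
   + 2 * TT (Suc 0) (Suc (Suc 0)) 0 e2 + 4 * TT 0 (Suc (Suc 0)) 0 e2)"
  unfolding circle_force_eq[OF sys s] arc_trig[OF s cS cS e2] r[OF adm(5,6)] by (simp add: algebra_simps power2_eq_square)
 have r3: "s\<^sup>2 * TT (Suc (Suc 0)) (Suc (Suc (Suc (Suc 0)))) 0 b3 = TT 0 (Suc (Suc 0)) 0 b3 + 2 * TT (Suc 0) (Suc (Suc 0)) 0 b3"
  using rec[OF adm(8), of 0 "Suc (Suc 0)" 0 z] by simp
 note ph = bessel_series_phase[OF adm(7) s] bessel_series_phase[OF adm(8) s]
 show "circle_force (vfld E) (ev q) s z $ 3 = 4 * pi * s\<^sup>2 * (TT (Suc 0) (Suc (Suc 0)) 0 a3 + TT (Suc 0) (Suc (Suc 0)) 0 b3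
   + TT 0 (Suc (Suc 0)) 0 b3)"
  unfolding circle_force_eq[OF sys s] arc_trig[OF s cS cS e3] r3 ph by (simp add: algebra_simps power2_eq_square)
qed

end

lemma sol_field_force:
 assumes adm: "\<forall>f\<in>{aa, bb, be, at', bt}. \<forall>V\<in>{V1, V2, V3}. admissible rr' (cseq f rr V)"
  and r: "0 <= rr'" "rr' < r"
 shows "circle_force (vfld (sol_field rr V1 V2 V3)) (ev (sol_pressure rr V1 V2 V3)) r z $ 1 = wave (%k. fN (kap k * r) (kap k * rr)) 0 V1 z"
  "circle_force (vfld (sol_field rr V1 V2 V3)) (ev (sol_pressure rr V1 V2 V3)) r z $ 2 = wave (%k. fN (kap k * r) (kap k * rr)) 0 V2 z"
  "circle_force (vfld (sol_field rr V1 V2 V3)) (ev (sol_pressure rr V1 V2 V3)) r z $ 3 = wave (%k. fT (kap k * r) (kap k * rr)) 0 V3 z"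
proof -
 have m: "V1 \<in> {V1, V2, V3}" "V2 \<in> {V1, V2, V3}" "V3 \<in> {V1, V2, V3}" by auto
 have a: "admissible rr' (cseq aa rr V1)" "admissible rr' (cseq bb rr V1)" "admissible rr' (cseq be rr V1)"
  "admissible rr' (cseq aa rr V2)" "admissible rr' (cseq bb rr V2)" "admissible rr' (cseq be rr V2)"
  "admissible rr' (cseq at' rr V3)" "admissible rr' (cseq bt rr V3)"
  using adm by blast+
 note F = stokes_field_force[OF a r, folded sol_field_def sol_pressure_def]
 note P = profile_waves[OF adm r]
 show "circle_force (vfld (sol_field rr V1 V2 V3)) (ev (sol_pressure rr V1 V2 V3)) r z $ 1 = wave (%k. fN (kap k * r) (kap k * rr)) 0 V1 z"
  unfolding F(1) P(6)[OF m(1)] bessel_series_wave ..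
 show "circle_force (vfld (sol_field rr V1 V2 V3)) (ev (sol_pressure rr V1 V2 V3)) r z $ 2 = wave (%k. fN (kap k * r) (kap k * rr)) 0 V2 z"
  unfolding F(2) P(6)[OF m(2)] bessel_series_wave ..
 show "circle_force (vfld (sol_field rr V1 V2 V3)) (ev (sol_pressure rr V1 V2 V3)) r z $ 3 = wave (%k. fT (kap k * r) (kap k * rr)) 0 V3 z"
  unfolding F(3) P(7)[OF m(3)] bessel_series_wave ..
qed

section \<open>Single-mode test flows and uniform kernel bounds\<close>

definition single :: "3 => nat => complex => 3 => nat => complex" where
 "single i n c l k = (if l = i & k = n then c else 0)"

lemma wave_single: "wave f m (single i n c l) z = (if l = i then f n * Re (\<i> ^ m * c * cis (kap n * z)) else 0)"
proof -
 have "wave f m (single i n c l) z = (\<Sum>k\<in>{n}. f k * Re (\<i> ^ m * single i n c l k * cis (kap k * z)))"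
  unfolding wave_def by (rule suminf_finite) (auto simp: single_def)
 then show ?thesis by (simp add: single_def)
qed

text \<open>A single term converges at every radius, so a flow normalised at radius s > \<epsilon>
  is still a Stokes flow in the full exterior of the cylinder of radius \<epsilon>.\<close>

lemma admissible_single: "admissible rr (cseq f s (single i n c l))"
 by (rule admissible_finite, rule finite_subset[of _ "{n}"]) (auto simp: cseq_def single_def)

text \<open>The amplitudes vary with s, hence a family of fields; its majorant is evaluated on the
  cylinder on which the flow is normalised.\<close>

definition ubd :: "real => (real => fld) => bool" where
 "ubd ee F \<longleftrightarrow> (\<exists>M. \<forall>s. ee < s --> s <= 2 * ee --> \<bar>bnd (F s) s\<bar> <= M)"

text \<open>The Bessel factor is at most a multiple of K1(X), and |f(X)| K1(X) is at most a multiple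
  of 1 + X; for one mode X = kap n s stays in a bounded interval.\<close>

lemma ubd_FT:
 assumes e: "ee > 0" and f: "f \<in> {aa, bb, be, at', bt}"
 shows "ubd ee (%s. FT m j l (cseq f s (single i n c q)))"
proof -
 obtain C where C: "C > 0" "!!X f. X >= ee ==> f \<in> {aa, bb, be, at', bt} ==> \<bar>f X\<bar> * K1 X <= C * (1 + X)"
  using coeff_linear_bounds[OF e] by blast
 obtain D where D: "D >= 0" "!!x. x >= ee ==> bessel_L m x <= D * K1 x"
  using bessel_L_le_K1[OF e, of m] by blast
 have "\<bar>bnd (FT m j l (cseq f s (single i n c q))) s\<bar> <= kap n ^ j * (D * (C * (1 + kap n * (2 * ee)))) * cmod c"
  if s: "ee < s" "s <= 2 * ee" for s
 proof -
  let ?X = "kap n * s"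
  have X: "?X >= ee" "?X <= kap n * (2 * ee)" "?X > 0"
   using kap_ge_1[of n] s e mult_mono[of 1 "kap n" ee s] by (auto intro: mult_left_mono)
  have L0: "bessel_L m ?X >= 0" by (rule less_imp_le[OF bessel_L_pos[OF X(3)]])
  have "bnd (FT m j l (cseq f s (single i n c q))) s = (\<Sum>k\<in>{n}. kap k ^ j * bessel_L m (kap k * s) * cmod (cseq f s (single i n c q) k))"
   unfolding bnd.simps bessel_bound_def by (rule suminf_finite) (auto simp: cseq_def single_def)
  then have "\<bar>bnd (FT m j l (cseq f s (single i n c q))) s\<bar> <= kap n ^ j * (bessel_L m ?X * \<bar>f ?X\<bar>) * cmod c"
   using L0 by (simp add: cseq_def single_def norm_mult abs_mult)
  also have "bessel_L m ?X * \<bar>f ?X\<bar> <= (D * K1 ?X) * \<bar>f ?X\<bar>" by (intro mult_right_mono D(2) X(1)) simp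
  also have "(D * K1 ?X) * \<bar>f ?X\<bar> = D * (\<bar>f ?X\<bar> * K1 ?X)" by simp
  also have "... <= D * (C * (1 + ?X))" by (intro mult_left_mono C(2) X(1) f D(1))
  also have "... <= D * (C * (1 + kap n * (2 * ee)))" using D(1) C(1) X(2) by (intro mult_left_mono) auto
  finally show ?thesis by (simp add: mult_left_mono mult_right_mono)
 qed
 then show ?thesis unfolding ubd_def by blast
qed

lemma ubd_Add: "ubd ee F ==> ubd ee G ==> ubd ee (%s. Add (F s) (G s))"
 unfolding ubd_def bnd.simps by (meson abs_triangle_ineq add_mono order_trans)

lemma ubd_Sc: "ubd ee F ==> ubd ee (%s. Sc a (F s))"
 unfolding ubd_def bnd.simps abs_mult by (meson abs_ge_zero mult_left_mono)

lemma ubd_FX: "ubd ee F ==> ee > 0 ==> ubd ee (%s. FX (F s))" "ubd ee F ==> ee > 0 ==> ubd ee (%s. FY (F s))"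
proof -
 assume F: "ubd ee F" and e: "ee > 0"
 obtain M where M: "!!s. ee < s ==> s <= 2 * ee ==> \<bar>bnd (F s) s\<bar> <= M" using F unfolding ubd_def by blast
 have "\<bar>s * bnd (F s) s\<bar> <= 2 * ee * M" if "ee < s" "s <= 2 * ee" for s
  unfolding abs_mult using M[OF that] that e by (intro mult_mono) auto
 then show "ubd ee (%s. FX (F s))" "ubd ee (%s. FY (F s))" unfolding ubd_def bnd.simps by blast+
qed

lemma ubd_sol_field:
 assumes e: "ee > 0"
 shows "ubd ee (%s. dd j (sol_field s (single i n c 1) (single i n c 2) (single i n c 3) l))"
  "ubd ee (%s. sol_pressure s (single i n c 1) (single i n c 2) (single i n c 3))"
 unfolding sol_field_def sol_pressure_def stokes_field_def stokes_pressure_def Let_def dd_def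
 by (cases "j = 1"; cases "j = 2"; cases "l = 1"; cases "l = 2";
   simp; intro ubd_Add ubd_Sc ubd_FX ubd_FT e; simp)
  (intro ubd_Add ubd_Sc ubd_FX ubd_FT e; simp)

lemma mode_periodic: "mode c n (z + 2) = mode c n z"
proof -
 have "cis (pi * real (Suc n) * (z + 2)) = cis (pi * real (Suc n) * z)"
  unfolding complex_eq_iff using sin_cos_eq_iff[of "pi * real (Suc n) * (z + 2)" "pi * real (Suc n) * z"]
  by (auto simp: algebra_simps intro!: exI[of _ "int (Suc n)"])
 then show ?thesis by (simp add: mode_def)
qed

text \<open>The adjoint flow is the single-mode Bessel field whose value on the cylinder of radius s
  is the test function in direction i. Its derivatives and pressure there are bounded uniformly in s
  by \<open>ubd_sol_field\<close>, and its decay makes the reciprocal flux vanish.\<close>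

lemma force_kernel_bound_mode:
 assumes e: "ee > 0"
 obtains M where "force_kernel_bound ee (mode c n) i M"
proof -
 define E where "E = (%s. sol_field s (single i n c 1) (single i n c 2) (single i n c 3))"
 define q where "q = (%s. sol_pressure s (single i n c 1) (single i n c 2) (single i n c 3))"
 define m where "m = (%l j. SOME M. \<forall>s. ee < s --> s <= 2 * ee --> \<bar>bnd (dd j (E s l)) s\<bar> <= M)"
 have "\<exists>M. \<forall>s. ee < s --> s <= 2 * ee --> \<bar>bnd (dd j (E s l)) s\<bar> <= M" for l j
  using ubd_sol_field(1)[OF e, of j i n c l] unfolding ubd_def E_def .
 from someI_ex[OF this] have m: "\<bar>bnd (dd j (E s l)) s\<bar> <= m l j" if "ee < s" "s <= 2 * ee" for l j s
  using that unfolding m_def by blast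
 obtain mq where mq: "!!s. ee < s ==> s <= 2 * ee ==> \<bar>bnd (q s) s\<bar> <= mq"
  using ubd_sol_field(2)[OF e, of i n c] unfolding ubd_def q_def by blast
 \<comment> \<open>Dominates the finitely many bounds on derivatives of W, the bound on its
   pressure, and, by the last summand, the derivative of the test function.\<close>
 define M where "M = (\<Sum>l\<in>UNIV. \<Sum>j\<in>UNIV. \<bar>m l j\<bar>) + \<bar>mq\<bar> + kap n * cmod c"
 have Mm: "\<bar>m l j\<bar> <= M" "\<bar>mq\<bar> <= M" "kap n * cmod c <= M" for l j
 proof -
  have "\<bar>m l j\<bar> <= (\<Sum>j\<in>UNIV. \<bar>m l j\<bar>)" by (rule member_le_sum) auto
  also have "... <= (\<Sum>l\<in>UNIV. \<Sum>j\<in>UNIV. \<bar>m l j\<bar>)"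
   by (rule member_le_sum[of l UNIV "%l. \<Sum>j\<in>UNIV. \<bar>m l j\<bar>"]) (auto intro: sum_nonneg)
  finally have 1: "\<bar>m l j\<bar> <= (\<Sum>l\<in>UNIV. \<Sum>j\<in>UNIV. \<bar>m l j\<bar>)" .
  have 2: "0 <= kap n * cmod c" by simp
  show "\<bar>m l j\<bar> <= M" using 1 2 abs_ge_zero[of mq] unfolding M_def by argo
  have "0 <= (\<Sum>l\<in>UNIV. \<Sum>j\<in>UNIV. \<bar>m l j\<bar>)" by (intro sum_nonneg) simp
  then show "\<bar>mq\<bar> <= M" "kap n * cmod c <= M" using 2 abs_ge_zero[of mq] unfolding M_def by argo+
 qed
 have g: "(mode c n has_real_derivative mode (\<i> * c * kap n) n z) (at z)" for z
 proof -
  have "mode c n z = Re c * cos (kap n * z) - Im c * sin (kap n * z)" for z by (simp add: mode_def kap_def)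
  then have "mode c n = (%z. Re c * cos (kap n * z) - Im c * sin (kap n * z))" by (rule ext)
  moreover have "mode (\<i> * c * kap n) n z = - (kap n * (Re c * sin (kap n * z))) - kap n * (Im c * cos (kap n * z))"
   by (simp add: mode_def kap_def algebra_simps)
  ultimately show ?thesis by (auto intro!: derivative_eq_intros)
 qed
 note per = mode_periodic[of c n]
 have gb: "\<bar>mode (\<i> * c * kap n) n z\<bar> <= M" for z
 proof -
  have "\<bar>mode (\<i> * c * kap n) n z\<bar> <= cmod (\<i> * c * kap n * cis (pi * real (Suc n) * z))"
   unfolding mode_def by (rule abs_Re_le_cmod)
  also have "... = kap n * cmod c" by (simp add: norm_mult)
  finally show ?thesis using Mm(3) by simp
 qed
 have "force_kernel_bound ee (mode c n) i (6 * M)"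
  unfolding force_kernel_bound_def
 proof (intro allI impI)
  fix s U P assume s: "ee < s" "s <= 2 * ee" and U: "stokes_system ee U P" and t: "tame U P"
  have e0: "0 <= ee" and s0: "s > 0" "0 < s" using e s by auto
  have adm: "admissible rr (cseq f s (single i n c l))" for rr f l by (rule admissible_single)
  have W: "stokes_system ee (%l. ev (E s l)) (ev (q s))"
   unfolding E_def q_def sol_field_def sol_pressure_def by (rule stokes_system_stokes_field[OF adm adm adm adm adm adm adm adm e0])
  have aE: "adf ee (E s l)" "adf ee (q s)" for l
   unfolding E_def q_def sol_field_def sol_pressure_def by (rule adf_stokes_field[OF adm adm adm adm adm adm adm adm])+
  define \<beta> where "\<beta> = (%r. (\<Sum>l\<in>UNIV. bnd (E s l) r) + (\<Sum>l\<in>UNIV. \<Sum>j\<in>UNIV. bnd (dd j (E s l)) r) + bnd (q s) r)"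
  have bn: "bnd (E s l) r >= 0" "bnd (dd j (E s l)) r >= 0" "bnd (q s) r >= 0" if "r > ee" for l j r
   using bnd_nonneg[OF aE(1) e0 that] bnd_nonneg[OF adf_dd[OF aE(1)] e0 that] bnd_nonneg[OF aE(2) e0 that] by auto
  have b\<beta>: "bnd (E s l) r <= \<beta> r" "bnd (dd j (E s l)) r <= \<beta> r" "bnd (q s) r <= \<beta> r" if r: "r > ee" for l j r
  proof -
   have 1: "bnd (E s l) r <= (\<Sum>l\<in>UNIV. bnd (E s l) r)" using bn[OF r] by (intro member_le_sum) auto
   have "bnd (dd j (E s l)) r <= (\<Sum>j\<in>UNIV. bnd (dd j (E s l)) r)" using bn[OF r] by (intro member_le_sum) auto
   also have "... <= (\<Sum>l\<in>UNIV. \<Sum>j\<in>UNIV. bnd (dd j (E s l)) r)"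
    using bn[OF r] by (intro member_le_sum[of l UNIV "%l. \<Sum>j\<in>UNIV. bnd (dd j (E s l)) r"]) (auto intro: sum_nonneg)
   finally have 2: "bnd (dd j (E s l)) r <= (\<Sum>l\<in>UNIV. \<Sum>j\<in>UNIV. bnd (dd j (E s l)) r)" .
   have 3: "0 <= (\<Sum>l\<in>UNIV. bnd (E s l) r)" "0 <= (\<Sum>l\<in>UNIV. \<Sum>j\<in>UNIV. bnd (dd j (E s l)) r)"
    using bn[OF r] by (auto intro!: sum_nonneg)
   show "bnd (E s l) r <= \<beta> r" "bnd (dd j (E s l)) r <= \<beta> r" "bnd (q s) r <= \<beta> r"
    using 1 2 3 bn(3)[OF r] unfolding \<beta>_def by simp_all
  qed
  have p: "partial j (ev (E s l)) x = ev (dd j (E s l)) x" if "ee < cyl_radius x" for j l x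
   by (rule partial_ev[OF aE(1) e0 that])
  have wb: "\<bar>ev (E s l) x\<bar> <= \<beta> (cyl_radius x)" "\<bar>partial j (ev (E s l)) x\<bar> <= \<beta> (cyl_radius x)" "\<bar>ev (q s) x\<bar> <= \<beta> (cyl_radius x)"
   if x: "ee < cyl_radius x" for l j x
   unfolding p[OF x] using b\<beta>[OF x] ev_le_bnd[OF aE(1) e0 x, of l] ev_le_bnd[OF adf_dd[OF aE(1)] e0 x, of j l] ev_le_bnd[OF aE(2) e0 x]
   by (meson order_trans)+
  have lim: "((%r. r * \<beta> r) \<longlongrightarrow> 0) at_top"
  proof -
   have d: "((%r. r * bnd f r) \<longlongrightarrow> 0) at_top" if "adf ee f" for f
    using bnd_decay[OF that e0, of 1] by simp
   have "((%r. (\<Sum>l\<in>UNIV. r * bnd (E s l) r) + (\<Sum>l\<in>UNIV. \<Sum>j\<in>UNIV. r * bnd (dd j (E s l)) r) + r * bnd (q s) r)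
     \<longlongrightarrow> (\<Sum>l\<in>(UNIV::3 set). 0) + (\<Sum>l\<in>(UNIV::3 set). \<Sum>j\<in>(UNIV::3 set). 0) + 0) at_top"
    by (intro tendsto_add tendsto_sum d aE adf_dd)
   then show ?thesis by (simp add: \<beta>_def distrib_left sum_distrib_left)
  qed
  obtain r0 where r0: "!!x. r0 <= cyl_radius x ==> (\<forall>i. \<bar>U i x\<bar> <= 1) & \<bar>P x\<bar> <= 1" using t unfolding tame_def by blast
  have flux: "ring_integral cos (green_field U P (%l. ev (E s l)) (ev (q s)) 1) s
    + ring_integral sin (green_field U P (%l. ev (E s l)) (ev (q s)) 2) s = 0"
   by (rule green_flux_zero[OF U W e0 s(1) _ _ wb lim, of r0]) (use r0 in auto)
  have bd: "ev (E s l) (cyl_point s t z) = (if l = i then mode c n z else 0)" for l t z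
  proof -
   have Xn: "kap n * s > 0" using s0 by simp
   have a: "\<forall>f\<in>{aa, bb, be, at', bt}. \<forall>V\<in>{single i n c 1, single i n c 2, single i n c 3}. admissible 0 (cseq f s V)"
    using adm by auto
   note ev = sol_field_eval[OF a order_refl s0(2)]
   show ?thesis
    using exhaust_3[of l] ev profile_boundary[OF Xn]
    by (auto simp: E_def wave_single mode_def kap_def)
  qed
  show "\<bar>ring_integral cos (%x. mode c n (x$3) * strain U P i 1 x) s + ring_integral sin (%x. mode c n (x$3) * strain U P i 2 x) s\<bar>
   <= 6 * M * ring_integral (%_. 1) (%x. \<bar>U 1 x\<bar> + \<bar>U 2 x\<bar> + \<bar>U 3 x\<bar>) s"
  proof (rule force_pairing_bound[OF U W e0 s(1) g continuous_on_mode per flux bd _ _ gb])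
   fix l j t z
   let ?x = "cyl_point s t z"
   have x: "ee < cyl_radius ?x" "cyl_radius ?x = s" using s s0 by auto
   show "\<bar>partial j (ev (E s l)) ?x\<bar> <= M"
    unfolding p[OF x(1)] using ev_le_bnd[OF adf_dd[OF aE(1)] e0 x(1), of j l] m[OF s, of j l] Mm(1)[of l j] x(2) by simp
   show "\<bar>ev (q s) ?x\<bar> <= M"
    using ev_le_bnd[OF aE(2) e0 x(1)] mq[OF s] Mm(2) x(2) by simp
  qed
 qed
 then show thesis by (rule that)
qed

subsection \<open>Existence\<close>

text \<open>Mean value theorem: the derivative of x R is \<open>bessel_defect\<close>, which lies
  between 0 and 2.\<close>

lemma mult_R_increment:
 assumes X: "X > 0" "X <= x"
 shows "0 <= x * R x - X * R X" "x * R x - X * R X <= 2 * (x - X)"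
proof -
 have "0 <= x * R x - X * R X & x * R x - X * R X <= 2 * (x - X)"
 proof (cases "X = x")
  case False
  then have "X < x" using X by simp
  from MVT2[OF this, of "%x. x * R x" bessel_defect] obtain y where y: "X < y" "y < x"
   "x * R x - X * R X = (x - X) * bessel_defect y"
   using DERIV_mult_R X by fastforce
  have "0 < bessel_defect y" "bessel_defect y <= 2"
   using bessel_defect_pos[of y] bessel_defect_le[of y] R_le_1[of y] y X by auto
  then have "0 <= (x - X) * bessel_defect y" "(x - X) * bessel_defect y <= (x - X) * 2"
   using \<open>X < x\<close> by (intro mult_nonneg_nonneg mult_left_mono; simp)+
  then show ?thesis unfolding y(3) by simp
 qed simp
 then show "0 <= x * R x - X * R X" "x * R x - X * R X <= 2 * (x - X)" by auto
qed

text \<open>The majorant for Tannery's theorem; linear growth in X costs one derivative of the data.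
  In the force profiles x R(x) - X R(X) may grow like x - X, and this is compensated by the decay
  exp(-(x - X)) of K1(x) relative to K1(X).\<close>

lemma profile_bounds:
 assumes a: "a > 0"
 obtains D where "D > 0" "\<forall>p\<in>{pH, pB, pU, pW, pZ, fN, fT}. \<forall>X x. a <= X --> X <= x --> x <= 2 * X --> \<bar>p x X\<bar> <= D * X"
proof -
 obtain C where C: "C > 0" "!!X. X >= a ==> \<bar>be X * K1 X\<bar> <= C" "!!X. X >= a ==> \<bar>bt X * K1 X\<bar> <= C"
  using coeff_bounds[OF a] by blast
 \<comment> \<open>The algebraic factors of the velocity profiles are at most 6 X + 4, and 4 <= 4 X
   / a. In \<open>D2\<close> the bound 16 pi for the force factors meets x <= 2 X.\<close>
 define D1 where "D1 = C * (6 + 4 / a)"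
 define D2 where "D2 = 32 * pi * C"
 have D: "D1 > 0" "D2 > 0" using C a by (simp_all add: D1_def D2_def add_pos_pos)
 have main: "\<bar>pH x X\<bar> <= D1 * X & \<bar>pB x X\<bar> <= D1 * X & \<bar>pU x X\<bar> <= D1 * X & \<bar>pW x X\<bar> <= D1 * X & \<bar>pZ x X\<bar> <= D1 * X
   & \<bar>fN x X\<bar> <= D2 * X & \<bar>fT x X\<bar> <= D2 * X" if Xa: "a <= X" and xX: "X <= x" "x <= 2 * X" for x X
 proof -
  have X: "X > 0" and x: "x > 0" using a Xa xX by auto
  note P = profile_reduced[OF x X]
  define E where "E = exp (- (x - X))"
  define q where "q = X * cQ X"
  define w where "w = X * R X"
  define \<Delta> where "\<Delta> = x * R x - X * R X"
  have E: "0 < E" "E <= 1" using xX by (auto simp: E_def)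
  have k: "K1 x > 0" "K1 X > 0" "K1 x <= K1 X * E" using K1_pos x X K1_decay[OF X xX(1)] by (auto simp: E_def)
  have co: "\<bar>be X * K1 x\<bar> <= C * E" "\<bar>bt X * K1 x\<bar> <= C * E"
  proof -
   have "\<bar>b\<bar> * K1 x <= \<bar>b\<bar> * (K1 X * E)" for b by (intro mult_left_mono k) simp
   moreover have "\<bar>be X\<bar> * K1 X * E <= C * E" "\<bar>bt X\<bar> * K1 X * E <= C * E"
    using C(2)[OF Xa] C(3)[OF Xa] k E by (auto intro!: mult_right_mono simp: abs_mult)
   ultimately show "\<bar>be X * K1 x\<bar> <= C * E" "\<bar>bt X * K1 x\<bar> <= C * E"
    using k by (auto simp: abs_mult mult.assoc intro: order_trans)
  qed
  have q: "0 <= q" "q <= X" using cQ_bounds[OF X] X by (auto simp: q_def mult_left_le)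
  have w: "0 <= w" "w <= X" using R_pos[OF X] R_le_1[OF X] X by (auto simp: w_def mult_left_le)
  have Rx: "0 < R x" "R x <= 1" using R_pos[OF x] R_le_1[OF x] by auto
  have xR1: "x * R x <= x * 1" using Rx x by (intro mult_left_mono) auto
  have xR: "0 <= x * R x" "x * R x <= 2 * X" using Rx x xR1 xX by (simp, linarith)
  have qx: "0 <= q / x" "q / x <= 1" using q x xX by (auto simp: divide_le_eq)
  have dl: "0 <= \<Delta>" "\<Delta> <= 2 * (x - X)" using mult_R_increment[OF X xX(1)] by (auto simp: \<Delta>_def)
  have Ey: "E * (x - X) <= 1"
  proof -
   have "x - X <= exp (x - X)" using exp_ge_add_one_self[of "x - X"] by linarith
   then have "E * (x - X) <= E * exp (x - X)" using E by (intro mult_left_mono) auto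
   also have "... = 1" by (simp add: E_def flip: exp_add)
   finally show ?thesis .
  qed
  have ED: "E * \<Delta> <= 2"
  proof -
   have "E * \<Delta> <= E * (2 * (x - X))" using dl E by (intro mult_left_mono) auto
   also have "... = 2 * (E * (x - X))" by simp
   finally show ?thesis using Ey by simp
  qed
  have X1: "1 <= X / a" using Xa a by simp
  have b1: "\<bar>b * t\<bar> <= D1 * X" if b: "\<bar>b\<bar> <= C * E" and t: "\<bar>t\<bar> <= 6 * X + 4" for b t
  proof -
   have "\<bar>b * t\<bar> <= (C * 1) * (6 * X + 4 * (X / a))"
   proof -
    have "\<bar>b\<bar> <= C * 1" by (rule order_trans[OF b]) (use C(1) E in \<open>intro mult_left_mono; simp\<close>)
    moreover have "\<bar>t\<bar> <= 6 * X + 4 * (X / a)" using t X1 by argo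
    ultimately show ?thesis unfolding abs_mult using C(1) by (intro mult_mono) auto
   qed
   also have "... = D1 * X" unfolding D1_def by (simp add: distrib_left distrib_right mult_ac)
   finally show ?thesis .
  qed
  have tH: "\<bar>(2 + 2 * q - 2 * w) * R x + 2 * q / x\<bar> <= 6 * X + 4"
  proof -
   have "\<bar>(2 + 2 * q - 2 * w) * R x\<bar> <= (2 + 2 * X) * 1"
    unfolding abs_mult using q w Rx X by (intro mult_mono) auto
   moreover have "2 * q / x = 2 * (q / x)" by simp
   moreover have "\<bar>g + b\<bar> <= 6 * X + 4" if "\<bar>g\<bar> <= (2 + 2 * X) * 1" "b = 2 * h" "0 <= h" "h <= 1" for g b h
    using that X by argo
   ultimately show ?thesis using qx by blast
  qed
  have tB: "\<bar>2 * x - 2 * q * (R x + 2 / x)\<bar> <= 6 * X + 4"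
  proof -
   have "2 * q * (R x + 2 / x) = 2 * (q * R x) + 4 * (q / x)" by (simp add: distrib_left)
   moreover have "0 <= q * R x" "q * R x <= X * 1" using q Rx X by (simp, intro mult_mono) simp_all
   moreover have "\<bar>2 * x - g\<bar> <= 6 * X + 4" if "g = 2 * h + 4 * i" "0 <= h" "h <= X * 1" "0 <= i" "i <= 1" for g h i
    using that X xX by argo
   ultimately show ?thesis using qx by blast
  qed
  have tU: "\<bar>x * R x - w\<bar> <= 6 * X + 4" "\<bar>2 * (w - x * R x)\<bar> <= 6 * X + 4" using xR w X by argo+
  have tZ: "\<bar>x - (2 + w) * R x\<bar> <= 6 * X + 4"
  proof -
   have "0 <= (2 + w) * R x" "(2 + w) * R x <= (2 + X) * 1" using w Rx X by (simp, intro mult_mono) simp_all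
   moreover have "\<bar>x - g\<bar> <= 6 * X + 4" if "0 <= g" "g <= (2 + X) * 1" for g
    using that X xX by argo
   ultimately show ?thesis by blast
  qed
  have b2: "\<bar>m * x * b * t\<bar> <= D2 * X" if b: "\<bar>b\<bar> <= C * E" and t: "E * \<bar>t\<bar> <= T" and m: "m >= 0" "m * T <= 16 * pi" for b t T m
  proof -
   have "\<bar>m * x * b * t\<bar> = m * x * (\<bar>b\<bar> * \<bar>t\<bar>)" using m x by (simp add: abs_mult)
   also have "... <= m * x * ((C * E) * \<bar>t\<bar>)" using m x b by (intro mult_left_mono mult_right_mono) auto
   also have "... = m * x * C * (E * \<bar>t\<bar>)" by simp
   also have "... <= m * x * C * T" using m x C t by (intro mult_left_mono) auto
   also have "... = (m * T) * (x * C)" by simp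
   also have "... <= (16 * pi) * (2 * X * C)" 
    by (rule mult_mono[OF m(2) mult_right_mono[OF xX(2)]]) (use x C in auto)
   finally show ?thesis by (simp add: D2_def mult_ac)
  qed
  have tN: "E * \<bar>8 - 2 * defect_quot X + 4 * \<Delta>\<bar> <= 16"
  proof -
   have "\<bar>8 - 2 * defect_quot X + 4 * \<Delta>\<bar> <= 8 + 4 * \<Delta>" using defect_quot_bounds[OF X] dl by argo
   then have "E * \<bar>8 - 2 * defect_quot X + 4 * \<Delta>\<bar> <= E * (8 + 4 * \<Delta>)" using E by (intro mult_left_mono) auto
   also have "... = 8 * E + 4 * (E * \<Delta>)" by (simp add: distrib_left)
   finally show ?thesis using E ED by argo
  qed
  have tT: "E * \<bar>\<Delta> - 1\<bar> <= 3"
  proof -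
   have "\<bar>\<Delta> - 1\<bar> <= 1 + \<Delta>" using dl by argo
   then have "E * \<bar>\<Delta> - 1\<bar> <= E * (1 + \<Delta>)" using E by (intro mult_left_mono) auto
   also have "... = E + E * \<Delta>" by (simp add: distrib_left)
   finally show ?thesis using E ED by argo
  qed
  have "\<bar>pH x X\<bar> <= D1 * X" unfolding P using b1[OF co(1) tH] by (simp add: q_def w_def)
  moreover have "\<bar>pB x X\<bar> <= D1 * X" unfolding P using b1[OF co(1) tB] by (simp add: q_def)
  moreover have "\<bar>pU x X\<bar> <= D1 * X" unfolding P using b1[OF co(2) tU(1)] by (simp add: w_def)
  moreover have "\<bar>pW x X\<bar> <= D1 * X" unfolding P using b1[OF co(1) tU(2)] by (simp add: w_def mult_ac)
  moreover have "\<bar>pZ x X\<bar> <= D1 * X" unfolding P using b1[OF co(2) tZ] by (simp add: w_def)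
  moreover have "\<bar>fN x X\<bar> <= D2 * X" unfolding P using b2[OF co(1) tN, of pi] by (simp add: \<Delta>_def)
  moreover have "\<bar>fT x X\<bar> <= D2 * X" unfolding P using b2[OF co(2) tT, of "4 * pi"] by (simp add: \<Delta>_def)
  ultimately show ?thesis by blast
 qed
 show thesis
 proof (rule that[of "D1 + D2"])
  show "D1 + D2 > 0" using D by simp
  have up: "y <= (D1 + D2) * X" if "y <= D1 * X \<or> y <= D2 * X" "X > 0" for y X
   unfolding distrib_right using that(1) mult_pos_pos[OF D(1) that(2)] mult_pos_pos[OF D(2) that(2)] by argo
  show "\<forall>p\<in>{pH, pB, pU, pW, pZ, fN, fT}. \<forall>X x. a <= X --> X <= x --> x <= 2 * X --> \<bar>p x X\<bar> <= (D1 + D2) * X"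
  proof (intro ballI allI impI)
   fix p X x assume "p \<in> {pH, pB, pU, pW, pZ, fN, fT}" and h: "a <= X" "X <= x" "x <= 2 * X"
   then show "\<bar>p x X\<bar> <= (D1 + D2) * X"
    using main[OF h] a by (intro up) auto
  qed
 qed
qed

lemma profile_tendsto:
 assumes e: "ee > 0" and p: "p \<in> {pH, pB, pU, pW, pZ, fN, fT}"
 shows "((%s. p (kap k * s) (kap k * ee)) \<longlongrightarrow> p (kap k * ee) (kap k * ee)) (at_right ee)"
proof -
 have X: "kap k * ee > 0" using e by simp
 have L: "isCont (bessel_L n) (kap k * ee)" for n by (rule DERIV_isCont[OF DERIV_bessel_L[OF X]])
 have "isCont (%x. p x (kap k * ee)) (kap k * ee)"
  using p unfolding pH_def[abs_def] pB_def[abs_def] pU_def[abs_def] pW_def[abs_def] pZ_def[abs_def] fN_def[abs_def] fT_def[abs_def]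
  by (elim insertE emptyE) (simp only:, intro continuous_intros L)+
 then show ?thesis
  by (rule isCont_tendsto_compose) (intro tendsto_intros)
qed

text \<open>Absolute summability makes the partial sums converge uniformly, so the sum is continuous
  and its coefficients are the limits given by \<open>fc_limit\<close>.\<close>

lemma wave_fourier:
 assumes ok: "wave_ok \<phi> V"
 shows "sq_integrable (wave \<phi> l V)" "fc (wave \<phi> l V) 0 = 0" "fc (wave \<phi> l V) (int (Suc n)) = of_real (\<phi> n) * (\<i> ^ l * V n)"
proof -
 define c where "c = (%n. of_real (\<phi> n) * (\<i> ^ l * V n))"
 define \<tau> where "\<tau> = (%N. \<Sum>k. \<bar>\<phi> (k + N)\<bar> * cmod (V (k + N)))"
 have sm: "summable (%k. \<bar>\<phi> k\<bar> * cmod (V k))" using ok by (simp add: wave_ok_def)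
 have m: "mode (c k) k z = \<phi> k * Re (\<i> ^ l * V k * cis (kap k * z))" for k z
 proof -
  have "c k * cis (pi * real (Suc k) * z) = of_real (\<phi> k) * (\<i> ^ l * V k * cis (kap k * z))" by (simp add: c_def kap_def)
  then show ?thesis unfolding mode_def by (simp only: Re_complex_of_real times_complex.sel Im_complex_of_real)
 qed
 have mb: "\<bar>mode (c k) k z\<bar> <= \<bar>\<phi> k\<bar> * cmod (V k)" for k z
 proof -
  have "\<bar>mode (c k) k z\<bar> <= cmod (c k * cis (pi * real (Suc k) * z))" unfolding mode_def by (rule abs_Re_le_cmod)
  then show ?thesis by (simp add: c_def norm_mult norm_power)
 qed
 have ms: "summable (%k. \<bar>mode (c k) k z\<bar>)" for z
  by (rule summable_comparison_test'[OF sm, of 0]) (use mb in simp)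
 have ws: "wave \<phi> l V z = (\<Sum>k. mode (c k) k z)" for z by (simp add: wave_def m)
 have bd: "\<bar>wave \<phi> l V z - mode_sum c N z\<bar> <= \<tau> N" for z N
 proof -
  have "wave \<phi> l V z = (\<Sum>k. mode (c (k + N)) (k + N) z) + mode_sum c N z"
   unfolding ws mode_sum_def by (rule suminf_split_initial_segment[OF summable_rabs_cancel[OF ms]])
  moreover have "\<bar>\<Sum>k. mode (c (k + N)) (k + N) z\<bar> <= (\<Sum>k. \<bar>mode (c (k + N)) (k + N) z\<bar>)"
   using summable_ignore_initial_segment[OF ms, of N] by (intro summable_rabs)
  moreover have "... <= \<tau> N"
   unfolding \<tau>_def using summable_ignore_initial_segment[OF ms, of N] summable_ignore_initial_segment[OF sm, of N]
   by (intro suminf_le mb)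
  ultimately show ?thesis by simp
 qed
 have \<tau>: "\<tau> \<longlonglongrightarrow> 0" unfolding \<tau>_def by (rule suminf_exist_split2[OF sm])
 have "uniform_limit UNIV (mode_sum c) (wave \<phi> l V) sequentially"
 proof (rule uniform_limitI)
  fix e :: real assume "e > 0"
  then have "\<forall>\<^sub>F N in sequentially. \<tau> N < e" using \<tau> by (auto dest: order_tendstoD(2))
  then show "\<forall>\<^sub>F N in sequentially. \<forall>x\<in>UNIV. dist (mode_sum c N x) (wave \<phi> l V x) < e"
  proof eventually_elim
   case (elim N)
   then show ?case using bd[of _ N] by (auto simp: dist_real_def abs_minus_commute intro: le_less_trans)
  qed
 qed
 then have "continuous_on UNIV (wave \<phi> l V)"
  by (rule uniform_limit_theorem[rotated]) (auto simp: continuous_on_mode_sum)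
 then show sq: "sq_integrable (wave \<phi> l V)" by (rule sq_integrable_continuous)
 have lim: "(%N. LBINT z:{-1..1}. (wave \<phi> l V z - mode_sum c N z)\<^sup>2) \<longlonglongrightarrow> 0"
 proof (rule tendsto_sandwich[OF _ _ tendsto_const])
  show "\<forall>\<^sub>F N in sequentially. 0 <= (LBINT z:{-1..1}. (wave \<phi> l V z - mode_sum c N z)\<^sup>2)"
   by (auto simp: set_lebesgue_integral_def intro!: Bochner_Integration.integral_nonneg)
  show "\<forall>\<^sub>F N in sequentially. (LBINT z:{-1..1}. (wave \<phi> l V z - mode_sum c N z)\<^sup>2) <= 2 * (\<tau> N)\<^sup>2"
  proof (rule always_eventually, rule allI)
   fix N
   have "(LBINT z:{-1..1}. (wave \<phi> l V z - mode_sum c N z)\<^sup>2) <= (LBINT z:{-1..1::real}. (\<tau> N)\<^sup>2)"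
   proof (rule set_integral_mono)
    show "set_integrable lborel {-1..1} (%z. (wave \<phi> l V z - mode_sum c N z)\<^sup>2)"
     using sq_integrable_diff[OF sq sq_integrable_mode_sum] by (simp add: sq_integrable_def)
    show "set_integrable lborel {-1..1::real} (%z. (\<tau> N)\<^sup>2)" by (rule borel_integrable_atLeastAtMost') simp
    show "(wave \<phi> l V z - mode_sum c N z)\<^sup>2 <= (\<tau> N)\<^sup>2" for z
     using bd[of z N] by (intro power2_le_iff_abs_le[THEN iffD2]) (auto intro: order_trans[OF abs_ge_zero])
   qed
   also have "... = 2 * (\<tau> N)\<^sup>2" by (simp add: set_lebesgue_integral_def)
   finally show "(LBINT z:{-1..1}. (wave \<phi> l V z - mode_sum c N z)\<^sup>2) <= 2 * (\<tau> N)\<^sup>2" .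
  qed
  show "(%N. 2 * (\<tau> N)\<^sup>2) \<longlonglongrightarrow> 0" using tendsto_mult[OF tendsto_const[of 2] tendsto_power[OF \<tau>, of 2]] by simp
 qed
 have "(%N. 0) \<longlonglongrightarrow> fc (wave \<phi> l V) 0" using fc_limit[OF sq lim, of 0] by (simp add: fc_mode_sum)
 then show "fc (wave \<phi> l V) 0 = 0" using LIMSEQ_unique tendsto_const by blast
 have "(%N. fc (mode_sum c N) (int (Suc n))) \<longlonglongrightarrow> c n"
  by (rule tendsto_eventually) (use eventually_gt_at_top[of n] in eventually_elim, simp only: fc_mode_sum if_True)
 from LIMSEQ_unique[OF fc_limit[OF sq lim] this]
 show "fc (wave \<phi> l V) (int (Suc n)) = of_real (\<phi> n) * (\<i> ^ l * V n)" by (simp only: c_def)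
qed

lemma wave_L2_distance:
 assumes ok: "wave_ok \<phi> V" and h: "sq_integrable h" "fc h 0 = 0"
  and hn: "!!n. fc h (int (Suc n)) = of_real (a n) * (\<i> ^ l * V n)"
 shows "set_integrable lborel {-1..1} (%z. (wave \<phi> l V z - h z)\<^sup>2)"
  "(LBINT z:{-1..1}. (wave \<phi> l V z - h z)\<^sup>2) = (\<Sum>n. (\<phi> n - a n)\<^sup>2 * (cmod (V n))\<^sup>2)"
proof -
 note w = wave_fourier[OF ok, where l=l]
 note i = sq_integrable_integrable[OF w(1)] sq_integrable_integrable[OF h(1)]
 have sq: "sq_integrable (%z. wave \<phi> l V z - h z)" by (rule sq_integrable_diff[OF w(1) h(1)])
 then show "set_integrable lborel {-1..1} (%z. (wave \<phi> l V z - h z)\<^sup>2)" by (simp add: sq_integrable_def)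
 have "fc (%z. wave \<phi> l V z - h z) 0 = 0" using fc_diff[OF i, of 0] w(2) h(2) by simp
 from parseval[OF sq this]
 have "(%n. (cmod (fc (%z. wave \<phi> l V z - h z) (int (Suc n))))\<^sup>2) sums (LBINT z:{-1..1}. (wave \<phi> l V z - h z)\<^sup>2)" .
 moreover have "(cmod (fc (%z. wave \<phi> l V z - h z) (int (Suc n))))\<^sup>2 = (\<phi> n - a n)\<^sup>2 * (cmod (V n))\<^sup>2" for n
 proof -
  have "fc (%z. wave \<phi> l V z - h z) (int (Suc n)) = of_real (\<phi> n - a n) * (\<i> ^ l * V n)"
   unfolding fc_diff[OF i] w(3) hn by (simp add: algebra_simps)
  then show ?thesis by (simp add: norm_mult norm_power power_mult_distrib del: of_real_diff)
 qed
 ultimately show "(LBINT z:{-1..1}. (wave \<phi> l V z - h z)\<^sup>2) = (\<Sum>n. (\<phi> n - a n)\<^sup>2 * (cmod (V n))\<^sup>2)"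
  by (simp add: sums_iff)
qed

text \<open>By Parseval the squared distance is a series of squared profile increments weighted with
  |V|^2. Each term tends to 0, and \<open>profile_bounds\<close> dominates it by a multiple of kap^2
  |V|^2, which is summable for H^1 data.\<close>

lemma profile_L2_tendsto:
 assumes e: "ee > 0" and p: "p \<in> {pH, pB, pU, pW, pZ, fN, fT}"
  and ok: "!!s. s > ee ==> wave_ok (%k. p (kap k * s) (kap k * ee)) V"
  and V: "summable (%k. (kap k)\<^sup>2 * (cmod (V k))\<^sup>2)"
  and h: "sq_integrable h" "fc h 0 = 0" "!!n. fc h (int (Suc n)) = of_real (p (kap n * ee) (kap n * ee)) * (\<i> ^ l * V n)"
 shows "((%s. LBINT z:{-1..1}. (wave (%k. p (kap k * s) (kap k * ee)) l V z - h z)\<^sup>2) \<longlongrightarrow> 0) (at_right ee)"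
proof -
 obtain D where D: "D > 0" "\<forall>p\<in>{pH, pB, pU, pW, pZ, fN, fT}. \<forall>X x. ee <= X --> X <= x --> x <= 2 * X --> \<bar>p x X\<bar> <= D * X"
  using profile_bounds[OF e] by blast
 let ?\<phi> = "%s k. p (kap k * s) (kap k * ee)"
 let ?f = "%k s. (?\<phi> s k - ?\<phi> ee k)\<^sup>2 * (cmod (V k))\<^sup>2"
 have ev: "\<forall>\<^sub>F s in at_right ee. s \<in> {ee<..<2 * ee}" using e by (intro eventually_at_right_real) simp
 have "((%s. \<Sum>k. ?f k s) \<longlongrightarrow> (\<Sum>k::nat. 0)) (at_right ee)"
 proof (rule tannerys_theorem[THEN conjunct2, THEN conjunct2])
  show "((%s. ?f k s) \<longlongrightarrow> 0) (at_right ee)" for k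
  proof -
   have "((%s. ?f k s) \<longlongrightarrow> (?\<phi> ee k - ?\<phi> ee k)\<^sup>2 * (cmod (V k))\<^sup>2) (at_right ee)"
    by (intro tendsto_intros profile_tendsto[OF e p])
   then show ?thesis by simp
  qed
  show "summable (%k. (2 * D * ee)\<^sup>2 * ((kap k)\<^sup>2 * (cmod (V k))\<^sup>2))" by (rule summable_mult[OF V])
  show "\<forall>\<^sub>F (k, s) in sequentially \<times>\<^sub>F at_right ee. norm (?f k s) <= (2 * D * ee)\<^sup>2 * ((kap k)\<^sup>2 * (cmod (V k))\<^sup>2)"
   unfolding eventually_prod_filter
  proof (intro exI conjI allI impI)
   show "\<forall>\<^sub>F s in at_right ee. s \<in> {ee<..<2 * ee}" by (rule ev)
   show "\<forall>\<^sub>F k in sequentially. True" by simp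
   fix k :: nat and s assume s: "s \<in> {ee<..<2 * ee}"
   have X: "ee <= kap k * ee" "kap k * ee <= kap k * s" "kap k * s <= 2 * (kap k * ee)" "kap k * ee <= 2 * (kap k * ee)"
    using kap_ge_1[of k] e s mult_right_mono[of 1 "kap k" ee] mult_left_mono[of s "2 * ee" "kap k"] by auto
   have "\<bar>?\<phi> s k\<bar> <= D * (kap k * ee)" "\<bar>?\<phi> ee k\<bar> <= D * (kap k * ee)"
    using D(2) p X by blast+
   then have "\<bar>?\<phi> s k - ?\<phi> ee k\<bar> <= 2 * D * ee * kap k" by (simp add: mult_ac)
   then have "(?\<phi> s k - ?\<phi> ee k)\<^sup>2 <= (2 * D * ee * kap k)\<^sup>2"
    by (intro power2_le_iff_abs_le[THEN iffD2]) (use D e in auto)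
   then have "?f k s <= (2 * D * ee * kap k)\<^sup>2 * (cmod (V k))\<^sup>2" by (intro mult_right_mono) auto
   then show "case (k, s) of (k, s) => norm (?f k s) <= (2 * D * ee)\<^sup>2 * ((kap k)\<^sup>2 * (cmod (V k))\<^sup>2)"
    by (simp add: power_mult_distrib mult_ac)
  qed
 qed simp
 then have lim: "((%s. \<Sum>k. ?f k s) \<longlongrightarrow> 0) (at_right ee)" by simp
 have e2: "\<forall>\<^sub>F s in at_right ee. (\<Sum>k. ?f k s) = (LBINT z:{-1..1}. (wave (?\<phi> s) l V z - h z)\<^sup>2)"
  using eventually_at_right_less[of ee]
 proof eventually_elim
  case (elim s)
  show ?case by (rule wave_L2_distance(2)[OF ok[OF elim] h, symmetric])
 qed
 show ?thesis by (rule Lim_transform_eventually[OF lim e2])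
qed

lemma wave_ok_lin:
 assumes ok: "wave_ok f1 V" "wave_ok f2 V" "wave_ok f3 V" "wave_ok f4 V"
  and h: "!!k. h k = a * f1 k + b * f2 k + c * f3 k + d * f4 k"
 shows "wave_ok h V"
proof -
 have "h = (%k. ((a * f1 k + b * f2 k) + c * f3 k) + d * f4 k)" by (rule ext) (rule h)
 then show ?thesis by (simp only: wave_ok_add wave_ok_cmult ok)
qed

lemma profile_wave_ok:
 assumes adm: "\<forall>f\<in>{aa, bb, be, at', bt}. \<forall>V\<in>{V1, V2, V3}. admissible rr' (cseq f rr V)"
  and r: "0 <= rr'" "rr' < r" and V: "V \<in> {V1, V2, V3}" and p: "p \<in> {pH, pB, pU, pW, pZ, fN, fT}"
 shows "wave_ok (%k. p (kap k * r) (kap k * rr)) V"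
proof -
 note ok = bessel_wave_ok[OF adm r _ V]
 note s = algebra_simps power2_eq_square numeral_2_eq_2
 have Suc1: "bessel_L 1 = bessel_L (Suc 0)" "bessel_L 2 = bessel_L (Suc (Suc 0))" by (simp_all add: numeral_2_eq_2)
 have "wave_ok (%k. pH (kap k * r) (kap k * rr)) V"
  by (rule wave_ok_lin[OF ok[of aa 0 0] ok[of bb 0 0] ok[of bb 0 "Suc 0"] ok[of aa 0 0], where a=1 and b="-1" and c="-2" and d=0])
   (simp_all add: pH_def s Suc1 del: bessel_L.simps)
 moreover
 have "wave_ok (%k. pB (kap k * r) (kap k * rr)) V"
  by (rule wave_ok_lin[OF ok[of bb "Suc (Suc 0)" "Suc (Suc 0)"] ok[of be "Suc (Suc 0)" "Suc 0"] ok[of aa 0 0] ok[of aa 0 0], where a="2 * r\<^sup>2" and b="2 * r\<^sup>2" and c=0 and d=0])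
   (simp_all add: pB_def s Suc1 del: bessel_L.simps)
 moreover
 have "wave_ok (%k. pU (kap k * r) (kap k * rr)) V"
  by (rule wave_ok_lin[OF ok[of at' "Suc 0" "Suc 0"] ok[of bt "Suc 0" "Suc 0"] ok[of bt "Suc 0" 0] ok[of aa 0 0], where a=r and b="2 * r" and c=r and d=0])
   (simp_all add: pU_def s Suc1 del: bessel_L.simps)
 moreover
 have "wave_ok (%k. pW (kap k * r) (kap k * rr)) V"
  by (rule wave_ok_lin[OF ok[of be "Suc 0" "Suc 0"] ok[of aa "Suc 0" "Suc 0"] ok[of bb "Suc 0" "Suc 0"] ok[of be "Suc 0" 0], where a="2 * r" and b="- r" and c="- r" and d="- 2 * r"])
   (simp_all add: pW_def s Suc1 del: bessel_L.simps)
 moreover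
 have "wave_ok (%k. pZ (kap k * r) (kap k * rr)) V"
  by (rule wave_ok_lin[OF ok[of at' 0 0] ok[of bt "Suc (Suc 0)" "Suc 0"] ok[of aa 0 0] ok[of aa 0 0], where a=1 and b="r\<^sup>2" and c=0 and d=0])
   (simp_all add: pZ_def s Suc1 del: bessel_L.simps)
 moreover
 have "wave_ok (%k. fN (kap k * r) (kap k * rr)) V"
  by (rule wave_ok_lin[OF ok[of aa "Suc (Suc 0)" "Suc 0"] ok[of bb "Suc (Suc 0)" "Suc 0"] ok[of be "Suc (Suc 0)" "Suc 0"] ok[of be "Suc (Suc 0)" 0], where a="3 * pi * r\<^sup>2" and b="pi * r\<^sup>2" and c="2 * pi * r\<^sup>2" and d="4 * pi * r\<^sup>2"])
   (simp_all add: fN_def s Suc1 del: bessel_L.simps)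
 moreover
 have "wave_ok (%k. fT (kap k * r) (kap k * rr)) V"
  by (rule wave_ok_lin[OF ok[of at' "Suc (Suc 0)" "Suc 0"] ok[of bt "Suc (Suc 0)" "Suc 0"] ok[of bt "Suc (Suc 0)" 0] ok[of aa 0 0], where a="4 * pi * r\<^sup>2" and b="4 * pi * r\<^sup>2" and c="4 * pi * r\<^sup>2" and d=0])
   (simp_all add: fT_def s Suc1 del: bessel_L.simps)
 ultimately show ?thesis using p by blast
qed

lemma square_sum4: "(a + b + c + d)\<^sup>2 <= 4 * (a\<^sup>2 + b\<^sup>2 + c\<^sup>2 + d\<^sup>2)" for a b c d :: real
proof -
 have "4 * (a\<^sup>2 + b\<^sup>2 + c\<^sup>2 + d\<^sup>2) - (a + b + c + d)\<^sup>2
   = (a - b)\<^sup>2 + (a - c)\<^sup>2 + (a - d)\<^sup>2 + (b - c)\<^sup>2 + (b - d)\<^sup>2 + (c - d)\<^sup>2"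
  by (simp add: power2_eq_square algebra_simps)
 moreover have "... >= 0" by (intro add_nonneg_nonneg zero_le_power2)
 ultimately show ?thesis by linarith
qed

lemma trig_combination_bounds:
 fixes c d w b1 b2 m :: real
 assumes "\<bar>c\<bar> <= 1" "\<bar>d\<bar> <= 1" "\<bar>k\<bar> <= 1"
 shows "(w + k * (c * b1 + d * b2 + m))\<^sup>2 <= 4 * (w\<^sup>2 + b1\<^sup>2 + b2\<^sup>2 + m\<^sup>2)"
  and "(c * b1 + d * b2 + w)\<^sup>2 <= 4 * (w\<^sup>2 + b1\<^sup>2 + b2\<^sup>2)"
proof -
 have 1: "\<bar>c * b1\<bar> <= \<bar>b1\<bar>" "\<bar>d * b2\<bar> <= \<bar>b2\<bar>"
  using abs_mult_le_one[OF assms(1) order_refl] abs_mult_le_one[OF assms(2) order_refl] by auto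
 then have "\<bar>c * b1 + d * b2 + m\<bar> <= \<bar>b1\<bar> + \<bar>b2\<bar> + \<bar>m\<bar>" by arith
 from abs_mult_le_one[OF assms(3) this]
 have "\<bar>w + k * (c * b1 + d * b2 + m)\<bar> <= \<bar>w\<bar> + \<bar>b1\<bar> + \<bar>b2\<bar> + \<bar>m\<bar>" by arith
 then have "(w + k * (c * b1 + d * b2 + m))\<^sup>2 <= (\<bar>w\<bar> + \<bar>b1\<bar> + \<bar>b2\<bar> + \<bar>m\<bar>)\<^sup>2"
  by (intro power2_le_iff_abs_le[THEN iffD2]) auto
 then show "(w + k * (c * b1 + d * b2 + m))\<^sup>2 <= 4 * (w\<^sup>2 + b1\<^sup>2 + b2\<^sup>2 + m\<^sup>2)"
  using square_sum4[of "\<bar>w\<bar>" "\<bar>b1\<bar>" "\<bar>b2\<bar>" "\<bar>m\<bar>"] by simp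
 have "\<bar>c * b1 + d * b2 + w\<bar> <= \<bar>w\<bar> + \<bar>b1\<bar> + \<bar>b2\<bar> + 0" using 1 by arith
 then have "(c * b1 + d * b2 + w)\<^sup>2 <= (\<bar>w\<bar> + \<bar>b1\<bar> + \<bar>b2\<bar> + 0)\<^sup>2"
  by (intro power2_le_iff_abs_le[THEN iffD2]) auto
 then show "(c * b1 + d * b2 + w)\<^sup>2 <= 4 * (w\<^sup>2 + b1\<^sup>2 + b2\<^sup>2)"
  using square_sum4[of "\<bar>w\<bar>" "\<bar>b1\<bar>" "\<bar>b2\<bar>" 0] by simp
qed

lemma norm_sq_3: "(norm (x :: real^3))\<^sup>2 = (x$1)\<^sup>2 + (x$2)\<^sup>2 + (x$3)\<^sup>2"
 unfolding power2_norm_eq_inner inner_vec_def sum_3 by (simp add: power2_eq_square)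

lemma set_integral_nonneg_real: "(!!z. f z >= (0::real)) ==> (LBINT z:A. f z) >= 0"
 unfolding set_lebesgue_integral_def by (rule Bochner_Integration.integral_nonneg) simp

section \<open>The solution and its force density for data in H^1\<close>

context
 fixes ee :: real and v :: "real => real^3" and V :: "3 => nat => complex"
 assumes e: "ee > 0" and v: "in_L2 v" "!!l. fc (%z. v z $ l) 0 = 0" "!!l n. fc (%z. v z $ l) (int (Suc n)) = V l n"
  and S: "!!l. summable (%k. (kap k)\<^sup>2 * (cmod (V l k))\<^sup>2)"
begin

lemma data_admissible: "\<forall>f\<in>{aa, bb, be, at', bt}. \<forall>W\<in>{V 1, V 2, V 3}. admissible ee (cseq f ee W)"
proof -
 have "admissible ee (cseq f ee (V l))" if "f \<in> {aa, bb, be, at', bt}" for f l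
 proof (rule admissible_cseq[OF e that])
  fix k
  have "(cmod (V l k))\<^sup>2 <= (kap k)\<^sup>2 * (cmod (V l k))\<^sup>2"
   using kap_ge_1[of k] one_le_power[of "kap k" 2] mult_right_mono[of 1 "(kap k)\<^sup>2" "(cmod (V l k))\<^sup>2"] by simp
  also have "... <= (\<Sum>k. (kap k)\<^sup>2 * (cmod (V l k))\<^sup>2)"
   using sum_le_suminf[OF S[of l], of "{k}"] by simp
  finally show "cmod (V l k) <= sqrt (\<Sum>k. (kap k)\<^sup>2 * (cmod (V l k))\<^sup>2)" by (rule real_le_rsqrt)
 qed
 then show ?thesis by blast
qed

lemma data_wave_ok:
 assumes "p \<in> {pH, pB, pU, pW, pZ, fN, fT}" "s > ee"
 shows "wave_ok (%k. p (kap k * s) (kap k * ee)) (V l)"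
 using profile_wave_ok[OF data_admissible less_imp_le[OF e] assms(2) _ assms(1), of "V l"] exhaust_3[of l] by auto

lemma data_L2:
 assumes p: "p \<in> {pH, pB, pU, pW, pZ, fN, fT}"
  and h: "sq_integrable h" "fc h 0 = 0" "!!n. fc h (int (Suc n)) = of_real (p (kap n * ee) (kap n * ee)) * (\<i> ^ j * V l n)"
 shows "((%s. LBINT z:{-1..1}. (wave (%k. p (kap k * s) (kap k * ee)) j (V l) z - h z)\<^sup>2) \<longlongrightarrow> 0) (at_right ee)"
  and "s > ee ==> set_integrable lborel {-1..1} (%z. (wave (%k. p (kap k * s) (kap k * ee)) j (V l) z - h z)\<^sup>2)"
 using profile_L2_tendsto[OF e p data_wave_ok[OF p] S h] wave_L2_distance(1)[OF data_wave_ok[OF p] h] by auto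

text \<open>These three profiles vanish on the boundary, so the comparison function is 0.\<close>

lemma data_L2_zero:
 assumes p: "p \<in> {pB, pU, pW}"
 shows "((%s. LBINT z:{-1..1}. (wave (%k. p (kap k * s) (kap k * ee)) j (V l) z)\<^sup>2) \<longlongrightarrow> 0) (at_right ee)"
  and "s > ee ==> set_integrable lborel {-1..1} (%z. (wave (%k. p (kap k * s) (kap k * ee)) j (V l) z)\<^sup>2)"
proof -
 have 0: "fc (%_. 0) k = 0" for k by (simp add: fc_def set_lebesgue_integral_def)
 have p': "p \<in> {pH, pB, pU, pW, pZ, fN, fT}" using p by auto
 have z: "p (kap n * ee) (kap n * ee) = 0" for n using p profile_boundary[of "kap n * ee"] e by auto
 have sq: "sq_integrable (%_. 0)" by (rule sq_integrable_continuous) simp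
 have h: "fc (%_. 0) (int (Suc n)) = of_real (p (kap n * ee) (kap n * ee)) * (\<i> ^ j * V l n)" for n
  by (simp add: 0 z)
 show "((%s. LBINT z:{-1..1}. (wave (%k. p (kap k * s) (kap k * ee)) j (V l) z)\<^sup>2) \<longlongrightarrow> 0) (at_right ee)"
  using data_L2(1)[OF p' sq 0 h] by simp
 show "s > ee ==> set_integrable lborel {-1..1} (%z. (wave (%k. p (kap k * s) (kap k * ee)) j (V l) z)\<^sup>2)"
  using data_L2(2)[OF p' sq 0 h] by simp
qed

lemma data_L2_value:
 assumes p: "p \<in> {pH, pZ}"
 shows "((%s. LBINT z:{-1..1}. (wave (%k. p (kap k * s) (kap k * ee)) 0 (V l) z - v z $ l)\<^sup>2) \<longlongrightarrow> 0) (at_right ee)"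
  and "s > ee ==> set_integrable lborel {-1..1} (%z. (wave (%k. p (kap k * s) (kap k * ee)) 0 (V l) z - v z $ l)\<^sup>2)"
proof -
 have p': "p \<in> {pH, pB, pU, pW, pZ, fN, fT}" using p by auto
 have "p (kap n * ee) (kap n * ee) = 1" for n using p profile_boundary[of "kap n * ee"] e by auto
 then have h: "fc (%z. v z $ l) (int (Suc n)) = of_real (p (kap n * ee) (kap n * ee)) * (\<i> ^ 0 * V l n)" for n
  by (simp only: v(3) of_real_1 power_0 mult_1)
 note d = data_L2[OF p' in_L2_component[OF v(1)] v(2) h]
 show "((%s. LBINT z:{-1..1}. (wave (%k. p (kap k * s) (kap k * ee)) 0 (V l) z - v z $ l)\<^sup>2) \<longlongrightarrow> 0) (at_right ee)"
  by (rule d(1))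
 show "s > ee ==> set_integrable lborel {-1..1} (%z. (wave (%k. p (kap k * s) (kap k * ee)) 0 (V l) z - v z $ l)\<^sup>2)"
  by (rule d(2))
qed

lemma data_stokes_solution:
 "stokes_solution ee v (vfld (sol_field ee (V 1) (V 2) (V 3))) (ev (sol_pressure ee (V 1) (V 2) (V 3)))"
proof -
 let ?W = "%p j l s z. wave (%k. p (kap k * s) (kap k * ee)) j (V l) z"
 let ?u = "vfld (sol_field ee (V 1) (V 2) (V 3))"
 have e0: "0 <= ee" using e by simp
 have adm: "admissible ee (cseq aa ee (V 1))" "admissible ee (cseq bb ee (V 1))" "admissible ee (cseq be ee (V 1))"
  "admissible ee (cseq aa ee (V 2))" "admissible ee (cseq bb ee (V 2))" "admissible ee (cseq be ee (V 2))"
  "admissible ee (cseq at' ee (V 3))" "admissible ee (cseq bt ee (V 3))"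
  using data_admissible by blast+
 \<comment> \<open>Up to a constant, a majorant of the squared boundary error that is independent of
   the angle; each of its summands tends to 0 in the mean over z.\<close>
 define A where "A = (%s z. (?W pH 0 1 s z - v z $ 1)\<^sup>2 + (?W pH 0 2 s z - v z $ 2)\<^sup>2 + (?W pZ 0 3 s z - v z $ 3)\<^sup>2
  + (?W pB 0 1 s z)\<^sup>2 + (?W pB 0 2 s z)\<^sup>2 + (?W pU (Suc 0) 3 s z)\<^sup>2 + (?W pW (Suc 0) 1 s z)\<^sup>2 + (?W pW (Suc 0) 2 s z)\<^sup>2)"
 have mem: "pH \<in> {pH, pZ}" "pZ \<in> {pH, pZ}" "pB \<in> {pB, pU, pW}" "pU \<in> {pB, pU, pW}" "pW \<in> {pB, pU, pW}" by auto
 note T = data_L2_value(1)[OF mem(1)] data_L2_value(1)[OF mem(2)] data_L2_zero(1)[OF mem(3)] data_L2_zero(1)[OF mem(4)] data_L2_zero(1)[OF mem(5)]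
 note I = data_L2_value(2)[OF mem(1)] data_L2_value(2)[OF mem(2)] data_L2_zero(2)[OF mem(3)] data_L2_zero(2)[OF mem(4)] data_L2_zero(2)[OF mem(5)]
 have AI: "set_integrable lborel {-1..1} (A s)" if "s > ee" for s
  unfolding A_def using that by (intro set_integral_add(1) I)
 have A0: "A s z >= 0" for s z unfolding A_def by (intro add_nonneg_nonneg zero_le_power2)
 have AL: "(LBINT z:{-1..1}. A s z) = (LBINT z:{-1..1}. (?W pH 0 1 s z - v z $ 1)\<^sup>2) + (LBINT z:{-1..1}. (?W pH 0 2 s z - v z $ 2)\<^sup>2)
  + (LBINT z:{-1..1}. (?W pZ 0 3 s z - v z $ 3)\<^sup>2) + (LBINT z:{-1..1}. (?W pB 0 1 s z)\<^sup>2) + (LBINT z:{-1..1}. (?W pB 0 2 s z)\<^sup>2)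
  + (LBINT z:{-1..1}. (?W pU (Suc 0) 3 s z)\<^sup>2) + (LBINT z:{-1..1}. (?W pW (Suc 0) 1 s z)\<^sup>2) + (LBINT z:{-1..1}. (?W pW (Suc 0) 2 s z)\<^sup>2)"
  if "s > ee" for s
  unfolding A_def using I[OF that] by (simp only: set_integral_add)
 have lim: "((%s. LBINT z:{-1..1}. A s z) \<longlongrightarrow> 0) (at_right ee)"
 proof (rule Lim_transform_eventually)
  show "((%s. (LBINT z:{-1..1}. (?W pH 0 1 s z - v z $ 1)\<^sup>2) + (LBINT z:{-1..1}. (?W pH 0 2 s z - v z $ 2)\<^sup>2)
  + (LBINT z:{-1..1}. (?W pZ 0 3 s z - v z $ 3)\<^sup>2) + (LBINT z:{-1..1}. (?W pB 0 1 s z)\<^sup>2) + (LBINT z:{-1..1}. (?W pB 0 2 s z)\<^sup>2)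
  + (LBINT z:{-1..1}. (?W pU (Suc 0) 3 s z)\<^sup>2) + (LBINT z:{-1..1}. (?W pW (Suc 0) 1 s z)\<^sup>2) + (LBINT z:{-1..1}. (?W pW (Suc 0) 2 s z)\<^sup>2)) \<longlongrightarrow> 0) (at_right ee)"
   by (intro tendsto_add_zero T)
  show "\<forall>\<^sub>F s in at_right ee. (LBINT z:{-1..1}. (?W pH 0 1 s z - v z $ 1)\<^sup>2) + (LBINT z:{-1..1}. (?W pH 0 2 s z - v z $ 2)\<^sup>2)
  + (LBINT z:{-1..1}. (?W pZ 0 3 s z - v z $ 3)\<^sup>2) + (LBINT z:{-1..1}. (?W pB 0 1 s z)\<^sup>2) + (LBINT z:{-1..1}. (?W pB 0 2 s z)\<^sup>2)
  + (LBINT z:{-1..1}. (?W pU (Suc 0) 3 s z)\<^sup>2) + (LBINT z:{-1..1}. (?W pW (Suc 0) 1 s z)\<^sup>2) + (LBINT z:{-1..1}. (?W pW (Suc 0) 2 s z)\<^sup>2) = (LBINT z:{-1..1}. A s z)"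
   using eventually_at_right_less[of ee] by eventually_elim (rule AL[symmetric])
 qed
 have pt: "(norm (?u (cyl_point s t z) - v z))\<^sup>2 <= 16 * A s z" if s: "s > ee" for s t z
 proof -
  note E = sol_field_eval[OF data_admissible e0 s, of t z]
  have c: "\<bar>cos t\<bar> <= 1" "\<bar>sin t\<bar> <= 1" by simp_all
  let ?a = "?W pH 0 1 s z - v z $ 1" and ?b = "?W pH 0 2 s z - v z $ 2" and ?z = "?W pZ 0 3 s z - v z $ 3"
  let ?B1 = "?W pB 0 1 s z" and ?B2 = "?W pB 0 2 s z" and ?U = "?W pU (Suc 0) 3 s z" and ?W1 = "?W pW (Suc 0) 1 s z" and ?W2 = "?W pW (Suc 0) 2 s z"
  have c3: "(?u (cyl_point s t z) - v z) $ 1 = ?a + cos t * (cos t * ?B1 + sin t * ?B2 + ?U)"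
   "(?u (cyl_point s t z) - v z) $ 2 = ?b + sin t * (cos t * ?B1 + sin t * ?B2 + ?U)"
   "(?u (cyl_point s t z) - v z) $ 3 = cos t * ?W1 + sin t * ?W2 + ?z"
   by (simp_all add: E)
  have "(norm (?u (cyl_point s t z) - v z))\<^sup>2 <= 4 * (?a\<^sup>2 + ?B1\<^sup>2 + ?B2\<^sup>2 + ?U\<^sup>2) + 4 * (?b\<^sup>2 + ?B1\<^sup>2 + ?B2\<^sup>2 + ?U\<^sup>2) + 4 * (?z\<^sup>2 + ?W1\<^sup>2 + ?W2\<^sup>2)"
   unfolding norm_sq_3 c3 by (intro add_mono trig_combination_bounds(1)[OF c c(1)] trig_combination_bounds(1)[OF c c(2)] trig_combination_bounds(2)[OF c c(1)])
  also have "... <= 16 * A s z"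
  proof -
   have "4 * (a + b1 + b2 + u) + 4 * (b + b1 + b2 + u) + 4 * (z + w1 + w2) <= 16 * (a + b + z + b1 + b2 + u + w1 + w2)"
    if "0 <= a" "0 <= b" "0 <= z" "0 <= b1" "0 <= b2" "0 <= u" "0 <= w1" "0 <= w2" for a b z b1 b2 u w1 w2 :: real
    using that by simp
   then show ?thesis unfolding A_def by simp
  qed
  finally show ?thesis .
 qed
 have nn: "(\<integral>\<^sup>+z\<in>{-1..1}. (\<integral>\<^sup>+t\<in>{0..2*pi}. ennreal ((norm (?u (cyl_point s t z) - v z))\<^sup>2) \<partial>lborel) \<partial>lborel)
   <= ennreal (32 * pi * (LBINT z:{-1..1}. A s z))" if s: "s > ee" for s
 proof -
  have "(\<integral>\<^sup>+t\<in>{0..2*pi}. ennreal ((norm (?u (cyl_point s t z) - v z))\<^sup>2) \<partial>lborel) <= ennreal (32 * pi * A s z)" for z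
  proof -
   have "(\<integral>\<^sup>+t\<in>{0..2*pi}. ennreal ((norm (?u (cyl_point s t z) - v z))\<^sup>2) \<partial>lborel) <= (\<integral>\<^sup>+t\<in>{0..2*pi}. ennreal (16 * A s z) \<partial>lborel)"
    by (intro nn_integral_mono mult_right_mono ennreal_leI pt[OF s]) simp
   also have "... = ennreal (16 * A s z) * ennreal (2 * pi)" by (simp add: nn_integral_cmult_indicator)
   also have "... = ennreal (32 * pi * A s z)" using A0[of s z] by (simp add: mult_ac flip: ennreal_mult)
   finally show ?thesis .
  qed
  then have "(\<integral>\<^sup>+z\<in>{-1..1}. (\<integral>\<^sup>+t\<in>{0..2*pi}. ennreal ((norm (?u (cyl_point s t z) - v z))\<^sup>2) \<partial>lborel) \<partial>lborel)
    <= (\<integral>\<^sup>+z\<in>{-1..1}. ennreal (32 * pi * A s z) \<partial>lborel)"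
   by (intro nn_integral_mono mult_right_mono) auto
  also have "... = ennreal (LBINT z:{-1..1}. 32 * pi * A s z)"
   by (rule nn_integral_set_real) (use AI[OF s] A0 in \<open>auto intro!: mult_nonneg_nonneg\<close>)
  finally show ?thesis by simp
 qed
 show ?thesis
  unfolding sol_field_def sol_pressure_def
 proof (rule stokes_solution_stokes_field[OF adm e0], fold sol_field_def)
  have "((%s. ennreal (32 * pi * (LBINT z:{-1..1}. A s z))) \<longlongrightarrow> ennreal (32 * pi * 0)) (at_right ee)"
   by (intro tendsto_ennrealI tendsto_mult tendsto_const lim)
  then have l: "((%s. ennreal (32 * pi * (LBINT z:{-1..1}. A s z))) \<longlongrightarrow> 0) (at_right ee)" by simp
  show "((%s. \<integral>\<^sup>+z\<in>{-1..1}. (\<integral>\<^sup>+t\<in>{0..2*pi}. ennreal ((norm (?u (cyl_point s t z) - v z))\<^sup>2) \<partial>lborel) \<partial>lborel) \<longlongrightarrow> 0) (at_right ee)"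
   by (rule tendsto_sandwich[OF _ _ tendsto_const l])
    (use eventually_at_right_less[of ee] nn in \<open>auto elim!: eventually_mono\<close>)
 qed
qed

text \<open>The limit is constructed by Riesz-Fischer from the values of the force profiles at r =
  \<epsilon>. These grow at most linearly in the wave number, so their products with H^1 data are
  square summable.\<close>

lemma data_force_density:
 obtains f where "is_force_density ee (vfld (sol_field ee (V 1) (V 2) (V 3))) (ev (sol_pressure ee (V 1) (V 2) (V 3))) f"
  "\<forall>n. fc (%z. f z $ 1) (int (Suc n)) = of_real (lambda_PDE_n (kap n * ee)) * V 1 n"
  "\<forall>n. fc (%z. f z $ 2) (int (Suc n)) = of_real (lambda_PDE_n (kap n * ee)) * V 2 n"
  "\<forall>n. fc (%z. f z $ 3) (int (Suc n)) = of_real (lambda_PDE_t (kap n * ee)) * V 3 n"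
proof -
 let ?W = "%p l s z. wave (%k. p (kap k * s) (kap k * ee)) 0 (V l) z"
 have e0: "0 <= ee" using e by simp
 obtain D where D: "D > 0" "\<forall>p\<in>{pH, pB, pU, pW, pZ, fN, fT}. \<forall>X x. ee <= X --> X <= x --> x <= 2 * X --> \<bar>p x X\<bar> <= D * X"
  using profile_bounds[OF e] by blast
 have h: "\<exists>h. (\<forall>z. h (z + 2) = h z) & sq_integrable h & fc h 0 = 0 & (\<forall>n. fc h (int (Suc n)) = of_real (p (kap n * ee) (kap n * ee)) * V l n)"
  if p: "p \<in> {fN, fT}" for p l
 proof -
  have "summable (%n. (cmod (of_real (p (kap n * ee) (kap n * ee)) * V l n))\<^sup>2)"
  proof (rule summable_comparison_test'[where N=0])
   show "summable (%n. (D * ee)\<^sup>2 * ((kap n)\<^sup>2 * (cmod (V l n))\<^sup>2))" by (rule summable_mult[OF S])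
   fix n
   have X: "ee <= kap n * ee" using kap_ge_1[of n] e mult_right_mono[of 1 "kap n" ee] by simp
   have "\<bar>p (kap n * ee) (kap n * ee)\<bar> <= D * (kap n * ee)" using D(2) p X e by auto
   then have "\<bar>p (kap n * ee) (kap n * ee)\<bar> * cmod (V l n) <= D * (kap n * ee) * cmod (V l n)" by (intro mult_right_mono) auto
   then have "(\<bar>p (kap n * ee) (kap n * ee)\<bar> * cmod (V l n))\<^sup>2 <= (D * (kap n * ee) * cmod (V l n))\<^sup>2" by (intro power_mono) auto
   then show "norm ((cmod (of_real (p (kap n * ee) (kap n * ee)) * V l n))\<^sup>2) <= (D * ee)\<^sup>2 * ((kap n)\<^sup>2 * (cmod (V l n))\<^sup>2)"
    by (simp add: norm_mult power_mult_distrib mult_ac)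
  qed
  from riesz_fischer[OF this] show ?thesis by metis
 qed
 obtain h1 where h1: "\<forall>z. h1 (z + 2) = h1 z" "sq_integrable h1" "fc h1 0 = 0" "!!n. fc h1 (int (Suc n)) = of_real (fN (kap n * ee) (kap n * ee)) * V 1 n"
  using h[of fN 1] by blast
 obtain h2 where h2: "\<forall>z. h2 (z + 2) = h2 z" "sq_integrable h2" "fc h2 0 = 0" "!!n. fc h2 (int (Suc n)) = of_real (fN (kap n * ee) (kap n * ee)) * V 2 n"
  using h[of fN 2] by blast
 obtain h3 where h3: "\<forall>z. h3 (z + 2) = h3 z" "sq_integrable h3" "fc h3 0 = 0" "!!n. fc h3 (int (Suc n)) = of_real (fT (kap n * ee) (kap n * ee)) * V 3 n"
  using h[of fT 3] by blast
 define f where "f = (%z. vector [h1 z, h2 z, h3 z] :: real^3)"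
 have fn: "f z $ 1 = h1 z" "f z $ 2 = h2 z" "f z $ 3 = h3 z" for z by (simp_all add: f_def)
 have hm: "h1 \<in> borel_measurable borel" "h2 \<in> borel_measurable borel" "h3 \<in> borel_measurable borel"
  "set_integrable lborel {-1..1} (%z. (h1 z)\<^sup>2)" "set_integrable lborel {-1..1} (%z. (h2 z)\<^sup>2)" "set_integrable lborel {-1..1} (%z. (h3 z)\<^sup>2)"
  using h1 h2 h3 by (auto simp: sq_integrable_def)
 have "f = (%z. h1 z *\<^sub>R axis 1 1 + h2 z *\<^sub>R axis 2 1 + h3 z *\<^sub>R axis 3 1)"
  by (simp add: fun_eq_iff vec3_eq_iff fn axis_def)
 then have fm: "f \<in> borel_measurable lborel"
  using hm by simp
 have fL: "in_L2 f"
  unfolding in_L2_def norm_sq_3 fn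
  using fm h1(1) h2(1) h3(1) hm by (auto simp: vec3_eq_iff fn intro!: set_integral_add(1))
 have m: "fN \<in> {pH, pB, pU, pW, pZ, fN, fT}" "fT \<in> {pH, pB, pU, pW, pZ, fN, fT}" by auto
 have k: "fc h1 (int (Suc n)) = of_real (fN (kap n * ee) (kap n * ee)) * (\<i> ^ 0 * V 1 n)"
  "fc h2 (int (Suc n)) = of_real (fN (kap n * ee) (kap n * ee)) * (\<i> ^ 0 * V 2 n)"
  "fc h3 (int (Suc n)) = of_real (fT (kap n * ee) (kap n * ee)) * (\<i> ^ 0 * V 3 n)" for n
  by (simp_all only: h1(4) h2(4) h3(4) power_0 mult_1)
 note L1 = data_L2[OF m(1) h1(2,3) k(1)] and L2 = data_L2[OF m(1) h2(2,3) k(2)] and L3 = data_L2[OF m(2) h3(2,3) k(3)]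
 let ?A = "%s. (LBINT z:{-1..1}. (?W fN 1 s z - h1 z)\<^sup>2) + (LBINT z:{-1..1}. (?W fN 2 s z - h2 z)\<^sup>2) + (LBINT z:{-1..1}. (?W fT 3 s z - h3 z)\<^sup>2)"
 have "((%s. ennreal (?A s)) \<longlongrightarrow> ennreal 0) (at_right ee)"
  by (intro tendsto_ennrealI tendsto_add_zero L1 L2 L3)
 then have l: "((%s. ennreal (?A s)) \<longlongrightarrow> 0) (at_right ee)" by simp
 have eq: "(\<integral>\<^sup>+z\<in>{-1..1}. ennreal ((norm (circle_force (vfld (sol_field ee (V 1) (V 2) (V 3))) (ev (sol_pressure ee (V 1) (V 2) (V 3))) s z - f z))\<^sup>2) \<partial>lborel)
   = ennreal (?A s)" if s: "s > ee" for s
 proof -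
  note F = sol_field_force[OF data_admissible e0 s]
  have i: "set_integrable lborel {-1..1} (%z. (?W fN 1 s z - h1 z)\<^sup>2 + (?W fN 2 s z - h2 z)\<^sup>2 + (?W fT 3 s z - h3 z)\<^sup>2)"
   by (intro set_integral_add(1) L1(2) L2(2) L3(2) s)
  have a: "(LBINT z:{-1..1}. (?W fN 1 s z - h1 z)\<^sup>2 + (?W fN 2 s z - h2 z)\<^sup>2 + (?W fT 3 s z - h3 z)\<^sup>2) = ?A s"
   using L1(2)[OF s] L2(2)[OF s] L3(2)[OF s] by (simp only: set_integral_add)
  show ?thesis
   unfolding norm_sq_3 vector_minus_component F fn a[symmetric]
   by (rule nn_integral_set_real[OF i]) (intro add_nonneg_nonneg zero_le_power2)
 qed
 have "is_force_density ee (vfld (sol_field ee (V 1) (V 2) (V 3))) (ev (sol_pressure ee (V 1) (V 2) (V 3))) f"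
  unfolding is_force_density_def
 proof (intro conjI fL)
  show "((%s. \<integral>\<^sup>+z\<in>{-1..1}. ennreal ((norm (circle_force (vfld (sol_field ee (V 1) (V 2) (V 3))) (ev (sol_pressure ee (V 1) (V 2) (V 3))) s z - f z))\<^sup>2) \<partial>lborel) \<longlongrightarrow> 0) (at_right ee)"
   by (rule Lim_transform_eventually[OF l]) (use eventually_at_right_less[of ee] eq in \<open>auto elim!: eventually_mono\<close>)
 qed
 moreover have "fc (%z. f z $ 1) (int (Suc n)) = of_real (lambda_PDE_n (kap n * ee)) * V 1 n"
  "fc (%z. f z $ 2) (int (Suc n)) = of_real (lambda_PDE_n (kap n * ee)) * V 2 n"
  "fc (%z. f z $ 3) (int (Suc n)) = of_real (lambda_PDE_t (kap n * ee)) * V 3 n" for n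
 proof -
  have X: "kap n * ee > 0" using e by simp
  show "fc (%z. f z $ 1) (int (Suc n)) = of_real (lambda_PDE_n (kap n * ee)) * V 1 n"
   "fc (%z. f z $ 2) (int (Suc n)) = of_real (lambda_PDE_n (kap n * ee)) * V 2 n"
   "fc (%z. f z $ 3) (int (Suc n)) = of_real (lambda_PDE_t (kap n * ee)) * V 3 n"
   unfolding fn h1(4) h2(4) h3(4) profile_boundary(6,7)[OF X] by (rule refl)+
 qed
 ultimately show thesis by (intro that allI)
qed

text \<open>The Bessel solution shows that there is something to choose. The chosen density belongs
  to an unknown solution, but its pairings with all modes agree with those of the Bessel force, and
  its mean is 0; this determines every coefficient.\<close>

lemma slender_body_PDE_coeffs:
 shows "in_L2 (slender_body_PDE ee v)" "fc (%z. slender_body_PDE ee v z $ l) 0 = 0"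
  "fc (%z. slender_body_PDE ee v z $ l) (int (Suc n)) = of_real ((if l = 3 then lambda_PDE_t else lambda_PDE_n) (kap n * ee)) * V l n"
proof -
 let ?u = "vfld (sol_field ee (V 1) (V 2) (V 3))" and ?p = "ev (sol_pressure ee (V 1) (V 2) (V 3))"
 let ?f = "slender_body_PDE ee v"
 obtain f where f: "is_force_density ee ?u ?p f"
  "\<forall>n. fc (%z. f z $ 1) (int (Suc n)) = of_real (lambda_PDE_n (kap n * ee)) * V 1 n"
  "\<forall>n. fc (%z. f z $ 2) (int (Suc n)) = of_real (lambda_PDE_n (kap n * ee)) * V 2 n"
  "\<forall>n. fc (%z. f z $ 3) (int (Suc n)) = of_real (lambda_PDE_t (kap n * ee)) * V 3 n"
  using data_force_density by blast
 have "\<exists>u p. stokes_solution ee v u p & is_force_density ee u p ?f"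
  unfolding slender_body_PDE_def
  by (rule someI_ex[where P="%f. \<exists>u p. stokes_solution ee v u p & is_force_density ee u p f"])
   (use data_stokes_solution f(1) in blast)
 then obtain u p where up: "stokes_solution ee v u p" "is_force_density ee u p ?f" by blast
 have e0: "0 <= ee" using e by simp
 show L: "in_L2 ?f" using up(2) by (simp add: is_force_density_def)
 have fL: "in_L2 f" using f(1) by (simp add: is_force_density_def)
 show "fc (%z. ?f z $ l) 0 = 0" unfolding fc_0 force_density_mean_zero[OF e0 up] by simp
 have vm: "v \<in> borel_measurable borel" using v(1) by (simp add: in_L2_def)
 have "fc (%z. ?f z $ l) (int (Suc n)) = fc (%z. f z $ l) (int (Suc n))"
 proof (rule complex_eq_of_pairing)
  fix d
  obtain M where M: "force_kernel_bound ee (mode d n) l M" using force_kernel_bound_mode[OF e] by blast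
  have b: "\<bar>mode d n z\<bar> <= cmod d" for z
   using abs_Re_le_cmod[of "d * cis (pi * real (Suc n) * z)"] by (simp add: mode_def norm_mult)
  have "(LBINT z:{-1..1}. mode d n z * ?f z $ l) = (LBINT z:{-1..1}. mode d n z * f z $ l)"
   by (rule force_density_pairing_unique[OF e vm up(1) data_stokes_solution up(2) f(1) continuous_on_mode b M])
  then show "Re (d * cnj (fc (%z. ?f z $ l) (int (Suc n)))) = Re (d * cnj (fc (%z. f z $ l) (int (Suc n))))"
   using integral_mult_mode[OF sq_integrable_integrable[OF in_L2_component[OF L]], of l d n]
    integral_mult_mode[OF sq_integrable_integrable[OF in_L2_component[OF fL]], of l d n] by (simp add: mult.commute)
 qed
 then show "fc (%z. ?f z $ l) (int (Suc n)) = of_real ((if l = 3 then lambda_PDE_t else lambda_PDE_n) (kap n * ee)) * V l n"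
  using f(2-4) exhaust_3[of l] by auto
qed

end

subsection \<open>The error estimate\<close>

lemma fourier_coeff_fc: "fourier_coeff v k $ j = (1/2) * fc (%z. v z $ j) k"
 by (simp add: fourier_coeff_def fc_def)

lemma fc_uminus: "fc g (- k) = cnj (fc g k)"
proof -
 have "cnj (fc g k) = (LBINT z. cnj (indicat_real {-1..1} z *\<^sub>R (of_real (g z) * cis (- (pi * of_int k * z)))))"
  unfolding fc_def set_lebesgue_integral_def by (rule Bochner_Integration.integral_cnj[symmetric])
 also have "... = fc g (- k)"
  unfolding fc_def set_lebesgue_integral_def by (rule Bochner_Integration.integral_cong) (simp_all add: cis_cnj)
 finally show ?thesis by simp
qed

lemma lambda_SB_eq:
 assumes e: "ee > 0"
 shows "lambda_SB_t ee (int (Suc n)) = 4 * pi / (2 * log_term (kap n * ee) - 1)"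
  "lambda_SB_n ee (int (Suc n)) = 8 * pi / (2 * log_term (kap n * ee) + 1)"
  "lambda_SB_t ee (- k) = lambda_SB_t ee k" "lambda_SB_n ee (- k) = lambda_SB_n ee k"
proof -
 have x: "pi * ee * of_int \<bar>int (Suc n)\<bar> / 2 = kap n * ee / 2" by (simp add: kap_def)
 have i: "1 / (1 / (c * pi) * w) = c * pi / w" for c w :: real by simp
 have t: "- (1 / (4 * pi)) * (1 + 2 * L + 2 * g) = 1 / (4 * pi) * (2 * (- L - g) - 1)" for L g :: real
  by (simp add: algebra_simps add_divide_distrib diff_divide_distrib)
 have n: "1 - 2 * L - 2 * g = 2 * (- L - g) + 1" for L g :: real by simp
 show "lambda_SB_t ee (int (Suc n)) = 4 * pi / (2 * log_term (kap n * ee) - 1)"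
  unfolding lambda_SB_t_def x t i log_term_def ..
 show "lambda_SB_n ee (int (Suc n)) = 8 * pi / (2 * log_term (kap n * ee) + 1)"
  unfolding lambda_SB_n_def x n i log_term_def ..
 show "lambda_SB_t ee (- k) = lambda_SB_t ee k" "lambda_SB_n ee (- k) = lambda_SB_n ee k"
  by (simp_all add: lambda_SB_t_def lambda_SB_n_def)
qed

text \<open>Index n stands for frequency n + 1, so a real cutoff N keeps exactly the indices below
  its floor; for a floor at most 0 both sides are empty.\<close>

lemma modes_eq: "modes N = (%n. int (Suc n)) ` {..<nat \<lfloor>N\<rfloor>} \<union> (%n. - int (Suc n)) ` {..<nat \<lfloor>N\<rfloor>}"
proof -
 have m: "int (Suc n) <= \<lfloor>N\<rfloor> \<longleftrightarrow> n < nat \<lfloor>N\<rfloor>" for n by linarith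
 have k: "k \<in> modes N \<longleftrightarrow> (\<exists>n<nat \<lfloor>N\<rfloor>. k = int (Suc n) \<or> k = - int (Suc n))" for k
 proof
  assume "k \<in> modes N"
  then have h: "1 <= \<bar>k\<bar>" "\<bar>k\<bar> <= \<lfloor>N\<rfloor>" by (auto simp: modes_def le_floor_iff)
  define n where "n = nat (\<bar>k\<bar> - 1)"
  have n: "int (Suc n) = \<bar>k\<bar>" using h by (simp add: n_def)
  then have "n < nat \<lfloor>N\<rfloor>" using h(2) m by metis
  moreover have "k = int (Suc n) \<or> k = - int (Suc n)" using n by arith
  ultimately show "\<exists>n<nat \<lfloor>N\<rfloor>. k = int (Suc n) \<or> k = - int (Suc n)" by blast
 next
  assume "\<exists>n<nat \<lfloor>N\<rfloor>. k = int (Suc n) \<or> k = - int (Suc n)"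
  then obtain n where "n < nat \<lfloor>N\<rfloor>" "\<bar>k\<bar> = int (Suc n)" by auto
  then have "\<bar>k\<bar> <= \<lfloor>N\<rfloor>" "1 <= \<bar>k\<bar>" using m[of n] by auto
  then show "k \<in> modes N" by (simp add: modes_def le_floor_iff)
 qed
 show ?thesis using k by (auto simp: set_eq_iff image_iff)
qed

text \<open>The frequencies k and -k contribute conjugate terms because the symbol is real and even.
  Their sum is twice a real part, and the 2 cancels the 1/2 that relates \<open>fc\<close> to the
  Fourier coefficient.\<close>

lemma modes_sum:
 assumes lam: "!!k. lam (- k) = (lam k :: real)"
 shows "(\<Sum>k\<in>modes N. of_real (lam k) * ((1/2) * fc g k) * cis (pi * of_int k * z))
  = of_real (mode_sum (%n. of_real (lam (int (Suc n))) * fc g (int (Suc n))) (nat \<lfloor>N\<rfloor>) z)"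
proof -
 let ?f = "%k. of_real (lam k) * ((1/2) * fc g k) * cis (pi * of_int k * z)"
 have cn: "?f (- k) = cnj (?f k)" for k by (simp add: lam fc_uminus cis_cnj)
 have "(\<Sum>k\<in>modes N. ?f k) = (\<Sum>k\<in>(%n. int (Suc n)) ` {..<nat \<lfloor>N\<rfloor>}. ?f k) + (\<Sum>k\<in>(%n. - int (Suc n)) ` {..<nat \<lfloor>N\<rfloor>}. ?f k)"
  unfolding modes_eq by (rule sum.union_disjoint) auto
 also have "... = (\<Sum>n<nat \<lfloor>N\<rfloor>. ?f (int (Suc n))) + (\<Sum>n<nat \<lfloor>N\<rfloor>. ?f (- int (Suc n)))"
  by (subst (1 2) sum.reindex) (auto simp: inj_on_def)
 also have "... = (\<Sum>n<nat \<lfloor>N\<rfloor>. ?f (int (Suc n)) + cnj (?f (int (Suc n))))"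
  unfolding cn by (rule sum.distrib[symmetric])
 also have "... = (\<Sum>n<nat \<lfloor>N\<rfloor>. of_real (mode (of_real (lam (int (Suc n))) * fc g (int (Suc n))) n z))"
 proof (rule sum.cong[OF refl])
  fix n
  have "?f (int (Suc n)) = (1/2) * (of_real (lam (int (Suc n))) * fc g (int (Suc n)) * cis (pi * real (Suc n) * z))" by simp
  then have "2 * Re (?f (int (Suc n))) = mode (of_real (lam (int (Suc n))) * fc g (int (Suc n))) n z"
   unfolding mode_def by (simp only: Re_divide_numeral mult_1 times_divide_eq_left)
  then show "?f (int (Suc n)) + cnj (?f (int (Suc n))) = of_real (mode (of_real (lam (int (Suc n))) * fc g (int (Suc n))) n z)"
   by (simp only: complex_add_cnj)
 qed
 finally show ?thesis by (simp add: mode_sum_def)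
qed

text \<open>Both rates at once: below the cutoff x <= 1 allows x^2 to be replaced by x^j, and above
  it x > a turns linear growth into D x^2 / a.\<close>

lemma truncated_error:
 fixes L T :: "real => real"
 assumes a: "0 < a" "a <= b" "b <= 1" and C: "C > 0" "!!x. 0 < x ==> x <= b ==> \<bar>L x - T x\<bar> <= C * x\<^sup>2"
  and D: "D > 0" "!!x. x >= a ==> \<bar>L x\<bar> <= D * x" and x: "x > 0" and j: "j \<in> {1, 2 :: nat}"
 shows "\<bar>L x - (if x <= a then T x else 0)\<bar> <= (C + D + D / a) * x ^ j"
proof (cases "x <= a")
 case True
 then have "x <= 1" using a by simp
 then have "x\<^sup>2 <= x ^ j" using j x by (auto simp: power2_eq_square mult_left_le)
 then have "C * x\<^sup>2 <= (C + D + D / a) * x ^ j" using C(1) D(1) a x by (intro mult_mono) auto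
 then show ?thesis using True C(2)[OF x] a by auto
next
 case False
 have "x <= x\<^sup>2 / a" using False x a by (simp add: power2_eq_square le_divide_eq)
 then have "D * x <= D * (x\<^sup>2 / a)" using D(1) by (intro mult_left_mono) auto
 then have "D * x <= (D + D / a) * x ^ j"
  using j D(1) a x by (auto simp: distrib_right intro: order_trans add_increasing add_increasing2)
 also have "... <= (C + D + D / a) * x ^ j" using C(1) x by (intro mult_right_mono) auto
 finally show ?thesis using False D(2)[of x] by auto
qed

lemma norm_sq_3c: "(norm (w :: complex^3))\<^sup>2 = (cmod (w$1))\<^sup>2 + (cmod (w$2))\<^sup>2 + (cmod (w$3))\<^sup>2"
 unfolding norm_vec_def L2_set_def by (simp add: sum_3)

text \<open>The positive frequencies form a part of a nonnegative sum over the integers. Discarding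
  the rest costs at most a constant factor.\<close>

lemma sobolev_sum:
 assumes "in_sobolev s v"
 shows "summable (%n. (1 + (kap n)\<^sup>2) powr s * (norm (fourier_coeff v (int (Suc n))))\<^sup>2)"
  "2 * (\<Sum>n. (1 + (kap n)\<^sup>2) powr s * (norm (fourier_coeff v (int (Suc n))))\<^sup>2) <= (sobolev_norm s v)\<^sup>2"
proof -
 define G where "G = (%k::int. (1 + (pi * of_int k)\<^sup>2) powr s * (norm (fourier_coeff v k))\<^sup>2)"
 let ?i = "%n. int (Suc n)"
 have G: "G summable_on UNIV" using assms by (simp add: in_sobolev_def G_def)
 have G0: "G k >= 0" for k by (simp add: G_def)
 have eq: "G (?i n) = (1 + (kap n)\<^sup>2) powr s * (norm (fourier_coeff v (int (Suc n))))\<^sup>2" for n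
  by (simp only: G_def kap_def of_int_of_nat_eq)
 have inj: "inj_on ?i UNIV" by (auto simp: inj_on_def)
 have r: "G summable_on (range ?i)" by (rule summable_on_subset_banach[OF G]) simp
 then have r2: "(%n. G (?i n)) summable_on UNIV" using summable_on_reindex[OF inj, of G] by (simp add: o_def)
 then have sm: "summable (%n. G (?i n))" by (rule summable_on_imp_summable)
 have "(\<Sum>n. G (?i n)) = infsum (%n. G (?i n)) UNIV"
  using has_sum_imp_sums[OF has_sum_infsum[OF r2]] by (rule sums_unique[symmetric])
 also have "... = infsum G (range ?i)" using infsum_reindex[OF inj, of G] by (simp add: o_def)
 also have "... <= infsum G UNIV" by (rule infsum_mono_neutral[OF r G]) (use G0 in auto)
 finally have le: "(\<Sum>n. G (?i n)) <= infsum G UNIV" .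
 have "infsum G UNIV >= 0" by (rule infsum_nonneg) (use G0 in auto)
 then have "(sobolev_norm s v)\<^sup>2 = 2 * infsum G UNIV" by (simp add: sobolev_norm_def G_def)
 then show "2 * (\<Sum>n. (1 + (kap n)\<^sup>2) powr s * (norm (fourier_coeff v (int (Suc n))))\<^sup>2) <= (sobolev_norm s v)\<^sup>2"
  unfolding eq[symmetric] using le by simp
 show "summable (%n. (1 + (kap n)\<^sup>2) powr s * (norm (fourier_coeff v (int (Suc n))))\<^sup>2)"
  unfolding eq[symmetric] by (rule sm)
qed

lemma in_sobolev_mono:
 assumes "in_sobolev s v" "t <= s"
 shows "in_sobolev t v"
 unfolding in_sobolev_def
proof
 show "in_L2 v" using assms by (simp add: in_sobolev_def)
 show "(%k::int. (1 + (pi * of_int k)\<^sup>2) powr t * (norm (fourier_coeff v k))\<^sup>2) summable_on UNIV"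
  by (rule summable_on_comparison_test[of "%k::int. (1 + (pi * of_int k)\<^sup>2) powr s * (norm (fourier_coeff v k))\<^sup>2"])
   (use assms in \<open>auto simp: in_sobolev_def intro!: mult_right_mono powr_mono\<close>)
qed

theorem theorem1p4:
  fixes C1 C2 :: real
  assumes "0 < C1" and "C1 \<le> 1 / (4 * pi)"
    and "0 < C2" and "C2 \<le> 73 / (100 * pi)"
  shows "\<exists>C::real. \<forall>\<epsilon>>0. \<forall>v :: real \<Rightarrow> real^3. zero_mean v \<longrightarrow>
    (in_sobolev 1 v \<longrightarrow>
       in_L2 (approx_error \<epsilon> (C1 / \<epsilon>) (C2 / \<epsilon>) v) \<and>
       L2_norm (approx_error \<epsilon> (C1 / \<epsilon>) (C2 / \<epsilon>) v) \<le> C * \<epsilon> * sobolev_norm 1 v) \<and>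
    (in_sobolev 2 v \<longrightarrow>
       in_L2 (approx_error \<epsilon> (C1 / \<epsilon>) (C2 / \<epsilon>) v) \<and>
       L2_norm (approx_error \<epsilon> (C1 / \<epsilon>) (C2 / \<epsilon>) v) \<le> C * \<epsilon>\<^sup>2 * sobolev_norm 2 v)"
proof -
 have a1: "0 < pi * C1" "pi * C1 <= 1/4" "(1/4::real) <= 1" and a2: "0 < pi * C2" "pi * C2 <= 73/100" "(73/100::real) <= 1"
  using assms by (simp_all add: field_simps)
 obtain CE where CE: "CE > 0"
  "!!x. 0 < x ==> x <= 1/4 ==> \<bar>lambda_PDE_t x - 4 * pi / (2 * log_term x - 1)\<bar> <= CE * x\<^sup>2"
  "!!x. 0 < x ==> x <= 73/100 ==> \<bar>lambda_PDE_n x - 8 * pi / (2 * log_term x + 1)\<bar> <= CE * x\<^sup>2"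
  using slender_body_eigenvalue_estimate by blast
 obtain Ct where Ct: "Ct > 0" "!!x. x >= pi * C1 ==> \<bar>lambda_PDE_t x\<bar> <= Ct * x" using lambda_PDE_t_linear[OF a1(1)] by blast
 obtain Cn where Cn: "Cn > 0" "!!x. x >= pi * C2 ==> \<bar>lambda_PDE_n x\<bar> <= Cn * x" using lambda_PDE_n_linear[OF a2(1)] by blast
 \<comment> \<open>The constants of \<open>truncated_error\<close> for a = pi C1 and a = pi C2, the
   values of x = kap \<epsilon> at which the two sums are cut off.\<close>
 define Kt where "Kt = CE + Ct + Ct / (pi * C1)"
 define Kn where "Kn = CE + Cn + Cn / (pi * C2)"
 define K where "K = Kt + Kn"
 have Kp1: "Kt > 0" unfolding Kt_def by (intro add_pos_pos divide_pos_pos CE(1) Ct(1) a1(1))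
 have Kp2: "Kn > 0" unfolding Kn_def by (intro add_pos_pos divide_pos_pos CE(1) Cn(1) a2(1))
 note Kp = Kp1 Kp2
 define lam where "lam = (%(l::3) ee k. if l = 3 then lambda_SB_t ee k else lambda_SB_n ee k)"
 define cut where "cut = (%l::3. if l = 3 then C1 else C2)"
 define err where "err = (%(l::3) ee n. (if l = 3 then lambda_PDE_t else lambda_PDE_n) (kap n * ee)
   - (if n < nat \<lfloor>cut l / ee\<rfloor> then lam l ee (int (Suc n)) else 0))"
 have errb: "\<bar>err l ee n\<bar> <= K * (kap n * ee) ^ j" if e: "ee > 0" and j: "j \<in> {1, 2}" for l ee n j
 proof -
  have x: "kap n * ee > 0" using e by simp
  have trunc: "n < nat \<lfloor>c / ee\<rfloor> \<longleftrightarrow> kap n * ee <= pi * c" for c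
  proof -
   have "n < nat \<lfloor>c / ee\<rfloor> \<longleftrightarrow> int (Suc n) <= \<lfloor>c / ee\<rfloor>" by linarith
   also have "... \<longleftrightarrow> real (Suc n) <= c / ee" by (simp only: le_floor_iff of_int_of_nat_eq)
   also have "... \<longleftrightarrow> real (Suc n) * ee <= c" using e by (simp only: pos_le_divide_eq)
   also have "... \<longleftrightarrow> pi * (real (Suc n) * ee) <= pi * c" using pi_gt_zero by (simp only: mult_le_cancel_left_pos)
   finally show ?thesis by (simp only: kap_def mult.assoc)
  qed
  have p: "0 <= (kap n * ee) ^ j" using x by simp
  have et: "err 3 ee n = lambda_PDE_t (kap n * ee)
    - (if kap n * ee <= pi * C1 then 4 * pi / (2 * log_term (kap n * ee) - 1) else 0)"
   by (simp only: err_def lam_def cut_def trunc lambda_SB_eq[OF e] if_True refl)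
  have t: "\<bar>err 3 ee n\<bar> <= Kt * (kap n * ee) ^ j"
   unfolding et Kt_def by (rule truncated_error[OF a1 CE(1,2) Ct x j])
  have en: "err l ee n = lambda_PDE_n (kap n * ee)
    - (if kap n * ee <= pi * C2 then 8 * pi / (2 * log_term (kap n * ee) + 1) else 0)" if "l \<noteq> 3"
   by (simp only: err_def lam_def cut_def trunc lambda_SB_eq[OF e] that if_False refl)
  have n: "\<bar>err l ee n\<bar> <= Kn * (kap n * ee) ^ j" if "l \<noteq> 3"
   unfolding en[OF that] Kn_def by (rule truncated_error[OF a2 CE(1,3) Cn x j])
  have "Kt * (kap n * ee) ^ j <= K * (kap n * ee) ^ j" "Kn * (kap n * ee) ^ j <= K * (kap n * ee) ^ j"
   using Kp p by (auto simp: K_def intro!: mult_right_mono)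
  then show ?thesis using t n by (cases "l = 3") (auto intro: order_trans)
 qed
 have main: "in_L2 (approx_error ee (C1 / ee) (C2 / ee) v) &
    L2_norm (approx_error ee (C1 / ee) (C2 / ee) v) <= (2 * K) * ee ^ j * sobolev_norm (real j) v"
  if e: "ee > 0" and zm: "zero_mean v" and j: "j \<in> {1, 2}" and sob: "in_sobolev (real j) v" for ee v j
 proof -
  have s1: "in_sobolev 1 v" by (rule in_sobolev_mono[OF sob]) (use j in auto)
  have vL: "in_L2 v" using s1 by (simp add: in_sobolev_def)
  define V where "V = (%l n. fc (%z. v z $ l) (int (Suc n)))"
  \<comment> \<open>The 4 is the square of the factor 2 between \<open>fc\<close> and
    \<open>fourier_coeff\<close>; it is the origin of the 2 in the final constant 2 K.\<close>
  have norm4: "4 * (norm (fourier_coeff v (int (Suc n))))\<^sup>2 = (cmod (V 1 n))\<^sup>2 + (cmod (V 2 n))\<^sup>2 + (cmod (V 3 n))\<^sup>2" for n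
   unfolding norm_sq_3c fourier_coeff_fc V_def by (simp add: norm_mult power_mult_distrib power2_eq_square)
  have Vle: "(cmod (V l n))\<^sup>2 <= 4 * (norm (fourier_coeff v (int (Suc n))))\<^sup>2" for l n
   unfolding norm4 using exhaust_3[of l] by auto
  define G where "G = (%i n. (1 + (kap n)\<^sup>2) powr real i * (norm (fourier_coeff v (int (Suc n))))\<^sup>2)"
  have kG: "((kap n) ^ i)\<^sup>2 * (4 * (norm (fourier_coeff v (int (Suc n))))\<^sup>2) <= 4 * G i n" for i n
  proof -
   have "((kap n) ^ i)\<^sup>2 = ((kap n)\<^sup>2) ^ i" by (simp only: power_mult[symmetric] mult.commute)
   also have "... <= (1 + (kap n)\<^sup>2) ^ i" by (intro power_mono) auto
   also have "... = (1 + (kap n)\<^sup>2) powr real i" by (rule powr_realpow[symmetric]) (simp add: add_pos_nonneg)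
   finally show ?thesis unfolding G_def by (simp add: mult_right_mono)
  qed
  have kV: "((kap n) ^ i)\<^sup>2 * (cmod (V l n))\<^sup>2 <= 4 * G i n" for i l n
   by (rule order_trans[OF mult_left_mono[OF Vle] kG]) simp
  have sG: "summable (G j)" "2 * (\<Sum>n. G j n) <= (sobolev_norm (real j) v)\<^sup>2"
   using sobolev_sum[OF sob] by (simp_all add: G_def)
  have sG1: "summable (G 1)" using sobolev_sum(1)[OF s1] by (simp add: G_def)
  have kVs: "summable (%k. (kap k)\<^sup>2 * (cmod (V l k))\<^sup>2)" for l
   by (rule summable_comparison_test'[OF summable_mult[OF sG1, of 4], of 0]) (use kV[of _ 1 l] in simp)
  \<comment> \<open>Square integrability on a period gives integrability, since the norm is at most
    1 plus its square; only then can the mean of the vector field be taken componentwise.\<close>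
  have v0: "fc (%z. v z $ l) 0 = 0" for l
  proof -
   have i: "set_integrable lborel {-1..1} v"
    unfolding set_integrable_def
   proof (rule Bochner_Integration.integrable_bound[where f="%z. indicat_real {-1..1} z *\<^sub>R (1 + (norm (v z))\<^sup>2)"])
    have "set_integrable lborel {-1..1::real} (%z. 1 + (norm (v z))\<^sup>2)"
     using vL by (intro set_integral_add(1)) (auto simp: in_L2_def intro: borel_integrable_atLeastAtMost')
    then show "integrable lborel (%z. indicat_real {-1..1} z *\<^sub>R (1 + (norm (v z))\<^sup>2))" by (simp add: set_integrable_def)
    show "(%z. indicat_real {-1..1} z *\<^sub>R v z) \<in> borel_measurable lborel"
     by (rule borel_measurable_scaleR) (use vL in \<open>simp_all add: in_L2_def\<close>)
    have "norm w <= 1 + (norm w)\<^sup>2" for w :: "real^3"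
    proof -
     have "norm w <= 1 + (norm w)\<^sup>2 / 2" using abs_le_weighted[of "1::real" "norm w"] by simp
     also have "... <= 1 + (norm w)\<^sup>2" by simp
     finally show ?thesis .
    qed
    then show "AE z in lborel. norm (indicat_real {-1..1} z *\<^sub>R v z) <= norm (indicat_real {-1..1} z *\<^sub>R (1 + (norm (v z))\<^sup>2))"
     by (auto simp: indicator_def abs_of_nonneg add_nonneg_nonneg)
   qed
   have "(LBINT z:{-1..1}. v z $ l) = (LBINT z:{-1..1}. v z) $ l" by (rule set_integral_vec_nth(2)[OF i, symmetric])
   then show ?thesis using zm by (simp add: fc_0 zero_mean_def)
  qed
  have VV: "fc (%z. v z $ l) (int (Suc n)) = V l n" for l n by (simp add: V_def)
  define f where "f = slender_body_PDE ee v"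
  note F = slender_body_PDE_coeffs[OF e vL v0 VV kVs, folded f_def]
  define c where "c = (%l n. of_real (lam l ee (int (Suc n))) * V l n)"
  define N where "N = (%l. nat \<lfloor>cut l / ee\<rfloor>)"
  define E where "E = (%l z. f z $ l - mode_sum (c l) (N l) z)"
  have ae: "approx_error ee (C1 / ee) (C2 / ee) v z $ l = of_real (E l z)" for l z
  proof -
   have "slender_body_approx ee (C1 / ee) (C2 / ee) v z $ l
     = (\<Sum>k\<in>modes (cut l / ee). of_real (lam l ee k) * ((1/2) * fc (%z. v z $ l) k) * cis (pi * of_int k * z))"
    using exhaust_3[of l]
    by (auto simp: slender_body_approx_def sum_component axis_def cut_def lam_def fourier_coeff_fc intro!: sum.cong)
   also have "... = of_real (mode_sum (c l) (N l) z)"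
    unfolding c_def N_def V_def by (rule modes_sum) (simp add: lam_def lambda_SB_eq[OF e])
   finally show ?thesis by (simp add: approx_error_def complexify_def E_def f_def)
  qed
  have sE: "sq_integrable (E l)" for l
   unfolding E_def by (rule sq_integrable_diff[OF in_L2_component[OF F(1)] sq_integrable_mode_sum])
  have iE: "set_integrable lborel {-1..1} (%z. (E l z)\<^sup>2)" for l using sE by (simp add: sq_integrable_def)
  note fi = sq_integrable_integrable[OF in_L2_component[OF F(1)]] sq_integrable_integrable[OF sq_integrable_mode_sum]
  have E0: "fc (E l) 0 = 0" for l
   unfolding E_def fc_diff[OF fi] F(2) fc_mode_sum by simp
  have En: "fc (E l) (int (Suc n)) = of_real (err l ee n) * V l n" for l n
   unfolding E_def fc_diff[OF fi] F(3) fc_mode_sum err_def c_def N_def by (simp add: algebra_simps)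
  \<comment> \<open>Parseval for the error: both operators act on mode n of each component by a real
    factor, and \<open>err\<close> is the difference of the two factors.\<close>
  have EL: "(LBINT z:{-1..1}. (E l z)\<^sup>2) = (\<Sum>n. (err l ee n)\<^sup>2 * (cmod (V l n))\<^sup>2) & summable (%n. (err l ee n)\<^sup>2 * (cmod (V l n))\<^sup>2)" for l
   using parseval[OF sE E0, of l] by (simp only: En norm_mult norm_of_real power_mult_distrib power2_abs sums_iff)
  have eb: "(err l ee n)\<^sup>2 <= (K * ee ^ j)\<^sup>2 * ((kap n) ^ j)\<^sup>2" for l n
  proof -
   have "(err l ee n)\<^sup>2 <= (K * (kap n * ee) ^ j)\<^sup>2"
    using errb[OF e j, of l n] Kp e by (intro power2_le_iff_abs_le[THEN iffD2]) (auto simp: K_def)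
   then show ?thesis by (simp add: power_mult_distrib mult_ac)
  qed
  let ?I = "(LBINT z:{-1..1}. (E 1 z)\<^sup>2) + (LBINT z:{-1..1}. (E 2 z)\<^sup>2) + (LBINT z:{-1..1}. (E 3 z)\<^sup>2)"
  have "?I = (\<Sum>n. (err 1 ee n)\<^sup>2 * (cmod (V 1 n))\<^sup>2 + (err 2 ee n)\<^sup>2 * (cmod (V 2 n))\<^sup>2 + (err 3 ee n)\<^sup>2 * (cmod (V 3 n))\<^sup>2)"
   using EL[of 1] EL[of 2] EL[of 3] by (simp add: suminf_add summable_add)
  also have "... <= (\<Sum>n. (K * ee ^ j)\<^sup>2 * (4 * G j n))"
  proof (rule suminf_le)
   fix n
   have "(err 1 ee n)\<^sup>2 * (cmod (V 1 n))\<^sup>2 + (err 2 ee n)\<^sup>2 * (cmod (V 2 n))\<^sup>2 + (err 3 ee n)\<^sup>2 * (cmod (V 3 n))\<^sup>2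
    <= (K * ee ^ j)\<^sup>2 * ((kap n) ^ j)\<^sup>2 * (cmod (V 1 n))\<^sup>2 + (K * ee ^ j)\<^sup>2 * ((kap n) ^ j)\<^sup>2 * (cmod (V 2 n))\<^sup>2 + (K * ee ^ j)\<^sup>2 * ((kap n) ^ j)\<^sup>2 * (cmod (V 3 n))\<^sup>2"
    by (intro add_mono mult_right_mono eb) auto
   also have "... = (K * ee ^ j)\<^sup>2 * (((kap n) ^ j)\<^sup>2 * (4 * (norm (fourier_coeff v (int (Suc n))))\<^sup>2))"
    unfolding norm4 by (simp only: distrib_left mult.assoc)
   also have "... <= (K * ee ^ j)\<^sup>2 * (4 * G j n)" by (intro mult_left_mono kG) simp
   finally show "(err 1 ee n)\<^sup>2 * (cmod (V 1 n))\<^sup>2 + (err 2 ee n)\<^sup>2 * (cmod (V 2 n))\<^sup>2 + (err 3 ee n)\<^sup>2 * (cmod (V 3 n))\<^sup>2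
    <= (K * ee ^ j)\<^sup>2 * (4 * G j n)" .
  qed (use EL sG(1) in \<open>auto intro!: summable_add summable_mult\<close>)
  also have "... = (K * ee ^ j)\<^sup>2 * (4 * (\<Sum>n. G j n))" using sG(1) by (simp add: suminf_mult summable_mult)
  also have "... <= (K * ee ^ j)\<^sup>2 * (4 * (sobolev_norm (real j) v)\<^sup>2)"
  proof (intro mult_left_mono)
   have "0 <= (\<Sum>n. G j n)" by (rule suminf_nonneg[OF sG(1)]) (simp add: G_def)
   then show "(\<Sum>n. G j n) <= (sobolev_norm (real j) v)\<^sup>2" using sG(2) by simp
  qed auto
  also have "... = ((2 * K) * ee ^ j * sobolev_norm (real j) v)\<^sup>2" by (simp add: power_mult_distrib)
  finally have Ib: "?I <= ((2 * K) * ee ^ j * sobolev_norm (real j) v)\<^sup>2" .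
  have nE: "(norm (approx_error ee (C1 / ee) (C2 / ee) v z))\<^sup>2 = (E 1 z)\<^sup>2 + (E 2 z)\<^sup>2 + (E 3 z)\<^sup>2" for z
   unfolding norm_sq_3c ae by simp
  have In: "(LBINT z:{-1..1}. (norm (approx_error ee (C1 / ee) (C2 / ee) v z))\<^sup>2) = ?I"
   unfolding nE using iE[of 1] iE[of 2] iE[of 3] by (simp only: set_integral_add)
  have s0: "sobolev_norm (real j) v >= 0" by (simp add: sobolev_norm_def infsum_nonneg)
  have "L2_norm (approx_error ee (C1 / ee) (C2 / ee) v) <= (2 * K) * ee ^ j * sobolev_norm (real j) v"
   unfolding L2_norm_def In
   by (rule real_le_lsqrt) (use Ib Kp e s0 in \<open>auto simp: K_def intro!: mult_nonneg_nonneg add_nonneg_nonneg set_integral_nonneg_real\<close>)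
  moreover have "in_L2 (approx_error ee (C1 / ee) (C2 / ee) v)"
   unfolding in_L2_def nE
  proof (intro conjI allI)
   have fp: "f (z + 2) = f z" for z using F(1) by (simp add: in_L2_def)
   have "E l (z + 2) = E l z" for l z by (simp add: E_def fp mode_sum_def mode_periodic)
   then show "approx_error ee (C1 / ee) (C2 / ee) v (z + 2) = approx_error ee (C1 / ee) (C2 / ee) v z" for z
    by (simp add: vec_eq_iff ae)
   have "approx_error ee (C1 / ee) (C2 / ee) v = (%z. E 1 z *\<^sub>R axis 1 1 + E 2 z *\<^sub>R axis 2 1 + E 3 z *\<^sub>R axis 3 1)"
    by (auto simp: fun_eq_iff vec3_eq_iff ae axis_def of_real_def)
   moreover have "E l \<in> borel_measurable borel" for l using sE by (simp add: sq_integrable_def)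
   ultimately show "approx_error ee (C1 / ee) (C2 / ee) v \<in> borel_measurable lborel" by simp
   show "set_integrable lborel {-1..1} (%z. (E 1 z)\<^sup>2 + (E 2 z)\<^sup>2 + (E 3 z)\<^sup>2)"
    by (intro set_integral_add(1) iE)
  qed
  ultimately show ?thesis by blast
 qed
 show ?thesis
 proof (rule exI[of _ "2 * K"], intro allI impI conjI)
  fix ee :: real and v :: "real => real^3" assume e: "ee > 0" and zm: "zero_mean v"
  show "in_L2 (approx_error ee (C1 / ee) (C2 / ee) v)" "L2_norm (approx_error ee (C1 / ee) (C2 / ee) v) <= 2 * K * ee * sobolev_norm 1 v"
   if "in_sobolev 1 v" using main[OF e zm, of 1] that by auto
  show "in_L2 (approx_error ee (C1 / ee) (C2 / ee) v)" "L2_norm (approx_error ee (C1 / ee) (C2 / ee) v) <= 2 * K * ee\<^sup>2 * sobolev_norm 2 v"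
   if "in_sobolev 2 v" using main[OF e zm, of 2] that by auto
 qed
qed

end
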